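(* Let $(M,\pi)$ be a Poisson manifold and let $N\subset M$ be a Poisson submanifold. Then for every cotangent loop $a:[0,1]\to T^*_NM$ one has $$\det h_N(a)=\exp\left(\int_a \mathrm{mod}_N(M)\right),$$ where $h_N(a):\nu(N)_x\to\nu(N)_x$ is the linear Poisson holonomy of $N$ along $a$ (with $x$ the base point of the loop) and $\mathrm{mod}_N(M)$ is the relative modular class of $N$ in $M$.
   Context: All manifolds are smooth and assumed orientable. For a Poisson manifold $(M,\pi)$: $\pi(\mathrm{d}f,\mathrm{d}g)=\{f,g\}$, $\pi^\sharp:T^*M\to TM$ with $\pi^\sharp(\mathrm{d}h)=X_h:=\{h,\cdot\}$. The cotangent bundle $T^*M$ is a Lie algebroid with anchor $\pi^\sharp$ and bracket $[\alpha,\beta]=\mathcal{L}_{\pi^\sharp\alpha}\beta-\mathcal{L}_{\pi^\sharp\beta}\alpha-\mathrm{d}\pi(\alpha,\beta)$. For a volume form $\mu$ on $M$, the modular vector field $X_\mu$ is defined by $\mathcal{L}_{X_f}\mu=X_\mu(f)\mu$ for all $f\in C^\infty(M)$. A Poisson submanifold $N\subset M$ is a submanifold carrying a Poisson structure $\pi_N$ such that the inclusion is a Poisson map. The restriction $T^*_NM:=T^*M|_N$ is a Lie algebroid over $N$ (anchor the restriction of $\pi^\sharp$, which takes values in $TN$; bracket the restriction of the bracket of $T^*M$). Its cohomology is the restricted Poisson cohomology $H^\bullet_{\pi,N}(M)$; its 1-cochains are vector fields along $N$, i.e. sections of $T_NM:=TM|_N$, and the exact ones are the hamiltonian vector fields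 of $(N,\pi_N)$. The relative modular class is $\mathrm{mod}_N(M):=[X_\mu|_N-X_\nu]\in H^1_{\pi,N}(M)$, for any volume forms $\mu$ on $M$ and $\nu$ on $N$ (with $X_\nu$ the modular vector field of $(N,\pi_N)$ relative to $\nu$); it does not depend on these choices. A cotangent path is a path $a:[0,1]\to T^*_NM$ covering a path $\gamma:[0,1]\to N$ with $\pi^\sharp(a(t))=\dot\gamma(t)$; it is a cotangent loop if $\gamma(0)=\gamma(1)$. For a cocycle $X\in\Gamma(T_NM)$ set $\int_aX:=\int_0^1\langle X|_{\gamma(t)},a(t)\rangle\,\mathrm{d}t$; for a cotangent loop this depends only on the class $[X]\in H^1_{\pi,N}(M)$. Linear holonomy: $\nu^*(N)=(TN)^0\subset T^*_NM$ is the conormal bundle. The Lie algebroid $T^*_NM$ is represented on $\nu^*(N)$ by $\nabla_\alpha\beta:=[\alpha,\beta]$, and on the normal bundle $\nu(N)=T_NM/TN$ by the dual flat connection, also denoted $\nabla$. For a cotangent path $a$ from $x$ to $y$, $h_N(a):\nu(N)_x\to\nu(N)_y$ is the parallel transport of $\nabla$ along $a$. *)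

theory Defs
  imports
    "HOL-Analysis.Analysis"
    "HOL-Library.Function_Algebras"
    "Jordan_Normal_Form.Determinant"
begin

text \<open>
  Tangent vectors are derivations of the algebra of smooth functions and covectors are functionals
  on tangent vectors; both are real-valued functions, and the linear structure is the pointwise one.
\<close>

instantiation "fun" :: (type, real_vector) real_vector
begin

definition scaleR_fun :: "real \<Rightarrow> ('a \<Rightarrow> 'b) \<Rightarrow> 'a \<Rightarrow> 'b"
  where "scaleR_fun c f = (\<lambda>x. c *\<^sub>R f x)"

instance
  by standard (auto simp: scaleR_fun_def plus_fun_def fun_eq_iff algebra_simps)

end


section \<open>Smooth manifolds\<close>

text \<open>
  Charts take values in the library's \<^const>\<open>Euclidean_space\<close>, whose points are the real sequences
  vanishing from index \<open>n\<close> on, so that every dimension, including zero, is covered.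
  A function on an open subset \<open>W\<close> of it is differentiated along the coordinates \<open>i < n\<close> only;
  for those \<open>x(i := t)\<close> stays in \<open>W\<close> for \<open>t\<close> near \<open>x i\<close>.
\<close>

definition partial_deriv :: "nat \<Rightarrow> ((nat \<Rightarrow> real) \<Rightarrow> real) \<Rightarrow> (nat \<Rightarrow> real) \<Rightarrow> real"
  where "partial_deriv i f x = deriv (\<lambda>t. f (x(i := t))) (x i)"

fun times_cont_diff :: "nat \<Rightarrow> nat \<Rightarrow> (nat \<Rightarrow> real) set \<Rightarrow> ((nat \<Rightarrow> real) \<Rightarrow> real) \<Rightarrow> bool"
  where
    "times_cont_diff n 0 W f \<longleftrightarrow> continuous_on W f"
  | "times_cont_diff n (Suc k) W f \<longleftrightarrow>
       continuous_on W f \<and>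
       (\<forall>i<n. (\<forall>x\<in>W. (\<lambda>t. f (x(i := t))) differentiable (at (x i))) \<and>
              times_cont_diff n k W (partial_deriv i f))"

definition smooth_in :: "nat \<Rightarrow> (nat \<Rightarrow> real) set \<Rightarrow> ((nat \<Rightarrow> real) \<Rightarrow> real) \<Rightarrow> bool"
  where "smooth_in n W f \<longleftrightarrow> (\<forall>k. times_cont_diff n k W f)"

text \<open>
  The underlying set of a manifold is a whole type. The atlas need not be maximal.
\<close>

record 'm manifold =
  mdim :: nat
  atlas :: "('m set \<times> ('m \<Rightarrow> nat \<Rightarrow> real)) set"

definition smooth_manifold ::
    "('m::{t2_space,second_countable_topology}) manifold \<Rightarrow> bool"
  where "smooth_manifold M \<longleftrightarrow>
    (\<Union>(U, \<phi>)\<in>atlas M. U) = UNIV \<and>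
    (\<forall>(U, \<phi>)\<in>atlas M.
       open U \<and> openin (Euclidean_space (mdim M)) (\<phi> ` U) \<and>
       homeomorphism U (\<phi> ` U) \<phi> (inv_into U \<phi>)) \<and>
    (\<forall>(U, \<phi>)\<in>atlas M. \<forall>(V, \<psi>)\<in>atlas M. \<forall>i<mdim M.
       smooth_in (mdim M) (\<phi> ` (U \<inter> V)) (\<lambda>x. \<psi> (inv_into U \<phi> x) i))"

definition smooth_funs :: "'m manifold \<Rightarrow> ('m \<Rightarrow> real) set"
  where "smooth_funs M =
    {f. \<forall>(U, \<phi>)\<in>atlas M. smooth_in (mdim M) (\<phi> ` U) (\<lambda>x. f (inv_into U \<phi> x))}"

definition smooth_map ::
    "('n::topological_space) manifold \<Rightarrow> ('m::topological_space) manifold \<Rightarrow> ('n \<Rightarrow> 'm) \<Rightarrow> bool"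
  where "smooth_map N M F \<longleftrightarrow>
    continuous_on UNIV F \<and>
    (\<forall>(V, \<psi>)\<in>atlas N. \<forall>(U, \<phi>)\<in>atlas M. \<forall>i<mdim M.
       smooth_in (mdim N) (\<psi> ` (V \<inter> F -` U)) (\<lambda>x. \<phi> (F (inv_into V \<psi> x)) i))"


section \<open>Tangent vectors, covectors, and tensor fields\<close>

type_synonym 'm tvec = "('m \<Rightarrow> real) \<Rightarrow> real"
type_synonym 'm covec = "'m tvec \<Rightarrow> real"

text \<open>
  Tangent vectors vanish by convention on non-smooth functions, and covectors vanish by convention
  off the tangent space, so that both are determined by their meaningful values.
\<close>

definition tangent_space :: "'m manifold \<Rightarrow> 'm \<Rightarrow> 'm tvec set"
  where "tangent_space M p =
    {v. (\<forall>f. f \<notin> smooth_funs M \<longrightarrow> v f = 0) \<and>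
        (\<forall>f\<in>smooth_funs M. \<forall>g\<in>smooth_funs M. \<forall>c.
           v (f + g) = v f + v g \<and> v (c *\<^sub>R f) = c * v f \<and>
           v (f * g) = f p * v g + g p * v f)}"

definition cotangent_space :: "'m manifold \<Rightarrow> 'm \<Rightarrow> 'm covec set"
  where "cotangent_space M p =
    {\<alpha>. (\<forall>v. v \<notin> tangent_space M p \<longrightarrow> \<alpha> v = 0) \<and>
        (\<forall>v\<in>tangent_space M p. \<forall>w\<in>tangent_space M p. \<forall>c.
           \<alpha> (v + w) = \<alpha> v + \<alpha> w \<and> \<alpha> (c *\<^sub>R v) = c * \<alpha> v)}"

definition vector_field :: "'m manifold \<Rightarrow> ('m \<Rightarrow> 'm tvec) \<Rightarrow> bool"
  where "vector_field M X \<longleftrightarrow>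
    (\<forall>p. X p \<in> tangent_space M p) \<and> (\<forall>f\<in>smooth_funs M. (\<lambda>p. X p f) \<in> smooth_funs M)"

definition one_form :: "'m manifold \<Rightarrow> ('m \<Rightarrow> 'm covec) \<Rightarrow> bool"
  where "one_form M \<alpha> \<longleftrightarrow>
    (\<forall>p. \<alpha> p \<in> cotangent_space M p) \<and>
    (\<forall>Y. vector_field M Y \<longrightarrow> (\<lambda>p. \<alpha> p (Y p)) \<in> smooth_funs M)"

definition differential :: "'m manifold \<Rightarrow> ('m \<Rightarrow> real) \<Rightarrow> 'm \<Rightarrow> 'm covec"
  where "differential M f p v = (if v \<in> tangent_space M p then v f else 0)"

definition pushforward ::
    "'m manifold \<Rightarrow> ('n \<Rightarrow> 'm) \<Rightarrow> 'n tvec \<Rightarrow> 'm tvec"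
  where "pushforward M F v f = (if f \<in> smooth_funs M then v (f \<circ> F) else 0)"

definition lie_bracket :: "('m \<Rightarrow> 'm tvec) \<Rightarrow> ('m \<Rightarrow> 'm tvec) \<Rightarrow> 'm \<Rightarrow> 'm tvec"
  where "lie_bracket X Y p f = X p (\<lambda>q. Y q f) - Y p (\<lambda>q. X q f)"

text \<open>
  Lie derivatives of covariant tensor fields are given at a point by the usual formula
  \<open>(L\<^sub>X \<omega>)(Y\<^sub>1,\<dots>,Y\<^sub>k) = X(\<omega>(Y\<^sub>1,\<dots>,Y\<^sub>k)) - \<Sum>\<^sub>i \<omega>(Y\<^sub>1,\<dots>,[X,Y\<^sub>i],\<dots>,Y\<^sub>k)\<close>, evaluated on vector fields
  extending the given tangent vectors; by tensoriality the choice of extensions is immaterial.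
\<close>

definition extend_tvec :: "'m manifold \<Rightarrow> 'm \<Rightarrow> 'm tvec \<Rightarrow> 'm \<Rightarrow> 'm tvec"
  where "extend_tvec M p v = (SOME Y. vector_field M Y \<and> Y p = v)"

definition lie_one_form ::
    "'m manifold \<Rightarrow> ('m \<Rightarrow> 'm tvec) \<Rightarrow> ('m \<Rightarrow> 'm covec) \<Rightarrow> 'm \<Rightarrow> 'm covec"
  where "lie_one_form M X \<beta> p v =
    (if v \<in> tangent_space M p then
       (let Y = extend_tvec M p v in X p (\<lambda>q. \<beta> q (Y q)) - \<beta> p (lie_bracket X Y p))
     else 0)"

text \<open>
  A top-degree form takes a sequence of tangent vectors, of which only the first \<open>mdim M\<close> matter.
\<close>

type_synonym 'm top_form = "'m \<Rightarrow> (nat \<Rightarrow> 'm tvec) \<Rightarrow> real"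

definition volume_form :: "'m manifold \<Rightarrow> 'm top_form \<Rightarrow> bool"
  where "volume_form M \<mu> \<longleftrightarrow>
    (\<forall>p v w. (\<forall>i<mdim M. v i = w i) \<longrightarrow> \<mu> p v = \<mu> p w) \<and>
    (\<forall>p v. (\<forall>i<mdim M. v i \<in> tangent_space M p) \<longrightarrow>
       (\<forall>i<mdim M. \<forall>u\<in>tangent_space M p. \<forall>w\<in>tangent_space M p. \<forall>c.
          \<mu> p (v(i := u + w)) = \<mu> p (v(i := u)) + \<mu> p (v(i := w)) \<and>
          \<mu> p (v(i := c *\<^sub>R u)) = c * \<mu> p (v(i := u))) \<and>
       (\<forall>i<mdim M. \<forall>j<mdim M. i \<noteq> j \<and> v i = v j \<longrightarrow> \<mu> p v = 0)) \<and>
    (\<forall>Y. (\<forall>i<mdim M. vector_field M (Y i)) \<longrightarrow> (\<lambda>p. \<mu> p (\<lambda>i. Y i p)) \<in> smooth_funs M) \<and>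
    (\<forall>p. \<exists>v. (\<forall>i<mdim M. v i \<in> tangent_space M p) \<and> \<mu> p v \<noteq> 0)"

definition lie_top_form :: "'m manifold \<Rightarrow> ('m \<Rightarrow> 'm tvec) \<Rightarrow> 'm top_form \<Rightarrow> 'm top_form"
  where "lie_top_form M X \<mu> p v =
    (let Y = (\<lambda>i. extend_tvec M p (v i)) in
       X p (\<lambda>q. \<mu> q (\<lambda>i. Y i q)) - (\<Sum>i<mdim M. \<mu> p (v(i := lie_bracket X (Y i) p))))"


section \<open>Poisson manifolds\<close>

type_synonym 'm bivector = "'m \<Rightarrow> 'm covec \<Rightarrow> 'm covec \<Rightarrow> real"

definition bivector_field :: "'m manifold \<Rightarrow> 'm bivector \<Rightarrow> bool"
  where "bivector_field M \<pi> \<longleftrightarrow>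
    (\<forall>p. \<forall>\<alpha>\<in>cotangent_space M p. \<forall>\<beta>\<in>cotangent_space M p.
       \<pi> p \<beta> \<alpha> = - \<pi> p \<alpha> \<beta> \<and>
       (\<forall>\<gamma>\<in>cotangent_space M p. \<forall>c.
          \<pi> p (\<alpha> + \<gamma>) \<beta> = \<pi> p \<alpha> \<beta> + \<pi> p \<gamma> \<beta> \<and> \<pi> p (c *\<^sub>R \<alpha>) \<beta> = c * \<pi> p \<alpha> \<beta>)) \<and>
    (\<forall>\<alpha> \<beta>. one_form M \<alpha> \<and> one_form M \<beta> \<longrightarrow> (\<lambda>p. \<pi> p (\<alpha> p) (\<beta> p)) \<in> smooth_funs M)"

definition poisson_bracket ::
    "'m manifold \<Rightarrow> 'm bivector \<Rightarrow> ('m \<Rightarrow> real) \<Rightarrow> ('m \<Rightarrow> real) \<Rightarrow> 'm \<Rightarrow> real"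
  where "poisson_bracket M \<pi> f g p = \<pi> p (differential M f p) (differential M g p)"

definition poisson_manifold ::
    "('m::{t2_space,second_countable_topology}) manifold \<Rightarrow> 'm bivector \<Rightarrow> bool"
  where "poisson_manifold M \<pi> \<longleftrightarrow>
    smooth_manifold M \<and> bivector_field M \<pi> \<and>
    (\<forall>f\<in>smooth_funs M. \<forall>g\<in>smooth_funs M. \<forall>h\<in>smooth_funs M.
       poisson_bracket M \<pi> f (poisson_bracket M \<pi> g h) +
       poisson_bracket M \<pi> g (poisson_bracket M \<pi> h f) +
       poisson_bracket M \<pi> h (poisson_bracket M \<pi> f g) = 0)"

definition sharp :: "'m manifold \<Rightarrow> 'm bivector \<Rightarrow> 'm \<Rightarrow> 'm covec \<Rightarrow> 'm tvec"
  where "sharp M \<pi> p \<alpha> f = (if f \<in> smooth_funs M then \<pi> p \<alpha> (differential M f p) else 0)"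

definition hamiltonian :: "'m manifold \<Rightarrow> 'm bivector \<Rightarrow> ('m \<Rightarrow> real) \<Rightarrow> 'm \<Rightarrow> 'm tvec"
  where "hamiltonian M \<pi> h p = sharp M \<pi> p (differential M h p)"

definition cotangent_bracket ::
    "'m manifold \<Rightarrow> 'm bivector \<Rightarrow> ('m \<Rightarrow> 'm covec) \<Rightarrow> ('m \<Rightarrow> 'm covec) \<Rightarrow> 'm \<Rightarrow> 'm covec"
  where "cotangent_bracket M \<pi> \<alpha> \<beta> p =
    lie_one_form M (\<lambda>q. sharp M \<pi> q (\<alpha> q)) \<beta> p
    - lie_one_form M (\<lambda>q. sharp M \<pi> q (\<beta> q)) \<alpha> p
    - differential M (\<lambda>q. \<pi> q (\<alpha> q) (\<beta> q)) p"

definition modular_vector_field ::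
    "'m manifold \<Rightarrow> 'm bivector \<Rightarrow> 'm top_form \<Rightarrow> 'm \<Rightarrow> 'm tvec"
  where "modular_vector_field M \<pi> \<mu> =
    (THE X. vector_field M X \<and>
       (\<forall>f\<in>smooth_funs M. \<forall>p v. (\<forall>i<mdim M. v i \<in> tangent_space M p) \<longrightarrow>
          lie_top_form M (hamiltonian M \<pi> f) \<mu> p v = X p f * \<mu> p v))"


section \<open>Poisson submanifolds\<close>

text \<open>
  A submanifold \<open>N\<close> of \<open>M\<close> is given by its inclusion \<open>\<iota>\<close>, an injective immersion; the manifold topology
  of \<open>N\<close> may be finer than the one induced from \<open>M\<close>, as for symplectic leaves.
  Vectors and covectors of \<open>M\<close> along \<open>N\<close> are based at \<open>\<iota> q\<close> for \<open>q\<close> in \<open>N\<close>.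
\<close>

definition submanifold ::
    "('n::topological_space) manifold \<Rightarrow> ('m::topological_space) manifold \<Rightarrow> ('n \<Rightarrow> 'm) \<Rightarrow> bool"
  where "submanifold N M \<iota> \<longleftrightarrow>
    smooth_map N M \<iota> \<and> inj \<iota> \<and> (\<forall>q. inj_on (pushforward M \<iota>) (tangent_space N q))"

definition poisson_submanifold ::
    "('n::{t2_space,second_countable_topology}) manifold \<Rightarrow> 'n bivector \<Rightarrow>
     ('m::{t2_space,second_countable_topology}) manifold \<Rightarrow> 'm bivector \<Rightarrow> ('n \<Rightarrow> 'm) \<Rightarrow> bool"
  where "poisson_submanifold N \<pi>\<^sub>N M \<pi> \<iota> \<longleftrightarrow>
    poisson_manifold N \<pi>\<^sub>N \<and> submanifold N M \<iota> \<and>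
    (\<forall>f\<in>smooth_funs M. \<forall>g\<in>smooth_funs M.
       poisson_bracket N \<pi>\<^sub>N (f \<circ> \<iota>) (g \<circ> \<iota>) = poisson_bracket M \<pi> f g \<circ> \<iota>)"

definition restricted_section ::
    "'n manifold \<Rightarrow> 'm manifold \<Rightarrow> ('n \<Rightarrow> 'm) \<Rightarrow> ('n \<Rightarrow> 'm covec) \<Rightarrow> bool"
  where "restricted_section N M \<iota> \<alpha> \<longleftrightarrow>
    (\<forall>q. \<alpha> q \<in> cotangent_space M (\<iota> q)) \<and>
    (\<forall>Y. vector_field M Y \<longrightarrow> (\<lambda>q. \<alpha> q (Y (\<iota> q))) \<in> smooth_funs N)"

text \<open>
  The extensions to \<open>M\<close> are only required near the given point of \<open>N\<close>, because an immersed \<open>N\<close> need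
  not admit global ones.
\<close>

definition restricted_bracket ::
    "'m manifold \<Rightarrow> 'm bivector \<Rightarrow> (('n::topological_space) \<Rightarrow> 'm) \<Rightarrow>
     ('n \<Rightarrow> 'm covec) \<Rightarrow> ('n \<Rightarrow> 'm covec) \<Rightarrow> 'n \<Rightarrow> 'm covec"
  where "restricted_bracket M \<pi> \<iota> \<alpha> \<beta> q =
    (THE \<eta>. \<exists>\<alpha>' \<beta>'. one_form M \<alpha>' \<and> one_form M \<beta>' \<and>
       (\<exists>V. open V \<and> q \<in> V \<and> (\<forall>r\<in>V. \<alpha>' (\<iota> r) = \<alpha> r \<and> \<beta>' (\<iota> r) = \<beta> r)) \<and>
       \<eta> = cotangent_bracket M \<pi> \<alpha>' \<beta>' (\<iota> q))"

text \<open>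
  The relative modular class is a coset of vector fields along \<open>N\<close> modulo the exact ones, i.e. modulo
  the hamiltonian vector fields of \<open>N\<close>.
\<close>

definition relative_modular_class ::
    "'m manifold \<Rightarrow> 'm bivector \<Rightarrow> 'n manifold \<Rightarrow> 'n bivector \<Rightarrow> ('n \<Rightarrow> 'm) \<Rightarrow>
     'm top_form \<Rightarrow> 'n top_form \<Rightarrow> ('n \<Rightarrow> 'm tvec) set"
  where "relative_modular_class M \<pi> N \<pi>\<^sub>N \<iota> \<mu> \<nu> =
    {(\<lambda>q. modular_vector_field M \<pi> \<mu> (\<iota> q) - pushforward M \<iota> (modular_vector_field N \<pi>\<^sub>N \<nu> q)
          + pushforward M \<iota> (hamiltonian N \<pi>\<^sub>N f q)) | f. f \<in> smooth_funs N}"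


section \<open>Cotangent paths\<close>

definition has_velocity :: "'n manifold \<Rightarrow> (real \<Rightarrow> 'n) \<Rightarrow> real \<Rightarrow> 'n tvec \<Rightarrow> bool"
  where "has_velocity N \<gamma> t w \<longleftrightarrow>
    w \<in> tangent_space N (\<gamma> t) \<and>
    (\<forall>f\<in>smooth_funs N. ((f \<circ> \<gamma>) has_real_derivative w f) (at t within {0..1}))"

text \<open>
  A path in the restricted cotangent bundle is represented by its base path \<open>\<gamma>\<close> together with the
  covectors \<open>a t\<close>. It is continuous for the vector bundle topology iff \<open>\<gamma>\<close> is continuous and all pairings
  with vector fields are. No more regularity than continuity of the path is required.
\<close>

definition cotangent_path ::
    "('n::topological_space) manifold \<Rightarrow> 'm manifold \<Rightarrow> 'm bivector \<Rightarrow> ('n \<Rightarrow> 'm) \<Rightarrow>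
     (real \<Rightarrow> 'n) \<Rightarrow> (real \<Rightarrow> 'm covec) \<Rightarrow> bool"
  where "cotangent_path N M \<pi> \<iota> \<gamma> a \<longleftrightarrow>
    continuous_on {0..1} \<gamma> \<and>
    (\<forall>t\<in>{0..1}. a t \<in> cotangent_space M (\<iota> (\<gamma> t))) \<and>
    (\<forall>Y. vector_field M Y \<longrightarrow> continuous_on {0..1} (\<lambda>t. a t (Y (\<iota> (\<gamma> t))))) \<and>
    (\<forall>t\<in>{0..1}. \<exists>w. has_velocity N \<gamma> t w \<and>
        sharp M \<pi> (\<iota> (\<gamma> t)) (a t) = pushforward M \<iota> w)"

definition cotangent_loop ::
    "('n::topological_space) manifold \<Rightarrow> 'm manifold \<Rightarrow> 'm bivector \<Rightarrow> ('n \<Rightarrow> 'm) \<Rightarrow>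
     (real \<Rightarrow> 'n) \<Rightarrow> (real \<Rightarrow> 'm covec) \<Rightarrow> bool"
  where "cotangent_loop N M \<pi> \<iota> \<gamma> a \<longleftrightarrow> cotangent_path N M \<pi> \<iota> \<gamma> a \<and> \<gamma> 0 = \<gamma> 1"

definition path_integral ::
    "(real \<Rightarrow> 'n) \<Rightarrow> (real \<Rightarrow> 'm covec) \<Rightarrow> ('n \<Rightarrow> 'm tvec) \<Rightarrow> real"
  where "path_integral \<gamma> a X = integral {0..1} (\<lambda>t. a t (X (\<gamma> t)))"

definition path_integral_class ::
    "(real \<Rightarrow> 'n) \<Rightarrow> (real \<Rightarrow> 'm covec) \<Rightarrow> ('n \<Rightarrow> 'm tvec) set \<Rightarrow> real"
  where "path_integral_class \<gamma> a c = (THE r. \<exists>X\<in>c. r = path_integral \<gamma> a X)"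


section \<open>Linear Poisson holonomy\<close>

text \<open>Elements of a quotient space \<open>V / W\<close> are represented by cosets of \<open>W\<close>.\<close>

definition lin_coset :: "'v::real_vector set \<Rightarrow> 'v \<Rightarrow> 'v set"
  where "lin_coset W v = (\<lambda>w. v + w) ` W"

definition quotient_basis ::
    "'v::real_vector set \<Rightarrow> 'v set \<Rightarrow> nat \<Rightarrow> (nat \<Rightarrow> 'v) \<Rightarrow> bool"
  where "quotient_basis V W r e \<longleftrightarrow>
    (\<forall>i<r. e i \<in> V) \<and>
    (\<forall>v\<in>V. \<exists>c::nat \<Rightarrow> real. lin_coset W v = lin_coset W (\<Sum>i<r. c i *\<^sub>R e i)) \<and>
    (\<forall>c::nat \<Rightarrow> real. (\<Sum>i<r. c i *\<^sub>R e i) \<in> W \<longrightarrow> (\<forall>i<r. c i = 0))"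

definition quotient_det :: "'v::real_vector set \<Rightarrow> 'v set \<Rightarrow> ('v set \<Rightarrow> 'v set) \<Rightarrow> real"
  where "quotient_det V W h =
    (THE d. \<exists>r e A. quotient_basis V W r e \<and>
       (\<forall>j<r. h (lin_coset W (e j)) = lin_coset W (\<Sum>i<r. A i j *\<^sub>R e i)) \<and>
       d = Determinant.det (Matrix.mat r r (\<lambda>(i, j). A i j)))"

definition tangent_image :: "'n manifold \<Rightarrow> 'm manifold \<Rightarrow> ('n \<Rightarrow> 'm) \<Rightarrow> 'n \<Rightarrow> 'm tvec set"
  where "tangent_image N M \<iota> q = pushforward M \<iota> ` tangent_space N q"

definition normal_space ::
    "'n manifold \<Rightarrow> 'm manifold \<Rightarrow> ('n \<Rightarrow> 'm) \<Rightarrow> 'n \<Rightarrow> 'm tvec set set"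
  where "normal_space N M \<iota> q = lin_coset (tangent_image N M \<iota> q) ` tangent_space M (\<iota> q)"

definition conormal_section ::
    "'n manifold \<Rightarrow> 'm manifold \<Rightarrow> ('n \<Rightarrow> 'm) \<Rightarrow> ('n \<Rightarrow> 'm covec) \<Rightarrow> bool"
  where "conormal_section N M \<iota> \<beta> \<longleftrightarrow>
    restricted_section N M \<iota> \<beta> \<and> (\<forall>q. \<forall>v\<in>tangent_image N M \<iota> q. \<beta> q v = 0)"

text \<open>A conormal covector takes a single value on each normal class.\<close>

definition normal_pairing :: "'m covec \<Rightarrow> 'm tvec set \<Rightarrow> real"
  where "normal_pairing \<eta> c = the_elem (\<eta> ` c)"

text \<open>
  \<open>u\<close> is the covariant derivative at time \<open>t\<close>, along the cotangent path \<open>a\<close> over \<open>\<gamma>\<close>, of the normal field \<open>s\<close>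
  along \<open>\<gamma>\<close>. This is the dual of the connection \<open>\<nabla>\<^sub>\<alpha> \<beta> = [\<alpha>, \<beta>]\<close> on conormal sections, pulled back
  along \<open>a\<close>: \<open>d/dt \<langle>\<beta>, s\<rangle> = \<langle>\<nabla>\<^sub>a \<beta>, s\<rangle> + \<langle>\<beta>, \<nabla>\<^sub>a s\<rangle>\<close> for all conormal \<open>\<beta>\<close>, where \<open>\<nabla>\<^sub>a \<beta>\<close> at \<open>\<gamma> t\<close> is computed
  with any section \<open>\<alpha>\<close> through \<open>a t\<close>.
\<close>

definition has_normal_covderiv ::
    "('n::topological_space) manifold \<Rightarrow> 'm manifold \<Rightarrow> 'm bivector \<Rightarrow> ('n \<Rightarrow> 'm) \<Rightarrow>
     (real \<Rightarrow> 'n) \<Rightarrow> (real \<Rightarrow> 'm covec) \<Rightarrow> (real \<Rightarrow> 'm tvec set) \<Rightarrow> real \<Rightarrow> 'm tvec set \<Rightarrow> bool"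
  where "has_normal_covderiv N M \<pi> \<iota> \<gamma> a s t u \<longleftrightarrow>
    u \<in> normal_space N M \<iota> (\<gamma> t) \<and>
    (\<forall>\<alpha> \<beta>. restricted_section N M \<iota> \<alpha> \<and> \<alpha> (\<gamma> t) = a t \<and> conormal_section N M \<iota> \<beta> \<longrightarrow>
       ((\<lambda>\<tau>. normal_pairing (\<beta> (\<gamma> \<tau>)) (s \<tau>)) has_real_derivative
          normal_pairing (restricted_bracket M \<pi> \<iota> \<alpha> \<beta> (\<gamma> t)) (s t)
          + normal_pairing (\<beta> (\<gamma> t)) u) (at t within {0..1}))"

text \<open>The zero of the normal space at \<open>\<gamma> t\<close> is the coset \<open>tangent_image N M \<iota> (\<gamma> t)\<close>.\<close>

definition parallel_along ::
    "('n::topological_space) manifold \<Rightarrow> 'm manifold \<Rightarrow> 'm bivector \<Rightarrow> ('n \<Rightarrow> 'm) \<Rightarrow>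
     (real \<Rightarrow> 'n) \<Rightarrow> (real \<Rightarrow> 'm covec) \<Rightarrow> (real \<Rightarrow> 'm tvec set) \<Rightarrow> bool"
  where "parallel_along N M \<pi> \<iota> \<gamma> a s \<longleftrightarrow>
    (\<forall>t\<in>{0..1}. s t \<in> normal_space N M \<iota> (\<gamma> t) \<and>
       has_normal_covderiv N M \<pi> \<iota> \<gamma> a s t (tangent_image N M \<iota> (\<gamma> t)))"

definition linear_holonomy ::
    "('n::topological_space) manifold \<Rightarrow> 'm manifold \<Rightarrow> 'm bivector \<Rightarrow> ('n \<Rightarrow> 'm) \<Rightarrow>
     (real \<Rightarrow> 'n) \<Rightarrow> (real \<Rightarrow> 'm covec) \<Rightarrow> 'm tvec set \<Rightarrow> 'm tvec set"
  where "linear_holonomy N M \<pi> \<iota> \<gamma> a c =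
    (THE c'. \<exists>s. parallel_along N M \<pi> \<iota> \<gamma> a s \<and> s 0 = c \<and> s 1 = c')"

definition holonomy_det ::
    "('n::topological_space) manifold \<Rightarrow> 'm manifold \<Rightarrow> 'm bivector \<Rightarrow> ('n \<Rightarrow> 'm) \<Rightarrow>
     (real \<Rightarrow> 'n) \<Rightarrow> (real \<Rightarrow> 'm covec) \<Rightarrow> real"
  where "holonomy_det N M \<pi> \<iota> \<gamma> a =
    quotient_det (tangent_space M (\<iota> (\<gamma> 0))) (tangent_image N M \<iota> (\<gamma> 0))
      (linear_holonomy N M \<pi> \<iota> \<gamma> a)"

end

theory Submission
  imports Defs
begin

text \<open>
  Both sides are the solution at time 1 of the same scalar linear equation. Near a point of \<open>N\<close> choose
  coordinates \<open>y\<^sub>1, \<dots>, y\<^sub>m\<close> of \<open>M\<close> such that the first \<open>n\<close> restrict to coordinates of \<open>N\<close> and the others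
  vanish on \<open>N\<close>. Since \<open>{y\<^sub>i, y\<^sub>j}\<close> vanishes on \<open>N\<close> for \<open>j > n\<close>, parallel normal fields satisfy a linear
  equation \<open>s' = B s\<close> with \<open>B\<^sub>j\<^sub>k = \<Sum>\<^sub>i a\<^sub>i \<partial>\<^sub>k {y\<^sub>i, y\<^sub>j}\<close>, so their determinant has logarithmic derivative
  \<open>tr B\<close>. Writing \<open>\<mu> = \<rho> dy\<^sub>1 \<dots> dy\<^sub>m\<close> and \<open>\<nu> = \<sigma> dy\<^sub>1 \<dots> dy\<^sub>n\<close>, the divergence formula
  \<open>X\<^sub>\<mu>(f) = {f, \<rho>} / \<rho> + \<Sum>\<^sub>j \<partial>\<^sub>j {f, y\<^sub>j}\<close> and its analogue on \<open>N\<close> give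
  \<open>\<langle>X\<^sub>\<mu> - X\<^sub>\<nu>, a\<rangle> = tr B + d/dt log (\<rho> / \<sigma>)\<close>. Hence the density \<open>\<mu> / \<nu>\<close> of the normal bundle, evaluated
  on a parallel frame, has logarithmic derivative \<open>\<langle>X\<^sub>\<mu> - X\<^sub>\<nu>, a\<rangle>\<close>, independently of coordinates; around
  a loop it is multiplied by the determinant of the holonomy.
\<close>

section \<open>Calculus on the spaces of finite sequences\<close>

text \<open>Tangent vectors, fields and forms are global objects here, whereas every computation is
  local. The calculus is therefore carried by frames: global functions and global vector fields that
  are dual to each other over an open set only, made global by bump functions. Adapted coordinates
  are reached by exchanging one coordinate at a time, so the only inverse function theorem required
  is the one that changes a single coordinate. \<open>N\<close> is merely immersed, and its
  functions need not extend to \<open>M\<close>; they are extended near one point of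
  \<open>N\<close> at a time, on neighbourhoods in the topology of \<open>N\<close>. The covectors
  \<open>a t\<close> are only continuous in \<open>t\<close>, so the transport equation has
  continuous coefficients; it is solved on short intervals and continued by compactness of
  \<open>{0..1}\<close>. The definite descriptions behind the holonomy, its determinant and the
  integral of the class each ask for a uniqueness argument: uniqueness of parallel fields,
  independence of the basis of the normal space, and vanishing of the integrals of hamiltonian
  fields of \<open>N\<close> around loops.\<close>

abbreviation eopen :: "nat \<Rightarrow> (nat \<Rightarrow> real) set \<Rightarrow> bool"
  where "eopen n W \<equiv> openin (Euclidean_space n) W"

abbreviation espace :: "nat \<Rightarrow> (nat \<Rightarrow> real) set"
  where "espace n \<equiv> {x. \<forall>i\<ge>n. x i = 0}"

definition cube :: "nat \<Rightarrow> (nat \<Rightarrow> real) \<Rightarrow> real \<Rightarrow> (nat \<Rightarrow> real) set"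
  where "cube n c e = {x. (\<forall>i\<ge>n. x i = 0) \<and> (\<forall>i<n. \<bar>x i - c i\<bar> < e)}"

lemma eopen_iff: "eopen n W \<longleftrightarrow> (\<exists>T. open T \<and> W = T \<inter> espace n)"
  by (simp add: Euclidean_space_def openin_subtopology euclidean_product_topology flip: open_openin)

lemma eopen_espace: "eopen n (espace n)"
  unfolding eopen_iff by (rule exI[of _ UNIV]) simp

lemma eopen_subset: "eopen n W \<Longrightarrow> W \<subseteq> espace n"
  by (auto simp: eopen_iff)

lemma eopen_preimage:
  assumes "eopen n W" "continuous_on W f" "open T"
  shows "eopen n (W \<inter> f -` T)"
proof -
  obtain A where A: "open A" "W = A \<inter> espace n"
    using assms(1) by (auto simp: eopen_iff)
  obtain B where B: "open B" "B \<inter> W = f -` T \<inter> W"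
    using assms(2,3) unfolding continuous_on_open_invariant by blast
  show ?thesis
    unfolding eopen_iff using A B by (intro exI[of _ "A \<inter> B"]) (auto simp: open_Int)
qed

lemma eopen_less:
  fixes f g :: "(nat \<Rightarrow> real) \<Rightarrow> real"
  assumes "eopen n W" "continuous_on W f" "continuous_on W g"
  shows "eopen n {x\<in>W. f x < g x}"
proof -
  have "eopen n (W \<inter> (\<lambda>x. g x - f x) -` {0<..})"
    by (intro eopen_preimage assms continuous_intros)
  moreover have "W \<inter> (\<lambda>x. g x - f x) -` {0<..} = {x\<in>W. f x < g x}"
    by auto
  ultimately show ?thesis by simp
qed

lemma continuous_on_coord: "continuous_on W (\<lambda>x::nat \<Rightarrow> real. x i)"
  by (rule continuous_on_subset[OF continuous_on_product_coordinates]) auto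

lemma eopen_cube: "eopen n (cube n c e)"
proof -
  have "open (\<Inter>i\<in>{..<n}. {x::nat \<Rightarrow> real. \<bar>x i - c i\<bar> < e})"
    by (intro open_INT finite_lessThan ballI open_Collect_less continuous_intros continuous_on_coord)
  then show ?thesis
    unfolding eopen_iff cube_def by (intro exI conjI, assumption) auto
qed

lemma cube_center: "e > 0 \<Longrightarrow> c \<in> espace n \<Longrightarrow> c \<in> cube n c e"
  by (auto simp: cube_def)

lemma cube_mono: "d \<le> e \<Longrightarrow> cube n c d \<subseteq> cube n c e"
  by (force simp: cube_def)

text \<open>Only the coordinates below \<open>n\<close> can vary, since the others are 0 on
  \<open>espace n\<close>; a minimum over finitely many radii then suffices although the ambient
  space is an infinite product.\<close>

lemma cube_inside:
  assumes "eopen n W" "c \<in> W"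
  obtains e where "e > 0" "cube n c e \<subseteq> W"
proof -
  obtain T where T: "open T" "W = T \<inter> espace n"
    using assms(1) by (auto simp: eopen_iff)
  have c: "c \<in> T" "\<And>i. i \<ge> n \<Longrightarrow> c i = 0" using T assms by auto
  obtain X where X: "c \<in> (\<Pi>\<^sub>E i\<in>UNIV. X i)" "\<And>i. open (X i)" "(\<Pi>\<^sub>E i\<in>UNIV. X i) \<subseteq> T"
    using product_topology_open_contains_basis[of "\<lambda>i. euclidean" UNIV T c] T(1) c
    by (auto simp: open_fun_def simp flip: open_openin)
  have "\<exists>e>0. ball (c i) e \<subseteq> X i" for i
    using X(1,2) by (auto simp: open_contains_ball PiE_iff)
  then obtain e where e: "\<And>i. e i > 0" "\<And>i. ball (c i) (e i) \<subseteq> X i"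
    by metis
  \<comment> \<open>The inserted 1 keeps the minimum defined when \<open>n = 0\<close>.\<close>
  define d where "d = Min (insert 1 (e ` {..<n}))"
  have d: "d > 0" unfolding d_def using e(1) by (subst Min_gr_iff) auto
  have de: "d \<le> e i" if "i < n" for i
    unfolding d_def using that by (intro Min_le) auto
  have "cube n c d \<subseteq> W"
  proof
    fix x assume x: "x \<in> cube n c d"
    have "x i \<in> X i" for i
    proof (cases "i < n")
      case True
      then have "\<bar>x i - c i\<bar> < e i" using x de[of i] by (force simp: cube_def)
      then show ?thesis using e(2)[of i] by (auto simp: dist_real_def abs_minus_commute subset_iff)
    next
      case False
      then have "x i = c i" using x c by (simp add: cube_def)
      then show ?thesis using X(1) by (simp add: PiE_iff)
    qed
    then show "x \<in> W" using X(3) x T(2) by (auto simp: PiE_iff cube_def)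
  qed
  then show ?thesis using d that by blast
qed

lemma cube_continuous:
  fixes f :: "(nat \<Rightarrow> real) \<Rightarrow> real"
  assumes "eopen n W" "c \<in> W" "continuous_on W f" "e > 0"
  obtains d where "d > 0" "cube n c d \<subseteq> W" "\<And>x. x \<in> cube n c d \<Longrightarrow> \<bar>f x - f c\<bar> < e"
proof -
  have "eopen n (W \<inter> f -` ball (f c) e)"
    by (intro eopen_preimage assms) auto
  then obtain d where "d > 0" "cube n c d \<subseteq> W \<inter> f -` ball (f c) e"
    using cube_inside[of n _ c] assms by (metis IntI centre_in_ball vimageI)
  then show ?thesis
    by (intro that[of d]) (auto simp: subset_iff dist_real_def abs_minus_commute)
qed

lemma continuous_on_eopenI:
  fixes f :: "(nat \<Rightarrow> real) \<Rightarrow> real"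
  assumes "\<And>c e. c \<in> W \<Longrightarrow> e > 0 \<Longrightarrow> \<exists>A. eopen n A \<and> c \<in> A \<and> (\<forall>x\<in>A \<inter> W. \<bar>f x - f c\<bar> < e)"
    and "W \<subseteq> espace n"
  shows "continuous_on W f"
  unfolding continuous_on_def
proof (intro ballI tendstoI)
  fix c and e :: real assume c: "c \<in> W" "e > 0"
  then obtain A where A: "eopen n A" "c \<in> A" "\<And>x. x \<in> A \<inter> W \<Longrightarrow> \<bar>f x - f c\<bar> < e"
    using assms(1) by meson
  then obtain T where T: "open T" "A = T \<inter> espace n" by (auto simp: eopen_iff)
  show "\<forall>\<^sub>F x in at c within W. dist (f x) (f c) < e"
    unfolding eventually_at_topological
    by (rule exI[of _ T]) (use A T assms(2) in \<open>auto simp: dist_real_def\<close>)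
qed

lemma coord_update_inside:
  assumes "eopen n W" "x \<in> W" "i < n"
  obtains d where "d > 0" "\<And>t. \<bar>t - x i\<bar> < d \<Longrightarrow> x(i := t) \<in> W"
proof -
  obtain d where d: "d > 0" "cube n x d \<subseteq> W"
    using cube_inside assms by metis
  have "x(i := t) \<in> cube n x d" if "\<bar>t - x i\<bar> < d" for t
    using that assms d eopen_subset[OF assms(1)] by (auto simp: cube_def)
  then show ?thesis using that d by blast
qed

lemma eventually_coord_update:
  assumes "eopen n W" "x \<in> W" "i < n"
  shows "\<forall>\<^sub>F t in nhds (x i). x(i := t) \<in> W"
  using coord_update_inside[OF assms] unfolding eventually_nhds_metric
  by (metis dist_real_def)

lemma continuous_on_coord_update: "continuous_on S (\<lambda>t::real. x(i := t))"
proof (rule continuous_on_coordinatewise_then_product)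
  show "continuous_on S (\<lambda>t. (x(i := t)) j)" for j
    by (cases "j = i") (auto intro: continuous_intros)
qed

section \<open>Iterated partial differentiability on open sets\<close>

lemma tcd_cont: "times_cont_diff n k W f \<Longrightarrow> continuous_on W f"
  by (cases k) auto

declare times_cont_diff.simps(2) [simp del]

lemma tcd_Suc_iff:
  "times_cont_diff n (Suc k) W f \<longleftrightarrow> continuous_on W f \<and>
    (\<forall>i<n. (\<forall>x\<in>W. ((\<lambda>t. f (x(i := t))) has_real_derivative partial_deriv i f x) (at (x i))) \<and>
       times_cont_diff n k W (partial_deriv i f))"
  by (simp add: times_cont_diff.simps(2) partial_deriv_def DERIV_deriv_iff_real_differentiable)

lemma tcd_partial:
  assumes "times_cont_diff n (Suc k) W f" "i < n"
  shows "x \<in> W \<Longrightarrow> ((\<lambda>t. f (x(i := t))) has_real_derivative partial_deriv i f x) (at (x i))"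
    and "times_cont_diff n k W (partial_deriv i f)"
  using assms by (auto simp: tcd_Suc_iff)

text \<open>Near a point of an open set \<open>x(i := t)\<close> stays in the set, so partial
  derivatives see only the values on \<open>W\<close>. Formulas that make no sense off
  \<open>W\<close> do no harm.\<close>

lemma tcd_cong:
  assumes "eopen n W" "\<And>x. x \<in> W \<Longrightarrow> f x = g x" "times_cont_diff n k W f"
  shows "times_cont_diff n k W g"
  using assms
proof (induction k arbitrary: f g)
  case 0
  then show ?case by (simp cong: continuous_on_cong)
next
  case (Suc k)
  have D: "((\<lambda>t. f (x(i := t))) has_real_derivative u) (at (x i)) \<longleftrightarrow>
      ((\<lambda>t. g (x(i := t))) has_real_derivative u) (at (x i))" if "i < n" "x \<in> W" for i x u
    by (intro DERIV_cong_ev refl eventually_mono[OF eventually_coord_update[OF Suc.prems(1) that(2,1)]]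
      Suc.prems(2))
  have P: "partial_deriv i f x = partial_deriv i g x" if "i < n" "x \<in> W" for i x
    unfolding partial_deriv_def deriv_def using D[OF that] by simp
  show ?case
    unfolding tcd_Suc_iff
  proof (intro conjI allI impI ballI)
    show "continuous_on W g" using tcd_cont[OF Suc.prems(3)] Suc.prems(2) by (simp cong: continuous_on_cong)
    fix i assume i: "i < n"
    show "times_cont_diff n k W (partial_deriv i g)"
      using Suc.IH[OF Suc.prems(1) P[OF i] tcd_partial(2)[OF Suc.prems(3) i]] .
    fix x assume x: "x \<in> W"
    show "((\<lambda>t. g (x(i := t))) has_real_derivative partial_deriv i g x) (at (x i))"
      using tcd_partial(1)[OF Suc.prems(3) i x] D[OF i x] P[OF i x] by metis
  qed
qed

text \<open>Candidate derivatives \<open>D i\<close> stand in for \<open>partial_deriv i f\<close>;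
  the inductions below can then work with explicit formulas to which the closure lemmas
  apply.\<close>

lemma tcd_SucI:
  assumes "eopen n W" "continuous_on W f"
    and "\<And>i x. i < n \<Longrightarrow> x \<in> W \<Longrightarrow> ((\<lambda>t. f (x(i := t))) has_real_derivative D i x) (at (x i))"
    and "\<And>i. i < n \<Longrightarrow> times_cont_diff n k W (D i)"
  shows "times_cont_diff n (Suc k) W f"
proof -
  have P: "D i x = partial_deriv i f x" if "i < n" "x \<in> W" for i x
    unfolding partial_deriv_def using DERIV_imp_deriv[OF assms(3)[OF that]] by simp
  show ?thesis
    unfolding tcd_Suc_iff using assms P tcd_cong[OF assms(1) P assms(4)] by auto
qed

lemma tcd_subset: "times_cont_diff n k W f \<Longrightarrow> W' \<subseteq> W \<Longrightarrow> times_cont_diff n k W' f"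
  by (induction k arbitrary: f) (auto simp: tcd_Suc_iff intro: continuous_on_subset)

lemma tcd_Suc_imp: "times_cont_diff n (Suc k) W f \<Longrightarrow> times_cont_diff n k W f"
  by (induction k arbitrary: f) (auto simp: tcd_Suc_iff)

lemma tcd_le: "times_cont_diff n k W f \<Longrightarrow> k' \<le> k \<Longrightarrow> times_cont_diff n k' W f"
  by (induction k) (auto simp: le_Suc_eq intro: tcd_Suc_imp)

lemma tcd_local:
  assumes "\<And>x. x \<in> W \<Longrightarrow> \<exists>W'. eopen n W' \<and> x \<in> W' \<and> times_cont_diff n k W' f" "eopen n W"
  shows "times_cont_diff n k W f"
  using assms(1)
proof (induction k arbitrary: f)
  case 0
  show ?case
    unfolding times_cont_diff.simps
  proof (rule continuous_on_eopenI[OF _ eopen_subset[OF assms(2)]])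
    fix c and e :: real assume c: "c \<in> W" "e > 0"
    then obtain W' where W': "eopen n W'" "c \<in> W'" "continuous_on W' f" using 0 by auto
    obtain d where "d > 0" "cube n c d \<subseteq> W'" "\<And>x. x \<in> cube n c d \<Longrightarrow> \<bar>f x - f c\<bar> < e"
      using cube_continuous[OF W' c(2)] by metis
    then show "\<exists>A. eopen n A \<and> c \<in> A \<and> (\<forall>x\<in>A \<inter> W. \<bar>f x - f c\<bar> < e)"
      using c eopen_subset[OF assms(2)] eopen_cube cube_center
      by (intro exI[of _ "cube n c d"]) (auto simp: subset_iff)
  qed
next
  case (Suc k)
  have *: "\<exists>W'. eopen n W' \<and> x \<in> W' \<and> times_cont_diff n k W' (g f)"
    if "x \<in> W" "\<And>W' . times_cont_diff n (Suc k) W' f \<Longrightarrow> times_cont_diff n k W' (g f)" for x g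
    using Suc.prems that by meson
  have "times_cont_diff n k W f"
    using Suc.IH[of f] *[of _ "\<lambda>f. f"] tcd_Suc_imp by blast
  moreover have "times_cont_diff n k W (partial_deriv i f)" if "i < n" for i
    using Suc.IH[of "partial_deriv i f"] *[of _ "partial_deriv i"] tcd_partial(2)[OF _ that] by blast
  moreover have "((\<lambda>t. f (x(i := t))) has_real_derivative partial_deriv i f x) (at (x i))"
    if "i < n" "x \<in> W" for i x
    using Suc.prems[OF that(2)] tcd_partial(1)[OF _ that(1)] by meson
  ultimately show ?case
    unfolding tcd_Suc_iff using tcd_cont by blast
qed

section \<open>Mean value theorem in one coordinate and the chain rule along curves\<close>

lemma coord_mvt:
  assumes "times_cont_diff n (Suc k) W f" "i < n"
    and "\<And>s. min a b \<le> s \<Longrightarrow> s \<le> max a b \<Longrightarrow> x(i := s) \<in> W"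
  shows "\<exists>s. min a b \<le> s \<and> s \<le> max a b \<and>
    f (x(i := b)) - f (x(i := a)) = (b - a) * partial_deriv i f (x(i := s))"
proof -
  have D: "((\<lambda>t. f (x(i := t))) has_real_derivative partial_deriv i f (x(i := s))) (at s)"
    if "min a b \<le> s" "s \<le> max a b" for s
    using tcd_partial(1)[OF assms(1,2) assms(3)[OF that]] by simp
  consider "a < b" | "a = b" | "b < a" by linarith
  then show ?thesis
  proof cases
    case 1
    then obtain z where "a < z" "z < b" "f (x(i := b)) - f (x(i := a)) = (b - a) * partial_deriv i f (x(i := z))"
      using MVT2[OF 1, of "\<lambda>t. f (x(i := t))" "\<lambda>s. partial_deriv i f (x(i := s))"] D by auto
    then show ?thesis
      by (intro exI[of _ z]) auto
  next
    case 2
    then show ?thesis by auto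
  next
    case 3
    then obtain z where "b < z" "z < a" "f (x(i := a)) - f (x(i := b)) = (a - b) * partial_deriv i f (x(i := z))"
      using MVT2[OF 3, of "\<lambda>t. f (x(i := t))" "\<lambda>s. partial_deriv i f (x(i := s))"] D by auto
    then show ?thesis
      by (intro exI[of _ z]) (auto simp: algebra_simps)
  qed
qed

text \<open>Continuity of the partial derivative makes the difference quotient converge even while
  the base point \<open>z\<close> and both end points move. The chain rule and the derivative of an
  implicit function both rest on this strict form of differentiability.\<close>

lemma coord_slope:
  assumes "eopen n W" "times_cont_diff n (Suc 0) W f" "j < n" "x \<in> W"
    and "\<And>i. i < n \<Longrightarrow> i \<noteq> j \<Longrightarrow> ((\<lambda>\<tau>. z \<tau> i) \<longlongrightarrow> x i) F"
    and "(a \<longlongrightarrow> x j) F" "(b \<longlongrightarrow> x j) F" "\<And>\<tau>. z \<tau> \<in> espace n"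
  obtains q where "(q \<longlongrightarrow> partial_deriv j f x) F"
    "\<And>\<tau>. f ((z \<tau>)(j := b \<tau>)) - f ((z \<tau>)(j := a \<tau>)) = q \<tau> * (b \<tau> - a \<tau>)"
proof -
  \<comment> \<open>Coinciding end points get the limit value, so the factorization below holds for
    every \<tau>.\<close>
  define q where "q \<tau> = (if a \<tau> = b \<tau> then partial_deriv j f x
    else (f ((z \<tau>)(j := b \<tau>)) - f ((z \<tau>)(j := a \<tau>))) / (b \<tau> - a \<tau>))" for \<tau>
  have "(q \<longlongrightarrow> partial_deriv j f x) F"
  proof (rule tendstoI)
    fix e :: real assume "e > 0"
    obtain d where d: "d > 0" "cube n x d \<subseteq> W"
      "\<And>y. y \<in> cube n x d \<Longrightarrow> \<bar>partial_deriv j f y - partial_deriv j f x\<bar> < e"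
      using cube_continuous[OF assms(1,4) tcd_cont[OF tcd_partial(2)[OF assms(2,3)]] \<open>e > 0\<close>]
      by metis
    have "\<forall>\<^sub>F \<tau> in F. \<forall>i\<in>{..<n} - {j}. dist (z \<tau> i) (x i) < d"
      by (intro eventually_ball_finite ballI tendstoD assms d) auto
    moreover have "\<forall>\<^sub>F \<tau> in F. dist (a \<tau>) (x j) < d" "\<forall>\<^sub>F \<tau> in F. dist (b \<tau>) (x j) < d"
      by (intro tendstoD assms d)+
    ultimately show "\<forall>\<^sub>F \<tau> in F. dist (q \<tau>) (partial_deriv j f x) < e"
    proof eventually_elim
      case (elim \<tau>)
      have in_cube: "(z \<tau>)(j := s) \<in> cube n x d" if "min (a \<tau>) (b \<tau>) \<le> s" "s \<le> max (a \<tau>) (b \<tau>)" for s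
        using elim assms(3,8) that by (auto simp: cube_def dist_real_def min_def max_def split: if_splits)
      obtain s where s: "min (a \<tau>) (b \<tau>) \<le> s" "s \<le> max (a \<tau>) (b \<tau>)"
        "f ((z \<tau>)(j := b \<tau>)) - f ((z \<tau>)(j := a \<tau>)) =
          (b \<tau> - a \<tau>) * partial_deriv j f ((z \<tau>)(j := s))"
        using coord_mvt[OF assms(2,3), of "a \<tau>" "b \<tau>" "z \<tau>"] in_cube d(2) by blast
      show ?case
      proof (cases "a \<tau> = b \<tau>")
        case True
        then show ?thesis using \<open>e > 0\<close> by (simp add: q_def)
      next
        case False
        then have "q \<tau> = partial_deriv j f ((z \<tau>)(j := s))" by (simp add: q_def s(3))
        then show ?thesis using d(3)[OF in_cube[OF s(1,2)]] by (simp add: dist_real_def)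
      qed
    qed
  qed
  moreover have "f ((z \<tau>)(j := b \<tau>)) - f ((z \<tau>)(j := a \<tau>)) = q \<tau> * (b \<tau> - a \<tau>)" for \<tau>
    by (simp add: q_def)
  ultimately show ?thesis using that by blast
qed

text \<open>The increment of \<open>f\<close> telescopes into changes of one coordinate each, and
  \<open>coord_slope\<close> handles them one by one. The derivative is taken within
  \<open>S\<close>, so end points of an interval are included.\<close>

lemma curve_chain:
  assumes "eopen n W" "times_cont_diff n (Suc 0) W f" "\<And>\<tau>. \<tau> \<in> S \<Longrightarrow> c \<tau> \<in> W" "c t \<in> W"
    and d: "\<And>i. i < n \<Longrightarrow> ((\<lambda>\<tau>. c \<tau> i) has_real_derivative d i) (at t within S)"
  shows "((\<lambda>\<tau>. f (c \<tau>)) has_real_derivative (\<Sum>i<n. partial_deriv i f (c t) * d i)) (at t within S)"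
proof -
  \<comment> \<open>The first \<open>j\<close> coordinates have moved to time \<tau>, the remaining
    ones are still at time \<open>t\<close>.\<close>
  define h where "h j \<tau> = (\<lambda>i. if i < j then c \<tau> i else c t i)" for j \<tau>
  have lim: "((\<lambda>\<tau>. c \<tau> i) \<longlongrightarrow> c t i) (at t within S)" if "i < n" for i
    using DERIV_continuous[OF d[OF that]] by (simp add: continuous_within)
  have ct: "c t i = 0" if "i \<ge> n" for i
    using eopen_subset[OF assms(1)] assms(4) that by auto
  have "((\<lambda>\<tau>. f (h j \<tau>)) has_real_derivative (\<Sum>i<j. partial_deriv i f (c t) * d i)) (at t within S)"
    if "j \<le> n" for j
    using that
  proof (induction j)
    case 0
    then show ?case by (simp add: h_def)
  next
    case (Suc j)
    then have j: "j < n" by simp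
    obtain q where q: "(q \<longlongrightarrow> partial_deriv j f (c t)) (at t within S)"
      "\<And>\<tau>. f ((h j \<tau>)(j := c \<tau> j)) - f ((h j \<tau>)(j := c t j)) = q \<tau> * (c \<tau> j - c t j)"
    proof (rule coord_slope[OF assms(1,2) j assms(4), of "h j" "at t within S" "\<lambda>_. c t j" "\<lambda>\<tau>. c \<tau> j"])
      show "((\<lambda>\<tau>. h j \<tau> i) \<longlongrightarrow> c t i) (at t within S)" if "i < n" "i \<noteq> j" for i
        using lim[OF that(1)] by (cases "i < j") (simp_all add: h_def)
      show "h j \<tau> \<in> espace n" for \<tau> using j ct by (auto simp: h_def)
    qed (use lim[OF j] in auto)
    have h1: "(h j \<tau>)(j := c \<tau> j) = h (Suc j) \<tau>" "(h j \<tau>)(j := c t j) = h j \<tau>" for \<tau>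
      by (auto simp: h_def fun_eq_iff)
    have "((\<lambda>\<tau>. q \<tau> * ((c \<tau> j - c t j) / (\<tau> - t))) \<longlongrightarrow> partial_deriv j f (c t) * d j) (at t within S)"
      by (intro tendsto_mult q d[OF j, unfolded has_field_derivative_iff])
    then have "((\<lambda>\<tau>. f (h (Suc j) \<tau>) - f (h j \<tau>)) has_real_derivative partial_deriv j f (c t) * d j) (at t within S)"
      unfolding has_field_derivative_iff using q(2) by (simp add: h1)
    from DERIV_add[OF Suc.IH this] j show ?case by (simp add: ac_simps)
  qed
  from this[of n] have *: "((\<lambda>\<tau>. f (h n \<tau>)) has_real_derivative (\<Sum>i<n. partial_deriv i f (c t) * d i)) (at t within S)"
    by simp
  have eq: "h n \<tau> = c \<tau>" if "c \<tau> \<in> W" for \<tau>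
    using eopen_subset[OF assms(1)] that ct by (auto simp: h_def fun_eq_iff)
  show ?thesis
  proof (rule iffD1[OF has_field_derivative_cong_eventually *])
    show "\<forall>\<^sub>F \<tau> in at t within S. f (h n \<tau>) = f (c \<tau>)"
      unfolding eventually_at_filter using eq assms(3) by (intro always_eventually) auto
  qed (use eq assms(4) in auto)
qed

section \<open>Closure under algebraic operations and composition\<close>

lemma tcd_const: "eopen n W \<Longrightarrow> times_cont_diff n k W (\<lambda>x. a)"
proof (induction k arbitrary: a)
  case (Suc k)
  then show ?case by (intro tcd_SucI[of n W _ "\<lambda>i x. 0"]) auto
qed simp

lemma tcd_coord: "eopen n W \<Longrightarrow> times_cont_diff n k W (\<lambda>x. x j)"
proof (induction k)
  case 0
  then show ?case by (simp add: continuous_on_coord)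
next
  case (Suc k)
  show ?case
    by (rule tcd_SucI[of n W _ "\<lambda>i x. if i = j then 1 else 0"])
      (auto simp: Suc.prems continuous_on_coord intro!: tcd_const derivative_eq_intros)
qed

lemma tcd_add:
  "eopen n W \<Longrightarrow> times_cont_diff n k W f \<Longrightarrow> times_cont_diff n k W g \<Longrightarrow> times_cont_diff n k W (\<lambda>x. f x + g x)"
proof (induction k arbitrary: f g)
  case 0
  then show ?case by (auto intro: continuous_intros)
next
  case (Suc k)
  show ?case
  proof (rule tcd_SucI[of n W _ "\<lambda>i x. partial_deriv i f x + partial_deriv i g x"])
    show "((\<lambda>t. f (x(i := t)) + g (x(i := t))) has_real_derivative
        partial_deriv i f x + partial_deriv i g x) (at (x i))" if "i < n" "x \<in> W" for i x
      using that by (intro DERIV_add tcd_partial(1)[OF Suc.prems(2)] tcd_partial(1)[OF Suc.prems(3)])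
  qed (use Suc tcd_cont in \<open>auto intro!: continuous_intros tcd_partial(2)\<close>)
qed

lemma tcd_mult:
  "eopen n W \<Longrightarrow> times_cont_diff n k W f \<Longrightarrow> times_cont_diff n k W g \<Longrightarrow> times_cont_diff n k W (\<lambda>x. f x * g x)"
proof (induction k arbitrary: f g)
  case 0
  then show ?case by (auto intro: continuous_intros)
next
  case (Suc k)
  show ?case
  proof (rule tcd_SucI[of n W _ "\<lambda>i x. partial_deriv i f x * g x + partial_deriv i g x * f x"])
    fix i x assume "i < n" "x \<in> W"
    then show "((\<lambda>t. f (x(i := t)) * g (x(i := t))) has_real_derivative
        partial_deriv i f x * g x + partial_deriv i g x * f x) (at (x i))"
      using DERIV_mult[OF tcd_partial(1)[OF Suc.prems(2), of i x] tcd_partial(1)[OF Suc.prems(3), of i x]]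
      by (simp add: fun_upd_def)
  next
    fix i assume "i < n"
    then show "times_cont_diff n k W (\<lambda>x. partial_deriv i f x * g x + partial_deriv i g x * f x)"
      using Suc by (intro tcd_add Suc.IH tcd_partial(2)) (auto intro: tcd_Suc_imp)
  qed (use Suc tcd_cont in \<open>auto intro!: continuous_intros\<close>)
qed

lemma tcd_sum:
  "eopen n W \<Longrightarrow> (\<And>i. i \<in> I \<Longrightarrow> times_cont_diff n k W (f i)) \<Longrightarrow> times_cont_diff n k W (\<lambda>x. \<Sum>i\<in>I. f i x)"
  by (induction I rule: infinite_finite_induct) (auto intro: tcd_add tcd_const)

lemma partial_deriv_compose:
  assumes W: "eopen n W" "eopen n' W'" "\<And>x. x \<in> W \<Longrightarrow> G x \<in> W'"
    and G: "\<And>i. i < n' \<Longrightarrow> times_cont_diff n (Suc 0) W (\<lambda>x. G x i)"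
    and h: "times_cont_diff n' (Suc 0) W' h" and j: "j < n" "x \<in> W"
  shows "((\<lambda>t. h (G (x(j := t)))) has_real_derivative
    (\<Sum>i<n'. partial_deriv i h (G x) * partial_deriv j (\<lambda>x. G x i) x)) (at (x j))"
proof -
  obtain d where d: "d > 0" "\<And>t. \<bar>t - x j\<bar> < d \<Longrightarrow> x(j := t) \<in> W"
    using coord_update_inside[OF W(1) j(2,1)] by metis
  let ?S = "ball (x j) d"
  have "((\<lambda>t. h (G (x(j := t)))) has_real_derivative
    (\<Sum>i<n'. partial_deriv i h (G (x(j := x j))) * partial_deriv j (\<lambda>x. G x i) x)) (at (x j) within ?S)"
  proof (rule curve_chain[OF W(2) h])
    show "G (x(j := t)) \<in> W'" if "t \<in> ?S" for t
      using that by (intro W d) (auto simp: dist_real_def abs_minus_commute)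
    show "G (x(j := x j)) \<in> W'" using W j by simp
    show "((\<lambda>\<tau>. G (x(j := \<tau>)) i) has_real_derivative partial_deriv j (\<lambda>x. G x i) x) (at (x j) within ?S)"
      if "i < n'" for i
      using tcd_partial(1)[OF G[OF that] j] by (rule has_field_derivative_at_within)
  qed
  then show ?thesis using d by (simp add: at_within_open[of _ ?S])
qed

lemma tcd_compose:
  assumes W: "eopen n W" "eopen n' W'" "\<And>x. x \<in> W \<Longrightarrow> G x \<in> W'"
    and "\<And>i. i < n' \<Longrightarrow> times_cont_diff n k W (\<lambda>x. G x i)" "times_cont_diff n' k W' h"
  shows "times_cont_diff n k W (\<lambda>x. h (G x))"
  using assms(4,5)
proof (induction k arbitrary: h)
  have *: "continuous_on W (\<lambda>x. h (G x))"
    if "\<And>i. i < n' \<Longrightarrow> continuous_on W (\<lambda>x. G x i)" "continuous_on W' h" for h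
  proof (rule continuous_on_compose2[OF that(2)])
    show "continuous_on W G"
    proof (rule continuous_on_coordinatewise_then_product)
      fix i
      show "continuous_on W (\<lambda>x. G x i)"
      proof (cases "i < n'")
        \<comment> \<open>From \<open>n'\<close> on the coordinates of \<open>G x\<close> vanish,
          because \<open>W'\<close> lies in \<open>espace n'\<close>.\<close>
        case False
        then have "\<And>x. x \<in> W \<Longrightarrow> G x i = 0" using W eopen_subset by fastforce
        then show ?thesis by (simp cong: continuous_on_cong)
      qed (use that in auto)
    qed
  qed (use W in auto)
  {
    case 0
    then show ?case using * by auto
  next
    case (Suc k)
    have "continuous_on W (\<lambda>x. h (G x))"
      by (rule *[OF tcd_cont tcd_cont]) (use Suc.prems in auto)
    show ?case
    proof (rule tcd_SucI[of n W _ "\<lambda>j x. \<Sum>i<n'. partial_deriv i h (G x) * partial_deriv j (\<lambda>x. G x i) x"])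
      fix j x assume "j < n" "x \<in> W"
      then show "((\<lambda>t. h (G (x(j := t)))) has_real_derivative
          (\<Sum>i<n'. partial_deriv i h (G x) * partial_deriv j (\<lambda>x. G x i) x)) (at (x j))"
        using Suc.prems by (intro partial_deriv_compose[OF W]) (auto intro: tcd_le)
    next
      fix j assume j: "j < n"
      show "times_cont_diff n k W (\<lambda>x. \<Sum>i<n'. partial_deriv i h (G x) * partial_deriv j (\<lambda>x. G x i) x)"
      proof (intro tcd_sum tcd_mult W(1))
        fix i assume i: "i \<in> {..<n'}"
        show "times_cont_diff n k W (\<lambda>x. partial_deriv i h (G x))"
          by (rule Suc.IH) (use Suc.prems i in \<open>auto intro: tcd_Suc_imp tcd_partial(2)\<close>)
        show "times_cont_diff n k W (partial_deriv j (\<lambda>x. G x i))"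
          using Suc.prems(1)[of i] i j by (intro tcd_partial(2)) auto
      qed
    qed (use \<open>continuous_on W (\<lambda>x. h (G x))\<close> W in auto)
  }
qed

lemma tcd_inverse:
  assumes "eopen n W" "\<And>x. x \<in> W \<Longrightarrow> f x \<noteq> 0" "times_cont_diff n k W f"
  shows "times_cont_diff n k W (\<lambda>x. inverse (f x))"
  using assms(3)
proof (induction k)
  case 0
  then show ?case using assms(2) by (auto intro!: continuous_intros)
next
  case (Suc k)
  show ?case
  \<comment> \<open>The derivative is spelled as a product of a constant, a partial derivative and
    inverses, so that the product lemma and the induction hypothesis cover it.\<close>
  proof (rule tcd_SucI[of n W _ "\<lambda>i x. (-1) * (partial_deriv i f x * (inverse (f x) * inverse (f x)))"])
    fix i x assume *: "i < n" "x \<in> W"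
    show "((\<lambda>t. inverse (f (x(i := t)))) has_real_derivative
        (-1) * (partial_deriv i f x * (inverse (f x) * inverse (f x)))) (at (x i))"
      using * assms(2) by (auto intro!: derivative_eq_intros tcd_partial(1)[OF Suc.prems] simp: ac_simps)
  next
    show "times_cont_diff n k W (\<lambda>x. (-1) * (partial_deriv i f x * (inverse (f x) * inverse (f x))))"
      if "i < n" for i
      using Suc that assms(1) by (intro tcd_mult tcd_const tcd_partial(2)) (auto intro: tcd_Suc_imp)
  qed (use assms Suc.prems tcd_cont in \<open>auto intro!: continuous_intros\<close>)
qed

section \<open>Smooth bump functions on cubes\<close>

definition flat :: "nat \<Rightarrow> real \<Rightarrow> real"
  where "flat k u = (if u > 0 then exp (- inverse u) * inverse u ^ k else 0)"

text \<open>Substituting \<open>inverse u\<close> turns the limit from the right into the growth of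
  the exponential against a power at infinity.\<close>

lemma flat_tendsto: "(flat k \<longlongrightarrow> 0) (at 0)"
proof -
  have "((\<lambda>x. inverse (inverse x) ^ k / exp (inverse (inverse x))) \<longlongrightarrow> (0::real)) at_top"
    using tendsto_power_div_exp_0 by simp
  then have "((\<lambda>x. inverse x ^ k / exp (inverse x)) \<longlongrightarrow> (0::real)) (at_right 0)"
    by (simp add: filterlim_at_right_to_top)
  then have r: "(flat k \<longlongrightarrow> 0) (at_right 0)"
    by (rule Lim_transform_eventually)
      (auto simp: eventually_at_filter flat_def exp_minus field_simps)
  have l: "(flat k \<longlongrightarrow> 0) (at_left 0)"
    by (rule tendsto_eventually) (auto simp: eventually_at_filter flat_def)
  from filterlim_split_at[OF l r] show ?thesis .
qed

text \<open>Differentiating \<open>exp (- inverse u)\<close> produces powers of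
  \<open>inverse u\<close>, which is why the family carries them: up to linear combinations it is
  closed under differentiation, and smoothness follows by induction.\<close>

lemma flat_deriv: "(flat k has_real_derivative flat (k + 2) u - real k * flat (k + 1) u) (at u)"
proof -
  consider "u > 0" | "u < 0" | "u = 0" by linarith
  then show ?thesis
  proof cases
    case 1
    have eq: "flat k x = exp (- inverse x) * inverse x ^ k" if "x \<in> {0<..}" for x
      using that by (simp add: flat_def)
    have "((\<lambda>x. exp (- inverse x) * inverse x ^ k) has_real_derivative
        flat (k + 2) u - real k * flat (k + 1) u) (at u)"
    proof (cases k)
      case 0
      then show ?thesis using 1
        by (auto intro!: derivative_eq_intros simp: flat_def power2_eq_square)
    next
      case (Suc m)
      show ?thesis using 1 unfolding Suc
        by (auto intro!: derivative_eq_intros simp: flat_def power2_eq_square algebra_simps)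
          (cases m; simp)
    qed
    then show ?thesis
      by (rule has_field_derivative_transform_within_open[of _ _ _ "{0<..}"]) (use 1 eq in auto)
  next
    case 2
    have "((\<lambda>x. 0) has_real_derivative flat (k + 2) u - real k * flat (k + 1) u) (at u)"
      using 2 by (simp add: flat_def)
    then show ?thesis
      by (rule has_field_derivative_transform_within_open[of _ _ _ "{..<0}"]) (use 2 in \<open>auto simp: flat_def\<close>)
  next
    case 3
    \<comment> \<open>The difference quotient of \<open>flat k\<close> at 0 is
      \<open>flat (Suc k)\<close>.\<close>
    have "((\<lambda>h. flat k h / h) \<longlongrightarrow> 0) (at 0)"
      by (rule Lim_transform_eventually[OF flat_tendsto[of "Suc k"]])
        (auto simp: flat_def divide_inverse eventually_at_filter)
    then show ?thesis using 3
      by (simp add: has_field_derivative_iff flat_def)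
  qed
qed

lemma tcd_flat:
  assumes "eopen n W"
  shows "times_cont_diff n k W f \<Longrightarrow> times_cont_diff n k W (\<lambda>x. flat m (f x))"
proof (induction k arbitrary: m)
  have c: "continuous_on UNIV (flat m)" for m
    by (rule DERIV_continuous_on[OF has_field_derivative_at_within[OF flat_deriv]])
  have *: "continuous_on W (\<lambda>x. flat m (f x))" if "continuous_on W f" for m
    by (rule continuous_on_compose2[OF c that]) auto
  {
    case 0
    then show ?case using * by auto
  next
    case (Suc k)
    show ?case
    proof (rule tcd_SucI[of n W _ "\<lambda>i x. (flat (m + 2) (f x) + (- real m) * flat (m + 1) (f x)) * partial_deriv i f x"])
      fix i x assume i: "i < n" "x \<in> W"
      show "((\<lambda>t. flat m (f (x(i := t)))) has_real_derivative
        (flat (m + 2) (f x) + (- real m) * flat (m + 1) (f x)) * partial_deriv i f x) (at (x i))"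
        using DERIV_chain2[OF flat_deriv tcd_partial(1)[OF Suc.prems i], of m]
        unfolding fun_upd_triv by (simp del: fun_upd_apply)
    next
      fix i assume "i < n"
      then show "times_cont_diff n k W
          (\<lambda>x. (flat (m + 2) (f x) + (- real m) * flat (m + 1) (f x)) * partial_deriv i f x)"
        using Suc assms by (intro tcd_mult tcd_add tcd_const tcd_partial(2)) (auto intro: tcd_Suc_imp)
    qed (use assms * Suc.prems tcd_cont in auto)
  }
qed

lemma bump_cube:
  assumes "e > 0"
  obtains \<beta> d where "smooth_in n (espace n) \<beta>" "d > 0" "\<And>x. x \<in> cube n c d \<Longrightarrow> \<beta> x = 1"
    "\<And>x. x \<in> espace n \<Longrightarrow> x \<notin> cube n c e \<Longrightarrow> \<beta> x = 0"
proof -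
  \<comment> \<open>\<open>u\<close> is \<open>2 - 2 |x - c|^2 / e^2\<close>. It is at most 0
    outside the large cube and at least 1 on the small one, so the quotient \<open>\<beta>\<close>
    is 0 and 1 there. Sums and constant factors replace differences to suit the closure
    lemmas.\<close>
  define u where "u x = 2 + (- 1 / e\<^sup>2 * 2) * (\<Sum>i<n. (x i + - c i) * (x i + - c i))" for x :: "nat \<Rightarrow> real"
  define \<beta> where "\<beta> x = flat 0 (u x) * inverse (flat 0 (u x) + flat 0 (1 + (-1) * u x))" for x
  have nz: "flat 0 s + flat 0 (1 + (-1) * s) \<noteq> 0" for s
  proof -
    have "flat 0 s \<ge> 0" "flat 0 (1 + (-1) * s) \<ge> 0" "s > 0 \<Longrightarrow> flat 0 s > 0" "s \<le> 0 \<Longrightarrow> flat 0 (1 + (-1) * s) > 0"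
      by (auto simp: flat_def)
    then show ?thesis by (cases "s > 0") auto
  qed
  have "smooth_in n (espace n) \<beta>"
    unfolding smooth_in_def \<beta>_def u_def
    by (intro allI tcd_mult tcd_inverse tcd_flat tcd_add tcd_sum tcd_const tcd_coord eopen_espace nz)
  \<comment> \<open>A sum of \<open>n\<close> squares, each at most
    \<open>e^2 / (4 (n + 1)^2)\<close>, is at most \<open>e^2 / 2\<close>, which gives
    \<open>u x \<ge> 1\<close>; the added 1 covers \<open>n = 0\<close>.\<close>
  moreover have "\<beta> x = 1" if x: "x \<in> cube n c (e / (2 * (real n + 1)))" for x
  proof -
    let ?d = "e / (2 * (real n + 1))"
    have d: "?d > 0" using assms by simp
    have "(\<Sum>i<n. (x i + - c i) * (x i + - c i)) \<le> (\<Sum>i<n. ?d * ?d)"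
    proof (rule sum_mono)
      fix i assume "i \<in> {..<n}"
      then have "\<bar>x i + - c i\<bar> \<le> ?d" using x by (force simp: cube_def)
      then have "\<bar>x i + - c i\<bar> * \<bar>x i + - c i\<bar> \<le> ?d * ?d" by (intro mult_mono) auto
      then show "(x i + - c i) * (x i + - c i) \<le> ?d * ?d" by (simp add: abs_mult_self_eq)
    qed
    also have "\<dots> = e\<^sup>2 / 2 * (real n / (2 * (real n + 1)\<^sup>2))"
      by (simp add: power2_eq_square field_simps)
    also have "\<dots> \<le> e\<^sup>2 / 2 * 1"
    proof (rule mult_left_mono)
      have "real n \<le> 2 * (real n + 1)\<^sup>2" by (simp add: power2_eq_square algebra_simps)
      then show "real n / (2 * (real n + 1)\<^sup>2) \<le> 1" by (simp add: divide_le_eq)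
    qed simp
    finally have "u x \<ge> 1" using assms by (simp add: u_def field_simps)
    then have "flat 0 (1 + (-1) * u x) = 0" "flat 0 (u x) > 0" by (auto simp: flat_def)
    then show ?thesis by (simp add: \<beta>_def)
  qed
  moreover have "\<beta> x = 0" if x: "x \<in> espace n" "x \<notin> cube n c e" for x
  proof -
    obtain i where i: "i < n" "\<bar>x i - c i\<bar> \<ge> e" using x by (force simp: cube_def)
    have "e\<^sup>2 \<le> \<bar>x i - c i\<bar>\<^sup>2" using i assms by (intro power_mono) auto
    also have "\<dots> = (x i + - c i) * (x i + - c i)" by (simp add: power2_eq_square)
    also have "\<dots> \<le> (\<Sum>i<n. (x i + - c i) * (x i + - c i))"
      using i by (intro member_le_sum) auto
    finally have "u x \<le> 0" using assms by (simp add: u_def field_simps)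
    then show ?thesis by (simp add: \<beta>_def flat_def)
  qed
  ultimately show ?thesis using assms that[of \<beta> "e / (2 * (real n + 1))"] by auto
qed

section \<open>The class of smooth functions on an open set\<close>

lemma smooth_inD: "smooth_in n W f \<Longrightarrow> times_cont_diff n k W f"
  by (simp add: smooth_in_def)

lemma smooth_in_cont: "smooth_in n W f \<Longrightarrow> continuous_on W f"
  using smooth_inD tcd_cont by blast

lemma smooth_in_const: "eopen n W \<Longrightarrow> smooth_in n W (\<lambda>x. a)"
  by (simp add: smooth_in_def tcd_const)

lemma smooth_in_coord: "eopen n W \<Longrightarrow> smooth_in n W (\<lambda>x. x j)"
  by (simp add: smooth_in_def tcd_coord)

lemma smooth_in_add:
  "eopen n W \<Longrightarrow> smooth_in n W f \<Longrightarrow> smooth_in n W g \<Longrightarrow> smooth_in n W (\<lambda>x. f x + g x)"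
  by (simp add: smooth_in_def tcd_add)

lemma smooth_in_mult:
  "eopen n W \<Longrightarrow> smooth_in n W f \<Longrightarrow> smooth_in n W g \<Longrightarrow> smooth_in n W (\<lambda>x. f x * g x)"
  by (simp add: smooth_in_def tcd_mult)

lemma smooth_in_minus: "eopen n W \<Longrightarrow> smooth_in n W f \<Longrightarrow> smooth_in n W (\<lambda>x. - f x)"
  using smooth_in_mult[OF _ smooth_in_const[of n W "-1"]] by force

lemma smooth_in_diff:
  "eopen n W \<Longrightarrow> smooth_in n W f \<Longrightarrow> smooth_in n W g \<Longrightarrow> smooth_in n W (\<lambda>x. f x - g x)"
  using smooth_in_add[OF _ _ smooth_in_minus] by force

lemma smooth_in_inverse:
  "eopen n W \<Longrightarrow> smooth_in n W f \<Longrightarrow> (\<And>x. x \<in> W \<Longrightarrow> f x \<noteq> 0) \<Longrightarrow> smooth_in n W (\<lambda>x. inverse (f x))"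
  by (simp add: smooth_in_def tcd_inverse)

lemma smooth_in_compose:
  assumes "eopen n W" "eopen n' W'" "\<And>x. x \<in> W \<Longrightarrow> G x \<in> W'"
    and "\<And>i. i < n' \<Longrightarrow> smooth_in n W (\<lambda>x. G x i)" "smooth_in n' W' h"
  shows "smooth_in n W (\<lambda>x. h (G x))"
  unfolding smooth_in_def
  using tcd_compose[OF assms(1-3) smooth_inD[OF assms(4)] smooth_inD[OF assms(5)]] by blast

lemma smooth_in_cong:
  "eopen n W \<Longrightarrow> (\<And>x. x \<in> W \<Longrightarrow> f x = g x) \<Longrightarrow> smooth_in n W f \<Longrightarrow> smooth_in n W g"
  unfolding smooth_in_def using tcd_cong by blast

lemma smooth_in_subset: "smooth_in n W f \<Longrightarrow> W' \<subseteq> W \<Longrightarrow> smooth_in n W' f"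
  unfolding smooth_in_def using tcd_subset by blast

lemma smooth_in_local:
  assumes "\<And>x. x \<in> W \<Longrightarrow> \<exists>W'. eopen n W' \<and> x \<in> W' \<and> smooth_in n W' f" "eopen n W"
  shows "smooth_in n W f"
  unfolding smooth_in_def
proof
  show "times_cont_diff n k W f" for k
    by (rule tcd_local[OF _ assms(2)]) (use assms(1) smooth_inD[of n _ f k] in meson)
qed

lemma smooth_in_partial: "smooth_in n W f \<Longrightarrow> i < n \<Longrightarrow> smooth_in n W (partial_deriv i f)"
  unfolding smooth_in_def using tcd_partial(2) by blast

lemma smooth_in_deriv:
  "smooth_in n W f \<Longrightarrow> i < n \<Longrightarrow> x \<in> W \<Longrightarrow>
    ((\<lambda>t. f (x(i := t))) has_real_derivative partial_deriv i f x) (at (x i))"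
  using smooth_inD tcd_partial(1) by blast

section \<open>Hadamard's lemma\<close>

lemma cube_segment:
  assumes "x \<in> cube n c e" "t \<in> {0..1}" "c \<in> espace n"
  shows "(\<lambda>i. c i + t * (x i - c i)) \<in> cube n c e"
proof -
  have "\<bar>t * (x i - c i)\<bar> < e" if "i < n" for i
  proof -
    have "\<bar>t * (x i - c i)\<bar> = \<bar>t\<bar> * \<bar>x i - c i\<bar>" by (rule abs_mult)
    also have "\<dots> \<le> 1 * \<bar>x i - c i\<bar>" using assms(2) by (intro mult_right_mono) auto
    also have "\<dots> < e" using assms(1) that by (simp add: cube_def)
    finally show ?thesis .
  qed
  then show ?thesis using assms by (simp add: cube_def)
qed

text \<open>The remainder in Hadamard's lemma is an integral of this form.\<close>

lemma tcd_segment_integral: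
  assumes "times_cont_diff n k (cube n c e) F" "c \<in> espace n" "e > 0"
  shows "times_cont_diff n k (cube n c e)
    (\<lambda>x. integral {0..1} (\<lambda>t. t ^ l * F (\<lambda>i. c i + t * (x i - c i))))"
  using assms(1)
proof (induction k arbitrary: F l)
  define Z where "Z x t = (\<lambda>i. c i + t * (x i - c i))" for x :: "nat \<Rightarrow> real" and t
  have Zin: "Z x t \<in> cube n c e" if "x \<in> cube n c e" "t \<in> {0..1}" for x t
    unfolding Z_def by (rule cube_segment[OF that assms(2)])
  have int_cont: "continuous_on (S \<times> {0..1}) (\<lambda>(s, t). t ^ l * F (Z (g s) t))"
    if "continuous_on (cube n c e) F" "continuous_on S g" "g ` S \<subseteq> cube n c e"
    for F l and S :: "'x::topological_space set" and g
  proof -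
    have g: "continuous_on S (\<lambda>s. g s i)" for i
      using that(2) by (rule continuous_on_product_then_coordinatewise)
    have "continuous_on (S \<times> {0..1}) (\<lambda>p. Z (g (fst p)) (snd p))"
      unfolding Z_def
      by (intro continuous_on_coordinatewise_then_product continuous_intros continuous_on_compose2[OF g]) auto
    then have "continuous_on (S \<times> {0..1}) (\<lambda>p. F (Z (g (fst p)) (snd p)))"
      by (rule continuous_on_compose2[OF that(1)]) (use that(3) Zin in auto)
    then show ?thesis
      unfolding case_prod_beta by (intro continuous_intros) auto
  qed
  have cont: "continuous_on (cube n c e) (\<lambda>x. integral {0..1} (\<lambda>t. t ^ l * F (Z x t)))"
    if "continuous_on (cube n c e) F" for F l
    using integral_continuous_on_param[of "cube n c e" 0 1 "\<lambda>x t. t ^ l * F (Z x t)"]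
      int_cont[OF that, of "cube n c e" "\<lambda>x. x" l] by (simp add: continuous_on_id)
  {
    case 0
    then show ?case using cont by (simp add: Z_def)
  next
    case (Suc k)
    show ?case
    \<comment> \<open>Differentiating under the integral in the coordinate \<open>j\<close> brings
      out a factor \<open>t\<close>, which is why the claim carries a general power
      \<open>t ^ l\<close>.\<close>
    proof (rule tcd_SucI[of n _ _ "\<lambda>j x. integral {0..1} (\<lambda>t. t ^ Suc l * partial_deriv j F (\<lambda>i. c i + t * (x i - c i)))"])
      fix j x assume j: "j < n" and x: "x \<in> cube n c e"
      \<comment> \<open>The parameters for which \<open>x(j := s)\<close> stays in the cube; the
        interval is open, so the derivative within it is the full derivative.\<close>
      let ?U = "ball (c j) e"
      have upd: "x(j := s) \<in> cube n c e" if "s \<in> ?U" for s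
        using x j that by (auto simp: cube_def dist_real_def abs_minus_commute)
      have xj: "x j \<in> ?U" using x j by (auto simp: cube_def dist_real_def abs_minus_commute)
      have Zupd: "Z (x(j := s)) t = (Z x t)(j := c j + t * (s - c j))" for s t
        by (auto simp: Z_def)
      have "((\<lambda>s. integral (cbox 0 1) (\<lambda>t. t ^ l * F (Z (x(j := s)) t))) has_real_derivative
        integral (cbox 0 1) (\<lambda>t. t ^ Suc l * partial_deriv j F (Z (x(j := x j)) t))) (at (x j) within ?U)"
      proof (rule leibniz_rule_field_derivative[where fx = "\<lambda>s t. t ^ Suc l * partial_deriv j F (Z (x(j := s)) t)"])
        fix s and t :: real assume s: "s \<in> ?U" "t \<in> cbox 0 1"
        have "Z (x(j := s)) t \<in> cube n c e" using upd[OF s(1)] s(2) by (intro Zin) auto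
        then have "((\<lambda>r. F ((Z (x(j := s)) t)(j := r))) has_real_derivative
            partial_deriv j F (Z (x(j := s)) t)) (at ((Z (x(j := s)) t) j))"
          by (rule tcd_partial(1)[OF Suc.prems j])
        then have "((\<lambda>r. F ((Z x t)(j := r))) has_real_derivative
            partial_deriv j F (Z (x(j := s)) t)) (at (c j + t * (s - c j)))"
          by (simp add: Zupd del: fun_upd_apply) (simp add: Z_def)
        moreover have "((\<lambda>s. c j + t * (s - c j)) has_real_derivative t) (at s within ?U)"
          by (auto intro!: derivative_eq_intros)
        ultimately have "((\<lambda>s. F ((Z x t)(j := c j + t * (s - c j)))) has_real_derivative
            partial_deriv j F (Z (x(j := s)) t) * t) (at s within ?U)"
          by (rule DERIV_chain2)
        from DERIV_cmult[OF this, of "t ^ l"]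
        show "((\<lambda>s. t ^ l * F (Z (x(j := s)) t)) has_real_derivative
            t ^ Suc l * partial_deriv j F (Z (x(j := s)) t)) (at s within ?U)"
          unfolding Zupd by (simp add: ac_simps)
      next
        fix s assume s: "s \<in> ?U"
        have "continuous_on ({s} \<times> {0..1}) (\<lambda>(s, t). t ^ l * F (Z (x(j := s)) t))"
        proof (intro int_cont tcd_cont[OF Suc.prems] continuous_on_coord_update)
          show "(\<lambda>s. x(j := s)) ` {s} \<subseteq> cube n c e"
            using upd[OF s] by (simp only: image_insert image_empty insert_subset empty_subsetI simp_thms)
        qed
        then have "continuous_on {0..1} (\<lambda>t. (\<lambda>(s, t). t ^ l * F (Z (x(j := s)) t)) (s, t))"
          by (rule continuous_on_compose2) (auto intro!: continuous_intros)
        then show "(\<lambda>t. t ^ l * F (Z (x(j := s)) t)) integrable_on cbox 0 1"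
          by (intro integrable_continuous) simp
      next
        show "continuous_on (?U \<times> cbox 0 1) (\<lambda>(s, t). t ^ Suc l * partial_deriv j F (Z (x(j := s)) t))"
          using int_cont[OF tcd_cont[OF tcd_partial(2)[OF Suc.prems j]] continuous_on_coord_update[of ?U x j], of "Suc l"] upd
          by (simp add: image_subset_iff fun_upd_def)
      qed (use xj in auto)
      then show "((\<lambda>t. integral {0..1} (\<lambda>ta. ta ^ l * F (\<lambda>i. c i + ta * ((x(j := t)) i - c i)))) has_real_derivative
          integral {0..1} (\<lambda>t. t ^ Suc l * partial_deriv j F (\<lambda>i. c i + t * (x i - c i)))) (at (x j))"
        using xj by (simp add: at_within_open[of _ ?U] Z_def)
    next
      fix j assume "j < n"
      then show "times_cont_diff n k (cube n c e)
          (\<lambda>x. integral {0..1} (\<lambda>t. t ^ Suc l * partial_deriv j F (\<lambda>i. c i + t * (x i - c i))))"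
        by (intro Suc.IH tcd_partial(2)[OF Suc.prems])
    qed (use cont[OF tcd_cont[OF Suc.prems]] eopen_cube in \<open>auto simp: Z_def\<close>)
  }
qed

text \<open>This is the fundamental theorem of calculus along the segment from \<open>c\<close> to
  \<open>x\<close>: the coefficient of \<open>x i - c i\<close> is the mean of the partial
  derivative over the segment, and at \<open>x = c\<close> the integrand is constant.\<close>

lemma hadamard:
  assumes "smooth_in n (cube n c e) f" "c \<in> espace n" "e > 0"
  obtains g where "\<And>i. i < n \<Longrightarrow> smooth_in n (cube n c e) (g i)"
    "\<And>i. i < n \<Longrightarrow> g i c = partial_deriv i f c"
    "\<And>x. x \<in> cube n c e \<Longrightarrow> f x = f c + (\<Sum>i<n. (x i - c i) * g i x)"
proof
  define g where "g i x = integral {0..1} (\<lambda>t. t ^ 0 * partial_deriv i f (\<lambda>j. c j + t * (x j - c j)))" for i x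
  show "smooth_in n (cube n c e) (g i)" if "i < n" for i
    unfolding smooth_in_def g_def
    by (intro allI tcd_segment_integral assms(2,3) smooth_inD[OF smooth_in_partial[OF assms(1) that]])
  show "g i c = partial_deriv i f c" for i by (simp add: g_def)
  fix x assume x: "x \<in> cube n c e"
  define Z where "Z t = (\<lambda>j. c j + t * (x j - c j))" for t
  have Zin: "Z t \<in> cube n c e" if "t \<in> {0..1}" for t
    unfolding Z_def by (rule cube_segment[OF x that assms(2)])
  have D: "((\<lambda>t. f (Z t)) has_real_derivative (\<Sum>i<n. partial_deriv i f (Z t) * (x i - c i))) (at t within {0..1})"
    if "t \<in> {0..1}" for t
    by (rule curve_chain[OF eopen_cube smooth_inD[OF assms(1)]])
      (use Zin that in \<open>auto simp: Z_def intro!: derivative_eq_intros\<close>)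
  have "((\<lambda>t. \<Sum>i<n. partial_deriv i f (Z t) * (x i - c i)) has_integral (f (Z 1) - f (Z 0))) {0..1}"
    using D by (intro fundamental_theorem_of_calculus) (auto simp: has_real_derivative_iff_has_vector_derivative)
  moreover have "((\<lambda>t. \<Sum>i<n. partial_deriv i f (Z t) * (x i - c i)) has_integral (\<Sum>i<n. g i x * (x i - c i))) {0..1}"
  proof (intro has_integral_sum has_integral_mult_left finite_lessThan)
    fix i assume "i \<in> {..<n}"
    then have "continuous_on (cube n c e) (partial_deriv i f)"
      using smooth_in_cont[OF smooth_in_partial[OF assms(1)]] by simp
    then have "continuous_on {0..1} (\<lambda>t. partial_deriv i f (Z t))"
      by (rule continuous_on_compose2)
        (use Zin in \<open>auto simp: Z_def intro!: continuous_on_coordinatewise_then_product continuous_intros\<close>)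
    then show "((\<lambda>t. partial_deriv i f (Z t)) has_integral g i x) {0..1}"
      unfolding g_def using integrable_integral[OF integrable_continuous_real] by (simp add: Z_def)
  qed
  ultimately have "f (Z 1) - f (Z 0) = (\<Sum>i<n. g i x * (x i - c i))"
    by (rule has_integral_unique)
  then show "f x = f c + (\<Sum>i<n. (x i - c i) * g i x)"
    by (simp add: Z_def mult.commute algebra_simps)
qed


text \<open>Inverse function theorem for the map that replaces \<open>x k\<close> by
  \<open>\<Gamma> x\<close>; \<open>H\<close> is the only nontrivial coordinate of the inverse. With
  the other coordinates frozen, \<open>\<Gamma>\<close> is strictly monotone in the coordinate
  \<open>k\<close>, so the intermediate value theorem does the work of a contraction
  argument.\<close>

lemma implicit_coord:
  assumes W: "eopen n W" and G: "smooth_in n W \<Gamma>" and c: "c \<in> W" and k: "k < n"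
    and nz: "partial_deriv k \<Gamma> c \<noteq> 0"
  obtains W' H V where "eopen n W'" "smooth_in n W' H" "eopen n V" "c \<in> V" "V \<subseteq> W"
    "\<And>x. x \<in> V \<Longrightarrow> x(k := \<Gamma> x) \<in> W' \<and> H (x(k := \<Gamma> x)) = x k"
proof -
  \<comment> \<open>Multiplying by the sign of the derivative reduces both signs to the increasing
    case.\<close>
  let ?\<sigma> = "sgn (partial_deriv k \<Gamma> c)"
  define P where "P x = ?\<sigma> * partial_deriv k \<Gamma> x" for x
  have Pc: "P c > 0" using nz by (simp add: P_def sgn_if)
  have "continuous_on W P"
    unfolding P_def by (intro continuous_intros smooth_in_cont[OF smooth_in_partial[OF G k]])
  then obtain e where e: "e > 0" "cube n c e \<subseteq> W" "\<And>x. x \<in> cube n c e \<Longrightarrow> \<bar>P x - P c\<bar> < P c"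
    using cube_continuous[OF W c _ Pc] by metis
  have Ppos: "P x > 0" if "x \<in> cube n c e" for x using e(3)[OF that] by linarith
  have \<sigma>: "?\<sigma> * ?\<sigma> = 1" using nz by (simp add: sgn_if)
  \<comment> \<open>The coordinate \<open>k\<close> of a point of \<open>B\<close> is free: it will
    hold a value of \<open>\<Gamma>\<close>, which may be far from \<open>c k\<close>.\<close>
  define B where "B = {y \<in> espace n. \<forall>i<n. i \<noteq> k \<longrightarrow> \<bar>y i - c i\<bar> < e}"
  have Bopen: "eopen n B"
  proof -
    have "open (\<Inter>i\<in>{..<n}-{k}. {x::nat \<Rightarrow> real. \<bar>x i - c i\<bar> < e})"
      by (intro open_INT finite_Diff finite_lessThan ballI open_Collect_less continuous_intros continuous_on_coord)
    then show ?thesis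
      unfolding eopen_iff B_def by (intro exI conjI, assumption) auto
  qed
  have Bupd: "y(k := s) \<in> cube n c e" if "y \<in> B" "\<bar>s - c k\<bar> < e" for y s
    using that k by (auto simp: B_def cube_def)
  have contB: "continuous_on A (\<lambda>y. \<Gamma> (y(k := s y)))"
    if "continuous_on A s" "A \<subseteq> B" "\<And>y. y \<in> A \<Longrightarrow> \<bar>s y - c k\<bar> < e" for A s
  proof (rule continuous_on_compose2[OF smooth_in_cont[OF G]])
    show "continuous_on A (\<lambda>y. y(k := s y))"
    proof (rule continuous_on_coordinatewise_then_product)
      show "continuous_on A (\<lambda>y. (y(k := s y)) i)" for i
        by (cases "i = k") (use that continuous_on_coord in auto)
    qed
    show "(\<lambda>y. y(k := s y)) ` A \<subseteq> W"
      using that Bupd e(2) by (intro image_subsetI) blast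
  qed
  have mono: "?\<sigma> * \<Gamma> (y(k := s)) < ?\<sigma> * \<Gamma> (y(k := s'))"
    if "y \<in> B" "\<bar>s - c k\<bar> < e" "\<bar>s' - c k\<bar> < e" "s < s'" for y s s'
  proof -
    have in_cube: "y(k := r) \<in> cube n c e" if "min s s' \<le> r" "r \<le> max s s'" for r
      using that \<open>\<bar>s - c k\<bar> < e\<close> \<open>\<bar>s' - c k\<bar> < e\<close> by (intro Bupd \<open>y \<in> B\<close>) linarith
    obtain r where r: "min s s' \<le> r" "r \<le> max s s'"
      "\<Gamma> (y(k := s')) - \<Gamma> (y(k := s)) = (s' - s) * partial_deriv k \<Gamma> (y(k := r))"
      using coord_mvt[OF smooth_inD[OF G] k, of s s' y] in_cube e(2) by blast
    have "0 < (s' - s) * P (y(k := r))"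
      using that Ppos[OF in_cube[OF r(1,2)]] by simp
    also have "\<dots> = ?\<sigma> * (\<Gamma> (y(k := s')) - \<Gamma> (y(k := s)))"
      unfolding r(3) P_def by (simp only: mult_ac)
    finally show ?thesis by (simp add: right_diff_distrib)
  qed
  \<comment> \<open>Half the side leaves room: the end points \<open>c k - a\<close> and
    \<open>c k + a\<close>, and small shifts of a solution, stay within distance \<open>e\<close> of
    \<open>c k\<close>.\<close>
  define a where "a = e / 2"
  have a: "0 < a" "a < e" using e(1) by (auto simp: a_def)
  \<comment> \<open>Points whose coordinate \<open>k\<close> lies strictly between the values of
    \<open>\<Gamma>\<close> at the two end points. The intermediate value theorem applies to them,
    and the strict inequalities make the set open.\<close>
  define W' where "W' = {y \<in> {y\<in>B. ?\<sigma> * \<Gamma> (y(k := c k - a)) < ?\<sigma> * y k}. ?\<sigma> * y k < ?\<sigma> * \<Gamma> (y(k := c k + a))}"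
  have W'B: "W' \<subseteq> B" by (auto simp: W'_def)
  have W'open: "eopen n W'"
    unfolding W'_def
    by (intro eopen_less Bopen continuous_intros contB continuous_on_coord) (use a in auto)
  define H where "H y = (SOME s. \<bar>s - c k\<bar> < a \<and> \<Gamma> (y(k := s)) = y k)" for y
  have H: "\<bar>H y - c k\<bar> < a" "\<Gamma> (y(k := H y)) = y k" if y: "y \<in> W'" for y
  proof -
    let ?f = "\<lambda>s. ?\<sigma> * \<Gamma> (y(k := s))"
    have "continuous_on {c k - a..c k + a} (\<lambda>s. \<Gamma> (y(k := s)))"
    proof (rule continuous_on_compose2[OF smooth_in_cont[OF G] continuous_on_coord_update])
      show "(\<lambda>s. y(k := s)) ` {c k - a..c k + a} \<subseteq> W"
      proof (rule image_subsetI)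
        fix s assume "s \<in> {c k - a..c k + a}"
        then have "\<bar>s - c k\<bar> < e" using a by auto
        then show "y(k := s) \<in> W" using Bupd y W'B e(2) by blast
      qed
    qed
    then have cf: "continuous_on {c k - a..c k + a} ?f" by (intro continuous_intros)
    have "?f (c k - a) < ?\<sigma> * y k" "?\<sigma> * y k < ?f (c k + a)" using y by (auto simp: W'_def)
    then obtain s where s: "c k - a \<le> s" "s \<le> c k + a" "?f s = ?\<sigma> * y k"
      using IVT'[of ?f "c k - a" "?\<sigma> * y k" "c k + a"] cf a by force
    have "s \<noteq> c k - a" "s \<noteq> c k + a"
      using s(3) \<open>?f (c k - a) < ?\<sigma> * y k\<close> \<open>?\<sigma> * y k < ?f (c k + a)\<close> by auto
    then have "\<bar>s - c k\<bar> < a" using s by auto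
    moreover have "\<Gamma> (y(k := s)) = y k" using s(3) nz by (simp add: sgn_if split: if_splits)
    ultimately have "\<exists>s. \<bar>s - c k\<bar> < a \<and> \<Gamma> (y(k := s)) = y k" by blast
    from someI_ex[OF this] show "\<bar>H y - c k\<bar> < a" "\<Gamma> (y(k := H y)) = y k"
      unfolding H_def by auto
  qed
  \<comment> \<open>Monotonicity turns comparisons with \<open>H y\<close> into strict inequalities
    between continuous functions, from which the continuity of \<open>H\<close> is read off.\<close>
  have H_less: "s < H y \<longleftrightarrow> ?\<sigma> * \<Gamma> (y(k := s)) < ?\<sigma> * y k" "H y < s \<longleftrightarrow> ?\<sigma> * y k < ?\<sigma> * \<Gamma> (y(k := s))"
    if "y \<in> W'" "\<bar>s - c k\<bar> < e" for y s
  proof -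
    have h: "\<bar>H y - c k\<bar> < e" using H(1)[OF that(1)] a by linarith
    have yB: "y \<in> B" using W'B that by auto
    have "s < H y \<Longrightarrow> ?\<sigma> * \<Gamma> (y(k := s)) < ?\<sigma> * y k" "H y < s \<Longrightarrow> ?\<sigma> * y k < ?\<sigma> * \<Gamma> (y(k := s))"
      using mono[OF yB that(2) h] mono[OF yB h that(2)] H(2)[OF that(1)] by auto
    moreover have "s = H y \<Longrightarrow> ?\<sigma> * y k = ?\<sigma> * \<Gamma> (y(k := s))" using H(2)[OF that(1)] by simp
    ultimately show "s < H y \<longleftrightarrow> ?\<sigma> * \<Gamma> (y(k := s)) < ?\<sigma> * y k" "H y < s \<longleftrightarrow> ?\<sigma> * y k < ?\<sigma> * \<Gamma> (y(k := s))"
      by (metis less_asym linorder_neqE_linordered_idom)+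
  qed
  have Hcont: "continuous_on W' H"
  proof (rule continuous_on_eopenI[OF _ eopen_subset[OF W'open]])
    fix y and r :: real assume y: "y \<in> W'" and r: "r > 0"
    define d where "d = min (r / 2) ((e - a) / 2)"
    have d: "0 < d" "d < r" "d < e - a" using r a by (auto simp: d_def min_def field_simps)
    have s: "\<bar>H y - d - c k\<bar> < e" "\<bar>H y + d - c k\<bar> < e" using H(1)[OF y] d by linarith+
    let ?A = "{z \<in> {z\<in>W'. ?\<sigma> * \<Gamma> (z(k := H y - d)) < ?\<sigma> * z k}. ?\<sigma> * z k < ?\<sigma> * \<Gamma> (z(k := H y + d))}"
    have "eopen n ?A"
      by (intro eopen_less W'open continuous_intros contB continuous_on_coord) (use W'B s in auto)
    moreover have "y \<in> ?A" using y iffD1[OF H_less(1)[OF y s(1)]] iffD1[OF H_less(2)[OF y s(2)]] d by auto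
    moreover have "\<bar>H z - H y\<bar> < r" if "z \<in> ?A" for z
    proof -
      have "z \<in> W'" using that by auto
      then have "H y - d < H z" "H z < H y + d" using H_less(1)[OF _ s(1), of z] H_less(2)[OF _ s(2), of z] that by auto
      then show ?thesis using d by linarith
    qed
    ultimately show "\<exists>A. eopen n A \<and> y \<in> A \<and> (\<forall>z\<in>A \<inter> W'. \<bar>H z - H y\<bar> < r)" by blast
  qed
  have graph: "y(k := H y) \<in> cube n c e" if "y \<in> W'" for y
    using that W'B H(1)[OF that] a by (intro Bupd) auto
  \<comment> \<open>Implicit differentiation at the point of the graph: the reciprocal of the
    \<open>k\<close>-th partial derivative for \<open>j = k\<close>, and minus the
    \<open>j\<close>-th divided by the \<open>k\<close>-th otherwise.\<close>
  define D where "D j y = ((if j = k then 1 else 0) + (if j = k then 0 else -1) * partial_deriv j \<Gamma> (y(k := H y)))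
    * inverse (partial_deriv k \<Gamma> (y(k := H y)))" for j y
  have nzk: "partial_deriv k \<Gamma> x \<noteq> 0" if "x \<in> cube n c e" for x
    using Ppos[OF that] by (auto simp: P_def)
  have HD: "((\<lambda>t. H (y(j := t))) has_real_derivative D j y) (at (y j))" if y: "y \<in> W'" and j: "j < n" for y j
  proof -
    let ?x = "y(k := H y)" and ?F = "at (y j)"
    have xW: "?x \<in> W" using graph[OF y] e(2) by blast
    have yE: "y \<in> espace n" using y W'open eopen_subset by blast
    have ev: "\<forall>\<^sub>F t in ?F. y(j := t) \<in> W'"
      using eventually_coord_update[OF W'open y j] by (simp add: eventually_nhds_conv_at)
    have tl: "((\<lambda>t. t) \<longlongrightarrow> y j) ?F" by (rule tendsto_ident_at)
    have upd_lim: "((\<lambda>t. y(j := t)) \<longlongrightarrow> y) ?F"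
      using continuous_on_coord_update[of UNIV y j] unfolding continuous_on_def by (metis UNIV_I fun_upd_triv)
    have Hlim: "((\<lambda>t. H (y(j := t))) \<longlongrightarrow> H y) ?F"
      using continuous_on_tendsto_compose[OF Hcont upd_lim y ev] .
    have zlim: "((\<lambda>t. (y(j := t)) i) \<longlongrightarrow> ?x i) ?F" if "i \<noteq> k" for i
      using that tl by (cases "i = j") auto
    obtain q where q: "(q \<longlongrightarrow> partial_deriv k \<Gamma> ?x) ?F"
      "\<And>t. \<Gamma> ((y(j := t))(k := H (y(j := t)))) - \<Gamma> ((y(j := t))(k := H y)) = q t * (H (y(j := t)) - H y)"
      by (rule coord_slope[OF W smooth_inD[OF G] k xW, of "\<lambda>t. y(j := t)" ?F "\<lambda>t. H y" "\<lambda>t. H (y(j := t))"])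
        (use zlim Hlim yE j in auto)
    have qnz: "\<forall>\<^sub>F t in ?F. q t \<noteq> 0"
      using tendsto_imp_eventually_ne[OF q(1) nzk[OF graph[OF y]]] .
    \<comment> \<open>In both cases the slope \<open>q\<close> of \<open>\<Gamma>\<close> times the
      increment of \<open>H\<close> is \<open>p\<close> times the increment of \<open>t\<close>: the
      value of \<open>\<Gamma>\<close> moves with \<open>t\<close> if \<open>j = k\<close> and is
      kept constant otherwise.\<close>
    obtain p where p: "(p \<longlongrightarrow> (if j = k then 1 else 0) + (if j = k then 0 else -1) * partial_deriv j \<Gamma> ?x) ?F"
      "\<And>t. y(j := t) \<in> W' \<Longrightarrow> q t * (H (y(j := t)) - H y) = p t * (t - y j)"
    proof (cases "j = k")
      case True
      have "q t * (H (y(j := t)) - H y) = 1 * (t - y j)" if "y(j := t) \<in> W'" for t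
        using q(2)[of t] H(2)[OF that] H(2)[OF y] True by simp
      then show ?thesis using that[of "\<lambda>_. 1"] True by simp
    next
      case False
      obtain p where p: "(p \<longlongrightarrow> partial_deriv j \<Gamma> ?x) ?F"
        "\<And>t. \<Gamma> (?x(j := t)) - \<Gamma> (?x(j := y j)) = p t * (t - y j)"
        by (rule coord_slope[OF W smooth_inD[OF G] j xW, of "\<lambda>t. ?x" ?F "\<lambda>t. y j" "\<lambda>t. t"])
          (use False tl yE k in auto)
      have tw: "?x(j := t) = (y(j := t))(k := H y)" for t using False by (simp add: fun_upd_twist)
      have "q t * (H (y(j := t)) - H y) = - p t * (t - y j)" if "y(j := t) \<in> W'" for t
      proof -
        have "\<Gamma> ((y(j := t))(k := H (y(j := t)))) = \<Gamma> (?x(j := y j))"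
          using H(2)[OF that] H(2)[OF y] False unfolding tw by simp
        then show ?thesis using q(2)[of t] p(2)[of t] unfolding tw by simp
      qed
      then show ?thesis using that[of "\<lambda>t. - p t"] False tendsto_minus[OF p(1)] by simp
    qed
    have "((\<lambda>t. p t * inverse (q t)) \<longlongrightarrow> D j y) ?F"
      unfolding D_def by (intro tendsto_mult p(1) tendsto_inverse q(1) nzk graph y)
    moreover have "\<forall>\<^sub>F t in ?F. p t * inverse (q t) = (H (y(j := t)) - H (y(j := y j))) / (t - y j)"
      using ev qnz eventually_neq_at_within[of "y j" "y j" UNIV]
    proof eventually_elim
      case (elim t)
      then show ?case using p(2)[of t] by (simp add: field_simps)
    qed
    ultimately show ?thesis
      unfolding has_field_derivative_iff by (rule Lim_transform_eventually)
  qed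
  have gr: "times_cont_diff n m W' (\<lambda>y. partial_deriv j \<Gamma> (y(k := H y)))"
    if "times_cont_diff n m W' H" "j < n" for m j
  proof (rule tcd_compose[OF W'open eopen_cube graph])
    show "times_cont_diff n m (cube n c e) (partial_deriv j \<Gamma>)"
      by (rule tcd_subset[OF smooth_inD[OF smooth_in_partial[OF G that(2)]] e(2)])
    show "times_cont_diff n m W' (\<lambda>y. (y(k := H y)) i)" for i
      by (cases "i = k") (use that tcd_coord[OF W'open] in auto)
  qed
  \<comment> \<open>Bootstrapping: \<open>D j\<close> involves \<open>H\<close> without derivatives,
    so each degree of differentiability of \<open>H\<close> passes to \<open>D j\<close> and yields
    one more degree for \<open>H\<close>.\<close>
  have "times_cont_diff n m W' H" for m
  proof (induction m)
    case 0
    then show ?case using Hcont by simp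
  next
    case (Suc m)
    show ?case
    proof (rule tcd_SucI[OF W'open Hcont HD])
      show "times_cont_diff n m W' (D j)" if "j < n" for j
        unfolding D_def
        by (intro tcd_mult tcd_add tcd_const tcd_inverse W'open gr[OF Suc] that k nzk graph)
    qed
  qed
  then have "smooth_in n W' H" by (simp add: smooth_in_def)
  moreover have "x(k := \<Gamma> x) \<in> W' \<and> H (x(k := \<Gamma> x)) = x k" if x: "x \<in> cube n c a" for x
  proof -
    let ?y = "x(k := \<Gamma> x)"
    have yB: "?y \<in> B" using x a k by (force simp: B_def cube_def)
    have xk: "\<bar>x k - c k\<bar> < a" using x k by (simp add: cube_def)
    have yk: "?y(k := s) = x(k := s)" for s by simp
    have "?\<sigma> * \<Gamma> (?y(k := c k - a)) < ?\<sigma> * \<Gamma> (?y(k := x k))" "?\<sigma> * \<Gamma> (?y(k := x k)) < ?\<sigma> * \<Gamma> (?y(k := c k + a))"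
      by (intro mono yB; use xk a in linarith)+
    then have yW': "?y \<in> W'" using yB by (simp add: W'_def)
    have "\<not> x k < H ?y" "\<not> H ?y < x k"
      using H_less[OF yW', of "x k"] xk a by auto
    then show ?thesis using yW' by auto
  qed
  moreover have "cube n c a \<subseteq> W" using cube_mono[of a e] a e(2) by force
  moreover have "c \<in> cube n c a" using cube_center[OF a(1)] eopen_subset[OF W] c by blast
  ultimately show ?thesis using that[OF W'open _ eopen_cube] by blast
qed

section \<open>Smooth functions and tangent vectors\<close>

lemma tvec_sum_apply:
  "(\<Sum>i\<in>I. c i *\<^sub>R X i) f = (\<Sum>i\<in>I. c i * X i f)" for X :: "'i \<Rightarrow> 'a \<Rightarrow> real"
  by (induction I rule: infinite_finite_induct) (auto simp: scaleR_fun_def plus_fun_def zero_fun_def)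

lemma sum_fun_apply: "(\<Sum>i\<in>I. X i) f = (\<Sum>i\<in>I. X i f)" for X :: "'i \<Rightarrow> 'a \<Rightarrow> real"
  by (induction I rule: infinite_finite_induct) (auto simp: plus_fun_def zero_fun_def)

definition coord_tuple :: "nat \<Rightarrow> (nat \<Rightarrow> 'm \<Rightarrow> real) \<Rightarrow> 'm \<Rightarrow> nat \<Rightarrow> real"
  where "coord_tuple n y q = (\<lambda>i. if i < n then y i q else 0)"

lemma coord_tuple_espace: "coord_tuple n y q \<in> espace n"
  by (simp add: coord_tuple_def)

lemma continuous_on_coord_tuple:
  "(\<And>i. i < n \<Longrightarrow> continuous_on A (y i)) \<Longrightarrow> continuous_on A (coord_tuple n y)"
proof (rule continuous_on_coordinatewise_then_product)
  fix i assume "\<And>i. i < n \<Longrightarrow> continuous_on A (y i)"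
  then show "continuous_on A (\<lambda>q. coord_tuple n y q i)"
    by (cases "i < n") (simp_all add: coord_tuple_def)
qed

locale smooth_mfd =
  fixes M :: "('m::{t2_space,second_countable_topology}) manifold"
  assumes mfd: "smooth_manifold M"
begin

abbreviation "m \<equiv> mdim M"
abbreviation "C \<equiv> smooth_funs M"
abbreviation "T \<equiv> tangent_space M"

lemma chart:
  assumes "(U, \<phi>) \<in> atlas M"
  shows "open U" "eopen m (\<phi> ` U)" "homeomorphism U (\<phi> ` U) \<phi> (inv_into U \<phi>)"
proof -
  have "\<forall>(U, \<phi>)\<in>atlas M. open U \<and> eopen m (\<phi> ` U) \<and> homeomorphism U (\<phi> ` U) \<phi> (inv_into U \<phi>)"
    using mfd by (simp add: smooth_manifold_def)
  from bspec[OF this assms] show "open U" "eopen m (\<phi> ` U)" "homeomorphism U (\<phi> ` U) \<phi> (inv_into U \<phi>)"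
    by simp_all
qed

lemma chart_cover: obtains U \<phi> where "(U, \<phi>) \<in> atlas M" "p \<in> U"
proof -
  have "(\<Union>(U, \<phi>)\<in>atlas M. U) = UNIV" using mfd by (simp add: smooth_manifold_def)
  then show ?thesis using that by blast
qed

lemma chart_inv:
  assumes "(U, \<phi>) \<in> atlas M" "q \<in> U"
  shows "inv_into U \<phi> (\<phi> q) = q"
  using homeomorphism_apply1[OF chart(3)[OF assms(1)] assms(2)] .

lemma transition:
  assumes "(U, \<phi>) \<in> atlas M" "(V, \<psi>) \<in> atlas M" "i < m"
  shows "smooth_in m (\<phi> ` (U \<inter> V)) (\<lambda>x. \<psi> (inv_into U \<phi> x) i)"
  using mfd assms unfolding smooth_manifold_def by blast

lemma chart_image_open:
  assumes "(U, \<phi>) \<in> atlas M" "open A" "A \<subseteq> U"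
  shows "eopen m (\<phi> ` A)"
proof -
  have "eopen m (\<phi> ` U \<inter> inv_into U \<phi> -` A)"
    by (intro eopen_preimage chart(2) assms homeomorphism_cont2[OF chart(3)])
  moreover have "\<phi> ` U \<inter> inv_into U \<phi> -` A = \<phi> ` A"
    using assms chart_inv by (auto simp: subset_iff)
  ultimately show ?thesis by simp
qed

lemma chart_preimage_open:
  assumes "(U, \<phi>) \<in> atlas M" "eopen m W"
  shows "open (U \<inter> \<phi> -` W)"
proof -
  obtain S where S: "open S" "W = S \<inter> espace m" using assms(2) by (auto simp: eopen_iff)
  have "open (U \<inter> \<phi> -` S)"
    using homeomorphism_cont1[OF chart(3)] chart(1) assms(1) S(1) by (auto intro: continuous_open_preimage)
  moreover have "U \<inter> \<phi> -` S = U \<inter> \<phi> -` W"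
    using eopen_subset[OF chart(2)[OF assms(1)]] S(2) by blast
  ultimately show ?thesis by simp
qed

definition smooth_near :: "('m \<Rightarrow> real) \<Rightarrow> 'm \<Rightarrow> bool"
  where "smooth_near f p \<longleftrightarrow> (\<exists>U \<phi> A. (U, \<phi>) \<in> atlas M \<and> open A \<and> p \<in> A \<and> A \<subseteq> U \<and>
    smooth_in m (\<phi> ` A) (\<lambda>x. f (inv_into U \<phi> x)))"

lemma smooth_funsD:
  "f \<in> C \<Longrightarrow> (U, \<phi>) \<in> atlas M \<Longrightarrow> smooth_in m (\<phi> ` U) (\<lambda>x. f (inv_into U \<phi> x))"
  by (auto simp: smooth_funs_def)

lemma smooth_nearI:
  assumes "(U, \<phi>) \<in> atlas M" "open A" "p \<in> A" "A \<subseteq> U"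
    "smooth_in m (\<phi> ` A) g" "\<And>q. q \<in> A \<Longrightarrow> f q = g (\<phi> q)"
  shows "smooth_near f p"
  unfolding smooth_near_def
proof (intro exI conjI)
  show "smooth_in m (\<phi> ` A) (\<lambda>x. f (inv_into U \<phi> x))"
    by (rule smooth_in_cong[OF chart_image_open[OF assms(1,2,4)] _ assms(5)])
      (use assms chart_inv in \<open>auto simp: subset_iff\<close>)
qed (use assms in auto)

lemma smooth_funs_near: "f \<in> C \<Longrightarrow> smooth_near f p"
  using chart_cover[of p] chart(1) smooth_funsD unfolding smooth_near_def by (metis subset_refl)

text \<open>Membership in \<open>smooth_funs\<close> asks for all charts; the transition maps carry
  smoothness over from the single chart that witnesses \<open>smooth_near\<close>.\<close>

lemma smooth_funsI:
  assumes "\<And>p. smooth_near f p"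
  shows "f \<in> C"
  unfolding smooth_funs_def
proof (clarify)
  fix V \<psi> assume V: "(V, \<psi>) \<in> atlas M"
  show "smooth_in m (\<psi> ` V) (\<lambda>x. f (inv_into V \<psi> x))"
  proof (rule smooth_in_local[OF _ chart(2)[OF V]])
    fix x assume "x \<in> \<psi> ` V"
    then obtain p where p: "p \<in> V" "x = \<psi> p" by auto
    obtain U \<phi> A where A: "(U, \<phi>) \<in> atlas M" "open A" "p \<in> A" "A \<subseteq> U"
      "smooth_in m (\<phi> ` A) (\<lambda>x. f (inv_into U \<phi> x))"
      using assms[of p] unfolding smooth_near_def by auto
    let ?B = "A \<inter> V"
    have B: "eopen m (\<psi> ` ?B)" using A V chart(1) by (intro chart_image_open) auto
    have "smooth_in m (\<psi> ` ?B) (\<lambda>x. (\<lambda>z. f (inv_into U \<phi> z)) (\<phi> (inv_into V \<psi> x)))"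
    proof (rule smooth_in_compose[OF B chart_image_open[OF A(1,2,4)] _ _ A(5)])
      show "\<phi> (inv_into V \<psi> x) \<in> \<phi> ` A" if "x \<in> \<psi> ` ?B" for x
        using that chart_inv[OF V] by auto
      show "smooth_in m (\<psi> ` ?B) (\<lambda>x. \<phi> (inv_into V \<psi> x) i)" if "i < m" for i
        by (rule smooth_in_subset[OF transition[OF V A(1) that]]) (use A in auto)
    qed
    then have "smooth_in m (\<psi> ` ?B) (\<lambda>x. f (inv_into V \<psi> x))"
      by (rule smooth_in_cong[OF B, rotated])
        (use chart_inv[OF V] chart_inv[OF A(1)] A(4) in \<open>auto simp: subset_iff\<close>)
    then show "\<exists>W'. eopen m W' \<and> x \<in> W' \<and> smooth_in m W' (\<lambda>x. f (inv_into V \<psi> x))"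
      using B p A(3) by blast
  qed
qed

lemma smooth_near_cong:
  assumes "open A" "p \<in> A" "\<And>q. q \<in> A \<Longrightarrow> f q = g q" "smooth_near g p"
  shows "smooth_near f p"
proof -
  obtain U \<phi> B where B: "(U, \<phi>) \<in> atlas M" "open B" "p \<in> B" "B \<subseteq> U"
    "smooth_in m (\<phi> ` B) (\<lambda>x. g (inv_into U \<phi> x))"
    using assms(4) unfolding smooth_near_def by auto
  show ?thesis
    by (rule smooth_nearI[OF B(1), of "A \<inter> B" _ "\<lambda>x. g (inv_into U \<phi> x)"])
      (use assms B chart_inv[OF B(1)] in \<open>auto intro: smooth_in_subset simp: subset_iff\<close>)
qed

lemma smooth_funs_local:
  assumes "\<And>p. \<exists>g\<in>C. \<exists>A. open A \<and> p \<in> A \<and> (\<forall>q\<in>A. f q = g q)"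
  shows "f \<in> C"
  by (rule smooth_funsI) (use assms smooth_near_cong smooth_funs_near in metis)

lemma smooth_funs_const: "(\<lambda>p. a) \<in> C"
  unfolding smooth_funs_def using smooth_in_const[OF chart(2)] by auto

lemma smooth_funs_add: "f \<in> C \<Longrightarrow> g \<in> C \<Longrightarrow> (\<lambda>p. f p + g p) \<in> C"
  unfolding smooth_funs_def using smooth_in_add[OF chart(2)] by fast

lemma smooth_funs_mult: "f \<in> C \<Longrightarrow> g \<in> C \<Longrightarrow> (\<lambda>p. f p * g p) \<in> C"
  unfolding smooth_funs_def using smooth_in_mult[OF chart(2)] by fast

lemma smooth_funs_minus: "f \<in> C \<Longrightarrow> (\<lambda>p. - f p) \<in> C"
  unfolding smooth_funs_def using smooth_in_minus[OF chart(2)] by fast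

lemma smooth_funs_diff: "f \<in> C \<Longrightarrow> g \<in> C \<Longrightarrow> (\<lambda>p. f p - g p) \<in> C"
  unfolding smooth_funs_def using smooth_in_diff[OF chart(2)] by fast

lemma smooth_funs_sum: "(\<And>i. i \<in> I \<Longrightarrow> f i \<in> C) \<Longrightarrow> (\<lambda>p. \<Sum>i\<in>I. f i p) \<in> C"
  by (induction I rule: infinite_finite_induct) (auto intro: smooth_funs_add smooth_funs_const)

lemma smooth_funs_prod: "(\<And>i. i \<in> I \<Longrightarrow> f i \<in> C) \<Longrightarrow> (\<lambda>p. \<Prod>i\<in>I. f i p) \<in> C"
  by (induction I rule: infinite_finite_induct) (auto intro: smooth_funs_mult smooth_funs_const)

lemma smooth_funs_continuous:
  assumes "f \<in> C"
  shows "continuous_on A f"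
proof -
  have "\<exists>B. open B \<and> p \<in> B \<and> continuous_on B f" for p
  proof -
    obtain U \<phi> where U: "(U, \<phi>) \<in> atlas M" "p \<in> U" using chart_cover by blast
    have "continuous_on U (\<lambda>q. f (inv_into U \<phi> (\<phi> q)))"
      by (rule continuous_on_compose2[OF smooth_in_cont[OF smooth_funsD[OF assms U(1)]]
          homeomorphism_cont1[OF chart(3)[OF U(1)]]]) auto
    then have "continuous_on U f" using chart_inv[OF U(1)] by (simp cong: continuous_on_cong)
    then show ?thesis using U chart(1) by blast
  qed
  then have "continuous_on UNIV f"
    by (metis UNIV_I continuous_on_eq_continuous_at open_UNIV)
  then show ?thesis by (rule continuous_on_subset) auto
qed

text \<open>Extension by 0 outside the chart is smooth only if the support is closed in the whole
  manifold. A closed cube is compact, so its image is compact, and closed because the manifold is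
  Hausdorff.\<close>

lemma bump:
  assumes "open A" "p \<in> A"
  obtains \<beta> K B where "\<beta> \<in> C" "closed K" "K \<subseteq> A" "open B" "p \<in> B" "B \<subseteq> K"
    "\<And>q. q \<in> B \<Longrightarrow> \<beta> q = 1" "\<And>q. q \<notin> K \<Longrightarrow> \<beta> q = 0"
proof -
  obtain U \<phi> where U: "(U, \<phi>) \<in> atlas M" "p \<in> U" using chart_cover by blast
  define c where "c = \<phi> p"
  have AU: "eopen m (\<phi> ` (A \<inter> U))" using U assms chart(1) by (intro chart_image_open) auto
  then obtain e where e: "e > 0" "cube m c e \<subseteq> \<phi> ` (A \<inter> U)"
    using cube_inside[of m "\<phi> ` (A \<inter> U)" c] U assms c_def by auto
  have cE: "c \<in> espace m" using U eopen_subset[OF chart(2)[OF U(1)]] c_def by auto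
  have e2: "e / 2 > 0" using e by simp
  obtain b d where b: "smooth_in m (espace m) b" "d > 0" "\<And>x. x \<in> cube m c d \<Longrightarrow> b x = 1"
    "\<And>x. x \<in> espace m \<Longrightarrow> x \<notin> cube m c (e / 2) \<Longrightarrow> b x = 0"
    by (rule bump_cube[OF e2]) (rule that; assumption)
  \<comment> \<open>A closed cube as a product of compact factors, with \<open>{0}\<close> from the
    dimension on; half the side keeps it inside the chart image.\<close>
  define Q where "Q = (\<Pi>\<^sub>E i\<in>UNIV. if i < m then {c i - e / 2..c i + e / 2} else {0})"
  have Qiff: "x \<in> Q \<longleftrightarrow> x \<in> espace m \<and> (\<forall>i<m. \<bar>x i - c i\<bar> \<le> e / 2)" for x
  proof -
    have "\<bar>a - b\<bar> \<le> e / 2 \<longleftrightarrow> b - e / 2 \<le> a \<and> a \<le> b + e / 2" for a b by linarith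
    then show ?thesis unfolding Q_def PiE_iff by (auto simp: not_less split: if_splits)
  qed
  have "compactin (product_topology (\<lambda>i. euclidean) UNIV) Q"
    unfolding Q_def compactin_PiE by auto
  then have "compact Q" by (simp add: euclidean_product_topology compactin_euclidean_iff)
  have Qcube: "Q \<subseteq> cube m c e"
  proof
    fix x assume "x \<in> Q"
    then have "x \<in> espace m" "\<And>i. i < m \<Longrightarrow> \<bar>x i - c i\<bar> < e" using e(1) by (force simp: Qiff)+
    then show "x \<in> cube m c e" by (simp add: cube_def)
  qed
  define K where "K = inv_into U \<phi> ` Q"
  have QU: "Q \<subseteq> \<phi> ` U" using Qcube e(2) by auto
  have "compact K"
    unfolding K_def using \<open>compact Q\<close> QU homeomorphism_cont2[OF chart(3)[OF U(1)]]
    by (intro compact_continuous_image) (auto intro: continuous_on_subset)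
  then have K: "closed K" by (rule compact_imp_closed)
  have KA: "K \<subseteq> A \<inter> U"
  proof
    fix q assume "q \<in> K"
    then obtain x where x: "x \<in> Q" "q = inv_into U \<phi> x" unfolding K_def by auto
    then obtain r where "r \<in> A \<inter> U" "x = \<phi> r" using Qcube e(2) by blast
    then show "q \<in> A \<inter> U" using x chart_inv[OF U(1)] by auto
  qed
  have Kiff: "q \<in> K" if "q \<in> U" "\<phi> q \<in> Q" for q
    unfolding K_def using that chart_inv[OF U(1)] by (metis image_eqI)
  define \<beta> where "\<beta> q = (if q \<in> U then b (\<phi> q) else 0)" for q
  have zero: "\<beta> q = 0" if "q \<notin> K" for q
  proof (cases "q \<in> U")
    case True
    then have "\<phi> q \<notin> Q" using Kiff that by blast
    moreover have "\<phi> q \<in> espace m" using True eopen_subset[OF chart(2)[OF U(1)]] by blast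
    ultimately have "\<phi> q \<notin> cube m c (e / 2)" unfolding Qiff cube_def by force
    then show ?thesis using b(4) \<open>\<phi> q \<in> espace m\<close> by (simp add: \<beta>_def)
  qed (simp add: \<beta>_def)
  have "smooth_near \<beta> q" for q
  proof (cases "q \<in> U")
    case True
    show ?thesis
      by (rule smooth_nearI[OF U(1) chart(1)[OF U(1)] True order_refl
          smooth_in_subset[OF b(1) eopen_subset[OF chart(2)[OF U(1)]]]]) (simp add: \<beta>_def)
  next
    case False
    then have q: "q \<in> - K" using KA by auto
    show ?thesis
      by (rule smooth_near_cong[OF _ q, of _ "\<lambda>q. 0"]) (use K zero smooth_funs_near[OF smooth_funs_const] in auto)
  qed
  then have "\<beta> \<in> C" by (rule smooth_funsI)
  moreover define B where "B = U \<inter> \<phi> -` cube m c (min d (e / 2))"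
  have "open B" unfolding B_def by (intro chart_preimage_open U eopen_cube)
  moreover have "p \<in> B" unfolding B_def using U cE b(2) e2 c_def cube_center[of "min d (e/2)" c m] by auto
  moreover have "B \<subseteq> K"
  proof
    fix q assume "q \<in> B"
    then have "q \<in> U" "\<phi> q \<in> cube m c (e / 2)" using cube_mono[OF min.cobounded2[of d "e/2"]] by (auto simp: B_def)
    then show "q \<in> K" using less_imp_le by (intro Kiff) (auto simp: Qiff cube_def)
  qed
  moreover have "\<beta> q = 1" if "q \<in> B" for q
    using that cube_mono[OF min.cobounded1[of d "e/2"]] b(3) by (auto simp: B_def \<beta>_def)
  ultimately show ?thesis using that K KA zero by blast
qed

lemma smooth_near_mult:
  assumes "f \<in> C" "smooth_near g p"
  shows "smooth_near (\<lambda>q. f q * g q) p"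
proof -
  obtain U \<phi> B where B: "(U, \<phi>) \<in> atlas M" "open B" "p \<in> B" "B \<subseteq> U"
    "smooth_in m (\<phi> ` B) (\<lambda>x. g (inv_into U \<phi> x))"
    using assms(2) unfolding smooth_near_def by auto
  have "smooth_in m (\<phi> ` B) (\<lambda>x. f (inv_into U \<phi> x) * g (inv_into U \<phi> x))"
    using B by (intro smooth_in_mult chart_image_open smooth_in_subset[OF smooth_funsD[OF assms(1) B(1)]]) auto
  then show ?thesis unfolding smooth_near_def using B by blast
qed

lemma cutoff_smooth:
  assumes "\<beta> \<in> C" "closed K" "K \<subseteq> A" "\<And>q. q \<notin> K \<Longrightarrow> \<beta> q = 0" "\<And>q. q \<in> A \<Longrightarrow> smooth_near g q"
  shows "(\<lambda>q. \<beta> q * g q) \<in> C"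
proof (rule smooth_funsI)
  fix q
  show "smooth_near (\<lambda>q. \<beta> q * g q) q"
  proof (cases "q \<in> K")
    case True
    then show ?thesis using assms by (intro smooth_near_mult) auto
  next
    case False
    have "open (- K)" "q \<in> - K" "\<And>r. r \<in> - K \<Longrightarrow> \<beta> r * g r = 0" using assms(2,4) False by auto
    then show ?thesis by (rule smooth_near_cong[OF _ _ _ smooth_funs_near[OF smooth_funs_const]])
  qed
qed

text \<open>Derivations act on global functions, so a function given near a point has to be replaced
  by a global one with the same germ.\<close>

lemma smooth_near_extend:
  assumes "open A" "p \<in> A" "\<And>q. q \<in> A \<Longrightarrow> smooth_near g q"
  obtains F B where "F \<in> C" "open B" "p \<in> B" "B \<subseteq> A" "\<And>q. q \<in> B \<Longrightarrow> F q = g q"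
proof -
  obtain \<beta> K B where b: "\<beta> \<in> C" "closed K" "K \<subseteq> A" "open B" "p \<in> B" "B \<subseteq> K"
    "\<And>q. q \<in> B \<Longrightarrow> \<beta> q = 1" "\<And>q. q \<notin> K \<Longrightarrow> \<beta> q = 0"
    by (rule bump[OF assms(1,2)]) (rule that; assumption)
  have "(\<lambda>q. \<beta> q * g q) \<in> C"
    by (rule cutoff_smooth[OF b(1-3) b(8) assms(3)])
  then show ?thesis using b by (intro that[of "\<lambda>q. \<beta> q * g q" B]) auto
qed

lemma smooth_near_chart:
  assumes "(U, \<phi>) \<in> atlas M" "eopen m W" "smooth_in m W G" "q \<in> U" "\<phi> q \<in> W"
  shows "smooth_near (\<lambda>q. G (\<phi> q)) q"
  by (rule smooth_nearI[OF assms(1) chart_preimage_open[OF assms(1,2)], of _ G])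
    (use assms(4,5) in \<open>auto intro: smooth_in_subset[OF assms(3)]\<close>)

lemma smooth_near_compose:
  assumes "\<And>i. i < n \<Longrightarrow> y i \<in> C" "eopen n W" "smooth_in n W G" "coord_tuple n y q \<in> W"
  shows "smooth_near (\<lambda>q. G (coord_tuple n y q)) q"
proof -
  obtain U \<phi> where U: "(U, \<phi>) \<in> atlas M" "q \<in> U" using chart_cover by blast
  obtain S where S: "open S" "W = S \<inter> espace n" using assms(2) by (auto simp: eopen_iff)
  let ?A = "U \<inter> coord_tuple n y -` S"
  have cont: "continuous_on U (coord_tuple n y)"
    by (intro continuous_on_coord_tuple smooth_funs_continuous assms(1))
  have A: "open ?A" by (rule continuous_open_preimage[OF cont chart(1)[OF U(1)] S(1)])
  have "smooth_in m (\<phi> ` ?A) (\<lambda>x. G (coord_tuple n y (inv_into U \<phi> x)))"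
  proof (rule smooth_in_compose[OF chart_image_open[OF U(1) A] assms(2) _ _ assms(3)])
    show "coord_tuple n y (inv_into U \<phi> x) \<in> W" if x: "x \<in> \<phi> ` ?A" for x
    proof -
      obtain q where "q \<in> ?A" "x = \<phi> q" using x by blast
      then show ?thesis using chart_inv[OF U(1)] S(2) coord_tuple_espace[of n y q] by simp
    qed
    show "smooth_in m (\<phi> ` ?A) (\<lambda>x. coord_tuple n y (inv_into U \<phi> x) i)" if "i < n" for i
      using smooth_in_subset[OF smooth_funsD[OF assms(1)[OF that] U(1)], of "\<phi> ` ?A"] that
      by (auto simp: coord_tuple_def)
  qed auto
  then show ?thesis
    unfolding smooth_near_def using U A assms(4) S(2) by blast
qed

lemma coord_tuple_preimage_open:
  assumes "\<And>i. i < n \<Longrightarrow> y i \<in> C" "eopen n W"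
  shows "open (coord_tuple n y -` W)"
proof -
  obtain S where S: "open S" "W = S \<inter> espace n" using assms(2) by (auto simp: eopen_iff)
  have "open (coord_tuple n y -` S)"
    using continuous_on_coord_tuple[OF smooth_funs_continuous[OF assms(1)]] S(1)
    by (auto intro!: open_vimage)
  moreover have "coord_tuple n y -` S = coord_tuple n y -` W"
    by (auto simp: S(2) coord_tuple_def)
  ultimately show ?thesis by simp
qed

lemma compose_extend:
  assumes "\<And>i. i < n \<Longrightarrow> y i \<in> C" "eopen n W" "smooth_in n W G" "coord_tuple n y p \<in> W"
  obtains F B where "F \<in> C" "open B" "p \<in> B" "\<And>q. q \<in> B \<Longrightarrow> coord_tuple n y q \<in> W \<and> F q = G (coord_tuple n y q)"
proof -
  let ?A = "coord_tuple n y -` W"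
  have p: "p \<in> ?A" using assms(4) by simp
  obtain F B where F: "F \<in> C" "open B" "p \<in> B" "B \<subseteq> ?A" "\<And>q. q \<in> B \<Longrightarrow> F q = G (coord_tuple n y q)"
    by (rule smooth_near_extend[OF coord_tuple_preimage_open[OF assms(1,2)] p, of "\<lambda>q. G (coord_tuple n y q)"])
      (use smooth_near_compose[OF assms(1-3)] in auto)
  then show ?thesis by (intro that[of F B]) auto
qed

lemma local_inverse:
  assumes "u \<in> C" "u p \<noteq> 0"
  obtains w B where "w \<in> C" "open B" "p \<in> B" "\<And>q. q \<in> B \<Longrightarrow> u q \<noteq> 0 \<and> w q = inverse (u q)"
proof -
  let ?A = "u -` (- {0})"
  have A: "open ?A" by (rule open_vimage) (use smooth_funs_continuous[OF assms(1)] in auto)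
  have sn: "smooth_near (\<lambda>q. inverse (u q)) q" if q: "q \<in> ?A" for q
  proof -
    obtain U \<phi> where U: "(U, \<phi>) \<in> atlas M" "q \<in> U" using chart_cover by blast
    have o: "open (U \<inter> ?A)" using A chart(1)[OF U(1)] by blast
    have "smooth_in m (\<phi> ` (U \<inter> ?A)) (\<lambda>x. inverse (u (inv_into U \<phi> x)))"
      by (intro smooth_in_inverse chart_image_open[OF U(1) o] smooth_in_subset[OF smooth_funsD[OF assms(1) U(1)]])
        (use chart_inv[OF U(1)] in auto)
    then show ?thesis
      unfolding smooth_near_def using U q o by blast
  qed
  obtain w B where "w \<in> C" "open B" "p \<in> B" "B \<subseteq> ?A" "\<And>q. q \<in> B \<Longrightarrow> w q = inverse (u q)"
    by (rule smooth_near_extend[OF A _ sn]) (use assms(2) in auto)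
  then show ?thesis by (intro that[of w B]) auto
qed

end

lemma smooth_map_compose:
  assumes "smooth_mfd N" "smooth_mfd M" "smooth_map N M F" "f \<in> smooth_funs M"
  shows "(\<lambda>q. f (F q)) \<in> smooth_funs N"
proof -
  interpret N: smooth_mfd N by fact
  interpret M: smooth_mfd M by fact
  show ?thesis
  proof (rule N.smooth_funsI)
    fix q
    obtain V \<psi> where V: "(V, \<psi>) \<in> atlas N" "q \<in> V" using N.chart_cover by blast
    obtain U \<phi> where U: "(U, \<phi>) \<in> atlas M" "F q \<in> U" using M.chart_cover by blast
    let ?A = "V \<inter> F -` U"
    have A: "open ?A"
      using assms(3) M.chart(1)[OF U(1)] N.chart(1)[OF V(1)]
      by (intro open_Int open_vimage) (auto simp: smooth_map_def)
    have "smooth_in (mdim N) (\<psi> ` ?A) (\<lambda>x. (\<lambda>z. f (inv_into U \<phi> z)) (\<phi> (F (inv_into V \<psi> x))))"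
    proof (rule smooth_in_compose[OF N.chart_image_open[OF V(1) A] M.chart(2)[OF U(1)] _ _ M.smooth_funsD[OF assms(4) U(1)]])
      show "\<phi> (F (inv_into V \<psi> x)) \<in> \<phi> ` U" if "x \<in> \<psi> ` ?A" for x
        using that N.chart_inv[OF V(1)] by auto
      show "smooth_in (mdim N) (\<psi> ` ?A) (\<lambda>x. \<phi> (F (inv_into V \<psi> x)) i)" if "i < mdim M" for i
        using assms(3) V(1) U(1) that unfolding smooth_map_def by blast
    qed auto
    then show "N.smooth_near (\<lambda>q. f (F q)) q"
      by (rule N.smooth_nearI[OF V(1) A, rotated 2])
        (use V U N.chart_inv[OF V(1)] M.chart_inv[OF U(1)] in auto)
  qed
qed

lemma partial_deriv_cong:
  assumes "eopen n W" "x \<in> W" "i < n" "\<And>z. z \<in> W \<Longrightarrow> f z = g z"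
  shows "partial_deriv i f x = partial_deriv i g x"
proof -
  have "((\<lambda>t. f (x(i := t))) has_real_derivative u) (at (x i)) \<longleftrightarrow>
      ((\<lambda>t. g (x(i := t))) has_real_derivative u) (at (x i))" for u
    by (intro DERIV_cong_ev refl eventually_mono[OF eventually_coord_update[OF assms(1-3)]] assms(4))
  then show ?thesis by (simp add: partial_deriv_def deriv_def)
qed

lemma partial_deriv_coord: "partial_deriv i (\<lambda>x. x j) x = (if i = j then 1 else 0)"
  unfolding partial_deriv_def by (rule DERIV_imp_deriv) (auto intro!: derivative_eq_intros)

lemma scaleR_fun_apply [simp]: "(c *\<^sub>R f) x = c *\<^sub>R f x"
  by (simp add: scaleR_fun_def)

section \<open>Tangent vectors and vector fields as derivations\<close>

context smooth_mfd
begin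

lemma tangentI:
  assumes "\<And>f. f \<notin> C \<Longrightarrow> v f = 0"
    and "\<And>f g. f \<in> C \<Longrightarrow> g \<in> C \<Longrightarrow> v (\<lambda>q. f q + g q) = v f + v g"
    and "\<And>f c. f \<in> C \<Longrightarrow> v (\<lambda>q. c * f q) = c * v f"
    and "\<And>f g. f \<in> C \<Longrightarrow> g \<in> C \<Longrightarrow> v (\<lambda>q. f q * g q) = f p * v g + g p * v f"
  shows "v \<in> T p"
  unfolding tangent_space_def plus_fun_def times_fun_def scaleR_fun_def real_scaleR_def
  using assms by blast

lemma tangent_off: "v \<in> T p \<Longrightarrow> f \<notin> C \<Longrightarrow> v f = 0"
  by (auto simp: tangent_space_def)

lemma tangent_add: "v \<in> T p \<Longrightarrow> f \<in> C \<Longrightarrow> g \<in> C \<Longrightarrow> v (\<lambda>q. f q + g q) = v f + v g"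
  unfolding tangent_space_def plus_fun_def by blast

lemma tangent_cmult: "v \<in> T p \<Longrightarrow> f \<in> C \<Longrightarrow> v (\<lambda>q. c * f q) = c * v f"
  unfolding tangent_space_def scaleR_fun_def real_scaleR_def by blast

lemma tangent_mult: "v \<in> T p \<Longrightarrow> f \<in> C \<Longrightarrow> g \<in> C \<Longrightarrow> v (\<lambda>q. f q * g q) = f p * v g + g p * v f"
  unfolding tangent_space_def times_fun_def by blast

lemma tangent_minus: "v \<in> T p \<Longrightarrow> f \<in> C \<Longrightarrow> v (\<lambda>q. - f q) = - v f"
  using tangent_cmult[of v p f "-1"] by simp

lemma tangent_diff: "v \<in> T p \<Longrightarrow> f \<in> C \<Longrightarrow> g \<in> C \<Longrightarrow> v (\<lambda>q. f q - g q) = v f - v g"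
  using tangent_add[of v p f "\<lambda>q. - g q"] tangent_minus[of v p g] smooth_funs_minus[of g] by simp

lemma tangent_const: "v \<in> T p \<Longrightarrow> v (\<lambda>q. c) = 0"
  using tangent_mult[of v p "\<lambda>q. 1" "\<lambda>q. 1"] tangent_cmult[of v p "\<lambda>q. 1" c] smooth_funs_const[of 1] by simp

lemma tangent_sum:
  assumes "v \<in> T p" "\<And>i. i \<in> I \<Longrightarrow> f i \<in> C"
  shows "v (\<lambda>q. \<Sum>i\<in>I. f i q) = (\<Sum>i\<in>I. v (f i))"
  using assms(2)
  by (induction I rule: infinite_finite_induct)
    (auto simp: tangent_add[OF assms(1)] tangent_const[OF assms(1)] smooth_funs_sum)

text \<open>For a bump \<beta> supported where \<open>f\<close> and \<open>g\<close> agree,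
  \<open>\<beta> * (f - g)\<close> is 0; the Leibniz rule at \<open>p\<close>, where \<beta> is 1
  and \<open>f - g\<close> is 0, leaves \<open>v (f - g)\<close>.\<close>

lemma tangent_local:
  assumes v: "v \<in> T p" and "f \<in> C" "g \<in> C" "open A" "p \<in> A" "\<And>q. q \<in> A \<Longrightarrow> f q = g q"
  shows "v f = v g"
proof -
  obtain \<beta> K B where b: "\<beta> \<in> C" "K \<subseteq> A" "p \<in> B" "\<And>q. q \<in> B \<Longrightarrow> \<beta> q = 1" "\<And>q. q \<notin> K \<Longrightarrow> \<beta> q = 0"
    by (rule bump[OF assms(4,5)]) (rule that; assumption)
  let ?h = "\<lambda>q. f q - g q"
  have h: "?h \<in> C" using assms by (intro smooth_funs_diff)
  have "(\<lambda>q. \<beta> q * ?h q) = (\<lambda>q. 0)" using b assms(6) by fastforce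
  then have "v (\<lambda>q. \<beta> q * ?h q) = 0" using tangent_const[OF v] by simp
  moreover have "\<beta> p = 1" "?h p = 0" using b assms by auto
  ultimately have "v ?h = 0" using tangent_mult[OF v b(1) h] by simp
  then show ?thesis using tangent_diff[OF v assms(2,3)] by simp
qed

lemma tangent_zero: "0 \<in> T p"
  unfolding zero_fun_def by (rule tangentI) auto

lemma tangent_plus: "v \<in> T p \<Longrightarrow> w \<in> T p \<Longrightarrow> v + w \<in> T p"
  unfolding plus_fun_def
  by (rule tangentI) (simp_all add: tangent_off tangent_add tangent_cmult tangent_mult algebra_simps)

lemma tangent_scale: "v \<in> T p \<Longrightarrow> c *\<^sub>R v \<in> T p"
  unfolding scaleR_fun_def
  by (rule tangentI) (simp_all add: tangent_off tangent_add tangent_cmult tangent_mult algebra_simps)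

lemma tangent_uminus: "v \<in> T p \<Longrightarrow> - v \<in> T p"
  using tangent_scale[of v p "-1"] by simp

lemma tangent_sub: "v \<in> T p \<Longrightarrow> w \<in> T p \<Longrightarrow> v - w \<in> T p"
  using tangent_plus[of v p "- w"] tangent_uminus by simp

lemma tangent_lincomb: "(\<And>i. i \<in> I \<Longrightarrow> X i \<in> T p) \<Longrightarrow> (\<Sum>i\<in>I. X i) \<in> T p"
  by (induction I rule: infinite_finite_induct) (auto intro: tangent_zero tangent_plus)

abbreviation "vf \<equiv> vector_field M"

lemma vf_tangent: "vf X \<Longrightarrow> X p \<in> T p"
  by (simp add: vector_field_def)

lemma vf_smooth: "vf X \<Longrightarrow> f \<in> C \<Longrightarrow> (\<lambda>p. X p f) \<in> C"
  by (simp add: vector_field_def)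

lemma vf_scale: "u \<in> C \<Longrightarrow> vf X \<Longrightarrow> vf (\<lambda>p. u p *\<^sub>R X p)"
  unfolding vector_field_def by (auto intro: tangent_scale simp: smooth_funs_mult)

lemma vf_add: "vf X \<Longrightarrow> vf Y \<Longrightarrow> vf (\<lambda>p. X p + Y p)"
  unfolding vector_field_def by (auto intro: tangent_plus simp: smooth_funs_add)

lemma vf_sum: "(\<And>i. i \<in> I \<Longrightarrow> vf (X i)) \<Longrightarrow> vf (\<lambda>p. \<Sum>i\<in>I. X i p)"
  unfolding vector_field_def by (auto intro: tangent_lincomb simp: sum_fun_apply smooth_funs_sum)

section \<open>Coordinate vectors of a chart and the chain rule for derivations\<close>

definition chart_vec :: "'m set \<Rightarrow> ('m \<Rightarrow> nat \<Rightarrow> real) \<Rightarrow> nat \<Rightarrow> 'm \<Rightarrow> 'm tvec"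
  where "chart_vec U \<phi> i q f = (if f \<in> C then partial_deriv i (\<lambda>x. f (inv_into U \<phi> x)) (\<phi> q) else 0)"

lemma chart_vec_tangent:
  assumes "(U, \<phi>) \<in> atlas M" "q \<in> U" "i < m"
  shows "chart_vec U \<phi> i q \<in> T q"
proof -
  have D: "((\<lambda>t. f (inv_into U \<phi> ((\<phi> q)(i := t)))) has_real_derivative
      partial_deriv i (\<lambda>x. f (inv_into U \<phi> x)) (\<phi> q)) (at (\<phi> q i))" if "f \<in> C" for f
    using smooth_in_deriv[OF smooth_funsD[OF that assms(1)] assms(3)] assms(2) by simp
  have e: "f (inv_into U \<phi> ((\<phi> q)(i := \<phi> q i))) = f q" for f :: "'m \<Rightarrow> real"
    using chart_inv[OF assms(1,2)] by simp
  show ?thesis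
  proof (rule tangentI)
    fix f g assume "f \<in> C" "g \<in> C"
    note D' = D[OF this(1)] D[OF this(2)]
    show "chart_vec U \<phi> i q (\<lambda>q. f q + g q) = chart_vec U \<phi> i q f + chart_vec U \<phi> i q g"
      using DERIV_imp_deriv[OF DERIV_add[OF D']] \<open>f \<in> C\<close> \<open>g \<in> C\<close>
      by (simp add: chart_vec_def smooth_funs_add partial_deriv_def)
    show "chart_vec U \<phi> i q (\<lambda>q. f q * g q) = f q * chart_vec U \<phi> i q g + g q * chart_vec U \<phi> i q f"
      using DERIV_imp_deriv[OF DERIV_mult[OF D']] \<open>f \<in> C\<close> \<open>g \<in> C\<close> chart_inv[OF assms(1,2)]
      by (simp add: chart_vec_def smooth_funs_mult partial_deriv_def)
  next
    fix f c assume f: "f \<in> C"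
    have "(\<lambda>q. c * f q) \<in> C" using smooth_funs_mult[OF smooth_funs_const f] .
    then show "chart_vec U \<phi> i q (\<lambda>q. c * f q) = c * chart_vec U \<phi> i q f"
      using DERIV_imp_deriv[OF DERIV_cmult[OF D[OF f]]] f
      by (simp add: chart_vec_def partial_deriv_def)
  qed (simp add: chart_vec_def)
qed

lemma chart_coords:
  assumes "(U, \<phi>) \<in> atlas M" "p \<in> U"
  obtains x B where "\<And>j. j < m \<Longrightarrow> x j \<in> C" "open B" "p \<in> B" "B \<subseteq> U" "\<And>j q. j < m \<Longrightarrow> q \<in> B \<Longrightarrow> x j q = \<phi> q j"
proof -
  have "\<exists>F B. F \<in> C \<and> open B \<and> p \<in> B \<and> B \<subseteq> U \<and> (\<forall>q\<in>B. F q = \<phi> q j)" for j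
  proof -
    have sn: "smooth_near (\<lambda>q. \<phi> q j) q" if "q \<in> U" for q
      using smooth_near_chart[OF assms(1) chart(2)[OF assms(1)] smooth_in_coord[OF chart(2)[OF assms(1)]], of q j] that
      by auto
    show ?thesis
      by (rule smooth_near_extend[OF chart(1)[OF assms(1)] assms(2) sn]) auto
  qed
  then obtain x B where x: "\<And>j. x j \<in> C" "\<And>j. open (B j)" "\<And>j. p \<in> B j" "\<And>j. B j \<subseteq> U" "\<And>j q. q \<in> B j \<Longrightarrow> x j q = \<phi> q j"
    by metis
  show ?thesis
    by (rule that[of x "U \<inter> (\<Inter>j\<in>{..<m}. B j)"]) (use x assms chart(1) in \<open>auto intro!: open_INT\<close>)
qed

text \<open>Hadamard's lemma writes \<open>f\<close> near \<open>q\<close> as a constant plus a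
  combination of the \<open>x i - \<phi> q i\<close> with smooth coefficients; the Leibniz rule
  leaves these coefficients at \<open>q\<close>, which are the partial derivatives. Hence a
  derivation is determined by its values on coordinates.\<close>

lemma chart_expand:
  assumes U: "(U, \<phi>) \<in> atlas M" and v: "v \<in> T q" and f: "f \<in> C" and x: "\<And>i. i < m \<Longrightarrow> x i \<in> C"
    and A: "open A" "q \<in> A" "A \<subseteq> U" "\<And>i r. i < m \<Longrightarrow> r \<in> A \<Longrightarrow> x i r = \<phi> r i"
  shows "v f = (\<Sum>i<m. v (x i) * partial_deriv i (\<lambda>z. f (inv_into U \<phi> z)) (\<phi> q))"
proof -
  let ?f = "\<lambda>z. f (inv_into U \<phi> z)" and ?c = "\<phi> q"
  have qU: "q \<in> U" using A by auto
  have cE: "?c \<in> espace m" using qU eopen_subset[OF chart(2)[OF U]] by auto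
  obtain e where e: "e > 0" "cube m ?c e \<subseteq> \<phi> ` A"
    using cube_inside[OF chart_image_open[OF U A(1,3)], of ?c] A(2) by auto
  have "smooth_in m (cube m ?c e) ?f"
    by (rule smooth_in_subset[OF smooth_funsD[OF f U]]) (use e A in auto)
  then obtain g where g: "\<And>i. i < m \<Longrightarrow> smooth_in m (cube m ?c e) (g i)"
    "\<And>i. i < m \<Longrightarrow> g i ?c = partial_deriv i ?f ?c"
    "\<And>z. z \<in> cube m ?c e \<Longrightarrow> ?f z = ?f ?c + (\<Sum>i<m. (z i - ?c i) * g i z)"
    by (rule hadamard[OF _ cE e(1)]) (rule that; assumption)
  let ?A = "U \<inter> \<phi> -` cube m ?c e"
  have oA: "open ?A" by (rule chart_preimage_open[OF U eopen_cube])
  have qA: "q \<in> ?A" using qU cube_center[OF e(1) cE] by simp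
  have "\<exists>F B. F \<in> C \<and> open B \<and> q \<in> B \<and> (\<forall>r\<in>B. F r = g i (\<phi> r))" if i: "i < m" for i
    by (rule smooth_near_extend[OF oA qA smooth_near_chart[OF U eopen_cube g(1)[OF i]]]) auto
  then obtain F B where F: "\<And>i. i < m \<Longrightarrow> F i \<in> C" "\<And>i. i < m \<Longrightarrow> open (B i)" "\<And>i. i < m \<Longrightarrow> q \<in> B i"
    "\<And>i r. i < m \<Longrightarrow> r \<in> B i \<Longrightarrow> F i r = g i (\<phi> r)"
    by metis
  let ?B = "A \<inter> ?A \<inter> (\<Inter>i\<in>{..<m}. B i)"
  have xc: "(\<lambda>r. x i r - ?c i) \<in> C" if "i < m" for i
    by (intro smooth_funs_diff x that smooth_funs_const)
  have "f r = f q + (\<Sum>i<m. (x i r - ?c i) * F i r)" if r: "r \<in> ?B" for r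
  proof -
    have "f r = ?f (\<phi> r)" using r chart_inv[OF U] by simp
    also have "\<dots> = ?f ?c + (\<Sum>i<m. (\<phi> r i - ?c i) * g i (\<phi> r))" using r by (intro g(3)) auto
    also have "\<dots> = f q + (\<Sum>i<m. (x i r - ?c i) * F i r)"
      using r chart_inv[OF U qU] A(4) F(4) by simp
    finally show ?thesis .
  qed
  moreover have "(\<lambda>r. f q + (\<Sum>i<m. (x i r - ?c i) * F i r)) \<in> C"
    by (intro smooth_funs_add smooth_funs_const smooth_funs_sum smooth_funs_mult xc F(1)) auto
  moreover have "open ?B" by (intro open_Int open_INT A(1) oA) (use F in auto)
  moreover have "q \<in> ?B" using A oA qA F by auto
  ultimately have "v f = v (\<lambda>r. f q + (\<Sum>i<m. (x i r - ?c i) * F i r))"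
    by (intro tangent_local[OF v f, of _ ?B])
  also have "\<dots> = (\<Sum>i<m. v (\<lambda>r. (x i r - ?c i) * F i r))"
    by (subst tangent_add[OF v smooth_funs_const])
      (auto simp: tangent_const[OF v] intro!: smooth_funs_sum smooth_funs_mult xc F tangent_sum[OF v])
  also have "\<dots> = (\<Sum>i<m. v (x i) * partial_deriv i ?f ?c)"
  proof (rule sum.cong[OF refl])
    fix i assume "i \<in> {..<m}"
    then have i: "i < m" by simp
    have "v (\<lambda>r. x i r - ?c i) = v (x i)"
      using tangent_diff[OF v x[OF i] smooth_funs_const] tangent_const[OF v] by simp
    then show "v (\<lambda>r. (x i r - ?c i) * F i r) = v (x i) * partial_deriv i ?f ?c"
      using tangent_mult[OF v xc[OF i] F(1)[OF i]] A(2,4) i F(3,4) g(2) by simp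
  qed
  finally show ?thesis .
qed

text \<open>Expanding \<open>f\<close> and each \<open>y i\<close> in one chart reduces this to the
  chain rule for partial derivatives. The number \<open>n\<close> of functions is arbitrary; it is
  used below with only those coordinates of \<open>M\<close> that restrict to coordinates of
  \<open>N\<close>.\<close>

lemma tangent_chain:
  assumes v: "v \<in> T p" and y: "\<And>i. i < n \<Longrightarrow> y i \<in> C" and W: "eopen n W" and G: "smooth_in n W G"
    and f: "f \<in> C" and A: "open A" "p \<in> A" "\<And>q. q \<in> A \<Longrightarrow> coord_tuple n y q \<in> W \<and> f q = G (coord_tuple n y q)"
  shows "v f = (\<Sum>i<n. partial_deriv i G (coord_tuple n y p) * v (y i))"
proof -
  obtain U \<phi> where U: "(U, \<phi>) \<in> atlas M" "p \<in> U" using chart_cover by blast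
  obtain x B where x: "\<And>j. j < m \<Longrightarrow> x j \<in> C" "open B" "p \<in> B" "B \<subseteq> U" "\<And>j q. j < m \<Longrightarrow> q \<in> B \<Longrightarrow> x j q = \<phi> q j"
    by (rule chart_coords[OF U]) (rule that; assumption)
  let ?inv = "inv_into U \<phi>"
  let ?W = "\<phi> ` (A \<inter> U)"
  have oW: "eopen m ?W" using A chart(1)[OF U(1)] by (intro chart_image_open[OF U(1)]) auto
  have tup: "(\<lambda>z. coord_tuple n y (?inv z) i) = (\<lambda>z. y i (?inv z))" if "i < n" for i
    using that by (simp add: coord_tuple_def)
  have in_W: "coord_tuple n y (?inv z) \<in> W \<and> f (?inv z) = G (coord_tuple n y (?inv z))" if "z \<in> ?W" for z
    using that A(3) chart_inv[OF U(1)] by auto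
  have pd: "partial_deriv j (\<lambda>z. f (?inv z)) (\<phi> p) =
      (\<Sum>i<n. partial_deriv i G (coord_tuple n y p) * partial_deriv j (\<lambda>z. y i (?inv z)) (\<phi> p))" if j: "j < m" for j
  proof -
    have "partial_deriv j (\<lambda>z. f (?inv z)) (\<phi> p) = partial_deriv j (\<lambda>z. G (coord_tuple n y (?inv z))) (\<phi> p)"
      by (rule partial_deriv_cong[OF oW _ j]) (use A U in_W in auto)
    also have "\<dots> = (\<Sum>i<n. partial_deriv i G (coord_tuple n y (?inv (\<phi> p))) *
        partial_deriv j (\<lambda>z. coord_tuple n y (?inv z) i) (\<phi> p))"
      unfolding partial_deriv_def[of j "\<lambda>z. G (coord_tuple n y (?inv z))"]
    proof (rule DERIV_imp_deriv, rule partial_deriv_compose[OF oW W _ _ smooth_inD[OF G] j])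
      show "times_cont_diff m (Suc 0) ?W (\<lambda>z. coord_tuple n y (?inv z) i)" if "i < n" for i
        unfolding tup[OF that]
        by (rule smooth_inD[OF smooth_in_subset[OF smooth_funsD[OF y[OF that] U(1)]]]) auto
    qed (use in_W A(2) U in auto)
    finally show ?thesis using chart_inv[OF U] by (simp add: tup)
  qed
  have vexp: "v h = (\<Sum>j<m. v (x j) * partial_deriv j (\<lambda>z. h (?inv z)) (\<phi> p))" if "h \<in> C" for h
    by (rule chart_expand[OF U(1) v that x(1-4)]) (use x(5) in auto)
  have "v f = (\<Sum>j<m. \<Sum>i<n. v (x j) * (partial_deriv i G (coord_tuple n y p) * partial_deriv j (\<lambda>z. y i (?inv z)) (\<phi> p)))"
    unfolding vexp[OF f] by (intro sum.cong refl) (simp add: pd sum_distrib_left)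
  also have "\<dots> = (\<Sum>i<n. \<Sum>j<m. v (x j) * (partial_deriv i G (coord_tuple n y p) * partial_deriv j (\<lambda>z. y i (?inv z)) (\<phi> p)))"
    by (rule sum.swap)
  also have "\<dots> = (\<Sum>i<n. partial_deriv i G (coord_tuple n y p) * v (y i))"
    by (intro sum.cong refl) (auto simp: vexp[OF y] sum_distrib_left ac_simps)
  finally show ?thesis .
qed

text \<open>Coordinates and coordinate fields are kept as global objects so that forms and brackets
  can be applied to them; only over \<open>V\<close> are they dual and spanning.\<close>

definition frame :: "'m set \<Rightarrow> (nat \<Rightarrow> 'm \<Rightarrow> real) \<Rightarrow> (nat \<Rightarrow> 'm \<Rightarrow> 'm tvec) \<Rightarrow> bool"
  where "frame V y E \<longleftrightarrow> open V \<and> (\<forall>i<m. y i \<in> C \<and> vf (E i)) \<and>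
    (\<forall>q\<in>V. (\<forall>i<m. \<forall>j<m. E i q (y j) = (if i = j then 1 else 0)) \<and>
      (\<forall>v\<in>T q. \<forall>f. v f = (\<Sum>i<m. v (y i) * E i q f)))"

text \<open>Coordinates in the nonlinear sense, near one point and with a neighbourhood that may
  depend on \<open>f\<close>. A frame controls first derivatives only, whereas straightening
  \<open>N\<close> requires its functions to be expressed through coordinates.\<close>

definition generates :: "'m \<Rightarrow> (nat \<Rightarrow> 'm \<Rightarrow> real) \<Rightarrow> bool"
  where "generates p y \<longleftrightarrow> (\<forall>f\<in>C. \<exists>G W A. eopen m W \<and> smooth_in m W G \<and> open A \<and> p \<in> A \<and>
    (\<forall>q\<in>A. coord_tuple m y q \<in> W \<and> f q = G (coord_tuple m y q)))"

lemma frameD: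
  assumes "frame V y E"
  shows "open V" "\<And>i. i < m \<Longrightarrow> y i \<in> C" "\<And>i. i < m \<Longrightarrow> vf (E i)"
    "\<And>q i j. q \<in> V \<Longrightarrow> i < m \<Longrightarrow> j < m \<Longrightarrow> E i q (y j) = (if i = j then 1 else 0)"
    "\<And>q v f. q \<in> V \<Longrightarrow> v \<in> T q \<Longrightarrow> v f = (\<Sum>i<m. v (y i) * E i q f)"
  using assms unfolding frame_def by blast+

lemma frame_expand:
  assumes "frame V y E" "q \<in> V" "v \<in> T q"
  shows "v = (\<Sum>i<m. v (y i) *\<^sub>R E i q)"
  unfolding fun_eq_iff tvec_sum_apply using frameD(5)[OF assms] by blast

lemma frame_subset: "frame V y E \<Longrightarrow> open V' \<Longrightarrow> V' \<subseteq> V \<Longrightarrow> frame V' y E"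
  unfolding frame_def by blast

lemma frame_exists:
  obtains V y E where "p \<in> V" "frame V y E" "generates p y"
proof -
  obtain U \<phi> where U: "(U, \<phi>) \<in> atlas M" "p \<in> U" using chart_cover by blast
  obtain y B where y: "\<And>j. j < m \<Longrightarrow> y j \<in> C" "open B" "p \<in> B" "B \<subseteq> U" "\<And>j q. j < m \<Longrightarrow> q \<in> B \<Longrightarrow> y j q = \<phi> q j"
    by (rule chart_coords[OF U]) (rule that; assumption)
  obtain \<beta> K V where b: "\<beta> \<in> C" "closed K" "K \<subseteq> B" "open V" "p \<in> V" "V \<subseteq> K" "\<And>q. q \<in> V \<Longrightarrow> \<beta> q = 1" "\<And>q. q \<notin> K \<Longrightarrow> \<beta> q = 0"
    by (rule bump[OF y(2,3)]) (rule that; assumption)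
  have VB: "V \<subseteq> B" using b by auto
  define E where "E i q = \<beta> q *\<^sub>R chart_vec U \<phi> i q" for i q
  have E_apply: "E i q f = \<beta> q * partial_deriv i (\<lambda>z. f (inv_into U \<phi> z)) (\<phi> q)" if "f \<in> C" for i q f
    using that by (simp add: E_def scaleR_fun_def chart_vec_def)
  have "vf (E i)" if i: "i < m" for i
    unfolding vector_field_def
  proof (intro conjI allI ballI)
    show "E i q \<in> T q" for q
    proof (cases "q \<in> U")
      case True
      then show ?thesis unfolding E_def by (intro tangent_scale chart_vec_tangent U i)
    next
      case False
      then have "\<beta> q = 0" using b(3,8) y(4) by blast
      then show ?thesis by (simp add: E_def tangent_zero)
    qed
    fix f assume f: "f \<in> C"
    have "(\<lambda>q. \<beta> q * partial_deriv i (\<lambda>z. f (inv_into U \<phi> z)) (\<phi> q)) \<in> C"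
    proof (rule cutoff_smooth[OF b(1-3) b(8)])
      fix q assume "q \<in> B"
      then show "smooth_near (\<lambda>q. partial_deriv i (\<lambda>z. f (inv_into U \<phi> z)) (\<phi> q)) q"
        using smooth_near_chart[OF U(1) chart(2)[OF U(1)] smooth_in_partial[OF smooth_funsD[OF f U(1)] i]] y(4)
        by auto
    qed
    then show "(\<lambda>q. E i q f) \<in> C" using f by (simp add: E_apply)
  qed
  moreover have "E i q (y j) = (if i = j then 1 else 0)" if "q \<in> V" "i < m" "j < m" for q i j
  proof -
    have "partial_deriv i (\<lambda>z. y j (inv_into U \<phi> z)) (\<phi> q) = partial_deriv i (\<lambda>z. z j) (\<phi> q)"
      by (rule partial_deriv_cong[OF chart_image_open[OF U(1) y(2,4)] _ that(2)])
        (use that VB y chart_inv[OF U(1)] in auto)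
    then show ?thesis using that b(7) y(1) by (simp add: E_apply partial_deriv_coord)
  qed
  moreover have "v f = (\<Sum>i<m. v (y i) * E i q f)" if "q \<in> V" "v \<in> T q" for q v f
  proof (cases "f \<in> C")
    case True
    have "v f = (\<Sum>i<m. v (y i) * partial_deriv i (\<lambda>z. f (inv_into U \<phi> z)) (\<phi> q))"
      by (rule chart_expand[OF U(1) that(2) True y(1,2) _ y(4,5)]) (use that VB in auto)
    then show ?thesis using True b(7)[OF that(1)] by (simp add: E_apply)
  next
    case False
    then show ?thesis using tangent_off[OF that(2)] by (simp add: E_def scaleR_fun_def chart_vec_def)
  qed
  ultimately have "frame V y E" using y(1) b(4) by (simp add: frame_def)
  moreover have "generates p y"
    unfolding generates_def
  proof
    fix f assume f: "f \<in> C"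
    have "coord_tuple m y q = \<phi> q" if "q \<in> B" for q
      using that y(4,5) eopen_subset[OF chart(2)[OF U(1)]] by (force simp: coord_tuple_def fun_eq_iff)
    then show "\<exists>G W A. eopen m W \<and> smooth_in m W G \<and> open A \<and> p \<in> A \<and>
        (\<forall>q\<in>A. coord_tuple m y q \<in> W \<and> f q = G (coord_tuple m y q))"
      using chart(2)[OF U(1)] smooth_funsD[OF f U(1)] y(2-4) chart_inv[OF U(1)]
      by (intro exI[of _ "\<lambda>z. f (inv_into U \<phi> z)"] exI[of _ "\<phi> ` U"] exI[of _ B]) auto
  qed
  ultimately show ?thesis using that b(5) by blast
qed

text \<open>Steinitz exchange for coordinates. The new dual fields are \<open>E k / E k g\<close>
  and \<open>E i - (E i g / E k g) E k\<close>; that all functions remain functions of the new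
  coordinates is the content of \<open>implicit_coord\<close>.\<close>

lemma frame_exchange:
  assumes fr: "frame V y E" and p: "p \<in> V" and gen: "generates p y" and k: "k < m"
    and g: "g \<in> C" and nz: "E k p g \<noteq> 0"
  obtains V' E' where "p \<in> V'" "frame V' (y(k := g)) E'" "generates p (y(k := g))"
proof -
  note f = frameD[OF fr]
  have EkC: "(\<lambda>q. E k q g) \<in> C" by (rule vf_smooth[OF f(3)[OF k] g])
  obtain w B where w: "w \<in> C" "open B" "p \<in> B" "\<And>q. q \<in> B \<Longrightarrow> E k q g \<noteq> 0 \<and> w q = inverse (E k q g)"
    by (rule local_inverse[OF EkC nz]) (rule that; assumption)
  \<comment> \<open>One expression for both formulas, with \<open>w\<close> a global function that
    equals \<open>1 / E k g\<close> near \<open>p\<close>.\<close>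
  define E' where "E' i = (\<lambda>q. (if i = k then 0 else 1) *\<^sub>R E i q +
    (w q * (if i = k then 1 else - E i q g)) *\<^sub>R E k q)" for i
  have E'_apply: "E' i q h = (if i = k then w q * E k q h else E i q h - w q * E i q g * E k q h)" for i q h
    by (simp add: E'_def scaleR_fun_def plus_fun_def)
  have "vf (E' i)" if "i < m" for i
  proof -
    have "(\<lambda>q. if i = k then 1 else - E i q g) \<in> C"
      by (cases "i = k") (auto intro: smooth_funs_const smooth_funs_minus vf_smooth[OF f(3)[OF that] g])
    then show ?thesis
      unfolding E'_def by (intro vf_add vf_scale smooth_funs_const smooth_funs_mult w(1) f(3) that k)
  qed
  moreover have "(y(k := g)) i \<in> C" if "i < m" for i using f(2)[OF that] g by simp
  moreover have "E' i q ((y(k := g)) j) = (if i = j then 1 else 0)" if "q \<in> V \<inter> B" "i < m" "j < m" for q i j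
    using that f(4)[of q] w(4)[of q] k by (auto simp: E'_apply)
  moreover have "v h = (\<Sum>i<m. v ((y(k := g)) i) * E' i q h)" if q: "q \<in> V \<inter> B" and v: "v \<in> T q" for q v h
  proof -
    let ?I = "{..<m} - {k}"
    have split: "(\<Sum>i<m. F i) = F k + (\<Sum>i\<in>?I. F i)" for F :: "nat \<Rightarrow> real"
      using k by (intro sum.remove) auto
    have vg: "v g = v (y k) * E k q g + (\<Sum>i\<in>?I. v (y i) * E i q g)"
      using f(5)[OF _ v, of g] q by (simp add: split)
    have vh: "v h = v (y k) * E k q h + (\<Sum>i\<in>?I. v (y i) * E i q h)"
      using f(5)[OF _ v, of h] q by (simp add: split)
    have "(\<Sum>i<m. v ((y(k := g)) i) * E' i q h) =
        v g * (w q * E k q h) + (\<Sum>i\<in>?I. v (y i) * (E i q h - w q * E i q g * E k q h))"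
      by (simp add: split E'_apply)
    also have "\<dots> = v g * (w q * E k q h) + (\<Sum>i\<in>?I. v (y i) * E i q h) -
        (w q * E k q h) * (\<Sum>i\<in>?I. v (y i) * E i q g)"
      by (simp add: sum_subtractf sum_distrib_left right_diff_distrib ac_simps)
    also have "\<dots> = (w q * E k q g) * (v (y k) * E k q h) + (\<Sum>i\<in>?I. v (y i) * E i q h)"
      unfolding vg by (simp add: algebra_simps)
    also have "\<dots> = v h" unfolding vh using w(4)[of q] q by simp
    finally show ?thesis by simp
  qed
  ultimately have "frame (V \<inter> B) (y(k := g)) E'"
    using f(1) w(2) unfolding frame_def by (intro conjI open_Int allI impI ballI)
  moreover have "generates p (y(k := g))"
    unfolding generates_def
  proof
    fix h assume h: "h \<in> C"
    let ?y = "coord_tuple m y" and ?y' = "coord_tuple m (y(k := g))"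
    have upd: "?y' q = (?y q)(k := g q)" for q using k by (auto simp: coord_tuple_def)
    obtain \<Gamma> W A where G: "eopen m W" "smooth_in m W \<Gamma>" "open A" "p \<in> A" "\<And>q. q \<in> A \<Longrightarrow> ?y q \<in> W \<and> g q = \<Gamma> (?y q)"
      using gen g unfolding generates_def by meson
    \<comment> \<open>Duality singles out the \<open>k\<close>-th term of the chain rule, so
      \<open>E k p g\<close> is the partial derivative that \<open>implicit_coord\<close> requires
      to be nonzero.\<close>
    have "E k p g = (\<Sum>i<m. partial_deriv i \<Gamma> (?y p) * E k p (y i))"
      by (rule tangent_chain[OF vf_tangent[OF f(3)[OF k]] f(2) G(1,2) g G(3-5)])
    also have "\<dots> = (\<Sum>i<m. if i = k then partial_deriv i \<Gamma> (?y p) else 0)"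
      using f(4)[OF p k] by (intro sum.cong refl) auto
    also have "\<dots> = partial_deriv k \<Gamma> (?y p)" using k by simp
    finally have nz': "partial_deriv k \<Gamma> (?y p) \<noteq> 0" using nz by simp
    have pW: "?y p \<in> W" using G by auto
    obtain W' H V0 where H: "eopen m W'" "smooth_in m W' H" "eopen m V0" "?y p \<in> V0" "V0 \<subseteq> W"
      "\<And>x. x \<in> V0 \<Longrightarrow> x(k := \<Gamma> x) \<in> W' \<and> H (x(k := \<Gamma> x)) = x k"
      by (rule implicit_coord[OF G(1,2) pW k nz']) (rule that; assumption)
    obtain G' W'' A' where G': "eopen m W''" "smooth_in m W'' G'" "open A'" "p \<in> A'" "\<And>q. q \<in> A' \<Longrightarrow> ?y q \<in> W'' \<and> h q = G' (?y q)"
      using gen h unfolding generates_def by meson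
    obtain S where S: "open S" "W'' = S \<inter> espace m" using G'(1) by (auto simp: eopen_iff)
    have c: "continuous_on W' (\<lambda>x. x(k := H x))"
    proof (rule continuous_on_coordinatewise_then_product)
      show "continuous_on W' (\<lambda>x. (x(k := H x)) i)" for i
        by (cases "i = k") (auto simp: continuous_on_coord smooth_in_cont[OF H(2)])
    qed
    \<comment> \<open>\<open>H\<close> restores the old coordinate \<open>k\<close>; the domain is
      cut down to where the restored tuple is admissible for \<open>G'\<close>.\<close>
    let ?D = "W' \<inter> (\<lambda>x. x(k := H x)) -` S"
    have oD: "eopen m ?D" by (rule eopen_preimage[OF H(1) c S(1)])
    have smD: "smooth_in m ?D (\<lambda>x. G' (x(k := H x)))"
    proof (rule smooth_in_compose[OF oD G'(1) _ _ G'(2)])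
      show "x(k := H x) \<in> W''" if "x \<in> ?D" for x
        using that S(2) eopen_subset[OF H(1)] k by auto
      show "smooth_in m ?D (\<lambda>x. (x(k := H x)) i)" for i
        by (cases "i = k") (auto simp: smooth_in_coord[OF oD] intro: smooth_in_subset[OF H(2)])
    qed
    let ?A = "A \<inter> A' \<inter> ?y -` V0"
    have oA: "open ?A" using G(3) G'(3) coord_tuple_preimage_open[of m y V0, OF f(2) H(3)] by blast
    have pA: "p \<in> ?A" using G(4) G'(4) H(4) by simp
    have "?y' q \<in> ?D \<and> h q = G' ((?y' q)(k := H (?y' q)))" if q: "q \<in> ?A" for q
    proof -
      have "?y' q = (?y q)(k := \<Gamma> (?y q))" using q G(5)[of q] by (simp add: upd)
      then have a: "?y' q \<in> W'" "H (?y' q) = ?y q k" using H(6)[of "?y q"] q by auto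
      then have b: "(?y' q)(k := H (?y' q)) = ?y q" by (simp add: upd)
      show ?thesis using a(1) b G'(5)[of q] q S(2) by simp
    qed
    then show "\<exists>G W A. eopen m W \<and> smooth_in m W G \<and> open A \<and> p \<in> A \<and>
        (\<forall>q\<in>A. ?y' q \<in> W \<and> h q = G (?y' q))"
      using oD smD oA pA
      by (intro exI[of _ "\<lambda>x. G' (x(k := H x))"] exI[of _ ?D] exI[of _ ?A]) blast
  qed
  ultimately show ?thesis using that[of "V \<inter> B" E'] p w(3) by blast
qed

end

section \<open>Submanifolds and adapted frames\<close>

locale submfd = M: smooth_mfd M + N: smooth_mfd N
  for M :: "('m::{t2_space,second_countable_topology}) manifold"
    and N :: "('n::{t2_space,second_countable_topology}) manifold" +
  fixes \<iota> :: "'n \<Rightarrow> 'm"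
  assumes sub: "submanifold N M \<iota>"
begin

lemma continuous_incl: "continuous_on A \<iota>"
  using sub continuous_on_subset unfolding submanifold_def smooth_map_def by blast

lemma open_incl_vimage: "open B \<Longrightarrow> open (\<iota> -` B)"
  by (rule open_vimage[OF _ continuous_incl])

lemma pullback_smooth: "f \<in> M.C \<Longrightarrow> (\<lambda>q. f (\<iota> q)) \<in> N.C"
  using smooth_map_compose[OF N.smooth_mfd_axioms M.smooth_mfd_axioms] sub
  by (simp add: submanifold_def)

abbreviation push :: "'n tvec \<Rightarrow> 'm tvec"
  where "push \<equiv> pushforward M \<iota>"

lemma push_apply: "f \<in> M.C \<Longrightarrow> push w f = w (\<lambda>q. f (\<iota> q))"
  by (simp add: pushforward_def o_def)

lemma push_tangent: "w \<in> N.T q \<Longrightarrow> push w \<in> M.T (\<iota> q)"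
  by (rule M.tangentI)
    (auto simp: pushforward_def o_def M.smooth_funs_add M.smooth_funs_mult
      M.smooth_funs_mult[OF M.smooth_funs_const] N.tangent_add[OF _ pullback_smooth pullback_smooth]
      N.tangent_cmult[OF _ pullback_smooth] N.tangent_mult[OF _ pullback_smooth pullback_smooth])

lemma push_add: "push (v + w) = push v + push w"
  by (auto simp: pushforward_def fun_eq_iff)

lemma push_scale: "push (c *\<^sub>R v) = c *\<^sub>R push v"
  by (auto simp: pushforward_def fun_eq_iff)

lemma push_zero: "push 0 = 0"
  by (auto simp: pushforward_def fun_eq_iff)

lemma push_eq_0: "w \<in> N.T q \<Longrightarrow> push w = 0 \<Longrightarrow> w = 0"
  using sub push_zero N.tangent_zero[of q] unfolding submanifold_def by (metis inj_onD)

lemma frame_reindex: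
  assumes fr: "M.frame V y E" and \<tau>: "bij_betw \<tau> {..<M.m} {..<M.m}"
  shows "M.frame V (\<lambda>i. y (\<tau> i)) (\<lambda>i. E (\<tau> i))"
proof -
  have lt: "\<tau> i < M.m" if "i < M.m" for i using bij_betwE[OF \<tau>] that by auto
  have inj: "\<tau> i = \<tau> j \<longleftrightarrow> i = j" if "i < M.m" "j < M.m" for i j
    using bij_betw_imp_inj_on[OF \<tau>] that by (auto simp: inj_on_def)
  have "v f = (\<Sum>i<M.m. v (y (\<tau> i)) * E (\<tau> i) q f)" if "q \<in> V" "v \<in> M.T q" for q v f
    using M.frameD(5)[OF fr that, of f] sum.reindex_bij_betw[OF \<tau>, of "\<lambda>i. v (y i) * E i q f"] by simp
  then show ?thesis
    using M.frameD(1-4)[OF fr] lt inj unfolding M.frame_def by simp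
qed

text \<open>Coordinates of \<open>N\<close> are exchanged one by one for restrictions of coordinates
  of \<open>M\<close>. As \<iota> is an immersion, \<open>push (e j q)\<close> is nonzero, so some
  \<open>y l\<close> has a nonzero derivative along it. The dual field \<open>e j\<close> kills the
  coordinates exchanged before, hence \<open>l\<close> is a new index.\<close>

lemma coordinate_selection:
  assumes fr: "M.frame V y E" and q: "\<iota> q \<in> V"
  obtains \<sigma> W e where "inj_on \<sigma> {..<N.m}" "\<sigma> ` {..<N.m} \<subseteq> {..<M.m}" "q \<in> W"
    "N.frame W (\<lambda>i r. y (\<sigma> i) (\<iota> r)) e" "N.generates q (\<lambda>i r. y (\<sigma> i) (\<iota> r))"
proof -
  have "\<exists>\<sigma> W x e. inj_on \<sigma> {..<j} \<and> \<sigma> ` {..<j} \<subseteq> {..<M.m} \<and> q \<in> W \<and> N.frame W x e \<and>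
      N.generates q x \<and> (\<forall>i<j. x i = (\<lambda>r. y (\<sigma> i) (\<iota> r)))" if "j \<le> N.m" for j
    using that
  proof (induction j)
    case 0
    obtain W x e where "q \<in> W" "N.frame W x e" "N.generates q x"
      by (rule N.frame_exists) (rule that; assumption)
    then show ?case
      by (intro exI[of _ "\<lambda>_. 0"] exI[of _ W] exI[of _ x] exI[of _ e]) simp
  next
    case (Suc j)
    from Suc.IH[OF Suc_leD[OF Suc.prems]]
    obtain \<sigma> W x e where IH: "inj_on \<sigma> {..<j}" "\<sigma> ` {..<j} \<subseteq> {..<M.m}" "q \<in> W" "N.frame W x e"
      "N.generates q x" and IH6: "\<forall>i<j. x i = (\<lambda>r. y (\<sigma> i) (\<iota> r))" by (elim exE conjE) (rule that)
    have j: "j < N.m" using Suc by simp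
    note f = N.frameD[OF IH(4)]
    have ej: "e j q \<in> N.T q" by (rule N.vf_tangent[OF f(3)[OF j]])
    have "e j q \<noteq> 0" using f(4)[OF IH(3) j j] by (metis zero_fun_apply zero_neq_one)
    then have "push (e j q) \<noteq> 0" using push_eq_0[OF ej] by blast
    have "\<exists>l<M.m. e j q (\<lambda>r. y l (\<iota> r)) \<noteq> 0"
    proof (rule ccontr)
      assume "\<not> ?thesis"
      then have "push (e j q) (y l) = 0" if "l < M.m" for l
        using that push_apply[OF M.frameD(2)[OF fr]] by simp
      then have "push (e j q) f = 0" for f
        using M.frameD(5)[OF fr q push_tangent[OF ej], of f] by simp
      then show False using \<open>push (e j q) \<noteq> 0\<close> by (auto simp: fun_eq_iff)
    qed
    then obtain l where l: "l < M.m" "e j q (\<lambda>r. y l (\<iota> r)) \<noteq> 0" by blast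
    have new: "l \<noteq> \<sigma> i" if "i < j" for i
      using l(2) f(4)[OF IH(3) j, of i] IH6 that j by auto
    obtain W' e' where W': "q \<in> W'" "N.frame W' (x(j := (\<lambda>r. y l (\<iota> r)))) e'"
      "N.generates q (x(j := (\<lambda>r. y l (\<iota> r))))"
      by (rule N.frame_exchange[OF IH(4,3,5) j pullback_smooth[OF M.frameD(2)[OF fr l(1)]] l(2)])
        (rule that; assumption)
    have "inj_on (\<sigma>(j := l)) {..<Suc j}"
      using IH(1) new unfolding inj_on_def by (auto simp: less_Suc_eq) metis+
    moreover have "(\<sigma>(j := l)) ` {..<Suc j} \<subseteq> {..<M.m}"
      using IH(2) l(1) by (auto simp: less_Suc_eq image_subset_iff)
    moreover have "\<forall>i<Suc j. (x(j := (\<lambda>r. y l (\<iota> r)))) i = (\<lambda>r. y ((\<sigma>(j := l)) i) (\<iota> r))"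
      using IH6 by (auto simp: less_Suc_eq)
    ultimately show ?case using W' by blast
  qed
  from this[OF order_refl] obtain \<sigma> W x e where S: "inj_on \<sigma> {..<N.m}" "\<sigma> ` {..<N.m} \<subseteq> {..<M.m}"
    "q \<in> W" "N.frame W x e" "N.generates q x" "\<And>i. i < N.m \<Longrightarrow> x i = (\<lambda>r. y (\<sigma> i) (\<iota> r))"
    by blast
  have "N.frame W (\<lambda>i r. y (\<sigma> i) (\<iota> r)) e"
    using S(4,6) unfolding N.frame_def by simp
  moreover have "coord_tuple N.m x = coord_tuple N.m (\<lambda>i r. y (\<sigma> i) (\<iota> r))"
    using S(6) by (auto simp: coord_tuple_def fun_eq_iff)
  then have "N.generates q (\<lambda>i r. y (\<sigma> i) (\<iota> r))"
    using S(5) unfolding N.generates_def by simp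
  ultimately show ?thesis using that S by blast
qed

text \<open>\<open>W\<close> is open in the topology of \<open>N\<close> and may be smaller than the
  preimage of \<open>V\<close>, because an immersed \<open>N\<close> can pass through
  \<open>V\<close> in several sheets; only the sheet \<open>W\<close> is straightened.\<close>

definition adapted :: "'m set \<Rightarrow> (nat \<Rightarrow> 'm \<Rightarrow> real) \<Rightarrow> (nat \<Rightarrow> 'm \<Rightarrow> 'm tvec) \<Rightarrow> 'n set \<Rightarrow> (nat \<Rightarrow> 'n \<Rightarrow> 'n tvec) \<Rightarrow> bool"
  where "adapted V y E W e \<longleftrightarrow> M.frame V y E \<and> N.frame W (\<lambda>i r. y i (\<iota> r)) e \<and> \<iota> ` W \<subseteq> V \<and> N.m \<le> M.m \<and>
    (\<forall>j. N.m \<le> j \<and> j < M.m \<longrightarrow> (\<forall>r\<in>W. y j (\<iota> r) = 0))"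

text \<open>
  In the normal directions the coordinates \<open>y j\<close> of \<open>M\<close> are corrected by the functions that express
  them on \<open>N\<close> through the first \<open>N.m\<close> coordinates.
\<close>

lemma adapted_exists:
  obtains V y E W e where "q \<in> W" "adapted V y E W e"
    and "\<And>f. f \<in> N.C \<Longrightarrow> \<exists>F\<in>M.C. \<exists>B. open B \<and> q \<in> B \<and> (\<forall>r\<in>B. F (\<iota> r) = f r)"
proof -
  let ?n = "N.m" and ?m = "M.m"
  obtain V0 y0 E0 where fr0: "\<iota> q \<in> V0" "M.frame V0 y0 E0"
    by (rule M.frame_exists) (rule that; assumption)
  obtain \<sigma> W0 e where sel: "inj_on \<sigma> {..<?n}" "\<sigma> ` {..<?n} \<subseteq> {..<?m}" "q \<in> W0"
    "N.frame W0 (\<lambda>i r. y0 (\<sigma> i) (\<iota> r)) e" "N.generates q (\<lambda>i r. y0 (\<sigma> i) (\<iota> r))"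
    by (rule coordinate_selection[OF fr0(2,1)]) (rule that; assumption)
  have nm: "?n \<le> ?m" using card_inj_on_le[OF sel(1,2)] by simp
  have "card ({..<?m} - \<sigma> ` {..<?n}) = card {?n..<?m}"
    using sel(1,2) by (simp add: card_Diff_subset card_image)
  then obtain \<rho> where \<rho>: "bij_betw \<rho> {?n..<?m} ({..<?m} - \<sigma> ` {..<?n})"
    using finite_same_card_bij[of "{?n..<?m}" "{..<?m} - \<sigma> ` {..<?n}"] by auto
  \<comment> \<open>Reordering that puts the selected coordinates first.\<close>
  define \<tau> where "\<tau> i = (if i < ?n then \<sigma> i else \<rho> i)" for i
  have "bij_betw \<tau> ({..<?n} \<union> {?n..<?m}) (\<sigma> ` {..<?n} \<union> ({..<?m} - \<sigma> ` {..<?n}))"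
  proof (rule bij_betw_combine)
    show "bij_betw \<tau> {..<?n} (\<sigma> ` {..<?n})"
      using inj_on_imp_bij_betw[OF sel(1)] by (rule iffD1[OF bij_betw_cong, rotated]) (simp add: \<tau>_def)
    show "bij_betw \<tau> {?n..<?m} ({..<?m} - \<sigma> ` {..<?n})"
      using \<rho> by (rule iffD1[OF bij_betw_cong, rotated]) (simp add: \<tau>_def)
  qed auto
  moreover have "{..<?n} \<union> {?n..<?m} = {..<?m}" "\<sigma> ` {..<?n} \<union> ({..<?m} - \<sigma> ` {..<?n}) = {..<?m}"
    using nm sel(2) by auto
  ultimately have \<tau>: "bij_betw \<tau> {..<?m} {..<?m}" by simp
  define u where "u i = y0 (\<tau> i)" for i
  define D where "D i = E0 (\<tau> i)" for i
  have fr: "M.frame V0 u D" unfolding u_def D_def by (rule frame_reindex[OF fr0(2) \<tau>])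
  note f = M.frameD[OF fr]
  let ?x = "\<lambda>i r. u i (\<iota> r)"
  have xn: "coord_tuple ?n (\<lambda>i r. y0 (\<sigma> i) (\<iota> r)) = coord_tuple ?n ?x"
    by (auto simp: coord_tuple_def u_def \<tau>_def fun_eq_iff)
  have frN: "N.frame W0 ?x e"
    using sel(4) unfolding N.frame_def u_def \<tau>_def by simp
  have tup: "coord_tuple ?n ?x r = coord_tuple ?n u (\<iota> r)" for r
    by (simp add: coord_tuple_def)
  have un: "i < ?n \<Longrightarrow> u i \<in> M.C" for i using f(2) nm by simp
  \<comment> \<open>Near \<open>\<iota> q\<close> the extension depends on the first coordinates
    only and is therefore killed by the remaining fields \<open>D k\<close>, which makes the change
    of frame below triangular. The extension property in the conclusion comes from here as
    well.\<close>
  have ext: "\<exists>F B A. F \<in> M.C \<and> open B \<and> \<iota> q \<in> B \<and> open A \<and> q \<in> A \<and> (\<forall>r\<in>A. F (\<iota> r) = g r) \<and>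
      (\<forall>p\<in>B \<inter> V0. \<forall>k. ?n \<le> k \<and> k < ?m \<longrightarrow> D k p F = 0)" if g: "g \<in> N.C" for g
  proof -
    obtain G X A where G: "eopen ?n X" "smooth_in ?n X G" "open A" "q \<in> A"
      "\<And>r. r \<in> A \<Longrightarrow> coord_tuple ?n ?x r \<in> X \<and> g r = G (coord_tuple ?n ?x r)"
      using sel(5) g unfolding N.generates_def xn by meson
    have X: "coord_tuple ?n u (\<iota> q) \<in> X" using G(4,5) tup by simp
    obtain F B where F: "F \<in> M.C" "open B" "\<iota> q \<in> B"
      "\<And>p. p \<in> B \<Longrightarrow> coord_tuple ?n u p \<in> X \<and> F p = G (coord_tuple ?n u p)"
      by (rule M.compose_extend[OF un G(1,2) X]) (assumption | (rule that; assumption))+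
    have "D k p F = 0" if p: "p \<in> B \<inter> V0" and k: "?n \<le> k" "k < ?m" for k p
    proof -
      have "D k p F = (\<Sum>i<?n. partial_deriv i G (coord_tuple ?n u p) * D k p (u i))"
        by (rule M.tangent_chain[OF M.vf_tangent[OF f(3)[OF k(2)]] un G(1,2) F(1,2) _ F(4)]) (use p in auto)
      also have "\<dots> = 0" using f(4)[of p k] p k by (intro sum.neutral) auto
      finally show ?thesis .
    qed
    moreover have "F (\<iota> r) = g r" if "r \<in> A \<inter> \<iota> -` B" for r
      using that F(4)[of "\<iota> r"] G(5)[of r] by (simp add: tup)
    moreover have "open (A \<inter> \<iota> -` B)" "q \<in> A \<inter> \<iota> -` B"
      using G(3,4) F(2,3) open_incl_vimage by auto
    ultimately show ?thesis using F(1-3) by (intro exI[of _ F] exI[of _ B] exI[of _ "A \<inter> \<iota> -` B"]) blast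
  qed
  define P where "P j F B A \<longleftrightarrow> F \<in> M.C \<and> open B \<and> \<iota> q \<in> B \<and> open A \<and> q \<in> A \<and> (\<forall>r\<in>A. F (\<iota> r) = u j (\<iota> r)) \<and>
      (\<forall>p\<in>B \<inter> V0. \<forall>k. ?n \<le> k \<and> k < ?m \<longrightarrow> D k p F = 0)" for j F B A
  have "\<exists>F B A. P j F B A" if "j < ?m" for j
    unfolding P_def by (rule ext[OF pullback_smooth[OF f(2)[OF that]]])
  then obtain F B A where "\<And>j. j < ?m \<Longrightarrow> P j (F j) (B j) (A j)" by metis
  then have F: "\<And>j. j < ?m \<Longrightarrow> F j \<in> M.C" "\<And>j. j < ?m \<Longrightarrow> open (B j)" "\<And>j. j < ?m \<Longrightarrow> \<iota> q \<in> B j"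
    "\<And>j. j < ?m \<Longrightarrow> open (A j)" "\<And>j. j < ?m \<Longrightarrow> q \<in> A j" "\<And>j r. j < ?m \<Longrightarrow> r \<in> A j \<Longrightarrow> F j (\<iota> r) = u j (\<iota> r)"
    "\<And>j p k. j < ?m \<Longrightarrow> p \<in> B j \<inter> V0 \<Longrightarrow> ?n \<le> k \<Longrightarrow> k < ?m \<Longrightarrow> D k p (F j) = 0"
    unfolding P_def by blast+
  define y where "y i = (if i < ?n then u i else (\<lambda>p. u i p - F i p))" for i
  \<comment> \<open>The coordinate fields for the corrected coordinates: as \<open>F j\<close>
    varies only with the first coordinates, a tangential \<open>D i\<close> picks up the combination
    of the \<open>D j\<close> with coefficients \<open>D i (F j)\<close>, and the normal fields are
    unchanged.\<close>
  define E where "E i = (if i < ?n then (\<lambda>p. D i p + (\<Sum>j\<in>{?n..<?m}. D i p (F j) *\<^sub>R D j p)) else D i)" for i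
  define V where "V = V0 \<inter> (\<Inter>j\<in>{..<?m}. B j)"
  define W where "W = W0 \<inter> \<iota> -` V \<inter> (\<Inter>j\<in>{..<?m}. A j)"
  have E_apply: "E i p h = D i p h + (if i < ?n then (\<Sum>j\<in>{?n..<?m}. D i p (F j) * D j p h) else 0)" for i p h
    by (simp add: E_def tvec_sum_apply)
  have oV: "open V" unfolding V_def by (intro open_Int open_INT f(1)) (use F(2) in auto)
  have oW: "open W" unfolding W_def by (intro open_Int open_INT N.frameD(1)[OF frN] open_incl_vimage oV) (use F(4) in auto)
  have split: "(\<Sum>i<?m. h i) = (\<Sum>i<?n. h i) + (\<Sum>i\<in>{?n..<?m}. h i)" for h :: "nat \<Rightarrow> real"
    using sum.atLeastLessThan_concat[of 0 ?n ?m h] nm by (simp add: lessThan_atLeast0)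
  have yC: "y i \<in> M.C" if "i < ?m" for i
    using that f(2) F(1) by (auto simp: y_def intro: M.smooth_funs_diff)
  have Evf: "M.vf (E i)" if "i < ?m" for i
  proof (cases "i < ?n")
    case True
    have "M.vf (\<lambda>p. D i p (F j) *\<^sub>R D j p)" if "j \<in> {?n..<?m}" for j
      by (rule M.vf_scale[OF M.vf_smooth[OF f(3)[OF \<open>i < ?m\<close>] F(1)] f(3)]) (use that in auto)
    from M.vf_add[OF f(3)[OF that] M.vf_sum[OF this]]
    have "M.vf (\<lambda>p. D i p + (\<Sum>j\<in>{?n..<?m}. D i p (F j) *\<^sub>R D j p))" .
    then show ?thesis using True by (simp add: E_def)
  qed (simp add: E_def f(3) that)
  have Dy: "D k p (y j) = (if k = j then 1 else 0) - (if ?n \<le> j then D k p (F j) else 0)"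
    if "p \<in> V0" "k < ?m" "j < ?m" for k j p
    using that f(4)[OF that] M.tangent_diff[OF M.vf_tangent[OF f(3)[OF that(2)]] f(2)[OF that(3)] F(1)[OF that(3)]]
    by (simp add: y_def)
  have dual: "E i p (y j) = (if i = j then 1 else 0)" if p: "p \<in> V" and ij: "i < ?m" "j < ?m" for i j p
  proof -
    have pB: "p \<in> V0" "\<And>j. j < ?m \<Longrightarrow> p \<in> B j \<inter> V0" using p by (auto simp: V_def)
    have F0: "D k p (F l) = 0" if "?n \<le> k" "k < ?m" "l < ?m" for k l
      using F(7)[OF that(3) pB(2)[OF that(3)] that(1,2)] .
    have *: "(\<Sum>l\<in>{?n..<?m}. D i p (F l) * D l p (y j)) = (if ?n \<le> j then D i p (F j) else 0)"
    proof -
      have "(\<Sum>l\<in>{?n..<?m}. D i p (F l) * D l p (y j)) = (\<Sum>l\<in>{?n..<?m}. if l = j then D i p (F j) else 0)"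
        by (rule sum.cong[OF refl]) (use Dy[OF pB(1)] F0 ij in auto)
      then show ?thesis using ij by simp
    qed
    show ?thesis
      using Dy[OF pB(1) ij] F0[of i j] ij by (auto simp: E_apply *)
  qed
  have span: "v h = (\<Sum>i<?m. v (y i) * E i p h)" if p: "p \<in> V" and v: "v \<in> M.T p" for v h p
  proof -
    have pB: "p \<in> V0" "\<And>j. j < ?m \<Longrightarrow> p \<in> B j \<inter> V0" using p by (auto simp: V_def)
    have vF: "v (F j) = (\<Sum>i<?n. v (u i) * D i p (F j))" if "j < ?m" for j
    proof -
      have "(\<Sum>i\<in>{?n..<?m}. v (u i) * D i p (F j)) = 0"
        using F(7)[OF that pB(2)[OF that]] by (intro sum.neutral) auto
      then show ?thesis using f(5)[OF pB(1) v, of "F j"] by (simp add: split)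
    qed
    have vy: "v (\<lambda>p. u j p - F j p) = v (u j) - v (F j)" if "j < ?m" for j
      using M.tangent_diff[OF v f(2)[OF that] F(1)[OF that]] .
    have "(\<Sum>i<?m. v (y i) * E i p h) =
        (\<Sum>i<?n. v (u i) * (D i p h + (\<Sum>j\<in>{?n..<?m}. D i p (F j) * D j p h))) +
        (\<Sum>j\<in>{?n..<?m}. (v (u j) - v (F j)) * D j p h)"
      unfolding split by (intro arg_cong2[of _ _ _ _ "(+)"] sum.cong refl) (auto simp: E_apply y_def vy)
    also have "(\<Sum>i<?n. v (u i) * (D i p h + (\<Sum>j\<in>{?n..<?m}. D i p (F j) * D j p h))) =
        (\<Sum>i<?n. v (u i) * D i p h) + (\<Sum>i<?n. \<Sum>j\<in>{?n..<?m}. v (u i) * (D i p (F j) * D j p h))"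
      by (simp add: distrib_left sum.distrib sum_distrib_left)
    also have "(\<Sum>i<?n. \<Sum>j\<in>{?n..<?m}. v (u i) * (D i p (F j) * D j p h)) = (\<Sum>j\<in>{?n..<?m}. v (F j) * D j p h)"
      by (subst sum.swap, intro sum.cong refl) (simp add: vF sum_distrib_right mult.assoc)
    also have "(\<Sum>i<?n. v (u i) * D i p h) + (\<Sum>j\<in>{?n..<?m}. v (F j) * D j p h) +
        (\<Sum>j\<in>{?n..<?m}. (v (u j) - v (F j)) * D j p h) = (\<Sum>i<?m. v (u i) * D i p h)"
      unfolding split by (simp add: left_diff_distrib sum_subtractf)
    also have "\<dots> = v h" using f(5)[OF pB(1) v, of h] by simp
    finally show ?thesis by simp
  qed
  have frV: "M.frame V y E"
    unfolding M.frame_def using oV yC Evf dual span by blast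
  have "N.frame W (\<lambda>i r. y i (\<iota> r)) e"
  proof -
    have "W \<subseteq> W0" by (auto simp: W_def)
    from N.frame_subset[OF frN oW this] show ?thesis unfolding N.frame_def y_def by simp
  qed
  moreover have "y j (\<iota> r) = 0" if "?n \<le> j" "j < ?m" "r \<in> W" for j r
    using that F(6)[of j r] by (simp add: y_def W_def)
  moreover have "\<iota> ` W \<subseteq> V" by (auto simp: W_def)
  ultimately have "adapted V y E W e" using frV nm by (auto simp: adapted_def)
  moreover have "q \<in> W" using sel(3) fr0(1) F(3,5) by (auto simp: W_def V_def)
  moreover have "\<exists>F\<in>M.C. \<exists>B. open B \<and> q \<in> B \<and> (\<forall>r\<in>B. F (\<iota> r) = g r)" if "g \<in> N.C" for g
    using ext[OF that] by blast
  ultimately show ?thesis using that by blast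
qed

lemma adaptedD:
  assumes "adapted V y E W e"
  shows "M.frame V y E" "N.frame W (\<lambda>i r. y i (\<iota> r)) e" "r \<in> W \<Longrightarrow> \<iota> r \<in> V" "N.m \<le> M.m"
    "N.m \<le> j \<Longrightarrow> j < M.m \<Longrightarrow> r \<in> W \<Longrightarrow> y j (\<iota> r) = 0"
  using assms by (auto simp: adapted_def)

lemma adapted_normal:
  assumes "adapted V y E W e" "r \<in> W" "w \<in> N.T r" "N.m \<le> j" "j < M.m"
  shows "push w (y j) = 0"
proof -
  have "w (\<lambda>q. y j (\<iota> q)) = w (\<lambda>q. 0)"
    by (rule N.tangent_local[OF assms(3) pullback_smooth N.smooth_funs_const N.frameD(1)[OF adaptedD(2)[OF assms(1)]] assms(2)])
      (use assms M.frameD(2)[OF adaptedD(1)] adaptedD(5) in auto)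
  then show ?thesis
    using assms M.frameD(2)[OF adaptedD(1)] N.tangent_const by (simp add: push_apply)
qed

text \<open>Both vectors take the same values on all \<open>y l\<close>; for normal \<open>l\<close>
  the function \<open>y l\<close> vanishes on \<open>W\<close>, hence so does its derivative along
  \<open>N\<close>.\<close>

lemma adapted_push_frame:
  assumes "adapted V y E W e" "r \<in> W" "i < N.m"
  shows "push (e i r) = E i (\<iota> r)"
proof -
  note a = adaptedD[OF assms(1)]
  have e: "e i r \<in> N.T r" by (rule N.vf_tangent[OF N.frameD(3)[OF a(2) assms(3)]])
  have "push (e i r) (y l) = (if l = i then 1 else 0)" if "l < M.m" for l
  proof (cases "l < N.m")
    case True
    then show ?thesis
      using N.frameD(4)[OF a(2) assms(2,3) True] M.frameD(2)[OF a(1) that] by (simp add: push_apply)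
  next
    case False
    then show ?thesis using adapted_normal[OF assms(1,2) e _ that] assms(3) by simp
  qed
  then have "push (e i r) h = E i (\<iota> r) h" for h
    using M.frameD(5)[OF a(1) a(3)[OF assms(2)] push_tangent[OF e], of h] assms(3) a(4)
    by (simp add: if_distrib[where f = "\<lambda>x. x * _"] cong: if_cong)
  then show ?thesis by (simp add: fun_eq_iff)
qed

text \<open>A vector without normal components is a combination of the first \<open>E i\<close>,
  which are the images of the frame of \<open>N\<close>.\<close>

lemma tangent_image_iff:
  assumes "adapted V y E W e" "r \<in> W" "v \<in> M.T (\<iota> r)"
  shows "v \<in> tangent_image N M \<iota> r \<longleftrightarrow> (\<forall>j. N.m \<le> j \<and> j < M.m \<longrightarrow> v (y j) = 0)"
proof
  assume "v \<in> tangent_image N M \<iota> r"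
  then show "\<forall>j. N.m \<le> j \<and> j < M.m \<longrightarrow> v (y j) = 0"
    using adapted_normal[OF assms(1,2)] by (auto simp: tangent_image_def)
next
  assume n: "\<forall>j. N.m \<le> j \<and> j < M.m \<longrightarrow> v (y j) = 0"
  note a = adaptedD[OF assms(1)]
  define w where "w = (\<Sum>i<N.m. v (y i) *\<^sub>R e i r)"
  have e: "e i r \<in> N.T r" if "i < N.m" for i by (rule N.vf_tangent[OF N.frameD(3)[OF a(2) that]])
  have w: "w \<in> N.T r" unfolding w_def by (intro N.tangent_lincomb N.tangent_scale e) auto
  have "push w f = v f" for f
  proof (cases "f \<in> M.C")
    case True
    have "push w f = (\<Sum>i<N.m. v (y i) * push (e i r) f)"
      using True by (simp add: push_apply w_def tvec_sum_apply)
    also have "\<dots> = (\<Sum>i<N.m. v (y i) * E i (\<iota> r) f)"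
      using adapted_push_frame[OF assms(1,2)] by simp
    also have "\<dots> = (\<Sum>i<M.m. v (y i) * E i (\<iota> r) f)"
      using a(4) n by (intro sum.mono_neutral_left) auto
    also have "\<dots> = v f" using M.frameD(5)[OF a(1) a(3)[OF assms(2)] assms(3), of f] by simp
    finally show ?thesis .
  next
    case False
    then show ?thesis using M.tangent_off[OF assms(3)] by (simp add: pushforward_def)
  qed
  then have "v = push w" by (simp add: fun_eq_iff)
  then show "v \<in> tangent_image N M \<iota> r" using w by (auto simp: tangent_image_def)
qed

end

section \<open>Alternating forms and determinants\<close>

text \<open>The algebraic conditions of \<open>volume_form\<close> at one point. Linearity is asked
  on \<open>S\<close> only, as a top form is unconstrained on arguments that are not tangent
  vectors.\<close>

definition alternating :: "'v::real_vector set \<Rightarrow> nat \<Rightarrow> ((nat \<Rightarrow> 'v) \<Rightarrow> real) \<Rightarrow> bool"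
  where "alternating S n \<omega> \<longleftrightarrow>
    (\<forall>v w. (\<forall>i<n. v i = w i) \<longrightarrow> \<omega> v = \<omega> w) \<and>
    (\<forall>v. (\<forall>i<n. v i \<in> S) \<longrightarrow>
       (\<forall>i<n. \<forall>u\<in>S. \<forall>w\<in>S. \<forall>c.
          \<omega> (v(i := u + w)) = \<omega> (v(i := u)) + \<omega> (v(i := w)) \<and>
          \<omega> (v(i := c *\<^sub>R u)) = c * \<omega> (v(i := u))) \<and>
       (\<forall>i<n. \<forall>j<n. i \<noteq> j \<and> v i = v j \<longrightarrow> \<omega> v = 0))"

text \<open>Matrices are functions of two indices, so that replacing a row is
  \<open>A(i := R)\<close>.\<close>

definition ndet :: "nat \<Rightarrow> (nat \<Rightarrow> nat \<Rightarrow> real) \<Rightarrow> real"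
  where "ndet n A = Determinant.det (Matrix.mat n n (\<lambda>(i, j). A i j))"

lemma ndet_leibniz: "ndet n A = (\<Sum>p | p permutes {..<n}. of_int (sign p) * (\<Prod>i<n. A i (p i)))"
proof -
  have "p i < n" if "p permutes {..<n}" "i < n" for p i
    using permutes_in_image[OF that(1)] that(2) by simp
  then show ?thesis
    unfolding ndet_def Determinant.det_def by (auto simp: lessThan_atLeast0 intro!: sum.cong prod.cong)
qed

lemma alternating_cong: "alternating S n \<omega> \<Longrightarrow> (\<And>i. i < n \<Longrightarrow> v i = w i) \<Longrightarrow> \<omega> v = \<omega> w"
  by (simp add: alternating_def)

lemma alternating_add:
  "alternating S n \<omega> \<Longrightarrow> (\<And>k. k < n \<Longrightarrow> v k \<in> S) \<Longrightarrow> i < n \<Longrightarrow> u \<in> S \<Longrightarrow> w \<in> S \<Longrightarrow>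
    \<omega> (v(i := u + w)) = \<omega> (v(i := u)) + \<omega> (v(i := w))"
  by (simp add: alternating_def)

lemma alternating_scale:
  "alternating S n \<omega> \<Longrightarrow> (\<And>k. k < n \<Longrightarrow> v k \<in> S) \<Longrightarrow> i < n \<Longrightarrow> u \<in> S \<Longrightarrow>
    \<omega> (v(i := c *\<^sub>R u)) = c * \<omega> (v(i := u))"
  unfolding alternating_def by blast

lemma alternating_eq_0:
  "alternating S n \<omega> \<Longrightarrow> (\<And>k. k < n \<Longrightarrow> v k \<in> S) \<Longrightarrow> i < n \<Longrightarrow> j < n \<Longrightarrow> i \<noteq> j \<Longrightarrow> v i = v j \<Longrightarrow> \<omega> v = 0"
  unfolding alternating_def by blast

lemma alternating_sum:
  assumes "alternating S n \<omega>" "\<And>k. k < n \<Longrightarrow> v k \<in> S" "i < n" "subspace S" "finite I" "\<And>k. k \<in> I \<Longrightarrow> u k \<in> S"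
  shows "\<omega> (v(i := (\<Sum>k\<in>I. c k *\<^sub>R u k))) = (\<Sum>k\<in>I. c k * \<omega> (v(i := u k)))"
  using assms(5,6)
proof (induction I rule: finite_induct)
  case empty
  have "\<omega> (v(i := 0 *\<^sub>R 0)) = 0"
    using alternating_scale[OF assms(1) _ assms(3) subspace_0[OF assms(4)], of v 0] assms(2)
    by (simp add: fun_upd_def)
  then show ?case by (simp only: sum.empty scaleR_zero_left)
next
  case (insert k I)
  have "\<omega> (v(i := (\<Sum>k\<in>insert k I. c k *\<^sub>R u k))) = \<omega> (v(i := c k *\<^sub>R u k + (\<Sum>k\<in>I. c k *\<^sub>R u k)))"
    using insert by simp
  also have "\<dots> = \<omega> (v(i := c k *\<^sub>R u k)) + \<omega> (v(i := (\<Sum>k\<in>I. c k *\<^sub>R u k)))"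
    by (rule alternating_add[OF assms(1,2,3)])
      (use insert.prems assms(4) in \<open>auto intro!: subspace_sum subspace_scale\<close>)
  also have "\<dots> = c k * \<omega> (v(i := u k)) + (\<Sum>k\<in>I. c k * \<omega> (v(i := u k)))"
    using insert.prems insert.IH alternating_scale[OF assms(1), where v = v and i = i, OF assms(2,3)]
    by (simp only: insert_iff simp_thms)
  finally show ?case by (simp only: sum.insert[OF insert.hyps])
qed

text \<open>Polarization: the form vanishes when the sum of the two vectors is placed in both
  slots.\<close>

lemma alternating_transpose:
  assumes \<omega>: "alternating S n \<omega>" and v: "\<And>k. k < n \<Longrightarrow> v k \<in> S" and S: "subspace S"
    and ab: "a < n" "b < n" "a \<noteq> b"
  shows "\<omega> (v \<circ> Transposition.transpose a b) = - \<omega> v"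
proof -
  let ?f = "\<lambda>x y. \<omega> (v(a := x, b := y))"
  have add1: "?f (x + y) z = ?f x z + ?f y z" and add2: "?f z (x + y) = ?f z x + ?f z y" and diag: "?f x x = 0"
    if "x \<in> S" "y \<in> S" "z \<in> S" for x y z
  proof -
    have "?f (x + y) z = \<omega> ((v(b := z))(a := x + y))" using ab by (simp add: fun_upd_twist)
    also have "\<dots> = \<omega> ((v(b := z))(a := x)) + \<omega> ((v(b := z))(a := y))"
      by (rule alternating_add[OF \<omega>]) (use v that ab in auto)
    finally show "?f (x + y) z = ?f x z + ?f y z" using ab by (simp add: fun_upd_twist)
    show "?f z (x + y) = ?f z x + ?f z y"
      by (rule alternating_add[OF \<omega>]) (use v that ab in auto)
    show "?f x x = 0"
      by (rule alternating_eq_0[OF \<omega>, of _ a b]) (use v that ab in auto)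
  qed
  let ?x = "v a" and ?y = "v b"
  have x: "?x \<in> S" "?y \<in> S" "?x + ?y \<in> S" using v ab subspace_add[OF S] by auto
  have "0 = ?f (?x + ?y) (?x + ?y)" using diag x by simp
  also have "\<dots> = ?f ?x ?x + ?f ?x ?y + (?f ?y ?x + ?f ?y ?y)"
    using add1[OF x(1,2,3)] add2[OF x(1,2,1)] add2[OF x(1,2,2)] by simp
  finally have "?f ?y ?x = - ?f ?x ?y" using diag[OF x(1) x(1) x(1)] diag[OF x(2) x(2) x(2)] by simp
  moreover have "v(a := ?y, b := ?x) = v \<circ> Transposition.transpose a b"
    by (auto simp: fun_eq_iff Transposition.transpose_def)
  moreover have "v(a := ?x, b := ?y) = v" by (auto simp: fun_eq_iff)
  ultimately show ?thesis by simp
qed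

lemma alternating_permute:
  assumes \<omega>: "alternating S n \<omega>" and S: "subspace S" and p: "p permutes {..<n}"
  shows "(\<And>k. k < n \<Longrightarrow> v k \<in> S) \<Longrightarrow> \<omega> (v \<circ> p) = of_int (sign p) * \<omega> v"
  using p finite_lessThan
proof (induction p arbitrary: v rule: permutes_induct)
  case id
  then show ?case by (simp add: o_def)
next
  case (swap a b p)
  have "(v \<circ> Transposition.transpose a b) k \<in> S" if "k < n" for k
    using swap.prems that swap.hyps by (auto simp: Transposition.transpose_def)
  then have "\<omega> ((v \<circ> Transposition.transpose a b) \<circ> p) = of_int (sign p) * \<omega> (v \<circ> Transposition.transpose a b)"
    by (rule swap.IH)
  also have "\<dots> = - of_int (sign p) * \<omega> v"
    using alternating_transpose[OF \<omega> swap.prems S] swap.hyps by simp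
  also have "- of_int (sign p) = (of_int (sign (Transposition.transpose a b \<circ> p)) :: real)"
    using swap.hyps permutation_permutes[of p] by (subst sign_compose) (auto simp: sign_swap_id permutation_swap_id)
  finally show ?case unfolding comp_assoc .
qed

lemma sum_PiE_insert:
  assumes "x \<notin> S"
  shows "(\<Sum>f\<in>Pi\<^sub>E (insert x S) (\<lambda>_. B). F f) = (\<Sum>f\<in>Pi\<^sub>E S (\<lambda>_. B). \<Sum>k\<in>B. F (f(x := k)))"
proof -
  have "(\<Sum>f\<in>Pi\<^sub>E (insert x S) (\<lambda>_. B). F f) = (\<Sum>(k, f)\<in>B \<times> Pi\<^sub>E S (\<lambda>_. B). F (f(x := k)))"
    unfolding PiE_insert_eq by (subst sum.reindex[OF inj_combinator[OF assms]]) (simp add: case_prod_beta)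
  also have "\<dots> = (\<Sum>k\<in>B. \<Sum>f\<in>Pi\<^sub>E S (\<lambda>_. B). F (f(x := k)))"
    by (rule sum.cartesian_product[symmetric])
  also have "\<dots> = (\<Sum>f\<in>Pi\<^sub>E S (\<lambda>_. B). \<Sum>k\<in>B. F (f(x := k)))"
    by (rule sum.swap)
  finally show ?thesis .
qed

text \<open>Multilinear expansion runs over all maps from slots to basis vectors; maps that are not
  injective contribute 0, and the injective ones are the permutations of the Leibniz
  formula.\<close>

lemma alternating_expand:
  assumes \<omega>: "alternating S n \<omega>" and S: "subspace S" and E: "\<And>k. k < n \<Longrightarrow> E k \<in> S"
  shows "\<omega> (\<lambda>i. \<Sum>k<n. A i k *\<^sub>R E k) = ndet n A * \<omega> E"
proof -
  define r where "r i = (\<Sum>k<n. A i k *\<^sub>R E k)" for i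
  have rS: "r i \<in> S" for i unfolding r_def using S E by (intro subspace_sum subspace_scale) auto
  \<comment> \<open>The first \<open>i\<close> slots hold basis vectors chosen by \<open>f\<close>,
    the others are not yet expanded.\<close>
  define mix where "mix i f = (\<lambda>l. if l < i then E (f l) else r l)" for i and f :: "nat \<Rightarrow> nat"
  have mixS: "mix i f k \<in> S" if "k < n" "i \<le> n" "f \<in> {..<i} \<rightarrow>\<^sub>E {..<n}" for i f k
    using that rS E by (auto simp: mix_def)
  have step: "\<omega> r = (\<Sum>f\<in>{..<i} \<rightarrow>\<^sub>E {..<n}. (\<Prod>l<i. A l (f l)) * \<omega> (mix i f))" if "i \<le> n" for i
    using that
  proof (induction i)
    case 0
    then show ?case by (simp add: mix_def)
  next
    case (Suc i)
    have i: "i < n" using Suc by simp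
    have "\<omega> (mix i f) = (\<Sum>k<n. A i k * \<omega> (mix (Suc i) (f(i := k))))" if f: "f \<in> {..<i} \<rightarrow>\<^sub>E {..<n}" for f
    proof -
      have upd: "(mix i f)(i := E k) = mix (Suc i) (f(i := k))" for k
        by (auto simp: mix_def fun_eq_iff less_Suc_eq)
      have "mix i f = (mix i f)(i := (\<Sum>k<n. A i k *\<^sub>R E k))" by (auto simp: mix_def r_def fun_eq_iff)
      then have "\<omega> (mix i f) = \<omega> ((mix i f)(i := (\<Sum>k<n. A i k *\<^sub>R E k)))" by simp
      also have "\<dots> = (\<Sum>k<n. A i k * \<omega> ((mix i f)(i := E k)))"
        by (rule alternating_sum[OF \<omega> mixS[OF _ _ f] i S]) (use i E in auto)
      finally show ?thesis unfolding upd .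
    qed
    then have "\<omega> r = (\<Sum>f\<in>{..<i} \<rightarrow>\<^sub>E {..<n}. \<Sum>k<n. (\<Prod>l<i. A l (f l)) * (A i k * \<omega> (mix (Suc i) (f(i := k)))))"
      using Suc.IH i by (simp add: sum_distrib_left)
    also have "\<dots> = (\<Sum>f\<in>{..<i} \<rightarrow>\<^sub>E {..<n}. \<Sum>k<n. (\<Prod>l<Suc i. A l ((f(i := k)) l)) * \<omega> (mix (Suc i) (f(i := k))))"
      by (intro sum.cong refl) simp
    also have "\<dots> = (\<Sum>f\<in>insert i {..<i} \<rightarrow>\<^sub>E {..<n}. (\<Prod>l<Suc i. A l (f l)) * \<omega> (mix (Suc i) f))"
      by (rule sum_PiE_insert[symmetric]) simp
    finally show ?case by (simp add: lessThan_Suc)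
  qed
  let ?P = "{..<n} \<rightarrow>\<^sub>E {..<n}" and ?inj = "{f \<in> {..<n} \<rightarrow>\<^sub>E {..<n}. inj_on f {..<n}}"
  have zero: "\<omega> (mix n f) = 0" if f: "f \<in> ?P - ?inj" for f
  proof -
    obtain i j where "i < n" "j < n" "i \<noteq> j" "f i = f j" using f by (auto simp: inj_on_def)
    then show ?thesis
      by (intro alternating_eq_0[OF \<omega>, where v = "mix n f" and i = i and j = j] mixS)
        (use f in \<open>auto simp: mix_def\<close>)
  qed
  have "\<omega> r = (\<Sum>f\<in>?P. (\<Prod>l<n. A l (f l)) * \<omega> (mix n f))" by (rule step) simp
  also have "\<dots> = (\<Sum>f\<in>?inj. (\<Prod>l<n. A l (f l)) * \<omega> (mix n f))"
    using zero by (intro sum.mono_neutral_right) (auto intro: finite_PiE)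
  \<comment> \<open>The functions in \<open>?inj\<close> are \<open>undefined\<close> off
    \<open>{..<n}\<close>, whereas permutations are the identity there; the bijection switches
    between the two conventions.\<close>
  also have "\<dots> = (\<Sum>p | p permutes {..<n}. (\<Prod>l<n. A l (p l)) * (of_int (sign p) * \<omega> E))"
  proof (rule sum.reindex_bij_witness[where i = "\<lambda>p. restrict p {..<n}" and j = "\<lambda>f l. if l < n then f l else l"])
    fix f assume f: "f \<in> ?inj"
    then have inj: "inj_on f {..<n}" and im: "f ` {..<n} \<subseteq> {..<n}" by auto
    show "restrict (\<lambda>l. if l < n then f l else l) {..<n} = f"
      using f by (auto simp: fun_eq_iff PiE_def extensional_def restrict_def)
    have "bij_betw f {..<n} {..<n}"
      using inj im by (simp add: bij_betw_def endo_inj_surj)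
    then have "bij_betw (\<lambda>l. if l < n then f l else l) {..<n} {..<n}"
      by (rule iffD1[OF bij_betw_cong, rotated]) simp
    then show perm: "(\<lambda>l. if l < n then f l else l) \<in> {p. p permutes {..<n}}"
      by (intro CollectI bij_imp_permutes) auto
    have "\<omega> (mix n f) = \<omega> (E \<circ> (\<lambda>l. if l < n then f l else l))"
      by (rule alternating_cong[OF \<omega>]) (simp add: mix_def)
    also have "\<dots> = of_int (sign (\<lambda>l. if l < n then f l else l)) * \<omega> E"
      using perm E by (intro alternating_permute[OF \<omega> S]) auto
    finally show "(\<Prod>l<n. A l (if l < n then f l else l)) * (of_int (sign (\<lambda>l. if l < n then f l else l)) * \<omega> E) =
        (\<Prod>l<n. A l (f l)) * \<omega> (mix n f)" by simp
  next
    fix p assume p: "p \<in> {p. p permutes {..<n}}"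
    then have "p permutes {..<n}" by simp
    then show "(\<lambda>l. if l < n then restrict p {..<n} l else l) = p"
      by (auto simp: fun_eq_iff permutes_def)
    have "inj_on p {..<n}" using \<open>p permutes {..<n}\<close> permutes_inj_on by blast
    then show "restrict p {..<n} \<in> ?inj"
      using permutes_in_image[OF \<open>p permutes {..<n}\<close>] by (auto simp: inj_on_def)
  qed
  also have "\<dots> = ndet n A * \<omega> E"
    unfolding ndet_leibniz sum_distrib_right by (intro sum.cong refl) simp
  finally show ?thesis unfolding r_def .
qed

lemma ndet_cong: "(\<And>i j. i < n \<Longrightarrow> j < n \<Longrightarrow> A i j = B i j) \<Longrightarrow> ndet n A = ndet n B"
  unfolding ndet_def by (intro arg_cong[of _ _ Determinant.det] eq_matI) auto

lemma ndet_mult: "ndet n (\<lambda>i j. \<Sum>k<n. A i k * B k j) = ndet n A * ndet n B"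
proof -
  have "Matrix.mat n n (\<lambda>(i, j). \<Sum>k<n. A i k * B k j) =
      Matrix.mat n n (\<lambda>(i, j). A i j) * Matrix.mat n n (\<lambda>(i, j). B i j)"
    by (intro eq_matI) (auto simp: scalar_prod_def lessThan_atLeast0)
  then show ?thesis unfolding ndet_def by (simp add: Determinant.det_mult[of _ n])
qed

lemma ndet_one: "ndet n (\<lambda>i j. if i = j then 1 else 0) = 1"
proof -
  have "Matrix.mat n n (\<lambda>(i, j). if i = j then 1 else 0 :: real) = 1\<^sub>m n" by (intro eq_matI) auto
  then show ?thesis by (simp add: ndet_def)
qed

lemma ndet_transpose: "ndet n (\<lambda>i j. A j i) = ndet n A"
proof -
  have "Matrix.mat n n (\<lambda>(i, j). A j i) = transpose_mat (Matrix.mat n n (\<lambda>(i, j). A i j))"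
    by (intro eq_matI) auto
  then show ?thesis unfolding ndet_def by (simp add: Determinant.det_transpose[of _ n])
qed

lemma ndet_identical_rows:
  assumes "i < n" "j < n" "i \<noteq> j" "A i = A j"
  shows "ndet n A = 0"
  unfolding ndet_def
  by (rule Determinant.det_identical_rows[of _ n i j]) (use assms in \<open>auto simp: Matrix.row_def\<close>)

lemma ndet_row_replace:
  assumes "i < n"
  shows "ndet n (A(i := R)) =
    (\<Sum>p | p permutes {..<n}. of_int (sign p) * (R (p i) * (\<Prod>l\<in>{..<n} - {i}. A l (p l))))"
  unfolding ndet_leibniz
proof (intro sum.cong refl arg_cong2[of _ _ _ _ "(*)"])
  fix p
  have "(\<Prod>l<n. (A(i := R)) l (p l)) = (A(i := R)) i (p i) * (\<Prod>l\<in>{..<n} - {i}. (A(i := R)) l (p l))"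
    using assms by (intro prod.remove) auto
  also have "(\<Prod>l\<in>{..<n} - {i}. (A(i := R)) l (p l)) = (\<Prod>l\<in>{..<n} - {i}. A l (p l))"
    by (rule prod.cong) auto
  finally show "(\<Prod>l<n. (A(i := R)) l (p l)) = R (p i) * (\<Prod>l\<in>{..<n} - {i}. A l (p l))" by simp
qed

text \<open>The right-hand side is what the product rule makes of the Leibniz formula, so the
  derivative of a determinant is the sum of the determinants with one row differentiated.\<close>

lemma ndet_rows_sum:
  "(\<Sum>i<n. ndet n (A(i := R i))) =
    (\<Sum>p | p permutes {..<n}. of_int (sign p) * (\<Sum>i<n. R i (p i) * (\<Prod>l\<in>{..<n} - {i}. A l (p l))))"
proof -
  have "(\<Sum>i<n. ndet n (A(i := R i))) =
      (\<Sum>i<n. \<Sum>p | p permutes {..<n}. of_int (sign p) * (R i (p i) * (\<Prod>l\<in>{..<n} - {i}. A l (p l))))"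
    by (intro sum.cong refl) (simp add: ndet_row_replace)
  then show ?thesis by (subst (asm) sum.swap) (simp add: sum_distrib_left)
qed

text \<open>Expand row \<open>i\<close> linearly: the terms with \<open>l\<close> different from
  \<open>i\<close> have two equal rows.\<close>

lemma ndet_trace_left:
  "(\<Sum>i<n. ndet n (A(i := (\<lambda>j. \<Sum>l<n. B i l * A l j)))) = (\<Sum>i<n. B i i) * ndet n A"
proof -
  have "ndet n (A(i := (\<lambda>j. \<Sum>l<n. B i l * A l j))) = B i i * ndet n A" if i: "i < n" for i
  proof -
    have "ndet n (A(i := (\<lambda>j. \<Sum>l<n. B i l * A l j))) = (\<Sum>l<n. B i l * ndet n (A(i := A l)))"
      unfolding ndet_row_replace[OF i] sum_distrib_left sum_distrib_right
      by (subst sum.swap) (simp add: ac_simps)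
    also have "\<dots> = (\<Sum>l<n. if l = i then B i i * ndet n A else 0)"
      by (intro sum.cong refl) (use i ndet_identical_rows[of i n] in auto)
    finally show ?thesis using i by simp
  qed
  then show ?thesis by (simp add: sum_distrib_right)
qed

lemma has_real_derivative_prod:
  assumes "finite I" "\<And>i. i \<in> I \<Longrightarrow> (f i has_real_derivative f' i) (at t within S)"
  shows "((\<lambda>x. \<Prod>i\<in>I. f i x) has_real_derivative (\<Sum>i\<in>I. f' i * (\<Prod>l\<in>I - {i}. f l t))) (at t within S)"
  using assms
proof (induction I rule: finite_induct)
  case (insert k I)
  have "((\<lambda>x. f k x * (\<Prod>i\<in>I. f i x)) has_real_derivative
      f' k * (\<Prod>i\<in>I. f i t) + (\<Sum>i\<in>I. f' i * (\<Prod>l\<in>I - {i}. f l t)) * f k t) (at t within S)"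
    using insert by (intro DERIV_mult) auto
  moreover have "(\<Prod>l\<in>insert k I - {i}. f l t) = f k t * (\<Prod>l\<in>I - {i}. f l t)" if "i \<in> I" for i
  proof -
    have "insert k I - {i} = insert k (I - {i})" using that insert by auto
    then show ?thesis using insert by simp
  qed
  moreover have "insert k I - {k} = I" using insert by auto
  ultimately show ?case using insert by (simp add: sum_distrib_left sum_distrib_right ac_simps)
qed simp

lemma ndet_has_derivative:
  assumes "\<And>i j. i < n \<Longrightarrow> j < n \<Longrightarrow> ((\<lambda>t. A t i j) has_real_derivative A' i j) (at t within S)"
  shows "((\<lambda>t. ndet n (A t)) has_real_derivative (\<Sum>i<n. ndet n ((A t)(i := A' i)))) (at t within S)"
  unfolding ndet_rows_sum unfolding ndet_leibniz
proof (intro DERIV_sum DERIV_cmult has_real_derivative_prod finite_lessThan)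
  fix p i assume "p \<in> {p. p permutes {..<n}}" "i \<in> {..<n}"
  then show "((\<lambda>t. A t i (p i)) has_real_derivative A' i (p i)) (at t within S)"
    using permutes_in_image[of p "{..<n}" i] by (intro assms) auto
qed

text \<open>Differentiate \<open>det (A + \<epsilon> A B) = det A \<cdot> det (1 + \<epsilon> B)\<close> at \<open>\<epsilon> = 0\<close>.\<close>

lemma ndet_trace_right:
  "(\<Sum>i<n. ndet n (A(i := (\<lambda>j. \<Sum>l<n. A i l * B l j)))) = (\<Sum>i<n. B i i) * ndet n A"
proof -
  let ?one = "\<lambda>i j. if i = j then 1 else 0 :: real"
  let ?AB = "\<lambda>i j. \<Sum>l<n. A i l * B l j"
  have D1: "((\<lambda>\<epsilon>. ndet n (\<lambda>i j. A i j + \<epsilon> * ?AB i j)) has_real_derivative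
      (\<Sum>i<n. ndet n ((\<lambda>i j. A i j + 0 * ?AB i j)(i := ?AB i)))) (at 0)"
    by (rule ndet_has_derivative) (auto intro!: derivative_eq_intros)
  have D2: "((\<lambda>\<epsilon>. ndet n (\<lambda>i j. ?one i j + \<epsilon> * B i j)) has_real_derivative
      (\<Sum>i<n. ndet n ((\<lambda>i j. ?one i j + 0 * B i j)(i := B i)))) (at 0)"
    by (rule ndet_has_derivative) (auto intro!: derivative_eq_intros)
  have one: "(\<Sum>l<n. x l * ?one l j) = x j" "(\<Sum>l<n. x l * ?one j l) = x j" if "j < n" for x :: "nat \<Rightarrow> real" and j
    using that by (simp_all add: if_distrib[where f = "\<lambda>z. _ * z"] cong: if_cong)
  \<comment> \<open>At the identity matrix multiplication by \<open>B\<close> from the left and from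
    the right agree, so \<open>ndet_trace_left\<close> gives the derivative there.\<close>
  have "(\<Sum>i<n. ndet n (?one(i := B i))) = (\<Sum>i<n. ndet n (?one(i := (\<lambda>j. \<Sum>l<n. B i l * ?one l j))))"
    by (intro sum.cong refl ndet_cong) (auto simp: one)
  also have "\<dots> = (\<Sum>i<n. B i i)" by (simp add: ndet_trace_left ndet_one)
  finally have T: "(\<Sum>i<n. ndet n (?one(i := B i))) = (\<Sum>i<n. B i i)" .
  have "ndet n (\<lambda>i j. A i j + \<epsilon> * ?AB i j) = ndet n A * ndet n (\<lambda>i j. ?one i j + \<epsilon> * B i j)" for \<epsilon>
    unfolding ndet_mult[symmetric]
    by (intro ndet_cong) (auto simp: distrib_left sum.distrib one sum_distrib_left ac_simps)
  then have "((\<lambda>\<epsilon>. ndet n (\<lambda>i j. A i j + \<epsilon> * ?AB i j)) has_real_derivative ndet n A * (\<Sum>i<n. B i i)) (at 0)"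
    using DERIV_cmult[OF D2, of "ndet n A"] by (simp add: T)
  from DERIV_unique[OF D1 this] show ?thesis by (simp add: mult.commute)
qed

lemma (in smooth_mfd) tangent_prod:
  assumes v: "v \<in> T p" and "finite I" "\<And>i. i \<in> I \<Longrightarrow> f i \<in> C"
  shows "v (\<lambda>q. \<Prod>i\<in>I. f i q) = (\<Sum>i\<in>I. v (f i) * (\<Prod>l\<in>I - {i}. f l p))"
  using assms(2,3)
proof (induction I rule: finite_induct)
  case empty
  then show ?case by (simp add: tangent_const[OF v])
next
  case (insert k I)
  have "v (\<lambda>q. f k q * (\<Prod>i\<in>I. f i q)) =
      f k p * (\<Sum>i\<in>I. v (f i) * (\<Prod>l\<in>I - {i}. f l p)) + (\<Prod>i\<in>I. f i p) * v (f k)"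
    using insert by (subst tangent_mult[OF v]) (auto intro: smooth_funs_prod)
  moreover have "(\<Prod>l\<in>insert k I - {i}. f l p) = f k p * (\<Prod>l\<in>I - {i}. f l p)" if "i \<in> I" for i
  proof -
    have "insert k I - {i} = insert k (I - {i})" using that insert by auto
    then show ?thesis using insert by simp
  qed
  moreover have "insert k I - {k} = I" using insert by auto
  ultimately show ?case using insert by (simp add: sum_distrib_left ac_simps)
qed

lemma (in smooth_mfd)
  assumes A: "\<And>i j. i < n \<Longrightarrow> j < n \<Longrightarrow> A i j \<in> C"
  shows smooth_funs_ndet: "(\<lambda>q. ndet n (\<lambda>i j. A i j q)) \<in> C"
    and tangent_ndet: "v \<in> T p \<Longrightarrow> v (\<lambda>q. ndet n (\<lambda>i j. A i j q)) =
      (\<Sum>i<n. ndet n ((\<lambda>i j. A i j p)(i := (\<lambda>j. v (A i j)))))"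
proof -
  have in_C: "A i (p i) \<in> C" if "p \<in> {p. p permutes {..<n}}" "i \<in> {..<n}" for p i
    using that permutes_in_image[of p "{..<n}" i] by (intro A) auto
  have prod_C: "(\<lambda>q. \<Prod>i<n. A i (p i) q) \<in> C" if "p \<in> {p. p permutes {..<n}}" for p
    using in_C[OF that] by (intro smooth_funs_prod) auto
  then show "(\<lambda>q. ndet n (\<lambda>i j. A i j q)) \<in> C"
    unfolding ndet_leibniz by (intro smooth_funs_sum smooth_funs_mult smooth_funs_const) auto
  assume v: "v \<in> T p"
  have "v (\<lambda>q. ndet n (\<lambda>i j. A i j q)) =
      (\<Sum>p | p permutes {..<n}. v (\<lambda>q. of_int (sign p) * (\<Prod>i<n. A i (p i) q)))"
    unfolding ndet_leibniz using prod_C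
    by (intro tangent_sum[OF v] smooth_funs_mult smooth_funs_const) auto
  also have "\<dots> = (\<Sum>i<n. ndet n ((\<lambda>i j. A i j p)(i := (\<lambda>j. v (A i j)))))"
    unfolding ndet_rows_sum
  proof (intro sum.cong refl)
    fix s assume s: "s \<in> {p. p permutes {..<n}}"
    have "v (\<lambda>q. of_int (sign s) * (\<Prod>i<n. A i (s i) q)) = of_int (sign s) * v (\<lambda>q. \<Prod>i<n. A i (s i) q)"
      by (rule tangent_cmult[OF v prod_C[OF s]])
    also have "v (\<lambda>q. \<Prod>i<n. A i (s i) q) = (\<Sum>i<n. v (A i (s i)) * (\<Prod>l\<in>{..<n} - {i}. A l (s l) p))"
      by (rule tangent_prod[OF v]) (use in_C[OF s] in auto)
    finally show "v (\<lambda>q. of_int (sign s) * (\<Prod>i<n. A i (s i) q)) =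
        of_int (sign s) * (\<Sum>i<n. v (A i (s i)) * (\<Prod>l\<in>{..<n} - {i}. A l (s l) p))" .
  qed
  finally show "v (\<lambda>q. ndet n (\<lambda>i j. A i j q)) =
      (\<Sum>i<n. ndet n ((\<lambda>i j. A i j p)(i := (\<lambda>j. v (A i j)))))" .
qed

section \<open>Bivector fields and brackets\<close>

context smooth_mfd
begin

abbreviation "dualT \<equiv> cotangent_space M"
abbreviation "dif \<equiv> differential M"

lemma covec_add: "\<alpha> \<in> dualT p \<Longrightarrow> v \<in> T p \<Longrightarrow> w \<in> T p \<Longrightarrow> \<alpha> (v + w) = \<alpha> v + \<alpha> w"
  unfolding cotangent_space_def by blast

lemma covec_scale: "\<alpha> \<in> dualT p \<Longrightarrow> v \<in> T p \<Longrightarrow> \<alpha> (c *\<^sub>R v) = c * \<alpha> v"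
  unfolding cotangent_space_def by blast

lemma covec_off: "\<alpha> \<in> dualT p \<Longrightarrow> v \<notin> T p \<Longrightarrow> \<alpha> v = 0"
  unfolding cotangent_space_def by blast

lemma covec_zero: "\<alpha> \<in> dualT p \<Longrightarrow> \<alpha> 0 = 0"
  using covec_scale[of \<alpha> p 0 0] tangent_zero by simp

lemma covec_minus: "\<alpha> \<in> dualT p \<Longrightarrow> v \<in> T p \<Longrightarrow> \<alpha> (- v) = - \<alpha> v"
  using covec_scale[of \<alpha> p v "-1"] by simp

lemma covec_diff: "\<alpha> \<in> dualT p \<Longrightarrow> v \<in> T p \<Longrightarrow> w \<in> T p \<Longrightarrow> \<alpha> (v - w) = \<alpha> v - \<alpha> w"
  using covec_add[of \<alpha> p v "- w"] covec_minus[of \<alpha> p w] tangent_uminus[of w p] by simp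

lemma covec_lincomb:
  assumes "\<alpha> \<in> dualT p" "\<And>i. i \<in> I \<Longrightarrow> X i \<in> T p"
  shows "\<alpha> (\<Sum>i\<in>I. c i *\<^sub>R X i) = (\<Sum>i\<in>I. c i * \<alpha> (X i))"
  using assms(2)
proof (induction I rule: infinite_finite_induct)
  case (insert k I)
  have "\<alpha> (c k *\<^sub>R X k + (\<Sum>i\<in>I. c i *\<^sub>R X i)) = \<alpha> (c k *\<^sub>R X k) + \<alpha> (\<Sum>i\<in>I. c i *\<^sub>R X i)"
    by (intro covec_add[OF assms(1)] tangent_scale tangent_lincomb insert.prems) auto
  also have "\<dots> = c k * \<alpha> (X k) + (\<Sum>i\<in>I. c i * \<alpha> (X i))"
    by (simp only: insert.IH[OF insert.prems[OF insertI2]] covec_scale[OF assms(1) insert.prems[OF insertI1]])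
  finally have "\<alpha> (c k *\<^sub>R X k + (\<Sum>i\<in>I. c i *\<^sub>R X i)) = \<dots>" .
  then show ?case by (simp only: sum.insert[OF insert.hyps])
qed (auto simp: covec_zero[OF assms(1)])

lemma covecI:
  assumes "\<And>v. v \<notin> T p \<Longrightarrow> \<alpha> v = 0" "\<And>v w. v \<in> T p \<Longrightarrow> w \<in> T p \<Longrightarrow> \<alpha> (v + w) = \<alpha> v + \<alpha> w"
    "\<And>v c. v \<in> T p \<Longrightarrow> \<alpha> (c *\<^sub>R v) = c * \<alpha> v"
  shows "\<alpha> \<in> dualT p"
  unfolding cotangent_space_def using assms by blast

lemma dif_apply: "v \<in> T p \<Longrightarrow> dif f p v = v f"
  by (simp add: differential_def)

lemma dif_cot: "dif f p \<in> dualT p"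
  by (rule covecI) (auto simp: differential_def tangent_plus tangent_scale)

lemma cot_zero: "0 \<in> dualT p"
  by (rule covecI) auto

lemma cot_plus: "\<alpha> \<in> dualT p \<Longrightarrow> \<beta> \<in> dualT p \<Longrightarrow> \<alpha> + \<beta> \<in> dualT p"
  by (rule covecI) (auto simp: covec_off covec_add covec_scale algebra_simps)

lemma cot_scale: "\<alpha> \<in> dualT p \<Longrightarrow> c *\<^sub>R \<alpha> \<in> dualT p"
  by (rule covecI) (auto simp: covec_off covec_add covec_scale algebra_simps)

lemma cot_lincomb: "(\<And>i. i \<in> I \<Longrightarrow> X i \<in> dualT p) \<Longrightarrow> (\<Sum>i\<in>I. X i) \<in> dualT p"
  by (induction I rule: infinite_finite_induct) (auto intro: cot_zero cot_plus)

lemma cot_eqI: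
  assumes "\<alpha> \<in> dualT p" "\<beta> \<in> dualT p" "\<And>v. v \<in> T p \<Longrightarrow> \<alpha> v = \<beta> v"
  shows "\<alpha> = \<beta>"
proof
  show "\<alpha> v = \<beta> v" for v
    using assms(3) covec_off[OF assms(1)] covec_off[OF assms(2)] by (cases "v \<in> T p") auto
qed

lemma dif_add: "f \<in> C \<Longrightarrow> g \<in> C \<Longrightarrow> dif (\<lambda>q. f q + g q) p = dif f p + dif g p"
  by (auto simp: differential_def fun_eq_iff tangent_add)

lemma dif_cmult: "f \<in> C \<Longrightarrow> dif (\<lambda>q. c * f q) p = c *\<^sub>R dif f p"
  by (auto simp: differential_def fun_eq_iff tangent_cmult)

lemma dif_mult: "f \<in> C \<Longrightarrow> g \<in> C \<Longrightarrow> dif (\<lambda>q. f q * g q) p = f p *\<^sub>R dif g p + g p *\<^sub>R dif f p"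
  by (auto simp: differential_def fun_eq_iff tangent_mult)

end

text \<open>As rewrite rules these would also expand unapplied sums and multiples of tangent vectors.\<close>

declare scaleR_fun_apply [simp del] plus_fun_apply [simp del] zero_fun_apply [simp del]

context smooth_mfd
begin

lemma one_form_dif: "f \<in> C \<Longrightarrow> one_form M (dif f)"
  unfolding one_form_def by (auto simp: dif_cot dif_apply[OF vf_tangent] vf_smooth)

lemma one_form_cot: "one_form M \<alpha> \<Longrightarrow> \<alpha> p \<in> dualT p"
  by (simp add: one_form_def)

lemma one_form_smooth: "one_form M \<alpha> \<Longrightarrow> vf Y \<Longrightarrow> (\<lambda>p. \<alpha> p (Y p)) \<in> C"
  by (simp add: one_form_def)

lemma one_form_sum:
  assumes "\<And>i. i \<in> I \<Longrightarrow> u i \<in> C" "\<And>i. i \<in> I \<Longrightarrow> one_form M (\<alpha> i)"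
  shows "one_form M (\<lambda>p. \<Sum>i\<in>I. u i p *\<^sub>R \<alpha> i p)"
  unfolding one_form_def
proof (intro conjI allI impI)
  show "(\<Sum>i\<in>I. u i p *\<^sub>R \<alpha> i p) \<in> dualT p" for p
    using one_form_cot[OF assms(2)] by (intro cot_lincomb cot_scale)
  fix Y assume Y: "vf Y"
  have "(\<lambda>p. \<Sum>i\<in>I. u i p * \<alpha> i p (Y p)) \<in> C"
    using assms(1) one_form_smooth[OF assms(2) Y] by (intro smooth_funs_sum smooth_funs_mult)
  then show "(\<lambda>p. (\<Sum>i\<in>I. u i p *\<^sub>R \<alpha> i p) (Y p)) \<in> C" by (simp only: tvec_sum_apply)
qed

lemma covec_expand:
  assumes "frame V y E" "q \<in> V" "\<alpha> \<in> dualT q"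
  shows "v \<in> T q \<Longrightarrow> \<alpha> v = (\<Sum>i<m. \<alpha> (E i q) * v (y i))"
    and "\<alpha> = (\<Sum>i<m. \<alpha> (E i q) *\<^sub>R dif (y i) q)"
proof -
  note f = frameD[OF assms(1)]
  have *: "\<alpha> v = (\<Sum>i<m. \<alpha> (E i q) * v (y i))" if "v \<in> T q" for v
  proof -
    have "\<alpha> v = \<alpha> (\<Sum>i<m. v (y i) *\<^sub>R E i q)" using frame_expand[OF assms(1,2) that] by simp
    also have "\<dots> = (\<Sum>i<m. v (y i) * \<alpha> (E i q))"
      by (rule covec_lincomb[OF assms(3)]) (use vf_tangent[OF f(3)] in auto)
    finally show ?thesis by (simp add: mult.commute)
  qed
  show "v \<in> T q \<Longrightarrow> \<alpha> v = (\<Sum>i<m. \<alpha> (E i q) * v (y i))" by (rule *)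
  show "\<alpha> = (\<Sum>i<m. \<alpha> (E i q) *\<^sub>R dif (y i) q)"
    by (rule cot_eqI[OF assms(3)]) (auto intro!: cot_lincomb cot_scale dif_cot simp: tvec_sum_apply dif_apply *)
qed

lemma extend_tvec:
  assumes "v \<in> T p"
  shows "vf (extend_tvec M p v)" "extend_tvec M p v p = v"
proof -
  obtain V y E where fr: "p \<in> V" "frame V y E" by (rule frame_exists) (rule that; assumption)
  have "vf (\<lambda>q. \<Sum>i<m. v (y i) *\<^sub>R E i q)"
    by (rule vf_sum, rule vf_scale[OF smooth_funs_const]) (use frameD(3)[OF fr(2)] in auto)
  moreover have "(\<Sum>i<m. v (y i) *\<^sub>R E i p) = v" using frame_expand[OF fr(2,1) assms] by simp
  ultimately have "\<exists>Y. vf Y \<and> Y p = v" by blast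
  from someI_ex[OF this] show "vf (extend_tvec M p v)" "extend_tvec M p v p = v"
    unfolding extend_tvec_def by auto
qed

lemma lie_bracket_tangent:
  assumes X: "vf X" and Y: "vf Y"
  shows "lie_bracket X Y p \<in> T p"
proof (rule tangentI)
  note Xp = vf_tangent[OF X] and Yp = vf_tangent[OF Y]
  fix f g assume f: "f \<in> C" and g: "g \<in> C"
  note s = vf_smooth[OF X f] vf_smooth[OF X g] vf_smooth[OF Y f] vf_smooth[OF Y g]
  show "lie_bracket X Y p (\<lambda>q. f q + g q) = lie_bracket X Y p f + lie_bracket X Y p g"
    by (simp add: lie_bracket_def tangent_add[OF Xp f g] tangent_add[OF Yp f g]
        tangent_add[OF Xp s(3,4)] tangent_add[OF Yp s(1,2)])
  have e: "Z p (\<lambda>q. f q * a q + g q * b q) = f p * Z p a + a p * Z p f + g p * Z p b + b p * Z p g"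
    if "vf Z" "a \<in> C" "b \<in> C" for Z a b
    by (subst tangent_add[OF vf_tangent[OF that(1)]])
      (auto simp: tangent_mult[OF vf_tangent[OF that(1)]] f g that smooth_funs_mult)
  show "lie_bracket X Y p (\<lambda>q. f q * g q) = f p * lie_bracket X Y p g + g p * lie_bracket X Y p f"
    by (simp add: lie_bracket_def tangent_mult[OF Xp f g] tangent_mult[OF Yp f g] e[OF X s(4,3)] e[OF Y s(2,1)]
        algebra_simps)
next
  fix f c assume f: "f \<in> C"
  show "lie_bracket X Y p (\<lambda>q. c * f q) = c * lie_bracket X Y p f"
    by (simp add: lie_bracket_def tangent_cmult[OF vf_tangent[OF X] f] tangent_cmult[OF vf_tangent[OF Y] f]
        tangent_cmult[OF vf_tangent[OF X] vf_smooth[OF Y f]] tangent_cmult[OF vf_tangent[OF Y] vf_smooth[OF X f]]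
        right_diff_distrib)
next
  fix f assume "f \<notin> C"
  then show "lie_bracket X Y p f = 0"
    by (simp add: lie_bracket_def tangent_off[OF vf_tangent[OF X]] tangent_off[OF vf_tangent[OF Y]]
        tangent_const[OF vf_tangent[OF X]] tangent_const[OF vf_tangent[OF Y]])
qed

text \<open>The derivatives \<open>X p (\<lambda>q. ?Y q (y j))\<close> of the extension chosen in
  the definition occur with both signs and cancel, so the value does not depend on the
  choice.\<close>

lemma lie_one_form_frame:
  assumes fr: "frame V y E" "p \<in> V" and X: "vf X" and \<beta>: "one_form M \<beta>" and v: "v \<in> T p"
  shows "lie_one_form M X \<beta> p v =
    (\<Sum>j<m. X p (\<lambda>q. \<beta> q (E j q)) * v (y j) + \<beta> p (E j p) * v (\<lambda>q. X q (y j)))"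
proof -
  note f = frameD[OF fr(1)]
  let ?Y = "extend_tvec M p v"
  note Y = extend_tvec[OF v]
  note Xp = vf_tangent[OF X, of p]
  have b: "(\<lambda>q. \<beta> q (E j q)) \<in> C" if "j < m" for j by (rule one_form_smooth[OF \<beta> f(3)[OF that]])
  have Yy: "(\<lambda>q. ?Y q (y j)) \<in> C" if "j < m" for j by (rule vf_smooth[OF Y(1) f(2)[OF that]])
  have "X p (\<lambda>q. \<beta> q (?Y q)) = X p (\<lambda>q. \<Sum>j<m. \<beta> q (E j q) * ?Y q (y j))"
    by (rule tangent_local[OF Xp one_form_smooth[OF \<beta> Y(1)] _ f(1) fr(2)])
      (use covec_expand(1)[OF fr(1) _ one_form_cot[OF \<beta>] vf_tangent[OF Y(1)]] b Yy
        in \<open>auto intro!: smooth_funs_sum smooth_funs_mult\<close>)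
  also have "\<dots> = (\<Sum>j<m. X p (\<lambda>q. \<beta> q (E j q) * ?Y q (y j)))"
    by (rule tangent_sum[OF Xp]) (use b Yy in \<open>auto intro!: smooth_funs_mult\<close>)
  also have "\<dots> = (\<Sum>j<m. \<beta> p (E j p) * X p (\<lambda>q. ?Y q (y j)) + v (y j) * X p (\<lambda>q. \<beta> q (E j q)))"
    by (intro sum.cong refl) (simp add: tangent_mult[OF Xp b Yy] Y(2))
  finally have 1: "X p (\<lambda>q. \<beta> q (?Y q)) = \<dots>" .
  have "\<beta> p (lie_bracket X ?Y p) = (\<Sum>j<m. \<beta> p (E j p) * lie_bracket X ?Y p (y j))"
    by (rule covec_expand(1)[OF fr one_form_cot[OF \<beta>] lie_bracket_tangent[OF X Y(1)]])
  also have "\<dots> = (\<Sum>j<m. \<beta> p (E j p) * X p (\<lambda>q. ?Y q (y j)) - \<beta> p (E j p) * v (\<lambda>q. X q (y j)))"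
    by (intro sum.cong refl) (simp add: lie_bracket_def Y(2) right_diff_distrib)
  finally have 2: "\<beta> p (lie_bracket X ?Y p) = \<dots>" .
  show ?thesis
    unfolding lie_one_form_def Let_def using v 1 2
    by (simp add: sum_subtractf sum.distrib mult.commute)
qed

end

section \<open>Poisson brackets, hamiltonian fields and the cotangent bracket\<close>

locale bivector_mfd = smooth_mfd M
  for M :: "('m::{t2_space,second_countable_topology}) manifold" +
  fixes \<pi> :: "'m bivector"
  assumes bivector: "bivector_field M \<pi>"
begin

lemma pi_anti: "\<alpha> \<in> dualT p \<Longrightarrow> \<beta> \<in> dualT p \<Longrightarrow> \<pi> p \<beta> \<alpha> = - \<pi> p \<alpha> \<beta>"
  using bivector unfolding bivector_field_def by blast

lemma pi_add1: "\<alpha> \<in> dualT p \<Longrightarrow> \<beta> \<in> dualT p \<Longrightarrow> \<gamma> \<in> dualT p \<Longrightarrow> \<pi> p (\<alpha> + \<gamma>) \<beta> = \<pi> p \<alpha> \<beta> + \<pi> p \<gamma> \<beta>"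
  using bivector unfolding bivector_field_def by blast

lemma pi_scale1:
  assumes "\<alpha> \<in> dualT p" "\<beta> \<in> dualT p"
  shows "\<pi> p (c *\<^sub>R \<alpha>) \<beta> = c * \<pi> p \<alpha> \<beta>"
proof -
  have "\<forall>\<gamma>\<in>dualT p. \<forall>c. \<pi> p (\<alpha> + \<gamma>) \<beta> = \<pi> p \<alpha> \<beta> + \<pi> p \<gamma> \<beta> \<and> \<pi> p (c *\<^sub>R \<alpha>) \<beta> = c * \<pi> p \<alpha> \<beta>"
    using bivector assms unfolding bivector_field_def by blast
  then show ?thesis using cot_zero[of p] by blast
qed

lemma pi_add2: "\<alpha> \<in> dualT p \<Longrightarrow> \<beta> \<in> dualT p \<Longrightarrow> \<gamma> \<in> dualT p \<Longrightarrow> \<pi> p \<alpha> (\<beta> + \<gamma>) = \<pi> p \<alpha> \<beta> + \<pi> p \<alpha> \<gamma>"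
  using pi_anti[of "\<beta> + \<gamma>" p \<alpha>] pi_anti[of \<beta> p \<alpha>] pi_anti[of \<gamma> p \<alpha>] pi_add1[of \<beta> p \<alpha> \<gamma>] cot_plus[of \<beta> p \<gamma>]
  by simp

lemma pi_scale2: "\<alpha> \<in> dualT p \<Longrightarrow> \<beta> \<in> dualT p \<Longrightarrow> \<pi> p \<alpha> (c *\<^sub>R \<beta>) = c * \<pi> p \<alpha> \<beta>"
  using pi_anti[of "c *\<^sub>R \<beta>" p \<alpha>] pi_anti[of \<beta> p \<alpha>] pi_scale1[of \<beta> p \<alpha> c] cot_scale[of \<beta> p c] by simp

lemma pi_smooth: "one_form M \<alpha> \<Longrightarrow> one_form M \<beta> \<Longrightarrow> (\<lambda>p. \<pi> p (\<alpha> p) (\<beta> p)) \<in> C"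
  using bivector unfolding bivector_field_def by blast

lemma pi_lincomb1:
  assumes "\<beta> \<in> dualT p" "\<And>i. i \<in> I \<Longrightarrow> \<alpha> i \<in> dualT p"
  shows "\<pi> p (\<Sum>i\<in>I. c i *\<^sub>R \<alpha> i) \<beta> = (\<Sum>i\<in>I. c i * \<pi> p (\<alpha> i) \<beta>)"
  using assms(2)
proof (induction I rule: infinite_finite_induct)
  case (insert k I)
  have "\<pi> p (c k *\<^sub>R \<alpha> k + (\<Sum>i\<in>I. c i *\<^sub>R \<alpha> i)) \<beta> =
      \<pi> p (c k *\<^sub>R \<alpha> k) \<beta> + \<pi> p (\<Sum>i\<in>I. c i *\<^sub>R \<alpha> i) \<beta>"
    by (intro pi_add1 assms(1) cot_scale cot_lincomb insert.prems) auto
  also have "\<dots> = c k * \<pi> p (\<alpha> k) \<beta> + (\<Sum>i\<in>I. c i * \<pi> p (\<alpha> i) \<beta>)"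
    by (simp only: insert.IH[OF insert.prems[OF insertI2]] pi_scale1[OF insert.prems[OF insertI1] assms(1)])
  finally have "\<pi> p (c k *\<^sub>R \<alpha> k + (\<Sum>i\<in>I. c i *\<^sub>R \<alpha> i)) \<beta> = \<dots>" .
  then show ?case by (simp only: sum.insert[OF insert.hyps])
next
  case (infinite I)
  show ?case
    using pi_scale1[OF cot_zero assms(1), of 0] by (simp only: scaleR_zero_left mult_zero_left sum.infinite[OF infinite.hyps])
next
  case empty
  show ?case
    using pi_scale1[OF cot_zero assms(1), of 0] by (simp only: scaleR_zero_left mult_zero_left sum.empty)
qed

lemma sharp_apply: "f \<in> C \<Longrightarrow> sharp M \<pi> p \<alpha> f = \<pi> p \<alpha> (dif f p)"
  by (simp add: sharp_def)

lemma sharp_tangent: "\<alpha> \<in> dualT p \<Longrightarrow> sharp M \<pi> p \<alpha> \<in> T p"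
  by (rule tangentI)
    (simp_all add: sharp_def dif_add dif_cmult dif_mult pi_add2 pi_scale2 dif_cot cot_scale smooth_funs_add
      smooth_funs_mult smooth_funs_mult[OF smooth_funs_const])

lemma vf_sharp: "one_form M \<alpha> \<Longrightarrow> vf (\<lambda>q. sharp M \<pi> q (\<alpha> q))"
  unfolding vector_field_def using pi_smooth[OF _ one_form_dif]
  by (auto simp: sharp_tangent one_form_cot sharp_apply)

abbreviation "pb \<equiv> poisson_bracket M \<pi>"
abbreviation "ham \<equiv> hamiltonian M \<pi>"

lemma pb_smooth: "f \<in> C \<Longrightarrow> g \<in> C \<Longrightarrow> pb f g \<in> C"
  unfolding poisson_bracket_def by (rule pi_smooth[OF one_form_dif one_form_dif])

lemma ham_apply: "g \<in> C \<Longrightarrow> ham f p g = pb f g p"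
  by (simp add: hamiltonian_def sharp_apply poisson_bracket_def)

lemma vf_ham: "f \<in> C \<Longrightarrow> vf (ham f)"
  unfolding hamiltonian_def by (rule vf_sharp[OF one_form_dif])

lemma pb_anti: "pb f g p = - pb g f p"
  unfolding poisson_bracket_def by (rule pi_anti[OF dif_cot dif_cot])

lemma sharp_frame:
  assumes "frame V y E" "q \<in> V" "\<alpha> \<in> dualT q" "g \<in> C"
  shows "sharp M \<pi> q \<alpha> g = (\<Sum>i<m. \<alpha> (E i q) * pb (y i) g q)"
proof -
  have "\<pi> q \<alpha> (dif g q) = \<pi> q (\<Sum>i<m. \<alpha> (E i q) *\<^sub>R dif (y i) q) (dif g q)"
    using covec_expand(2)[OF assms(1-3)] by simp
  also have "\<dots> = (\<Sum>i<m. \<alpha> (E i q) * pb (y i) g q)"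
    unfolding poisson_bracket_def by (rule pi_lincomb1[OF dif_cot dif_cot])
  finally show ?thesis using assms(4) by (simp add: sharp_apply)
qed

lemma pi_frame:
  assumes "frame V y E" "q \<in> V" "\<alpha> \<in> dualT q" "\<beta> \<in> dualT q"
  shows "\<pi> q \<alpha> \<beta> = (\<Sum>i<m. \<Sum>j<m. \<alpha> (E i q) * \<beta> (E j q) * pb (y i) (y j) q)"
proof -
  have *: "\<pi> q (dif (y i) q) \<beta> = (\<Sum>j<m. \<beta> (E j q) * pb (y i) (y j) q)" if "i < m" for i
  proof -
    have "\<pi> q (dif (y i) q) \<beta> = - \<pi> q \<beta> (dif (y i) q)" by (rule pi_anti[OF assms(4) dif_cot])
    also have "\<pi> q \<beta> (dif (y i) q) = (\<Sum>j<m. \<beta> (E j q) * pb (y j) (y i) q)"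
      using sharp_frame[OF assms(1,2,4)] frameD(2)[OF assms(1)] that by (simp add: sharp_apply)
    also have "- \<dots> = (\<Sum>j<m. \<beta> (E j q) * pb (y i) (y j) q)"
      unfolding sum_negf[symmetric] by (intro sum.cong refl) (simp add: pb_anti[of "y _" "y i"])
    finally show ?thesis .
  qed
  have "\<pi> q \<alpha> \<beta> = \<pi> q (\<Sum>i<m. \<alpha> (E i q) *\<^sub>R dif (y i) q) \<beta>"
    using covec_expand(2)[OF assms(1-3)] by simp
  also have "\<dots> = (\<Sum>i<m. \<alpha> (E i q) * \<pi> q (dif (y i) q) \<beta>)"
    by (rule pi_lincomb1[OF assms(4) dif_cot])
  also have "\<dots> = (\<Sum>i<m. \<Sum>j<m. \<alpha> (E i q) * \<beta> (E j q) * pb (y i) (y j) q)"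
    by (intro sum.cong refl) (simp add: * sum_distrib_left ac_simps)
  finally show ?thesis .
qed

text \<open>The derivatives of the components of \<alpha> and \<beta> along \<open>v\<close> arise
  from the two Lie derivatives and cancel against the differential of the pairing. What is left
  differentiates components only along the images under \<open>sharp\<close>, which are tangent to a
  Poisson submanifold; this is why the bracket restricts.\<close>

lemma cotangent_bracket_frame:
  assumes fr: "frame V y E" "p \<in> V" and \<alpha>: "one_form M \<alpha>" and \<beta>: "one_form M \<beta>" and v: "v \<in> T p"
  shows "cotangent_bracket M \<pi> \<alpha> \<beta> p v =
    (\<Sum>j<m. sharp M \<pi> p (\<alpha> p) (\<lambda>q. \<beta> q (E j q)) * v (y j)) -
    (\<Sum>i<m. sharp M \<pi> p (\<beta> p) (\<lambda>q. \<alpha> q (E i q)) * v (y i)) +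
    (\<Sum>i<m. \<Sum>j<m. \<alpha> p (E i p) * \<beta> p (E j p) * v (pb (y i) (y j)))"
proof -
  note f = frameD[OF fr(1)]
  define a where "a i q = \<alpha> q (E i q)" for i q
  define b where "b i q = \<beta> q (E i q)" for i q
  let ?P = "\<lambda>i j. pb (y i) (y j)"
  let ?X = "\<lambda>q. sharp M \<pi> q (\<alpha> q)" and ?Z = "\<lambda>q. sharp M \<pi> q (\<beta> q)"
  have aC: "a i \<in> C" and bC: "b i \<in> C" if "i < m" for i
    unfolding a_def b_def using one_form_smooth[OF \<alpha> f(3)[OF that]] one_form_smooth[OF \<beta> f(3)[OF that]] by auto
  have PC: "?P i j \<in> C" if "i < m" "j < m" for i j using pb_smooth f(2) that by blast
  have vab: "v (\<lambda>q. c q * P q) = c p * v P + P p * v c" if "c \<in> C" "P \<in> C" for c P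
    by (rule tangent_mult[OF v that])
  have X: "v (\<lambda>q. ?X q (y j)) = (\<Sum>i<m. a i p * v (?P i j) + ?P i j p * v (a i))" if j: "j < m" for j
  proof -
    have "v (\<lambda>q. ?X q (y j)) = v (\<lambda>q. \<Sum>i<m. a i q * ?P i j q)"
      by (rule tangent_local[OF v vf_smooth[OF vf_sharp[OF \<alpha>] f(2)[OF j]] _ f(1) fr(2)])
        (use sharp_frame[OF fr(1) _ one_form_cot[OF \<alpha>] f(2)[OF j]] aC PC j
          in \<open>auto intro!: smooth_funs_sum smooth_funs_mult simp flip: a_def\<close>)
    also have "\<dots> = (\<Sum>i<m. v (\<lambda>q. a i q * ?P i j q))"
      by (rule tangent_sum[OF v]) (use aC PC j in \<open>auto intro!: smooth_funs_mult\<close>)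
    finally show ?thesis using aC PC j by (simp add: vab)
  qed
  have Z: "v (\<lambda>q. ?Z q (y i)) = - (\<Sum>j<m. b j p * v (?P i j) + ?P i j p * v (b j))" if i: "i < m" for i
  proof -
    have "v (\<lambda>q. ?Z q (y i)) = v (\<lambda>q. - (\<Sum>j<m. b j q * ?P i j q))"
    proof (rule tangent_local[OF v vf_smooth[OF vf_sharp[OF \<beta>] f(2)[OF i]] _ f(1) fr(2)])
      show "(\<lambda>q. - (\<Sum>j<m. b j q * ?P i j q)) \<in> C"
        using bC PC i by (intro smooth_funs_minus smooth_funs_sum smooth_funs_mult) auto
      fix q assume q: "q \<in> V"
      show "?Z q (y i) = - (\<Sum>j<m. b j q * ?P i j q)"
        unfolding sharp_frame[OF fr(1) q one_form_cot[OF \<beta>] f(2)[OF i]] sum_negf[symmetric]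
        by (intro sum.cong refl) (simp add: pb_anti[of "y _" "y i"] b_def)
    qed
    also have "\<dots> = - v (\<lambda>q. \<Sum>j<m. b j q * ?P i j q)"
      using bC PC i by (intro tangent_minus[OF v] smooth_funs_sum smooth_funs_mult) auto
    also have "v (\<lambda>q. \<Sum>j<m. b j q * ?P i j q) = (\<Sum>j<m. v (\<lambda>q. b j q * ?P i j q))"
      by (rule tangent_sum[OF v]) (use bC PC i in \<open>auto intro!: smooth_funs_mult\<close>)
    finally show ?thesis using bC PC i by (simp add: vab)
  qed
  have "dif (\<lambda>q. \<pi> q (\<alpha> q) (\<beta> q)) p v = v (\<lambda>q. \<Sum>i<m. \<Sum>j<m. a i q * b j q * ?P i j q)"
    unfolding dif_apply[OF v]
    by (rule tangent_local[OF v pi_smooth[OF \<alpha> \<beta>] _ f(1) fr(2)])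
      (use pi_frame[OF fr(1) _ one_form_cot[OF \<alpha>] one_form_cot[OF \<beta>]] aC bC PC
        in \<open>auto intro!: smooth_funs_sum smooth_funs_mult simp flip: a_def b_def\<close>)
  also have "\<dots> = (\<Sum>i<m. \<Sum>j<m. v (\<lambda>q. a i q * b j q * ?P i j q))"
  proof -
    have abP: "(\<lambda>q. a i q * b j q * ?P i j q) \<in> C" if "i < m" "j < m" for i j
      using aC bC PC that by (intro smooth_funs_mult)
    have "v (\<lambda>q. \<Sum>i<m. \<Sum>j<m. a i q * b j q * ?P i j q) = (\<Sum>i<m. v (\<lambda>q. \<Sum>j<m. a i q * b j q * ?P i j q))"
      by (rule tangent_sum[OF v], rule smooth_funs_sum) (simp add: abP)
    also have "\<dots> = (\<Sum>i<m. \<Sum>j<m. v (\<lambda>q. a i q * b j q * ?P i j q))"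
      by (intro sum.cong refl tangent_sum[OF v]) (simp add: abP)
    finally show ?thesis .
  qed
  also have "\<dots> = (\<Sum>i<m. \<Sum>j<m. a i p * b j p * v (?P i j) + ?P i j p * (a i p * v (b j) + b j p * v (a i)))"
    using aC bC PC by (intro sum.cong refl) (simp add: vab smooth_funs_mult)
  finally have 3: "dif (\<lambda>q. \<pi> q (\<alpha> q) (\<beta> q)) p v = \<dots>" .
  have 1: "lie_one_form M ?X \<beta> p v = (\<Sum>j<m. ?X p (b j) * v (y j)) +
      (\<Sum>i<m. \<Sum>j<m. b j p * (a i p * v (?P i j) + ?P i j p * v (a i)))"
  proof -
    have "(\<Sum>j<m. b j p * v (\<lambda>q. ?X q (y j))) =
        (\<Sum>j<m. \<Sum>i<m. b j p * (a i p * v (?P i j) + ?P i j p * v (a i)))"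
      by (simp add: X sum_distrib_left)
    also have "\<dots> = (\<Sum>i<m. \<Sum>j<m. b j p * (a i p * v (?P i j) + ?P i j p * v (a i)))"
      by (rule sum.swap)
    finally show ?thesis
      unfolding lie_one_form_frame[OF fr vf_sharp[OF \<alpha>] \<beta> v] sum.distrib by (simp add: b_def[abs_def])
  qed
  have 2: "lie_one_form M ?Z \<alpha> p v = (\<Sum>i<m. ?Z p (a i) * v (y i)) -
      (\<Sum>i<m. \<Sum>j<m. a i p * (b j p * v (?P i j) + ?P i j p * v (b j)))"
    unfolding lie_one_form_frame[OF fr vf_sharp[OF \<beta>] \<alpha> v] sum.distrib
    by (simp add: Z sum_distrib_left sum_negf flip: a_def)
  have "cotangent_bracket M \<pi> \<alpha> \<beta> p v = lie_one_form M ?X \<beta> p v - lie_one_form M ?Z \<alpha> p v -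
      dif (\<lambda>q. \<pi> q (\<alpha> q) (\<beta> q)) p v"
    by (simp add: cotangent_bracket_def)
  also have "\<dots> = (\<Sum>j<m. ?X p (b j) * v (y j)) - (\<Sum>i<m. ?Z p (a i) * v (y i)) +
      (\<Sum>i<m. \<Sum>j<m. a i p * b j p * v (?P i j))"
    unfolding 1 2 3 by (simp add: sum.distrib algebra_simps)
  finally show ?thesis by (simp add: a_def[abs_def] b_def[abs_def])
qed

lemma cotangent_bracket_off: "v \<notin> T p \<Longrightarrow> cotangent_bracket M \<pi> \<alpha> \<beta> p v = 0"
  by (simp add: cotangent_bracket_def lie_one_form_def differential_def)

end

section \<open>Volume forms and modular vector fields\<close>

context smooth_mfd
begin

lemma tangent_subspace: "subspace (T p)"
  by (simp add: subspace_def tangent_zero tangent_plus tangent_scale)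

lemma volume_alternating: "volume_form M \<mu> \<Longrightarrow> alternating (T p) m (\<mu> p)"
  by (simp add: volume_form_def alternating_def)

lemma volume_smooth:
  "volume_form M \<mu> \<Longrightarrow> (\<And>i. i < m \<Longrightarrow> vf (Y i)) \<Longrightarrow> (\<lambda>p. \<mu> p (\<lambda>i. Y i p)) \<in> C"
  by (simp add: volume_form_def)

lemma volume_nonzero: "volume_form M \<mu> \<Longrightarrow> \<exists>v. (\<forall>i<m. v i \<in> T p) \<and> \<mu> p v \<noteq> 0"
  by (simp add: volume_form_def)

lemma volume_expand:
  assumes "volume_form M \<mu>" "frame V y E" "q \<in> V" "\<And>i. i < m \<Longrightarrow> v i \<in> T q"
  shows "\<mu> q v = ndet m (\<lambda>i j. v i (y j)) * \<mu> q (\<lambda>i. E i q)"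
proof -
  have "\<mu> q v = \<mu> q (\<lambda>i. \<Sum>k<m. v i (y k) *\<^sub>R E k q)"
    by (rule alternating_cong[OF volume_alternating[OF assms(1)]])
      (use frame_expand[OF assms(2,3) assms(4)] in auto)
  also have "\<dots> = ndet m (\<lambda>i j. v i (y j)) * \<mu> q (\<lambda>i. E i q)"
    by (rule alternating_expand[OF volume_alternating[OF assms(1)] tangent_subspace])
      (rule vf_tangent[OF frameD(3)[OF assms(2)]])
  finally show ?thesis .
qed

lemma volume_frame:
  assumes "volume_form M \<mu>" "frame V y E"
  shows "(\<lambda>q. \<mu> q (\<lambda>i. E i q)) \<in> C" and "q \<in> V \<Longrightarrow> \<mu> q (\<lambda>i. E i q) \<noteq> 0"
proof -
  show "(\<lambda>q. \<mu> q (\<lambda>i. E i q)) \<in> C"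
    by (rule volume_smooth[OF assms(1) frameD(3)[OF assms(2)]])
  assume q: "q \<in> V"
  obtain v where "\<forall>i<m. v i \<in> T q" "\<mu> q v \<noteq> 0"
    using volume_nonzero[OF assms(1)] by blast
  then show "\<mu> q (\<lambda>i. E i q) \<noteq> 0"
    using volume_expand[OF assms q, of v] by auto
qed

text \<open>The derivatives of the extended fields cancel between the two parts of the Lie
  derivative. The rows left over are those of \<open>ndet_trace_right\<close>, and their trace is
  the divergence of \<open>X\<close> in the frame.\<close>

lemma lie_top_form_frame:
  assumes \<mu>: "volume_form M \<mu>" and fr: "frame V y E" "p \<in> V" and X: "vf X" and v: "\<And>i. i < m \<Longrightarrow> v i \<in> T p"
  shows "lie_top_form M X \<mu> p v =
    (X p (\<lambda>q. \<mu> q (\<lambda>i. E i q)) / \<mu> p (\<lambda>i. E i p) + (\<Sum>j<m. E j p (\<lambda>q. X q (y j)))) * \<mu> p v"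
proof -
  note f = frameD[OF fr(1)]
  note Xp = vf_tangent[OF X, of p]
  define \<rho> where "\<rho> q = \<mu> q (\<lambda>i. E i q)" for q
  define Y where "Y i = extend_tvec M p (v i)" for i
  have Y: "vf (Y i)" "Y i p = v i" if "i < m" for i
    unfolding Y_def using extend_tvec[OF v[OF that]] by auto
  define a where "a i j q = Y i q (y j)" for i j q
  have aC: "a i j \<in> C" if "i < m" "j < m" for i j
    unfolding a_def by (rule vf_smooth[OF Y(1)[OF that(1)] f(2)[OF that(2)]])
  have \<rho>C: "\<rho> \<in> C" unfolding \<rho>_def by (rule volume_frame(1)[OF \<mu> fr(1)])
  have \<rho>p: "\<rho> p \<noteq> 0" unfolding \<rho>_def by (rule volume_frame(2)[OF \<mu> fr])
  define B where "B k j = E k p (\<lambda>q. X q (y j))" for k j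
  let ?A = "\<lambda>i j. a i j p"
  have \<mu>v: "\<mu> p v = ndet m ?A * \<rho> p"
  proof -
    have "\<mu> p v = ndet m (\<lambda>i j. v i (y j)) * \<rho> p" unfolding \<rho>_def by (rule volume_expand[OF \<mu> fr v])
    also have "ndet m (\<lambda>i j. v i (y j)) = ndet m ?A" by (rule ndet_cong) (simp add: a_def Y(2))
    finally show ?thesis .
  qed
  have "X p (\<lambda>q. \<mu> q (\<lambda>i. Y i q)) = X p (\<lambda>q. ndet m (\<lambda>i j. a i j q) * \<rho> q)"
  proof (rule tangent_local[OF Xp _ _ f(1) fr(2)])
    show "(\<lambda>q. \<mu> q (\<lambda>i. Y i q)) \<in> C" by (rule volume_smooth[OF \<mu> Y(1)])
    show "(\<lambda>q. ndet m (\<lambda>i j. a i j q) * \<rho> q) \<in> C"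
      by (intro smooth_funs_mult smooth_funs_ndet aC \<rho>C)
    show "\<mu> q (\<lambda>i. Y i q) = ndet m (\<lambda>i j. a i j q) * \<rho> q" if "q \<in> V" for q
      unfolding \<rho>_def a_def by (rule volume_expand[OF \<mu> fr(1) that vf_tangent[OF Y(1)]])
  qed
  also have "\<dots> = ndet m ?A * X p \<rho> + \<rho> p * (\<Sum>i<m. ndet m (?A(i := (\<lambda>j. X p (a i j)))))"
    by (subst tangent_mult[OF Xp smooth_funs_ndet \<rho>C]) (simp_all add: aC tangent_ndet[OF aC Xp])
  finally have 1: "X p (\<lambda>q. \<mu> q (\<lambda>i. Y i q)) = \<dots>" .
  \<comment> \<open>In coordinates the second part of the bracket multiplies the row of coefficients
    by the Jacobian \<open>B\<close> of \<open>X\<close>.\<close>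
  have br: "lie_bracket X (Y i) p (y j) = X p (a i j) - (\<Sum>k<m. a i k p * B k j)" if "i < m" "j < m" for i j
    using f(5)[OF fr(2) v[OF that(1)], of "\<lambda>q. X q (y j)"] Y(2)[OF that(1)]
    by (simp add: lie_bracket_def a_def[abs_def] B_def)
  have 2: "\<mu> p (v(i := lie_bracket X (Y i) p)) =
      (ndet m (?A(i := (\<lambda>j. X p (a i j)))) - ndet m (?A(i := (\<lambda>j. \<Sum>k<m. a i k p * B k j)))) * \<rho> p"
    if i: "i < m" for i
  proof -
    have "\<mu> p (v(i := lie_bracket X (Y i) p)) =
        ndet m (\<lambda>l j. (v(i := lie_bracket X (Y i) p)) l (y j)) * \<rho> p"
      unfolding \<rho>_def
      by (rule volume_expand[OF \<mu> fr]) (use v lie_bracket_tangent[OF X Y(1)[OF i]] in auto)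
    also have "ndet m (\<lambda>l j. (v(i := lie_bracket X (Y i) p)) l (y j)) =
        ndet m (?A(i := (\<lambda>j. X p (a i j) - (\<Sum>k<m. a i k p * B k j))))"
      by (rule ndet_cong) (use br i Y(2) in \<open>auto simp: a_def\<close>)
    also have "\<dots> = ndet m (?A(i := (\<lambda>j. X p (a i j)))) - ndet m (?A(i := (\<lambda>j. \<Sum>k<m. a i k p * B k j)))"
      unfolding ndet_row_replace[OF i] sum_subtractf[symmetric]
      by (intro sum.cong refl) (simp add: algebra_simps)
    finally show ?thesis .
  qed
  have "(\<Sum>i<m. \<mu> p (v(i := lie_bracket X (Y i) p))) =
      ((\<Sum>i<m. ndet m (?A(i := (\<lambda>j. X p (a i j))))) - (\<Sum>i<m. B i i) * ndet m ?A) * \<rho> p"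
    by (simp add: 2 sum_subtractf left_diff_distrib sum_distrib_right[symmetric] ndet_trace_right
        del: fun_upd_apply)
  then have "lie_top_form M X \<mu> p v = ndet m ?A * X p \<rho> + (\<Sum>i<m. B i i) * ndet m ?A * \<rho> p"
    unfolding lie_top_form_def Let_def Y_def[symmetric] 1 by (simp add: algebra_simps)
  also have "\<dots> = (X p \<rho> / \<rho> p + (\<Sum>i<m. B i i)) * \<mu> p v"
    unfolding \<mu>v using \<rho>p by (simp add: field_simps)
  finally show ?thesis by (simp add: \<rho>_def[abs_def] B_def)
qed

end

context bivector_mfd
begin

text \<open>Evaluating the defining equation on one tuple where \<mu> is nonzero determines the
  field, so uniqueness is immediate. The work lies in existence: the quotient has to be a derivation
  in \<open>f\<close> although \<open>f\<close> is differentiated twice, and this is checked on the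
  frame formula.\<close>

lemma
  assumes \<mu>: "volume_form M \<mu>"
  shows vf_modular: "vf (modular_vector_field M \<pi> \<mu>)"
    and modular_frame: "frame V y E \<Longrightarrow> p \<in> V \<Longrightarrow> f \<in> C \<Longrightarrow> modular_vector_field M \<pi> \<mu> p f =
      ham f p (\<lambda>q. \<mu> q (\<lambda>i. E i q)) / \<mu> p (\<lambda>i. E i p) + (\<Sum>j<m. E j p (pb f (y j)))"
proof -
  define b where "b p = (SOME v. (\<forall>i<m. v i \<in> T p) \<and> \<mu> p v \<noteq> 0)" for p
  have b: "\<And>i. i < m \<Longrightarrow> b p i \<in> T p" "\<mu> p (b p) \<noteq> 0" for p
  proof -
    from someI_ex[OF volume_nonzero[OF \<mu>]] show "\<And>i. i < m \<Longrightarrow> b p i \<in> T p" "\<mu> p (b p) \<noteq> 0" unfolding b_def by auto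
  qed
  define D where "D p f = (if f \<in> C then lie_top_form M (ham f) \<mu> p (b p) / \<mu> p (b p) else 0)" for p f
  have D: "D p f = ham f p (\<lambda>q. \<mu> q (\<lambda>i. E i q)) / \<mu> p (\<lambda>i. E i p) + (\<Sum>j<m. E j p (pb f (y j)))"
    if fr: "frame V y E" "p \<in> V" and f: "f \<in> C" for V y E p f
  proof -
    have "(\<Sum>j<m. E j p (\<lambda>q. ham f q (y j))) = (\<Sum>j<m. E j p (pb f (y j)))"
      by (intro sum.cong refl) (simp add: ham_apply frameD(2)[OF fr(1)])
    then show ?thesis
      using lie_top_form_frame[OF \<mu> fr vf_ham[OF f] b(1)] b(2)[of p] f by (simp add: D_def)
  qed
  have "vf D"
    unfolding vector_field_def
  proof (intro conjI allI ballI)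
    fix p
    obtain V y E where fr: "p \<in> V" "frame V y E" by (rule frame_exists) (rule that; assumption)
    note F = frameD[OF fr(2)]
    let ?\<rho> = "\<lambda>q. \<mu> q (\<lambda>i. E i q)"
    have \<rho>: "?\<rho> \<in> C" by (rule volume_frame(1)[OF \<mu> fr(2)])
    note Ep = vf_tangent[OF F(3)]
    note D' = D[OF fr(2,1)]
    have pb_l: "pb f g p = - ham g p f" if "f \<in> C" for f g using that ham_apply pb_anti by metis
    show "D p \<in> T p"
    proof (rule tangentI)
      fix f g assume f: "f \<in> C" and g: "g \<in> C"
      have S: "(\<lambda>q. f q + g q) \<in> C" "(\<lambda>q. f q * g q) \<in> C" by (intro smooth_funs_add smooth_funs_mult f g)+
      have pa: "pb (\<lambda>q. f q + g q) h = (\<lambda>q. pb f h q + pb g h q)" if "h \<in> C" for h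
        by (auto simp: poisson_bracket_def fun_eq_iff dif_add[OF f g] pi_add1 dif_cot)
      have pm: "pb (\<lambda>q. f q * g q) h = (\<lambda>q. f q * pb g h q + g q * pb f h q)" if "h \<in> C" for h
        by (auto simp: poisson_bracket_def fun_eq_iff dif_mult[OF f g] pi_add1 pi_scale1 dif_cot cot_scale)
      have ea: "E j p (pb (\<lambda>q. f q + g q) (y j)) = E j p (pb f (y j)) + E j p (pb g (y j))" if "j < m" for j
        unfolding pa[OF F(2)[OF that]]
        by (rule tangent_add[OF Ep[OF that]]) (use pb_smooth f g F(2)[OF that] in auto)
      show "D p (\<lambda>q. f q + g q) = D p f + D p g"
        using f g S \<rho> by (simp add: D' ham_apply pa ea sum.distrib add_divide_distrib)
      have em: "E j p (pb (\<lambda>q. f q * g q) (y j)) = f p * E j p (pb g (y j)) + pb g (y j) p * E j p f +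
          (g p * E j p (pb f (y j)) + pb f (y j) p * E j p g)" if "j < m" for j
        unfolding pm[OF F(2)[OF that]]
        by (subst tangent_add[OF Ep[OF that]])
          (use pb_smooth f g F(2)[OF that] tangent_mult[OF Ep[OF that]] in \<open>auto intro!: smooth_funs_mult\<close>)
      \<comment> \<open>The terms by which the second-order part fails the Leibniz rule add up to
        \<open>{g, f} + {f, g}\<close>.\<close>
      have "(\<Sum>j<m. pb g (y j) p * E j p f + pb f (y j) p * E j p g) = ham g p f + ham f p g"
        using F(5)[OF fr(1) vf_tangent[OF vf_ham[OF g]], of f] F(5)[OF fr(1) vf_tangent[OF vf_ham[OF f]], of g]
        by (simp add: ham_apply F(2) sum.distrib)
      also have "\<dots> = 0" using f g pb_anti[of f g p] by (simp add: ham_apply)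
      finally have "(\<Sum>j<m. pb g (y j) p * E j p f) + (\<Sum>j<m. pb f (y j) p * E j p g) = 0"
        by (simp add: sum.distrib)
      then have "(\<Sum>j<m. E j p (pb (\<lambda>q. f q * g q) (y j))) =
          f p * (\<Sum>j<m. E j p (pb g (y j))) + g p * (\<Sum>j<m. E j p (pb f (y j)))"
        by (simp add: em sum.distrib sum_distrib_left)
      then show "D p (\<lambda>q. f q * g q) = f p * D p g + g p * D p f"
        using f g S \<rho> by (simp add: D' ham_apply pm add_divide_distrib algebra_simps)
    next
      fix f c assume f: "f \<in> C"
      have S: "(\<lambda>q. c * f q) \<in> C" by (intro smooth_funs_mult smooth_funs_const f)
      have pc: "pb (\<lambda>q. c * f q) h = (\<lambda>q. c * pb f h q)" for h
        by (auto simp: poisson_bracket_def fun_eq_iff dif_cmult[OF f] pi_scale1 dif_cot)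
      show "D p (\<lambda>q. c * f q) = c * D p f"
        using f S \<rho> by (simp add: D' ham_apply pc tangent_cmult[OF Ep pb_smooth] F(2) sum_distrib_left distrib_left)
    qed (simp add: D_def)
  next
    fix f assume f: "f \<in> C"
    show "(\<lambda>p. D p f) \<in> C"
    proof (rule smooth_funs_local)
      fix p
      obtain V y E where fr: "p \<in> V" "frame V y E" by (rule frame_exists) (rule that; assumption)
      note F = frameD[OF fr(2)]
      let ?\<rho> = "\<lambda>q. \<mu> q (\<lambda>i. E i q)"
      have \<rho>: "?\<rho> \<in> C" by (rule volume_frame(1)[OF \<mu> fr(2)])
      obtain w B where w: "w \<in> C" "open B" "p \<in> B" "\<And>q. q \<in> B \<Longrightarrow> ?\<rho> q \<noteq> 0 \<and> w q = inverse (?\<rho> q)"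
        by (rule local_inverse[OF \<rho> volume_frame(2)[OF \<mu> fr(2,1)]]) (rule that; assumption)
      let ?g = "\<lambda>q. ham f q ?\<rho> * w q + (\<Sum>j<m. E j q (pb f (y j)))"
      have "?g \<in> C"
        by (intro smooth_funs_add smooth_funs_mult smooth_funs_sum vf_smooth[OF vf_ham[OF f] \<rho>] w(1)
            vf_smooth[OF F(3)] pb_smooth f F(2)) auto
      moreover have "\<forall>q\<in>V \<inter> B. D q f = ?g q"
        using D[OF fr(2) _ f] w(4) by (simp add: divide_inverse)
      ultimately show "\<exists>g\<in>C. \<exists>A. open A \<and> p \<in> A \<and> (\<forall>q\<in>A. D q f = g q)"
        using F(1) w(2,3) fr(1) by (intro bexI[of _ ?g] exI[of _ "V \<inter> B"]) auto
    qed
  qed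
  have eq: "modular_vector_field M \<pi> \<mu> = D"
    unfolding modular_vector_field_def
  proof (rule the_equality)
    have "lie_top_form M (ham f) \<mu> p v = D p f * \<mu> p v" if f: "f \<in> C" and v: "\<forall>i<m. v i \<in> T p" for f p v
    proof -
      obtain V y E where fr: "p \<in> V" "frame V y E" by (rule frame_exists) (rule that; assumption)
      show ?thesis
        using lie_top_form_frame[OF \<mu> fr(2,1) vf_ham[OF f], of v] lie_top_form_frame[OF \<mu> fr(2,1) vf_ham[OF f] b(1)]
          v b(2)[of p] f by (simp add: D_def)
    qed
    then show "vf D \<and> (\<forall>f\<in>C. \<forall>p v. (\<forall>i<m. v i \<in> T p) \<longrightarrow> lie_top_form M (ham f) \<mu> p v = D p f * \<mu> p v)"
      using \<open>vf D\<close> by blast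
  next
    fix X assume X: "vf X \<and> (\<forall>f\<in>C. \<forall>p v. (\<forall>i<m. v i \<in> T p) \<longrightarrow> lie_top_form M (ham f) \<mu> p v = X p f * \<mu> p v)"
    show "X = D"
    proof (intro ext)
      fix p f
      show "X p f = D p f"
      proof (cases "f \<in> C")
        case True
        then have "lie_top_form M (ham f) \<mu> p (b p) = X p f * \<mu> p (b p)" using X b(1) by blast
        then show ?thesis using True b(2)[of p] by (simp add: D_def)
      next
        case False
        then show ?thesis using X tangent_off[OF vf_tangent] by (simp add: D_def)
      qed
    qed
  qed
  show "vf (modular_vector_field M \<pi> \<mu>)" using \<open>vf D\<close> eq by simp
  show "frame V y E \<Longrightarrow> p \<in> V \<Longrightarrow> f \<in> C \<Longrightarrow> modular_vector_field M \<pi> \<mu> p f =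
      ham f p (\<lambda>q. \<mu> q (\<lambda>i. E i q)) / \<mu> p (\<lambda>i. E i p) + (\<Sum>j<m. E j p (pb f (y j)))"
    using D eq by simp
qed

end

section \<open>Linear differential equations\<close>

text \<open>Picard iteration, written as a series that is differentiated term by term. The bound 1/2
  makes the increments decay geometrically; longer intervals are reached later by composing
  transports.\<close>

lemma linear_ode_exists:
  fixes B :: "'j \<Rightarrow> 'j \<Rightarrow> real \<Rightarrow> real"
  assumes J: "finite J" and ab: "a \<le> b" and K: "K \<ge> 0" "real (card J) * K * (b - a) \<le> 1 / 2"
    and B: "\<And>j k. j \<in> J \<Longrightarrow> k \<in> J \<Longrightarrow> continuous_on {a..b} (B j k)"
      "\<And>j k t. j \<in> J \<Longrightarrow> k \<in> J \<Longrightarrow> t \<in> {a..b} \<Longrightarrow> \<bar>B j k t\<bar> \<le> K"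
  obtains x where "\<And>j. j \<in> J \<Longrightarrow> x j a = x0 j"
    "\<And>j t. j \<in> J \<Longrightarrow> t \<in> {a..b} \<Longrightarrow> (x j has_real_derivative (\<Sum>k\<in>J. B j k t * x k t)) (at t within {a..b})"
proof -
  define rhs where "rhs w j t = (\<Sum>k\<in>J. B j k t * w k t)" for w :: "'j \<Rightarrow> real \<Rightarrow> real" and j t
  \<comment> \<open>The increments of the iteration: by linearity each is the integrated right-hand
    side of the one before, starting from the constant initial value.\<close>
  define u where "u n = ((\<lambda>w j t. integral {a..t} (rhs w j)) ^^ n) (\<lambda>j t. x0 j)" for n
  have u0: "u 0 j t = x0 j" and uS: "u (Suc n) j t = integral {a..t} (rhs (u n) j)" for n j t
    by (simp_all add: u_def)
  define c where "c = (\<Sum>j\<in>J. \<bar>x0 j\<bar>)"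
  have c: "c \<ge> 0" by (simp add: c_def sum_nonneg)
  have rhs_cont: "continuous_on {a..b} (rhs w j)"
    if "\<And>k. k \<in> J \<Longrightarrow> continuous_on {a..b} (w k)" "j \<in> J" for w j
    unfolding rhs_def[abs_def] using that B(1) by (intro continuous_intros) auto
  have rhs_bound: "\<bar>rhs w j t\<bar> \<le> real (card J) * K * h"
    if "\<And>k. k \<in> J \<Longrightarrow> \<bar>w k t\<bar> \<le> h" "j \<in> J" "t \<in> {a..b}" for w j t h
  proof -
    have "\<bar>rhs w j t\<bar> \<le> (\<Sum>k\<in>J. \<bar>B j k t * w k t\<bar>)" unfolding rhs_def by (rule sum_abs)
    also have "\<dots> \<le> (\<Sum>k\<in>J. K * h)"
      unfolding abs_mult using that B(2) K(1) by (intro sum_mono mult_mono) auto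
    finally show ?thesis by (simp add: ac_simps)
  qed
  have u: "(\<forall>j\<in>J. continuous_on {a..b} (u n j)) \<and> (\<forall>j\<in>J. \<forall>t\<in>{a..b}. \<bar>u n j t\<bar> \<le> c * (1 / 2) ^ n)" for n
  proof (induction n)
    case 0
    have "\<bar>x0 j\<bar> \<le> c" if "j \<in> J" for j
      unfolding c_def using J that by (intro member_le_sum) auto
    then show ?case by (simp add: u0[abs_def])
  next
    case (Suc n)
    have rc: "continuous_on {a..b} (rhs (u n) j)" if "j \<in> J" for j
      using Suc.IH that by (intro rhs_cont) auto
    have "continuous_on {a..b} (u (Suc n) j)" if "j \<in> J" for j
      unfolding uS[abs_def] by (rule indefinite_integral_continuous_1[OF integrable_continuous_real[OF rc[OF that]]])
    moreover have "\<bar>u (Suc n) j t\<bar> \<le> c * (1 / 2) ^ Suc n" if j: "j \<in> J" and t: "t \<in> {a..b}" for j t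
    proof -
      have "norm (integral {a..t} (rhs (u n) j)) \<le> (real (card J) * K * (c * (1 / 2) ^ n)) * (t - a)"
        using t Suc.IH j by (intro integral_bound continuous_on_subset[OF rc[OF j]]) (auto intro!: rhs_bound)
      also have "\<dots> \<le> (real (card J) * K * (c * (1 / 2) ^ n)) * (b - a)"
        using t c K by (intro mult_left_mono) auto
      also have "\<dots> = (real (card J) * K * (b - a)) * (c * (1 / 2) ^ n)" by simp
      also have "\<dots> \<le> (1 / 2) * (c * (1 / 2) ^ n)"
        using c by (intro mult_right_mono K(2)) auto
      finally show ?thesis by (simp add: uS)
    qed
    ultimately show ?case by blast
  qed
  have summ: "summable (\<lambda>n. u n j t)" if "j \<in> J" "t \<in> {a..b}" for j t
    by (rule summable_comparison_test'[of "\<lambda>n. c * (1 / 2) ^ n" 0])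
      (use u that in \<open>auto intro!: summable_mult summable_geometric\<close>)
  \<comment> \<open>The index shifts by one: increment \<open>Suc n\<close> has the right-hand side
    at increment \<open>n\<close> as derivative, and increment 0 is constant.\<close>
  define u' where "u' n j t = (case n of 0 \<Rightarrow> 0 | Suc n \<Rightarrow> rhs (u n) j t)" for n j t
  have du: "(u n j has_real_derivative u' n j t) (at t within {a..b})" if "j \<in> J" "t \<in> {a..b}" for n j t
  proof (cases n)
    case 0
    then show ?thesis by (simp add: u0[abs_def] u'_def)
  next
    case (Suc k)
    have "continuous_on {a..b} (rhs (u k) j)" using u that by (intro rhs_cont) auto
    from integral_has_vector_derivative[OF this that(2)] show ?thesis
      by (simp add: Suc u'_def uS[abs_def] has_real_derivative_iff_has_vector_derivative)
  qed
  define x where "x j t = (\<Sum>n. u n j t)" for j t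
  have "(x j has_real_derivative rhs x j t) (at t within {a..b})" if j: "j \<in> J" and t: "t \<in> {a..b}" for j t
  proof -
    define Mn where "Mn n = (case n of 0 \<Rightarrow> 0 | Suc n \<Rightarrow> real (card J) * K * (c * (1 / 2) ^ n))" for n
    have "summable (\<lambda>n. real (card J) * K * (c * (1 / 2 :: real) ^ n))"
      by (intro summable_mult summable_geometric) auto
    then have Msum: "summable Mn"
      by (subst summable_Suc_iff[symmetric]) (simp add: Mn_def)
    have u'_bound: "norm (u' n j s) \<le> Mn n" if "s \<in> {a..b}" for n s
      using rhs_bound[of "u (n - 1)" s _ j] u[of "n - 1"] that j by (cases n) (auto simp: u'_def Mn_def)
    have ul: "uniform_limit {a..b} (\<lambda>n s. \<Sum>i<n. u' i j s) (\<lambda>s. suminf (\<lambda>i. u' i j s)) sequentially"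
      by (rule Weierstrass_m_test[OF u'_bound Msum])
    have "\<exists>g. \<forall>s\<in>{a..b}. (\<lambda>n. u n j s) sums g s \<and> (g has_real_derivative (\<Sum>i. u' i j s)) (at s within {a..b})"
      by (rule has_field_derivative_series[OF convex_real_interval(5) du[OF j] ul, of a]) (use ab summ j in auto)
    then obtain g where g: "\<And>s. s \<in> {a..b} \<Longrightarrow> (\<lambda>n. u n j s) sums g s \<and>
        (g has_real_derivative (\<Sum>i. u' i j s)) (at s within {a..b})" by blast
    have gx: "g s = x j s" if "s \<in> {a..b}" for s
      using g[OF that] by (simp add: x_def sums_iff)
    have "(\<Sum>i. u' i j t) = (\<Sum>n. \<Sum>k\<in>J. B j k t * u n k t)"
    proof -
      have "summable (\<lambda>i. u' i j t)" by (rule summable_comparison_test'[OF Msum]) (use u'_bound[OF t] in auto)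
      moreover have "u' (Suc n) j t = (\<Sum>k\<in>J. B j k t * u n k t)" "u' 0 j t = 0" for n
        by (simp_all add: u'_def rhs_def)
      ultimately show ?thesis using suminf_split_head[of "\<lambda>i. u' i j t"] by simp
    qed
    also have "\<dots> = (\<Sum>k\<in>J. \<Sum>n. B j k t * u n k t)"
      by (rule suminf_sum) (use summ t in \<open>auto intro: summable_mult\<close>)
    also have "\<dots> = rhs x j t"
      unfolding rhs_def x_def using summ t by (intro sum.cong refl suminf_mult) auto
    finally have "(g has_real_derivative rhs x j t) (at t within {a..b})" using g[OF t] by simp
    then show ?thesis
      by (rule has_field_derivative_transform_within[where d = 1]) (use gx t in auto)
  qed
  moreover have "x j a = x0 j" if "j \<in> J" for j
  proof -
    have "(\<lambda>n. u n j a) = (\<lambda>n. if n = 0 then x0 j else 0)"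
    proof
      show "u n j a = (if n = 0 then x0 j else 0)" for n by (cases n) (auto simp: u0 uS)
    qed
    then show ?thesis using sums_unique[OF sums_If_finite[of "\<lambda>n. n = 0" "\<lambda>n. x0 j"]] by (simp add: x_def)
  qed
  ultimately show ?thesis using that[of x] by (simp add: rhs_def)
qed

text \<open>For the difference of two solutions, which vanishes at \<open>a\<close>, the mean value
  inequality halves any bound; iterating leaves only 0.\<close>

lemma linear_ode_unique:
  fixes B :: "'j \<Rightarrow> 'j \<Rightarrow> real \<Rightarrow> real"
  assumes J: "finite J" and K: "K \<ge> 0" "real (card J) * K * (b - a) \<le> 1 / 2"
    and B: "\<And>j k t. j \<in> J \<Longrightarrow> k \<in> J \<Longrightarrow> t \<in> {a..b} \<Longrightarrow> \<bar>B j k t\<bar> \<le> K"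
    and x: "\<And>j t. j \<in> J \<Longrightarrow> t \<in> {a..b} \<Longrightarrow> (x j has_real_derivative (\<Sum>k\<in>J. B j k t * x k t)) (at t within {a..b})"
    and y: "\<And>j t. j \<in> J \<Longrightarrow> t \<in> {a..b} \<Longrightarrow> (y j has_real_derivative (\<Sum>k\<in>J. B j k t * y k t)) (at t within {a..b})"
    and eq: "\<And>j. j \<in> J \<Longrightarrow> x j a = y j a" and jt: "j \<in> J" "t \<in> {a..b}"
  shows "x j t = y j t"
proof -
  define d where "d j t = x j t - y j t" for j t
  have d': "(d j has_real_derivative (\<Sum>k\<in>J. B j k t * d k t)) (at t within {a..b})" if "j \<in> J" "t \<in> {a..b}" for j t
    using DERIV_diff[OF x[OF that] y[OF that]]
    by (simp add: d_def[abs_def] right_diff_distrib sum_subtractf)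
  have "\<exists>h. \<forall>t\<in>{a..b}. \<bar>d j t\<bar> \<le> h" if "j \<in> J" for j
  proof -
    have "continuous_on {a..b} (d j)" using d'[OF that] by (rule DERIV_continuous_on)
    then have "bounded (d j ` {a..b})" by (intro compact_imp_bounded compact_continuous_image) auto
    then show ?thesis by (auto simp: bounded_iff)
  qed
  then obtain h where h: "\<And>j t. j \<in> J \<Longrightarrow> t \<in> {a..b} \<Longrightarrow> \<bar>d j t\<bar> \<le> h j" by metis
  define H where "H = (\<Sum>j\<in>J. \<bar>h j\<bar>)"
  have ab: "a \<in> {a..b}" using jt by auto
  have "\<forall>j\<in>J. \<forall>t\<in>{a..b}. \<bar>d j t\<bar> \<le> H * (1 / 2) ^ n" for n
  proof (induction n)
    case 0
    have "\<bar>d j t\<bar> \<le> H" if "j \<in> J" "t \<in> {a..b}" for j t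
    proof -
      have "\<bar>d j t\<bar> \<le> \<bar>h j\<bar>" using h[OF that] by linarith
      also have "\<dots> \<le> H" unfolding H_def using J that by (intro member_le_sum) auto
      finally show ?thesis .
    qed
    then show ?case by simp
  next
    case (Suc n)
    have Hn: "H * (1 / 2) ^ n \<ge> 0" by (simp add: H_def sum_nonneg)
    have "\<bar>d j t\<bar> \<le> H * (1 / 2) ^ Suc n" if j: "j \<in> J" and t: "t \<in> {a..b}" for j t
    proof -
      have "norm (d j t - d j a) \<le> (real (card J) * K * (H * (1 / 2) ^ n)) * norm (t - a)"
      proof (rule field_differentiable_bound[OF _ d'[OF j] _ t ab])
        fix s assume s: "s \<in> {a..b}"
        have "\<bar>\<Sum>k\<in>J. B j k s * d k s\<bar> \<le> (\<Sum>k\<in>J. \<bar>B j k s * d k s\<bar>)" by (rule sum_abs)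
        also have "\<dots> \<le> (\<Sum>k\<in>J. K * (H * (1 / 2) ^ n))"
          unfolding abs_mult using Suc.IH B j s K(1) by (intro sum_mono mult_mono) auto
        finally show "norm (\<Sum>k\<in>J. B j k s * d k s) \<le> real (card J) * K * (H * (1 / 2) ^ n)"
          by (simp add: ac_simps)
      qed auto
      also have "\<dots> \<le> (real (card J) * K * (H * (1 / 2) ^ n)) * (b - a)"
        using t K(1) Hn by (intro mult_left_mono) auto
      also have "\<dots> = (real (card J) * K * (b - a)) * (H * (1 / 2) ^ n)" by simp
      also have "\<dots> \<le> (1 / 2) * (H * (1 / 2) ^ n)"
        using Hn by (intro mult_right_mono K(2)) auto
      finally show ?thesis using eq[OF j] by (simp add: d_def)
    qed
    then show ?case by blast
  qed
  then have "\<forall>n. \<bar>d j t\<bar> \<le> H * (1 / 2) ^ n" using jt by blast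
  moreover have "(\<lambda>n. H * (1 / 2 :: real) ^ n) \<longlonglongrightarrow> H * 0"
    by (intro tendsto_mult tendsto_const LIMSEQ_power_zero) auto
  ultimately have "\<bar>d j t\<bar> \<le> 0" by (intro LIMSEQ_le_const) auto
  then show ?thesis by (simp add: d_def)
qed

text \<open>Outside one of the halves the filter within that half is trivial, so each premise is
  conditional and covers just the times in its half.\<close>

lemma has_real_derivative_union:
  assumes "a \<le> b" "b \<le> c"
    and "t \<le> b \<Longrightarrow> (f has_real_derivative D) (at t within {a..b})"
    and "b \<le> t \<Longrightarrow> (f has_real_derivative D) (at t within {b..c})"
  shows "(f has_real_derivative D) (at t within {a..c})"
proof -
  have "(f has_real_derivative D) (at t within {a..b})"
  proof (cases "t \<le> b")
    case False
    then have "at t within {a..b} = bot" unfolding at_within_eq_bot_iff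
      using closure_minimal[of "{a..b} - {t}" "{a..b}"] by auto
    then show ?thesis by (simp add: has_field_derivative_iff)
  qed (rule assms(3))
  moreover have "(f has_real_derivative D) (at t within {b..c})"
  proof (cases "b \<le> t")
    case False
    then have "at t within {b..c} = bot" unfolding at_within_eq_bot_iff
      using closure_minimal[of "{b..c} - {t}" "{b..c}"] by auto
    then show ?thesis by (simp add: has_field_derivative_iff)
  qed (rule assms(4))
  moreover have "{a..c} = {a..b} \<union> {b..c}" using assms(1,2) by auto
  ultimately show ?thesis unfolding has_field_derivative_iff by (simp add: at_within_union filterlim_sup)
qed

section \<open>Parallel transport in the normal bundle\<close>

lemma lin_coset_eq_iff:
  assumes "subspace W"
  shows "lin_coset W v = lin_coset W v' \<longleftrightarrow> v - v' \<in> W"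
proof
  assume "lin_coset W v = lin_coset W v'"
  moreover have "v \<in> lin_coset W v" using subspace_0[OF assms] by (force simp: lin_coset_def)
  ultimately obtain w where "w \<in> W" "v = v' + w" by (auto simp: lin_coset_def)
  then show "v - v' \<in> W" by simp
next
  assume d: "v - v' \<in> W"
  have "v + w = v' + ((v - v') + w)" "v' + w = v + (w - (v - v'))" for w by simp_all
  then show "lin_coset W v = lin_coset W v'"
    unfolding lin_coset_def using subspace_add[OF assms d] subspace_diff[OF assms _ d] by (metis image_eqI subsetI subset_antisym image_subsetI)
qed

section \<open>The restricted cotangent algebroid of a Poisson submanifold\<close>

locale poisson_submfd = submfd M N \<iota> + M: bivector_mfd M \<pi> + N: bivector_mfd N \<pi>\<^sub>N
  for M :: "('m::{t2_space,second_countable_topology}) manifold" and \<pi> :: "'m bivector"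
    and N :: "('n::{t2_space,second_countable_topology}) manifold" and \<pi>\<^sub>N :: "'n bivector"
    and \<iota> :: "'n \<Rightarrow> 'm" +
  assumes poisson_map: "\<And>f g q. f \<in> M.C \<Longrightarrow> g \<in> M.C \<Longrightarrow>
    N.pb (\<lambda>r. f (\<iota> r)) (\<lambda>r. g (\<iota> r)) q = M.pb f g (\<iota> q)"
begin

abbreviation "TI \<equiv> tangent_image N M \<iota>"
abbreviation "nu \<equiv> normal_space N M \<iota>"
abbreviation "rsec \<equiv> restricted_section N M \<iota>"
abbreviation "csec \<equiv> conormal_section N M \<iota>"
abbreviation "rbr \<equiv> restricted_bracket M \<pi> \<iota>"
abbreviation "np \<equiv> normal_pairing"

lemma push_ham:
  assumes f: "f \<in> M.C"
  shows "push (N.ham (\<lambda>r. f (\<iota> r)) q) = M.ham f (\<iota> q)"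
proof
  fix g
  show "push (N.ham (\<lambda>r. f (\<iota> r)) q) g = M.ham f (\<iota> q) g"
  proof (cases "g \<in> M.C")
    case True
    then show ?thesis
      using poisson_map[OF f True] by (simp add: push_apply N.ham_apply[OF pullback_smooth] M.ham_apply)
  next
    case False
    then show ?thesis by (simp add: pushforward_def hamiltonian_def sharp_def)
  qed
qed

lemma push_TI: "w \<in> N.T q \<Longrightarrow> push w \<in> TI q"
  by (simp add: tangent_image_def)

lemma TI_subset: "TI q \<subseteq> M.T (\<iota> q)"
  by (auto simp: tangent_image_def push_tangent)

lemma TI_subspace: "subspace (TI q)"
  unfolding subspace_def tangent_image_def
  using push_zero N.tangent_zero[of q] N.tangent_plus[of _ q] N.tangent_scale[of _ q] push_add push_scale
  by (auto simp: image_iff) metis+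

text \<open>Constant coefficients in a frame. Covectors thus become differentials of functions on
  \<open>M\<close>, to which the Poisson map condition applies.\<close>

lemma covec_differential:
  assumes "\<alpha> \<in> M.dualT p"
  obtains F where "F \<in> M.C" "M.dif F p = \<alpha>"
proof -
  obtain V y E where fr: "p \<in> V" "M.frame V y E" by (rule M.frame_exists) (rule that; assumption)
  note f = M.frameD[OF fr(2)]
  let ?F = "\<lambda>q. \<Sum>i<M.m. \<alpha> (E i p) * y i q"
  have c: "(\<lambda>q. \<alpha> (E i p) * y i q) \<in> M.C" if "i < M.m" for i
    by (rule M.smooth_funs_mult[OF M.smooth_funs_const f(2)[OF that]])
  have F: "?F \<in> M.C" by (rule M.smooth_funs_sum) (use c in auto)
  moreover have "M.dif ?F p = \<alpha>"
  proof (rule M.cot_eqI[OF M.dif_cot assms])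
    fix v assume v: "v \<in> M.T p"
    have "v ?F = (\<Sum>i<M.m. v (\<lambda>q. \<alpha> (E i p) * y i q))" by (rule M.tangent_sum[OF v]) (use c in auto)
    also have "\<dots> = \<alpha> v"
      using M.tangent_cmult[OF v f(2)] M.covec_expand(1)[OF fr(2,1) assms v] by simp
    finally show "M.dif ?F p v = \<alpha> v" by (simp add: M.dif_apply[OF v])
  qed
  ultimately show ?thesis by (rule that)
qed

text \<open>At points of \<open>N\<close> a hamiltonian vector of \<open>M\<close> is the image of
  the hamiltonian vector of the restricted function, so the anchor takes values in the tangent space
  of \<open>N\<close>.\<close>

lemma sharp_tangential:
  assumes "\<alpha> \<in> M.dualT (\<iota> q)"
  obtains w where "w \<in> N.T q" "sharp M \<pi> (\<iota> q) \<alpha> = push w"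
proof -
  obtain F where F: "F \<in> M.C" "M.dif F (\<iota> q) = \<alpha>" by (rule covec_differential[OF assms]) (rule that; assumption)
  have "sharp M \<pi> (\<iota> q) \<alpha> = M.ham F (\<iota> q)" by (simp add: hamiltonian_def F(2))
  also have "\<dots> = push (N.ham (\<lambda>r. F (\<iota> r)) q)" by (rule push_ham[OF F(1), symmetric])
  finally show ?thesis
    using that N.vf_tangent[OF N.vf_ham[OF pullback_smooth[OF F(1)]]] by blast
qed

lemma push_inj: "u \<in> N.T q \<Longrightarrow> w \<in> N.T q \<Longrightarrow> push u = push w \<Longrightarrow> u = w"
  using sub unfolding submanifold_def by (meson inj_onD)

text \<open>Antisymmetry of the bracket on \<open>N\<close>, for a function \<open>f\<close> that
  lives on \<open>N\<close> only. It makes hamiltonian fields integrate to differences of end values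
  along cotangent paths.\<close>

lemma covec_push_ham:
  assumes \<alpha>: "\<alpha> \<in> M.dualT (\<iota> q)" and w: "w \<in> N.T q" "sharp M \<pi> (\<iota> q) \<alpha> = push w" and f: "f \<in> N.C"
  shows "\<alpha> (push (N.ham f q)) = - w f"
proof -
  obtain F where F: "F \<in> M.C" "M.dif F (\<iota> q) = \<alpha>" by (rule covec_differential[OF \<alpha>]) (rule that; assumption)
  let ?F = "\<lambda>r. F (\<iota> r)"
  have FN: "?F \<in> N.C" by (rule pullback_smooth[OF F(1)])
  have hf: "N.ham f q \<in> N.T q" "N.ham ?F q \<in> N.T q" by (intro N.vf_tangent N.vf_ham f FN)+
  have "push (N.ham ?F q) = push w" using push_ham[OF F(1)] w(2) F(2) by (simp add: hamiltonian_def)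
  then have w': "N.ham ?F q = w" by (rule push_inj[OF hf(2) w(1)])
  have "\<alpha> (push (N.ham f q)) = push (N.ham f q) F"
    using M.dif_apply[OF push_tangent[OF hf(1)], of F] F(2) by simp
  also have "\<dots> = N.pb f ?F q" using F(1) FN by (simp add: push_apply N.ham_apply)
  also have "\<dots> = - N.ham ?F q f" using N.pb_anti[of f ?F q] f by (simp add: N.ham_apply)
  finally show ?thesis by (simp add: w')
qed

text \<open>A conormal covector pairs to 0 with the hamiltonian fields of \<open>N\<close>, which
  are tangent; by antisymmetry its image kills every function on \<open>N\<close>.\<close>

lemma sharp_conormal:
  assumes \<beta>: "\<beta> \<in> M.dualT (\<iota> q)" "\<And>v. v \<in> TI q \<Longrightarrow> \<beta> v = 0"
  shows "sharp M \<pi> (\<iota> q) \<beta> = 0"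
proof -
  obtain w where w: "w \<in> N.T q" "sharp M \<pi> (\<iota> q) \<beta> = push w" by (rule sharp_tangential[OF \<beta>(1)]) (rule that; assumption)
  have "w f = 0" for f
  proof (cases "f \<in> N.C")
    case True
    have "N.ham f q \<in> N.T q" by (intro N.vf_tangent N.vf_ham True)
    then have "\<beta> (push (N.ham f q)) = 0" by (intro \<beta>(2) push_TI)
    then show ?thesis using covec_push_ham[OF \<beta>(1) w True] by simp
  qed (use N.tangent_off[OF w(1)] in auto)
  then have "w = 0" by (auto simp: fun_eq_iff zero_fun_apply)
  then show ?thesis using w(2) push_zero by simp
qed

lemma rsec_cot: "rsec \<alpha> \<Longrightarrow> \<alpha> q \<in> M.dualT (\<iota> q)"
  by (simp add: restricted_section_def)

lemma rsec_smooth: "rsec \<alpha> \<Longrightarrow> M.vf Y \<Longrightarrow> (\<lambda>q. \<alpha> q (Y (\<iota> q))) \<in> N.C"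
  by (simp add: restricted_section_def)

text \<open>The components in an adapted frame are functions on \<open>N\<close>, and these extend
  to \<open>M\<close> near \<open>q\<close>.\<close>

lemma rsec_extend:
  assumes "rsec \<alpha>"
  obtains \<alpha>' B where "one_form M \<alpha>'" "open B" "q \<in> B" "\<And>r. r \<in> B \<Longrightarrow> \<alpha>' (\<iota> r) = \<alpha> r"
proof -
  obtain V y E W e where A: "q \<in> W" "adapted V y E W e"
    and ext: "\<And>f. f \<in> N.C \<Longrightarrow> \<exists>F\<in>M.C. \<exists>B. open B \<and> q \<in> B \<and> (\<forall>r\<in>B. F (\<iota> r) = f r)"
    by (rule adapted_exists) (rule that; assumption)
  note a = adaptedD[OF A(2)]
  have "\<exists>F\<in>M.C. \<exists>B. open B \<and> q \<in> B \<and> (\<forall>r\<in>B. F (\<iota> r) = \<alpha> r (E i (\<iota> r)))" if "i < M.m" for i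
    by (rule ext[OF rsec_smooth[OF assms M.frameD(3)[OF a(1) that]]])
  then obtain F B where F: "\<And>i. i < M.m \<Longrightarrow> F i \<in> M.C" "\<And>i. i < M.m \<Longrightarrow> open (B i)" "\<And>i. i < M.m \<Longrightarrow> q \<in> B i"
    "\<And>i r. i < M.m \<Longrightarrow> r \<in> B i \<Longrightarrow> F i (\<iota> r) = \<alpha> r (E i (\<iota> r))"
    by metis
  let ?B = "W \<inter> (\<Inter>i\<in>{..<M.m}. B i)"
  show ?thesis
  proof (rule that[of "\<lambda>p. \<Sum>i<M.m. F i p *\<^sub>R M.dif (y i) p" ?B])
    show "one_form M (\<lambda>p. \<Sum>i<M.m. F i p *\<^sub>R M.dif (y i) p)"
      by (rule M.one_form_sum) (use F(1) M.one_form_dif[OF M.frameD(2)[OF a(1)]] in auto)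
    show "open ?B" by (intro open_Int open_INT N.frameD(1)[OF a(2)]) (use F(2) in auto)
    show "q \<in> ?B" using A(1) F(3) by auto
    fix r assume r: "r \<in> ?B"
    have "\<alpha> r = (\<Sum>i<M.m. \<alpha> r (E i (\<iota> r)) *\<^sub>R M.dif (y i) (\<iota> r))"
      using r by (intro M.covec_expand(2)[OF a(1) a(3) rsec_cot[OF assms]]) auto
    also have "\<dots> = (\<Sum>i<M.m. F i (\<iota> r) *\<^sub>R M.dif (y i) (\<iota> r))"
      using r F(4) by (intro sum.cong refl) auto
    finally show "(\<Sum>i<M.m. F i (\<iota> r) *\<^sub>R M.dif (y i) (\<iota> r)) = \<alpha> r" by simp
  qed
qed

text \<open>The extensions are differentiated only along \<open>w\<close> and \<open>w'\<close>,
  that is along \<open>N\<close>, so the result depends only on the given sections near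
  \<open>q\<close>. This gives the definite description in \<open>restricted_bracket\<close> its
  value.\<close>

lemma rbr_frame:
  assumes \<alpha>: "rsec \<alpha>" and \<beta>: "rsec \<beta>" and fr: "M.frame V y E" "\<iota> q \<in> V"
    and w: "w \<in> N.T q" "sharp M \<pi> (\<iota> q) (\<alpha> q) = push w"
    and w': "w' \<in> N.T q" "sharp M \<pi> (\<iota> q) (\<beta> q) = push w'" and v: "v \<in> M.T (\<iota> q)"
  shows "rbr \<alpha> \<beta> q v =
    (\<Sum>j<M.m. w (\<lambda>r. \<beta> r (E j (\<iota> r))) * v (y j)) -
    (\<Sum>i<M.m. w' (\<lambda>r. \<alpha> r (E i (\<iota> r))) * v (y i)) +
    (\<Sum>i<M.m. \<Sum>j<M.m. \<alpha> q (E i (\<iota> q)) * \<beta> q (E j (\<iota> q)) * v (M.pb (y i) (y j)))"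
proof -
  define R where "R v = (\<Sum>j<M.m. w (\<lambda>r. \<beta> r (E j (\<iota> r))) * v (y j)) -
    (\<Sum>i<M.m. w' (\<lambda>r. \<alpha> r (E i (\<iota> r))) * v (y i)) +
    (\<Sum>i<M.m. \<Sum>j<M.m. \<alpha> q (E i (\<iota> q)) * \<beta> q (E j (\<iota> q)) * v (M.pb (y i) (y j)))" for v :: "'m tvec"
  note f = M.frameD[OF fr(1)]
  have loc: "push u (\<lambda>p. \<eta>' p (E j p)) = u (\<lambda>r. \<eta> r (E j (\<iota> r)))"
    if "one_form M \<eta>'" "rsec \<eta>" "open X" "q \<in> X" "\<And>r. r \<in> X \<Longrightarrow> \<eta>' (\<iota> r) = \<eta> r" "u \<in> N.T q" "j < M.m"
    for \<eta>' \<eta> X u j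
  proof -
    have c: "(\<lambda>p. \<eta>' p (E j p)) \<in> M.C" by (rule M.one_form_smooth[OF that(1) f(3)[OF that(7)]])
    have "push u (\<lambda>p. \<eta>' p (E j p)) = u (\<lambda>r. \<eta>' (\<iota> r) (E j (\<iota> r)))" by (rule push_apply[OF c])
    also have "\<dots> = u (\<lambda>r. \<eta> r (E j (\<iota> r)))"
      by (rule N.tangent_local[OF that(6) pullback_smooth[OF c] rsec_smooth[OF that(2) f(3)[OF that(7)]] that(3,4)])
        (simp add: that(5))
    finally show ?thesis .
  qed
  have eval: "cotangent_bracket M \<pi> \<alpha>' \<beta>' (\<iota> q) = (\<lambda>v. if v \<in> M.T (\<iota> q) then R v else 0)"
    if "one_form M \<alpha>'" "one_form M \<beta>'" "open X" "q \<in> X" "\<forall>r\<in>X. \<alpha>' (\<iota> r) = \<alpha> r \<and> \<beta>' (\<iota> r) = \<beta> r" for \<alpha>' \<beta>' X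
  proof
    fix v
    have eq: "\<alpha>' (\<iota> q) = \<alpha> q" "\<beta>' (\<iota> q) = \<beta> q" using that(4,5) by auto
    have "cotangent_bracket M \<pi> \<alpha>' \<beta>' (\<iota> q) v = R v" if v: "v \<in> M.T (\<iota> q)"
      unfolding M.cotangent_bracket_frame[OF fr \<open>one_form M \<alpha>'\<close> \<open>one_form M \<beta>'\<close> v] eq w(2) w'(2) R_def
      using loc[OF \<open>one_form M \<beta>'\<close> \<beta> \<open>open X\<close> \<open>q \<in> X\<close> _ w(1)] loc[OF \<open>one_form M \<alpha>'\<close> \<alpha> \<open>open X\<close> \<open>q \<in> X\<close> _ w'(1)]
        \<open>\<forall>r\<in>X. \<alpha>' (\<iota> r) = \<alpha> r \<and> \<beta>' (\<iota> r) = \<beta> r\<close>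
      by simp
    then show "cotangent_bracket M \<pi> \<alpha>' \<beta>' (\<iota> q) v = (if v \<in> M.T (\<iota> q) then R v else 0)"
      using M.cotangent_bracket_off by simp
  qed
  obtain \<alpha>' A where A: "one_form M \<alpha>'" "open A" "q \<in> A" "\<And>r. r \<in> A \<Longrightarrow> \<alpha>' (\<iota> r) = \<alpha> r"
    by (rule rsec_extend[OF \<alpha>]) (rule that; assumption)
  obtain \<beta>' B where B: "one_form M \<beta>'" "open B" "q \<in> B" "\<And>r. r \<in> B \<Longrightarrow> \<beta>' (\<iota> r) = \<beta> r"
    by (rule rsec_extend[OF \<beta>]) (rule that; assumption)
  have AB: "open (A \<inter> B)" "q \<in> A \<inter> B" "\<forall>r\<in>A \<inter> B. \<alpha>' (\<iota> r) = \<alpha> r \<and> \<beta>' (\<iota> r) = \<beta> r" using A B by auto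
  have "rbr \<alpha> \<beta> q = (\<lambda>v. if v \<in> M.T (\<iota> q) then R v else 0)"
    unfolding restricted_bracket_def
  proof (rule the_equality)
    show "\<exists>\<alpha>' \<beta>'. one_form M \<alpha>' \<and> one_form M \<beta>' \<and>
        (\<exists>V. open V \<and> q \<in> V \<and> (\<forall>r\<in>V. \<alpha>' (\<iota> r) = \<alpha> r \<and> \<beta>' (\<iota> r) = \<beta> r)) \<and>
        (\<lambda>v. if v \<in> M.T (\<iota> q) then R v else 0) = cotangent_bracket M \<pi> \<alpha>' \<beta>' (\<iota> q)"
      using A(1) B(1) AB eval[OF A(1) B(1) AB] by (intro exI[of _ \<alpha>'] exI[of _ \<beta>'] conjI exI[of _ "A \<inter> B"]) simp_all
  next
    fix \<eta>
    assume "\<exists>\<alpha>' \<beta>'. one_form M \<alpha>' \<and> one_form M \<beta>' \<and>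
        (\<exists>V. open V \<and> q \<in> V \<and> (\<forall>r\<in>V. \<alpha>' (\<iota> r) = \<alpha> r \<and> \<beta>' (\<iota> r) = \<beta> r)) \<and>
        \<eta> = cotangent_bracket M \<pi> \<alpha>' \<beta>' (\<iota> q)"
    then show "\<eta> = (\<lambda>v. if v \<in> M.T (\<iota> q) then R v else 0)" using eval by blast
  qed
  then show ?thesis using v by (simp add: R_def)
qed

section \<open>The normal connection in an adapted frame\<close>

abbreviation "normal_indices \<equiv> {N.m..<M.m}"

lemma frame_sum_split:
  assumes "adapted V y E W e"
  shows "(\<Sum>i<M.m. h i) = (\<Sum>i<N.m. h i) + (\<Sum>i\<in>normal_indices. h i :: real)"
  using sum.atLeastLessThan_concat[of 0 N.m M.m h] adaptedD(4)[OF assms] by (simp add: lessThan_atLeast0)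

lemma csecD:
  assumes "csec \<beta>"
  shows "rsec \<beta>" "v \<in> TI q \<Longrightarrow> \<beta> q v = 0"
  using assms by (auto simp: conormal_section_def)

lemma adapted_E_TI:
  assumes "adapted V y E W e" "r \<in> W" "j < N.m"
  shows "E j (\<iota> r) \<in> TI r"
  using push_TI[OF N.vf_tangent[OF N.frameD(3)[OF adaptedD(2)[OF assms(1)] assms(3)]], of r]
    adapted_push_frame[OF assms] by simp

lemma push_pb_normal:
  assumes A: "adapted V y E W e" and q: "q \<in> W" and u: "u \<in> N.T q" and ij: "i < M.m" "j \<in> normal_indices"
  shows "push u (M.pb (y i) (y j)) = 0"
proof -
  note a = adaptedD[OF A]
  have y: "y i \<in> M.C" "y j \<in> M.C" using M.frameD(2)[OF a(1)] ij by auto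
  have c: "M.pb (y i) (y j) \<in> M.C" by (rule M.pb_smooth[OF y])
  have z: "M.pb (y i) (y j) (\<iota> r) = 0" if r: "r \<in> W" for r
  proof -
    have h: "N.ham (\<lambda>r. y i (\<iota> r)) r \<in> N.T r" by (intro N.vf_tangent N.vf_ham pullback_smooth y)
    have "N.ham (\<lambda>r. y i (\<iota> r)) r (\<lambda>r. y j (\<iota> r)) = N.ham (\<lambda>r. y i (\<iota> r)) r (\<lambda>r. 0)"
      by (rule N.tangent_local[OF h pullback_smooth[OF y(2)] N.smooth_funs_const N.frameD(1)[OF a(2)] r])
        (use a(5) ij in auto)
    then show ?thesis
      using poisson_map[OF y, of r] N.tangent_const[OF h] by (simp add: N.ham_apply[OF pullback_smooth[OF y(2)]])
  qed
  have "u (\<lambda>r. M.pb (y i) (y j) (\<iota> r)) = u (\<lambda>r. 0)"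
    by (rule N.tangent_local[OF u pullback_smooth[OF c] N.smooth_funs_const N.frameD(1)[OF a(2)] q]) (use z in auto)
  then show ?thesis using N.tangent_const[OF u] by (simp add: push_apply[OF c])
qed

text \<open>The tangential components of a conormal section vanish on \<open>W\<close>, hence so do
  their derivatives along \<open>w\<close>; the term with the image of \<beta> drops out by
  \<open>sharp_conormal\<close>.\<close>

lemma rbr_conormal:
  assumes \<alpha>: "rsec \<alpha>" and \<beta>: "csec \<beta>" and A: "adapted V y E W e" and q: "q \<in> W"
    and w: "w \<in> N.T q" "sharp M \<pi> (\<iota> q) (\<alpha> q) = push w" and v: "v \<in> M.T (\<iota> q)"
  shows "rbr \<alpha> \<beta> q v = (\<Sum>j\<in>normal_indices. w (\<lambda>r. \<beta> r (E j (\<iota> r))) * v (y j) +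
    \<beta> q (E j (\<iota> q)) * (\<Sum>k\<in>normal_indices. (\<Sum>i<M.m. \<alpha> q (E i (\<iota> q)) * E k (\<iota> q) (M.pb (y i) (y j))) * v (y k)))"
proof -
  note a = adaptedD[OF A]
  note f = M.frameD[OF a(1)]
  have z: "N.T q \<noteq> {}" "0 \<in> N.T q" using N.tangent_zero by auto
  have s0: "sharp M \<pi> (\<iota> q) (\<beta> q) = push 0"
    using sharp_conormal[OF rsec_cot[OF csecD(1)[OF \<beta>]] csecD(2)[OF \<beta>]] push_zero by simp
  have b0: "\<beta> r (E j (\<iota> r)) = 0" if "r \<in> W" "j < N.m" for r j
    by (rule csecD(2)[OF \<beta> adapted_E_TI[OF A that]])
  have wb: "w (\<lambda>r. \<beta> r (E j (\<iota> r))) = 0" if j: "j < N.m" for j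
  proof -
    have jm: "j < M.m" using j a(4) by simp
    have "w (\<lambda>r. \<beta> r (E j (\<iota> r))) = w (\<lambda>r. 0)"
      by (rule N.tangent_local[OF w(1) rsec_smooth[OF csecD(1)[OF \<beta>] f(3)[OF jm]] N.smooth_funs_const N.frameD(1)[OF a(2)] q])
        (use b0 j in auto)
    then show ?thesis using N.tangent_const[OF w(1)] by simp
  qed
  have vp: "v (M.pb (y i) (y j)) = (\<Sum>k\<in>normal_indices. E k (\<iota> q) (M.pb (y i) (y j)) * v (y k))"
    if ij: "i < M.m" "j \<in> normal_indices" for i j
  proof -
    have "E k (\<iota> q) (M.pb (y i) (y j)) = 0" if k: "k < N.m" for k
      using push_pb_normal[OF A q N.vf_tangent[OF N.frameD(3)[OF a(2) k]] ij] adapted_push_frame[OF A q k] by simp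
    then show ?thesis
      using f(5)[OF a(3)[OF q] v, of "M.pb (y i) (y j)"] by (simp add: frame_sum_split[OF A] mult.commute)
  qed
  \<comment> \<open>The middle sum is that of \<open>rbr_frame\<close> with the zero vector for
    \<open>w'\<close>; the \<open>0\<close> in it is applied as a function.\<close>
  have "rbr \<alpha> \<beta> q v =
    (\<Sum>j<M.m. w (\<lambda>r. \<beta> r (E j (\<iota> r))) * v (y j)) -
    (\<Sum>i<M.m. 0 (\<lambda>r. \<alpha> r (E i (\<iota> r))) * v (y i)) +
    (\<Sum>i<M.m. \<Sum>j<M.m. \<alpha> q (E i (\<iota> q)) * \<beta> q (E j (\<iota> q)) * v (M.pb (y i) (y j)))"
    by (rule rbr_frame[OF \<alpha> csecD(1)[OF \<beta>] a(1) a(3)[OF q] w z(2) s0 v])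
  also have "(\<Sum>i<M.m. 0 (\<lambda>r. \<alpha> r (E i (\<iota> r))) * v (y i)) = 0" by (simp add: zero_fun_apply)
  also have "(\<Sum>j<M.m. w (\<lambda>r. \<beta> r (E j (\<iota> r))) * v (y j)) =
      (\<Sum>j\<in>normal_indices. w (\<lambda>r. \<beta> r (E j (\<iota> r))) * v (y j))"
    by (simp add: frame_sum_split[OF A] wb)
  also have "(\<Sum>i<M.m. \<Sum>j<M.m. \<alpha> q (E i (\<iota> q)) * \<beta> q (E j (\<iota> q)) * v (M.pb (y i) (y j))) =
      (\<Sum>j<M.m. \<beta> q (E j (\<iota> q)) * (\<Sum>i<M.m. \<alpha> q (E i (\<iota> q)) * v (M.pb (y i) (y j))))"
    by (subst sum.swap) (simp add: sum_distrib_left ac_simps)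
  also have "\<dots> = (\<Sum>j\<in>normal_indices. \<beta> q (E j (\<iota> q)) * (\<Sum>i<M.m. \<alpha> q (E i (\<iota> q)) * v (M.pb (y i) (y j))))"
    by (simp add: frame_sum_split[OF A] b0[OF q])
  also have "\<dots> = (\<Sum>j\<in>normal_indices. \<beta> q (E j (\<iota> q)) *
      (\<Sum>k\<in>normal_indices. (\<Sum>i<M.m. \<alpha> q (E i (\<iota> q)) * E k (\<iota> q) (M.pb (y i) (y j))) * v (y k)))"
  proof (rule sum.cong[OF refl])
    fix j assume j: "j \<in> normal_indices"
    have "(\<Sum>i<M.m. \<alpha> q (E i (\<iota> q)) * v (M.pb (y i) (y j))) =
        (\<Sum>i<M.m. \<Sum>k\<in>normal_indices. \<alpha> q (E i (\<iota> q)) * E k (\<iota> q) (M.pb (y i) (y j)) * v (y k))"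
      by (intro sum.cong refl) (simp add: vp[OF _ j] sum_distrib_left mult.assoc)
    also have "\<dots> = (\<Sum>k\<in>normal_indices. (\<Sum>i<M.m. \<alpha> q (E i (\<iota> q)) * E k (\<iota> q) (M.pb (y i) (y j))) * v (y k))"
      by (subst sum.swap) (simp add: sum_distrib_right)
    finally show "\<beta> q (E j (\<iota> q)) * (\<Sum>i<M.m. \<alpha> q (E i (\<iota> q)) * v (M.pb (y i) (y j))) = \<beta> q (E j (\<iota> q)) *
      (\<Sum>k\<in>normal_indices. (\<Sum>i<M.m. \<alpha> q (E i (\<iota> q)) * E k (\<iota> q) (M.pb (y i) (y j))) * v (y k))" by simp
  qed
  finally show ?thesis by (simp add: sum.distrib)
qed

text \<open>Invariance under \<open>TI q\<close> is all that is asked, so the lemma also serves the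
  restricted bracket, whose formula shows the invariance directly.\<close>

lemma np_coset:
  assumes "\<And>u. u \<in> TI q \<Longrightarrow> \<eta> (v + u) = \<eta> v"
  shows "np \<eta> (lin_coset (TI q) v) = \<eta> v"
proof -
  have "\<eta> ` lin_coset (TI q) v = {\<eta> v}"
    unfolding lin_coset_def image_image using assms subspace_0[OF TI_subspace] by fastforce
  then show ?thesis by (simp add: normal_pairing_def)
qed

lemma np_covec:
  assumes "\<eta> \<in> M.dualT (\<iota> q)" "\<And>u. u \<in> TI q \<Longrightarrow> \<eta> u = 0" "v \<in> M.T (\<iota> q)"
  shows "np \<eta> (lin_coset (TI q) v) = \<eta> v"
  by (rule np_coset) (simp add: assms(2) M.covec_add[OF assms(1,3) subsetD[OF TI_subset]])

lemma nuE:
  assumes "c \<in> nu q"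
  obtains v where "v \<in> M.T (\<iota> q)" "c = lin_coset (TI q) v"
  using assms by (auto simp: normal_space_def)

text \<open>Linear coordinates on the normal space: for normal \<open>j\<close> the differential of
  \<open>y j\<close> annihilates the tangent space of \<open>N\<close>.\<close>

definition ncoord :: "(nat \<Rightarrow> 'm \<Rightarrow> real) \<Rightarrow> 'n \<Rightarrow> 'm tvec set \<Rightarrow> nat \<Rightarrow> real"
  where "ncoord y q c j = np (M.dif (y j) (\<iota> q)) c"

lemma ncoord_coset:
  assumes A: "adapted V y E W e" and q: "q \<in> W" and v: "v \<in> M.T (\<iota> q)" and j: "j \<in> normal_indices"
  shows "ncoord y q (lin_coset (TI q) v) j = v (y j)"
proof -
  have "M.dif (y j) (\<iota> q) u = 0" if u: "u \<in> TI q" for u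
    using tangent_image_iff[OF A q] u TI_subset j M.dif_apply by fastforce
  then show ?thesis
    unfolding ncoord_def using np_covec[OF M.dif_cot _ v] M.dif_apply[OF v] by simp
qed

lemma nu_eqI:
  assumes A: "adapted V y E W e" and q: "q \<in> W" and c: "c \<in> nu q" "c' \<in> nu q"
    and eq: "\<And>j. j \<in> normal_indices \<Longrightarrow> ncoord y q c j = ncoord y q c' j"
  shows "c = c'"
proof -
  obtain v v' where v: "v \<in> M.T (\<iota> q)" "c = lin_coset (TI q) v" and v': "v' \<in> M.T (\<iota> q)" "c' = lin_coset (TI q) v'"
    using c by (metis nuE)
  have "(v - v') (y j) = 0" if j: "j \<in> normal_indices" for j
    using eq[OF j] ncoord_coset[OF A q _ j] v v' by simp
  then have "v - v' \<in> TI q"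
    using tangent_image_iff[OF A q M.tangent_sub[OF v(1) v'(1)]] by simp
  then show ?thesis using v(2) v'(2) lin_coset_eq_iff[OF TI_subspace] by blast
qed

lemma nu_build:
  fixes S :: "nat \<Rightarrow> real"
  assumes A: "adapted V y E W e" and q: "q \<in> W"
  defines "c \<equiv> lin_coset (TI q) (\<Sum>j\<in>normal_indices. S j *\<^sub>R E j (\<iota> q))"
  shows "c \<in> nu q" "\<And>j. j \<in> normal_indices \<Longrightarrow> ncoord y q c j = S j"
proof -
  note a = adaptedD[OF A]
  note f = M.frameD[OF a(1)]
  have v: "(\<Sum>j\<in>normal_indices. S j *\<^sub>R E j (\<iota> q)) \<in> M.T (\<iota> q)"
    by (intro M.tangent_lincomb M.tangent_scale M.vf_tangent f(3)) auto
  then show "c \<in> nu q" by (auto simp: c_def normal_space_def)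
  fix j assume j: "j \<in> normal_indices"
  have "ncoord y q c j = (\<Sum>k\<in>normal_indices. S k * E k (\<iota> q) (y j))"
    unfolding c_def ncoord_coset[OF A q v j] tvec_sum_apply ..
  also have "\<dots> = (\<Sum>k\<in>normal_indices. if k = j then S j else 0)"
    using f(4)[OF a(3)[OF q]] j by (intro sum.cong refl) auto
  finally show "ncoord y q c j = S j" using j by simp
qed

lemma np_conormal:
  assumes A: "adapted V y E W e" and q: "q \<in> W" and c: "c \<in> nu q" and \<beta>: "csec \<beta>"
  shows "np (\<beta> q) c = (\<Sum>j\<in>normal_indices. \<beta> q (E j (\<iota> q)) * ncoord y q c j)"
proof -
  note a = adaptedD[OF A]
  obtain v where v: "v \<in> M.T (\<iota> q)" "c = lin_coset (TI q) v" by (rule nuE[OF c]) (rule that; assumption)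
  have "np (\<beta> q) c = \<beta> q v"
    unfolding v(2) by (rule np_covec[OF rsec_cot[OF csecD(1)[OF \<beta>]] csecD(2)[OF \<beta>] v(1)])
  also have "\<dots> = (\<Sum>j<M.m. \<beta> q (E j (\<iota> q)) * v (y j))"
    by (rule M.covec_expand(1)[OF a(1) a(3)[OF q] rsec_cot[OF csecD(1)[OF \<beta>]] v(1)])
  also have "\<dots> = (\<Sum>j\<in>normal_indices. \<beta> q (E j (\<iota> q)) * v (y j))"
    using csecD(2)[OF \<beta> adapted_E_TI[OF A q]] by (simp add: frame_sum_split[OF A])
  finally show ?thesis using ncoord_coset[OF A q v(1)] v(2) by simp
qed

lemma np_rbr:
  assumes \<alpha>: "rsec \<alpha>" and \<beta>: "csec \<beta>" and A: "adapted V y E W e" and q: "q \<in> W"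
    and w: "w \<in> N.T q" "sharp M \<pi> (\<iota> q) (\<alpha> q) = push w" and c: "c \<in> nu q"
  shows "np (rbr \<alpha> \<beta> q) c = (\<Sum>j\<in>normal_indices. w (\<lambda>r. \<beta> r (E j (\<iota> r))) * ncoord y q c j +
    \<beta> q (E j (\<iota> q)) * (\<Sum>k\<in>normal_indices. (\<Sum>i<M.m. \<alpha> q (E i (\<iota> q)) * E k (\<iota> q) (M.pb (y i) (y j))) * ncoord y q c k))"
proof -
  obtain v where v: "v \<in> M.T (\<iota> q)" "c = lin_coset (TI q) v" by (rule nuE[OF c]) (rule that; assumption)
  have "np (rbr \<alpha> \<beta> q) c = rbr \<alpha> \<beta> q v"
    unfolding v(2)
  proof (rule np_coset)
    fix u assume u: "u \<in> TI q"
    have vu: "v + u \<in> M.T (\<iota> q)" using M.tangent_plus[OF v(1)] u TI_subset by blast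
    have "u (y j) = 0" if "j \<in> normal_indices" for j
      using tangent_image_iff[OF A q, of u] u TI_subset that by auto
    then have "(v + u) (y j) = v (y j)" if "j \<in> normal_indices" for j
      using that by (simp add: plus_fun_apply)
    then show "rbr \<alpha> \<beta> q (v + u) = rbr \<alpha> \<beta> q v"
      unfolding rbr_conormal[OF \<alpha> \<beta> A q w vu] rbr_conormal[OF \<alpha> \<beta> A q w v(1)] by simp
  qed
  then show ?thesis
    unfolding rbr_conormal[OF \<alpha> \<beta> A q w v(1)] using ncoord_coset[OF A q v(1)] v(2) by simp
qed

end

section \<open>Parallel normal fields along a cotangent path\<close>

locale cotangent_curve = poisson_submfd M \<pi> N \<pi>\<^sub>N \<iota>
  for M :: "('m::{t2_space,second_countable_topology}) manifold" and \<pi> :: "'m bivector"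
    and N :: "('n::{t2_space,second_countable_topology}) manifold" and \<pi>\<^sub>N :: "'n bivector"
    and \<iota> :: "'n \<Rightarrow> 'm" +
  fixes \<gamma> :: "real \<Rightarrow> 'n" and a :: "real \<Rightarrow> 'm covec"
  assumes path: "cotangent_path N M \<pi> \<iota> \<gamma> a"
begin

lemma path_continuous: "continuous_on {0..1} \<gamma>"
  using path by (simp add: cotangent_path_def)

lemma path_cot: "t \<in> {0..1} \<Longrightarrow> a t \<in> M.dualT (\<iota> (\<gamma> t))"
  using path by (simp add: cotangent_path_def)

lemma path_pairing: "M.vf Y \<Longrightarrow> continuous_on {0..1} (\<lambda>t. a t (Y (\<iota> (\<gamma> t))))"
  using path by (simp add: cotangent_path_def)

lemma path_velocity:
  assumes "t \<in> {0..1}"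
  obtains w where "w \<in> N.T (\<gamma> t)" "sharp M \<pi> (\<iota> (\<gamma> t)) (a t) = push w"
    "\<And>f. f \<in> N.C \<Longrightarrow> ((\<lambda>\<tau>. f (\<gamma> \<tau>)) has_real_derivative w f) (at t within {0..1})"
  using path assms unfolding cotangent_path_def has_velocity_def o_def by blast

text \<open>Parallelism over a subinterval, with derivatives taken within it, so that fields over
  adjacent intervals can be glued.\<close>

definition parallel_on :: "real \<Rightarrow> real \<Rightarrow> (real \<Rightarrow> 'm tvec set) \<Rightarrow> bool"
  where "parallel_on l u s \<longleftrightarrow> (\<forall>t\<in>{l..u}. s t \<in> nu (\<gamma> t) \<and>
    (\<forall>\<alpha> \<beta>. rsec \<alpha> \<and> \<alpha> (\<gamma> t) = a t \<and> csec \<beta> \<longrightarrow>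
      ((\<lambda>\<tau>. np (\<beta> (\<gamma> \<tau>)) (s \<tau>)) has_real_derivative np (rbr \<alpha> \<beta> (\<gamma> t)) (s t)) (at t within {l..u})))"

lemma TI_coset: "TI q = lin_coset (TI q) 0"
  by (simp add: lin_coset_def)

lemma parallel_along_iff: "parallel_along N M \<pi> \<iota> \<gamma> a s \<longleftrightarrow> parallel_on 0 1 s"
proof -
  have "TI q \<in> nu q" for q
    using TI_coset[of q] M.tangent_zero unfolding normal_space_def by blast
  moreover have "np (\<beta> q) (TI q) = 0" if "csec \<beta>" for \<beta> q
    using np_covec[OF rsec_cot[OF csecD(1)[OF that]] csecD(2)[OF that] M.tangent_zero, of q]
      M.covec_zero[OF rsec_cot[OF csecD(1)[OF that]]] TI_coset[of q] by simp
  ultimately show ?thesis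
    unfolding parallel_along_def has_normal_covderiv_def parallel_on_def
    by (intro ball_cong refl conj_cong) (simp_all cong: conj_cong)
qed

lemma eventually_in_nbhd:
  assumes "0 \<le> l" "u \<le> 1" "t \<in> {l..u}" "open W" "\<gamma> t \<in> W"
  shows "\<forall>\<^sub>F \<tau> in at t within {l..u}. \<gamma> \<tau> \<in> W"
proof -
  have "continuous_on {l..u} \<gamma>" by (rule continuous_on_subset[OF path_continuous]) (use assms in auto)
  then have "(\<gamma> \<longlongrightarrow> \<gamma> t) (at t within {l..u})" using assms(3) by (simp add: continuous_on_def)
  then show ?thesis using assms(4,5) by (rule topological_tendstoD)
qed

definition transport_mat :: "(nat \<Rightarrow> 'm \<Rightarrow> real) \<Rightarrow> (nat \<Rightarrow> 'm \<Rightarrow> 'm tvec) \<Rightarrow> nat \<Rightarrow> nat \<Rightarrow> real \<Rightarrow> real"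
  where "transport_mat y E j k t = (\<Sum>i<M.m. a t (E i (\<iota> (\<gamma> t))) * E k (\<iota> (\<gamma> t)) (M.pb (y i) (y j)))"

lemma path_smooth_continuous:
  assumes "f \<in> N.C"
  shows "continuous_on {0..1} (\<lambda>t. f (\<gamma> t))"
  by (rule continuous_on_compose2[OF N.smooth_funs_continuous[OF assms] path_continuous, of UNIV]) auto

lemma transport_mat_continuous:
  assumes "M.frame V y E" "j < M.m" "k < M.m"
  shows "continuous_on {0..1} (transport_mat y E j k)"
proof -
  note f = M.frameD[OF assms(1)]
  have "continuous_on {0..1} (\<lambda>t. E k (\<iota> (\<gamma> t)) (M.pb (y i) (y j)))" if "i < M.m" for i
    by (rule path_smooth_continuous[OF pullback_smooth[OF M.vf_smooth[OF f(3)[OF assms(3)] M.pb_smooth[OF f(2)[OF that] f(2)[OF assms(2)]]]]])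
  then show ?thesis
    unfolding transport_mat_def[abs_def]
    by (intro continuous_on_sum continuous_on_mult path_pairing f(3)) auto
qed

lemma rsec_sum:
  assumes "\<And>i. i \<in> I \<Longrightarrow> u i \<in> N.C" "\<And>i. i \<in> I \<Longrightarrow> f i \<in> M.C"
  shows "rsec (\<lambda>r. \<Sum>i\<in>I. u i r *\<^sub>R M.dif (f i) (\<iota> r))"
  unfolding restricted_section_def
proof (intro conjI allI impI)
  show "(\<Sum>i\<in>I. u i q *\<^sub>R M.dif (f i) (\<iota> q)) \<in> M.dualT (\<iota> q)" for q
    by (intro M.cot_lincomb M.cot_scale M.dif_cot)
  fix Y assume Y: "M.vf Y"
  have "(\<lambda>r. \<Sum>i\<in>I. u i r * Y (\<iota> r) (f i)) \<in> N.C"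
    by (intro N.smooth_funs_sum N.smooth_funs_mult assms(1) pullback_smooth M.vf_smooth[OF Y] assms(2))
  then show "(\<lambda>q. (\<Sum>i\<in>I. u i q *\<^sub>R M.dif (f i) (\<iota> q)) (Y (\<iota> q))) \<in> N.C"
    by (simp only: tvec_sum_apply M.dif_apply[OF M.vf_tangent[OF Y]])
qed

lemma rsec_scale:
  assumes "u \<in> N.C" "f \<in> M.C"
  shows "rsec (\<lambda>r. u r *\<^sub>R M.dif f (\<iota> r))"
  using rsec_sum[of "{()}" "\<lambda>_. u" "\<lambda>_. f"] assms by simp

text \<open>The test section is a cut-off of the differential of \<open>y j\<close>. Its components
  are constant near \<open>\<gamma> t\<close>, so only the matrix term of \<open>np_rbr\<close>
  survives.\<close>

lemma parallel_ode:
  assumes lu: "0 \<le> l" "u \<le> 1" and s: "parallel_on l u s" and t: "t \<in> {l..u}"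
    and A: "adapted V y E W e" and q: "\<gamma> t \<in> W" and j: "j \<in> normal_indices"
  shows "((\<lambda>\<tau>. ncoord y (\<gamma> \<tau>) (s \<tau>) j) has_real_derivative
    (\<Sum>k\<in>normal_indices. transport_mat y E j k t * ncoord y (\<gamma> t) (s t) k)) (at t within {l..u})"
proof -
  note ad = adaptedD[OF A]
  note f = M.frameD[OF ad(1)]
  let ?q = "\<gamma> t"
  have t01: "t \<in> {0..1}" using lu t by auto
  obtain w where w: "w \<in> N.T ?q" "sharp M \<pi> (\<iota> ?q) (a t) = push w"
    by (rule path_velocity[OF t01]) (rule that; assumption)
  obtain \<chi>' K B where b: "\<chi>' \<in> N.C" "closed K" "K \<subseteq> W" "open B" "?q \<in> B" "B \<subseteq> K"
    "\<And>r. r \<in> B \<Longrightarrow> \<chi>' r = 1" "\<And>r. r \<notin> K \<Longrightarrow> \<chi>' r = 0"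
    by (rule N.bump[OF N.frameD(1)[OF ad(2)] q]) (rule that; assumption)
  have jm: "j < M.m" using j by simp
  \<comment> \<open>Outside \<open>W\<close> the differential of \<open>y j\<close> need not
    annihilate the tangent space of \<open>N\<close>; the factor \<open>\<chi>'\<close> makes the
    section conormal everywhere.\<close>
  define \<beta> where "\<beta> r = \<chi>' r *\<^sub>R M.dif (y j) (\<iota> r)" for r
  define \<alpha> where "\<alpha> r = (\<Sum>i<M.m. a t (E i (\<iota> ?q)) *\<^sub>R M.dif (y i) (\<iota> r))" for r
  have "rsec \<beta>" unfolding \<beta>_def[abs_def] by (rule rsec_scale[OF b(1) f(2)[OF jm]])
  moreover have "\<beta> r v = 0" if v: "v \<in> TI r" for r v
  proof (cases "r \<in> W")
    case True
    then have "v (y j) = 0" using tangent_image_iff[OF A True, of v] v TI_subset j by auto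
    then show ?thesis using v TI_subset M.dif_apply by (simp add: \<beta>_def scaleR_fun_apply subset_iff)
  next
    case False
    then have "\<chi>' r = 0" using b by blast
    then show ?thesis by (simp add: \<beta>_def zero_fun_apply)
  qed
  ultimately have \<beta>: "csec \<beta>" by (simp add: conormal_section_def)
  have \<alpha>: "rsec \<alpha>" unfolding \<alpha>_def[abs_def]
    by (rule rsec_sum) (use f(2) N.smooth_funs_const in auto)
  have \<alpha>q: "\<alpha> ?q = a t"
    unfolding \<alpha>_def by (rule M.covec_expand(2)[OF ad(1) ad(3)[OF q] path_cot[OF t01], symmetric])
  have w': "sharp M \<pi> (\<iota> ?q) (\<alpha> ?q) = push w" using w(2) \<alpha>q by simp
  have c: "s t \<in> nu ?q" using s t by (simp add: parallel_on_def)
  have bl: "\<beta> r (E l (\<iota> r)) = (if l = j then 1 else 0)" if "r \<in> B" "l < M.m" for r l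
    using that b(3,6,7) f(4)[OF ad(3), of r l j] M.dif_apply[OF M.vf_tangent[OF f(3)[OF that(2)]]] jm
    by (auto simp: \<beta>_def scaleR_fun_apply)
  have wl: "w (\<lambda>r. \<beta> r (E l (\<iota> r))) = 0" if l: "l < M.m" for l
  proof -
    have "w (\<lambda>r. \<beta> r (E l (\<iota> r))) = w (\<lambda>r. if l = j then 1 else 0)"
      by (rule N.tangent_local[OF w(1) rsec_smooth[OF csecD(1)[OF \<beta>] f(3)[OF l]] N.smooth_funs_const b(4,5)])
        (use bl l in auto)
    then show ?thesis using N.tangent_const[OF w(1)] by simp
  qed
  have "np (rbr \<alpha> \<beta> ?q) (s t) = (\<Sum>l\<in>normal_indices. w (\<lambda>r. \<beta> r (E l (\<iota> r))) * ncoord y ?q (s t) l +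
    \<beta> ?q (E l (\<iota> ?q)) * (\<Sum>k\<in>normal_indices. transport_mat y E l k t * ncoord y ?q (s t) k))"
    unfolding np_rbr[OF \<alpha> \<beta> A q w(1) w' c] \<alpha>q transport_mat_def ..
  also have "\<dots> = (\<Sum>l\<in>normal_indices. if l = j then (\<Sum>k\<in>normal_indices. transport_mat y E j k t * ncoord y ?q (s t) k) else 0)"
    by (intro sum.cong refl) (auto simp: wl bl[OF b(5)])
  also have "\<dots> = (\<Sum>k\<in>normal_indices. transport_mat y E j k t * ncoord y ?q (s t) k)" using j by simp
  finally have val: "np (rbr \<alpha> \<beta> ?q) (s t) = \<dots>" .
  have "((\<lambda>\<tau>. np (\<beta> (\<gamma> \<tau>)) (s \<tau>)) has_real_derivative np (rbr \<alpha> \<beta> ?q) (s t)) (at t within {l..u})"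
    using s t \<alpha> \<alpha>q \<beta> by (simp add: parallel_on_def)
  then have D: "((\<lambda>\<tau>. np (\<beta> (\<gamma> \<tau>)) (s \<tau>)) has_real_derivative
      (\<Sum>k\<in>normal_indices. transport_mat y E j k t * ncoord y ?q (s t) k)) (at t within {l..u})"
    unfolding val .
  have eq: "np (\<beta> (\<gamma> \<tau>)) (s \<tau>) = ncoord y (\<gamma> \<tau>) (s \<tau>) j" if "\<gamma> \<tau> \<in> B" for \<tau>
    using b(7)[OF that] by (simp add: \<beta>_def ncoord_def)
  have "\<forall>\<^sub>F \<tau> in at t within {l..u}. np (\<beta> (\<gamma> \<tau>)) (s \<tau>) = ncoord y (\<gamma> \<tau>) (s \<tau>) j"
    using eventually_in_nbhd[OF lu t b(4,5)] by (rule eventually_mono) (rule eq)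
  from iffD1[OF has_field_derivative_cong_eventually[OF this eq[OF b(5)]] D] show ?thesis .
qed

text \<open>Converse of \<open>parallel_ode\<close>. For a general conormal section the product rule
  gives the derivative of its components along the path plus the matrix term, and these are the two
  parts of \<open>np_rbr\<close>.\<close>

lemma ode_parallel:
  assumes lu: "0 \<le> l" "u \<le> 1" and s: "\<And>\<tau>. \<tau> \<in> {l..u} \<Longrightarrow> s \<tau> \<in> nu (\<gamma> \<tau>)" and t: "t \<in> {l..u}"
    and A: "adapted V y E W e" and q: "\<gamma> t \<in> W"
    and D: "\<And>j. j \<in> normal_indices \<Longrightarrow> ((\<lambda>\<tau>. ncoord y (\<gamma> \<tau>) (s \<tau>) j) has_real_derivative
      (\<Sum>k\<in>normal_indices. transport_mat y E j k t * ncoord y (\<gamma> t) (s t) k)) (at t within {l..u})"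
    and \<alpha>: "rsec \<alpha>" "\<alpha> (\<gamma> t) = a t" and \<beta>: "csec \<beta>"
  shows "((\<lambda>\<tau>. np (\<beta> (\<gamma> \<tau>)) (s \<tau>)) has_real_derivative np (rbr \<alpha> \<beta> (\<gamma> t)) (s t)) (at t within {l..u})"
proof -
  note ad = adaptedD[OF A]
  note f = M.frameD[OF ad(1)]
  let ?q = "\<gamma> t"
  have sub: "{l..u} \<subseteq> {0..1}" using lu by auto
  then have t01: "t \<in> {0..1}" using t by auto
  obtain w where w: "w \<in> N.T ?q" "sharp M \<pi> (\<iota> ?q) (a t) = push w"
    "\<And>f. f \<in> N.C \<Longrightarrow> ((\<lambda>\<tau>. f (\<gamma> \<tau>)) has_real_derivative w f) (at t within {0..1})"
    by (rule path_velocity[OF t01]) (rule that; assumption)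
  have w': "sharp M \<pi> (\<iota> ?q) (\<alpha> ?q) = push w" using w(2) \<alpha>(2) by simp
  define b where "b j r = \<beta> r (E j (\<iota> r))" for j r
  have bC: "b j \<in> N.C" if "j \<in> normal_indices" for j
    unfolding b_def[abs_def] by (rule rsec_smooth[OF csecD(1)[OF \<beta>] f(3)]) (use that in auto)
  have bD: "((\<lambda>\<tau>. b j (\<gamma> \<tau>)) has_real_derivative w (b j)) (at t within {l..u})" if "j \<in> normal_indices" for j
    by (rule DERIV_subset[OF w(3)[OF bC[OF that]] sub])
  let ?F = "\<lambda>\<tau>. \<Sum>j\<in>normal_indices. b j (\<gamma> \<tau>) * ncoord y (\<gamma> \<tau>) (s \<tau>) j"
  have "(?F has_real_derivative (\<Sum>j\<in>normal_indices. w (b j) * ncoord y ?q (s t) j +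
      (\<Sum>k\<in>normal_indices. transport_mat y E j k t * ncoord y ?q (s t) k) * b j ?q)) (at t within {l..u})"
    by (intro DERIV_sum DERIV_mult bD D)
  also have "(\<Sum>j\<in>normal_indices. w (b j) * ncoord y ?q (s t) j +
      (\<Sum>k\<in>normal_indices. transport_mat y E j k t * ncoord y ?q (s t) k) * b j ?q) = np (rbr \<alpha> \<beta> ?q) (s t)"
    unfolding np_rbr[OF \<alpha>(1) \<beta> A q w(1) w' s[OF t]] \<alpha>(2) transport_mat_def b_def[abs_def]
    by (simp add: mult.commute)
  finally have FD: "(?F has_real_derivative np (rbr \<alpha> \<beta> ?q) (s t)) (at t within {l..u})" .
  have eq: "?F \<tau> = np (\<beta> (\<gamma> \<tau>)) (s \<tau>)" if "\<gamma> \<tau> \<in> W" "\<tau> \<in> {l..u}" for \<tau>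
    using np_conormal[OF A that(1) s[OF that(2)] \<beta>] by (simp add: b_def)
  have "\<forall>\<^sub>F \<tau> in at t within {l..u}. \<gamma> \<tau> \<in> W \<and> \<tau> \<in> {l..u}"
    using eventually_in_nbhd[OF lu t N.frameD(1)[OF ad(2)] q]
    by (simp add: eventually_conj_iff eventually_at_filter)
  then have "\<forall>\<^sub>F \<tau> in at t within {l..u}. ?F \<tau> = np (\<beta> (\<gamma> \<tau>)) (s \<tau>)"
    by (rule eventually_mono) (use eq in blast)
  from iffD1[OF has_field_derivative_cong_eventually[OF this eq[OF q t]] FD] show ?thesis .
qed

lemma parallel_on_union:
  assumes lm: "l \<le> c" "c \<le> u" and s: "parallel_on l c s" "parallel_on c u s"
  shows "parallel_on l u s"
  unfolding parallel_on_def
proof (intro ballI conjI allI impI)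
  fix t assume t: "t \<in> {l..u}"
  then have d: "t \<in> {l..c} \<or> t \<in> {c..u}" by auto
  show "s t \<in> nu (\<gamma> t)" using d s by (auto simp: parallel_on_def)
  fix \<alpha> \<beta> assume *: "rsec \<alpha> \<and> \<alpha> (\<gamma> t) = a t \<and> csec \<beta>"
  show "((\<lambda>\<tau>. np (\<beta> (\<gamma> \<tau>)) (s \<tau>)) has_real_derivative np (rbr \<alpha> \<beta> (\<gamma> t)) (s t)) (at t within {l..u})"
    by (rule has_real_derivative_union[OF lm]) (use s * t in \<open>auto simp: parallel_on_def\<close>)
qed

lemma parallel_on_subset:
  assumes "parallel_on l u s" "{l'..u'} \<subseteq> {l..u}"
  shows "parallel_on l' u' s"
  unfolding parallel_on_def
proof (intro ballI conjI allI impI)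
  fix t assume t: "t \<in> {l'..u'}"
  then have t': "t \<in> {l..u}" using assms(2) by auto
  show "s t \<in> nu (\<gamma> t)" using t' assms(1) by (simp add: parallel_on_def)
  fix \<alpha> \<beta> assume "rsec \<alpha> \<and> \<alpha> (\<gamma> t) = a t \<and> csec \<beta>"
  then show "((\<lambda>\<tau>. np (\<beta> (\<gamma> \<tau>)) (s \<tau>)) has_real_derivative np (rbr \<alpha> \<beta> (\<gamma> t)) (s t)) (at t within {l'..u'})"
    using assms(1) t' by (intro DERIV_subset[OF _ assms(2)]) (simp add: parallel_on_def)
qed

lemma parallel_on_cong:
  assumes "parallel_on l u s" "\<And>t. t \<in> {l..u} \<Longrightarrow> s t = s' t"
  shows "parallel_on l u s'"
  unfolding parallel_on_def
proof (intro ballI conjI allI impI)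
  fix t assume t: "t \<in> {l..u}"
  show "s' t \<in> nu (\<gamma> t)" using t assms by (simp add: parallel_on_def)
  fix \<alpha> \<beta> assume "rsec \<alpha> \<and> \<alpha> (\<gamma> t) = a t \<and> csec \<beta>"
  then have "((\<lambda>\<tau>. np (\<beta> (\<gamma> \<tau>)) (s \<tau>)) has_real_derivative np (rbr \<alpha> \<beta> (\<gamma> t)) (s' t)) (at t within {l..u})"
    using assms t by (simp add: parallel_on_def)
  then show "((\<lambda>\<tau>. np (\<beta> (\<gamma> \<tau>)) (s' \<tau>)) has_real_derivative np (rbr \<alpha> \<beta> (\<gamma> t)) (s' t)) (at t within {l..u})"
    by (rule has_field_derivative_transform_within[where d = 1]) (use t assms(2) in auto)
qed

text \<open>Unique solvability for every initial class, as a predicate on the two end points: the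
  shape on which a compactness argument over intervals operates.\<close>

definition transport :: "real \<Rightarrow> real \<Rightarrow> bool"
  where "transport l u \<longleftrightarrow> (\<forall>c\<in>nu (\<gamma> l). (\<exists>s. parallel_on l u s \<and> s l = c) \<and>
    (\<forall>s s'. parallel_on l u s \<and> parallel_on l u s' \<and> s l = c \<and> s' l = c \<longrightarrow> (\<forall>t\<in>{l..u}. s t = s' t)))"

lemma transport_ex: "transport l u \<Longrightarrow> c \<in> nu (\<gamma> l) \<Longrightarrow> \<exists>s. parallel_on l u s \<and> s l = c"
  by (simp add: transport_def)

lemma transport_unique:
  assumes "transport l u" "parallel_on l u s" "parallel_on l u s'" "s l = s' l" "l \<le> u" "t \<in> {l..u}"
  shows "s t = s' t"
proof -
  have "s l \<in> nu (\<gamma> l)" using assms(2,5) by (simp add: parallel_on_def)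
  with assms(1) have "\<forall>s1 s2. parallel_on l u s1 \<and> parallel_on l u s2 \<and> s1 l = s l \<and> s2 l = s l \<longrightarrow>
      (\<forall>t\<in>{l..u}. s1 t = s2 t)" by (simp add: transport_def)
  from this[THEN spec, THEN spec, THEN mp, OF conjI[OF assms(2) conjI[OF assms(3)]]] assms(4,6)
  show ?thesis by simp
qed

lemma transport_trans:
  assumes "transport l c" "transport c u" "l \<le> c" "c \<le> u"
  shows "transport l u"
  unfolding transport_def
proof (intro ballI conjI allI impI)
  fix x assume x: "x \<in> nu (\<gamma> l)"
  obtain s1 where s1: "parallel_on l c s1" "s1 l = x" using transport_ex[OF assms(1) x] by blast
  then have "s1 c \<in> nu (\<gamma> c)" using assms(3) by (simp add: parallel_on_def)
  then obtain s2 where s2: "parallel_on c u s2" "s2 c = s1 c" using transport_ex[OF assms(2)] by blast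
  let ?s = "\<lambda>t. if t \<le> c then s1 t else s2 t"
  have "parallel_on l c ?s" by (rule parallel_on_cong[OF s1(1)]) auto
  moreover have "parallel_on c u ?s" by (rule parallel_on_cong[OF s2(1)]) (use s2(2) in auto)
  ultimately have "parallel_on l u ?s" by (rule parallel_on_union[OF assms(3,4)])
  then show "\<exists>s. parallel_on l u s \<and> s l = x" using s1(2) assms(3) by (intro exI[of _ ?s]) auto
next
  fix x s s' t
  assume x: "x \<in> nu (\<gamma> l)" and *: "parallel_on l u s \<and> parallel_on l u s' \<and> s l = x \<and> s' l = x" and t: "t \<in> {l..u}"
  have sub: "{l..c} \<subseteq> {l..u}" "{c..u} \<subseteq> {l..u}" using assms(3,4) by auto
  have 1: "s t = s' t" if "t \<in> {l..c}" for t
    using transport_unique[OF assms(1) parallel_on_subset[OF _ sub(1)] parallel_on_subset[OF _ sub(1)], of s s' t]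
      * that assms(3) by simp
  have "s c = s' c" using 1[of c] assms(3) by simp
  then have "s t = s' t" if "t \<in> {c..u}" for t
    using transport_unique[OF assms(2) parallel_on_subset[OF _ sub(2)] parallel_on_subset[OF _ sub(2)], of s s' t]
      * that assms(4) by simp
  then show "s t = s' t" using 1 t by (cases "t \<le> c") auto
qed

lemma transport_local:
  assumes t0: "t0 \<in> {0..1}"
  shows "\<exists>d>0. \<forall>l u. l \<le> t0 \<and> t0 \<le> u \<and> u - l < d \<and> 0 \<le> l \<and> u \<le> 1 \<longrightarrow> transport l u"
proof -
  obtain V y E W e where A: "\<gamma> t0 \<in> W" "adapted V y E W e"
    by (rule adapted_exists) (rule that; assumption)
  note ad = adaptedD[OF A(2)]
  let ?J = normal_indices
  have "\<exists>h. \<forall>t\<in>{0..1}. \<bar>transport_mat y E j k t\<bar> \<le> h" if "j \<in> ?J" "k \<in> ?J" for j k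
  proof -
    have "bounded (transport_mat y E j k ` {0..1})"
      using that by (intro compact_imp_bounded compact_continuous_image transport_mat_continuous[OF ad(1)]) auto
    then show ?thesis by (auto simp: bounded_iff)
  qed
  then obtain h where h: "\<And>j k t. j \<in> ?J \<Longrightarrow> k \<in> ?J \<Longrightarrow> t \<in> {0..1} \<Longrightarrow> \<bar>transport_mat y E j k t\<bar> \<le> h j k"
    by metis
  define K where "K = (\<Sum>j\<in>?J. \<Sum>k\<in>?J. \<bar>h j k\<bar>)"
  have K: "K \<ge> 0" by (simp add: K_def sum_nonneg)
  have hK: "\<bar>transport_mat y E j k t\<bar> \<le> K" if "j \<in> ?J" "k \<in> ?J" "t \<in> {0..1}" for j k t
  proof -
    have "\<bar>transport_mat y E j k t\<bar> \<le> \<bar>h j k\<bar>" using h[OF that] by linarith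
    also have "\<dots> \<le> (\<Sum>k\<in>?J. \<bar>h j k\<bar>)" using that by (intro member_le_sum) auto
    also have "\<dots> \<le> K" unfolding K_def using that by (intro member_le_sum[of _ _ "\<lambda>j. \<Sum>k\<in>?J. \<bar>h j k\<bar>"]) (auto intro: sum_nonneg)
    finally show ?thesis .
  qed
  have "\<forall>\<^sub>F \<tau> in at t0 within {0..1}. \<gamma> \<tau> \<in> W"
    by (rule eventually_in_nbhd[OF _ _ t0 N.frameD(1)[OF ad(2)] A(1)]) auto
  then obtain d1 where d1: "d1 > 0" "\<And>\<tau>. \<tau> \<in> {0..1} \<Longrightarrow> \<bar>\<tau> - t0\<bar> < d1 \<Longrightarrow> \<gamma> \<tau> \<in> W"
    using A(1) unfolding eventually_at dist_real_def by (metis (no_types, lifting))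
  define L where "L = real (card ?J) * K"
  have L: "L \<ge> 0" unfolding L_def using K by simp
  \<comment> \<open>The second bound gives \<open>L * (u - l) \<le> 1 / 2\<close>, the smallness
    that the lemmas on linear equations ask for; the added 1 covers \<open>L = 0\<close>.\<close>
  define d where "d = min d1 (1 / (2 * (L + 1)))"
  have d: "d > 0" "d \<le> d1" "d \<le> 1 / (2 * (L + 1))" using d1(1) L by (auto simp: d_def)
  have "transport l u" if lu: "l \<le> t0" "t0 \<le> u" "u - l < d" "0 \<le> l" "u \<le> 1" for l u
  proof -
    have sub: "{l..u} \<subseteq> {0..1}" and lule: "l \<le> u" using lu by auto
    have inW: "\<gamma> \<tau> \<in> W" if "\<tau> \<in> {l..u}" for \<tau>
      by (rule d1(2)) (use that sub lu d(2) in auto)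
    have "L * (u - l) \<le> L * (1 / (2 * (L + 1)))" using lu(3) d(3) L by (intro mult_left_mono) auto
    also have "\<dots> \<le> 1 / 2" using L by (simp add: divide_le_eq)
    finally have LK: "real (card ?J) * K * (u - l) \<le> 1 / 2" by (simp add: L_def)
    note Bb = hK[OF _ _ subsetD[OF sub]]
    show ?thesis
      unfolding transport_def
    proof (intro ballI conjI allI impI)
      fix c assume c: "c \<in> nu (\<gamma> l)"
      obtain x where x: "\<And>j. j \<in> ?J \<Longrightarrow> x j l = ncoord y (\<gamma> l) c j"
        "\<And>j t. j \<in> ?J \<Longrightarrow> t \<in> {l..u} \<Longrightarrow>
          (x j has_real_derivative (\<Sum>k\<in>?J. transport_mat y E j k t * x k t)) (at t within {l..u})"
        by (rule linear_ode_exists[of ?J l u K "transport_mat y E" "ncoord y (\<gamma> l) c"])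
          (use lule K LK Bb continuous_on_subset[OF transport_mat_continuous[OF ad(1)] sub] in auto)
      define s where "s \<tau> = lin_coset (TI (\<gamma> \<tau>)) (\<Sum>j\<in>?J. x j \<tau> *\<^sub>R E j (\<iota> (\<gamma> \<tau>)))" for \<tau>
      have s: "s \<tau> \<in> nu (\<gamma> \<tau>)" "j \<in> ?J \<Longrightarrow> ncoord y (\<gamma> \<tau>) (s \<tau>) j = x j \<tau>" if "\<tau> \<in> {l..u}" for \<tau> j
        unfolding s_def using nu_build[OF A(2) inW[OF that]] by auto
      have "parallel_on l u s"
        unfolding parallel_on_def
      proof (intro ballI conjI allI impI)
        fix t assume t: "t \<in> {l..u}"
        show "s t \<in> nu (\<gamma> t)" by (rule s(1)[OF t])
        fix \<alpha> \<beta> assume *: "rsec \<alpha> \<and> \<alpha> (\<gamma> t) = a t \<and> csec \<beta>"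
        have "((\<lambda>\<tau>. ncoord y (\<gamma> \<tau>) (s \<tau>) j) has_real_derivative
            (\<Sum>k\<in>?J. transport_mat y E j k t * ncoord y (\<gamma> t) (s t) k)) (at t within {l..u})" if j: "j \<in> ?J" for j
        proof -
          have "(x j has_real_derivative (\<Sum>k\<in>?J. transport_mat y E j k t * ncoord y (\<gamma> t) (s t) k)) (at t within {l..u})"
            using x(2)[OF j t] s(2)[OF t] by simp
          then show ?thesis
            by (rule has_field_derivative_transform_within[where d = 1]) (use t s(2) j in auto)
        qed
        then show "((\<lambda>\<tau>. np (\<beta> (\<gamma> \<tau>)) (s \<tau>)) has_real_derivative np (rbr \<alpha> \<beta> (\<gamma> t)) (s t)) (at t within {l..u})"
          using * by (intro ode_parallel[OF lu(4,5) s(1) t A(2) inW[OF t]]) auto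
      qed
      moreover have "s l = c"
        by (rule nu_eqI[OF A(2) inW s(1) c]) (use lule s(2) x(1) in auto)
      ultimately show "\<exists>s. parallel_on l u s \<and> s l = c" by blast
    next
      fix c s s' t
      assume *: "parallel_on l u s \<and> parallel_on l u s' \<and> s l = c \<and> s' l = c" and t: "t \<in> {l..u}"
      have nu: "s t \<in> nu (\<gamma> t)" "s' t \<in> nu (\<gamma> t)" using * t by (auto simp: parallel_on_def)
      show "s t = s' t"
      proof (rule nu_eqI[OF A(2) inW[OF t] nu])
        fix j assume j: "j \<in> ?J"
        show "ncoord y (\<gamma> t) (s t) j = ncoord y (\<gamma> t) (s' t) j"
          by (rule linear_ode_unique[of ?J K u l "transport_mat y E" "\<lambda>j \<tau>. ncoord y (\<gamma> \<tau>) (s \<tau>) j" "\<lambda>j \<tau>. ncoord y (\<gamma> \<tau>) (s' \<tau>) j"])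
            (use K LK Bb * j t parallel_ode[OF lu(4,5) _ _ A(2) inW] in auto)
      qed
    qed
  qed
  then show ?thesis using d(1) by blast
qed

lemma transport_exists: "transport 0 1"
proof -
  \<comment> \<open>The guard is there because the small intervals around a point in
    \<open>Bolzano\<close> may stick out of \<open>{0..1}\<close>.\<close>
  let ?P = "\<lambda>l u. 0 \<le> l \<and> u \<le> 1 \<longrightarrow> transport l u"
  have "?P 0 (1 :: real)"
  proof (rule Bolzano[of 0 1 ?P])
    fix x :: real assume "0 \<le> x" "x \<le> 1"
    then show "\<exists>d>0. \<forall>a b. a \<le> x \<and> x \<le> b \<and> b - a < d \<longrightarrow> ?P a b"
      using transport_local[of x] by auto
  next
    fix l c u :: real assume *: "?P l c" "?P c u" "l \<le> c" "c \<le> u"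
    then show "?P l u" using transport_trans[of l c u] by auto
  qed simp
  then show ?thesis by simp
qed

lemma parallel_exists:
  assumes "c \<in> nu (\<gamma> 0)"
  obtains s where "parallel_on 0 1 s" "s 0 = c"
  using transport_ex[OF transport_exists assms] that by blast

lemma linear_holonomy_eq:
  assumes "parallel_on 0 1 s"
  shows "linear_holonomy N M \<pi> \<iota> \<gamma> a (s 0) = s 1"
  unfolding linear_holonomy_def parallel_along_iff
proof (rule the_equality)
  show "\<exists>s'. parallel_on 0 1 s' \<and> s' 0 = s 0 \<and> s' 1 = s 1" using assms by blast
next
  fix c' assume "\<exists>s'. parallel_on 0 1 s' \<and> s' 0 = s 0 \<and> s' 1 = c'"
  then obtain s' where s': "parallel_on 0 1 s'" "s' 0 = s 0" "s' 1 = c'" by blast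
  from transport_unique[OF transport_exists s'(1) assms s'(2), of 1] show "c' = s 1" using s'(3) by simp
qed

end

section \<open>The determinant of the holonomy\<close>

lemma ndet_block:
  assumes "\<And>i j. i < n \<Longrightarrow> n \<le> j \<Longrightarrow> j < n + r \<Longrightarrow> A i j = 0"
  shows "ndet (n + r) A = ndet n A * ndet r (\<lambda>i j. A (n + i) (n + j))"
proof -
  let ?A1 = "Matrix.mat n n (\<lambda>(i, j). A i j)" and ?A3 = "Matrix.mat r n (\<lambda>(i, j). A (n + i) j)"
    and ?A4 = "Matrix.mat r r (\<lambda>(i, j). A (n + i) (n + j))"
  have "Matrix.mat (n + r) (n + r) (\<lambda>(i, j). A i j) = four_block_mat ?A1 (0\<^sub>m n r) ?A3 ?A4"
    by (rule eq_matI) (auto simp: assms)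
  then show ?thesis
    unfolding ndet_def by (simp add: det_four_block_mat_upper_right_zero[of ?A1 n "0\<^sub>m n r" r ?A3 ?A4])
qed

section \<open>The normal density along the path and the determinant\<close>

locale cotangent_curve_volume = cotangent_curve M \<pi> N \<pi>\<^sub>N \<iota> \<gamma> a
  for M :: "('m::{t2_space,second_countable_topology}) manifold" and \<pi> :: "'m bivector"
    and N :: "('n::{t2_space,second_countable_topology}) manifold" and \<pi>\<^sub>N :: "'n bivector"
    and \<iota> :: "'n \<Rightarrow> 'm" and \<gamma> :: "real \<Rightarrow> 'n" and a :: "real \<Rightarrow> 'm covec" +
  fixes \<mu> :: "'m top_form" and \<nu> :: "'n top_form"
  assumes \<mu>: "volume_form M \<mu>" and \<nu>: "volume_form N \<nu>"
begin

abbreviation "codim \<equiv> M.m - N.m"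
abbreviation "X\<mu> \<equiv> modular_vector_field M \<pi> \<mu>"
abbreviation "X\<nu> \<equiv> modular_vector_field N \<pi>\<^sub>N \<nu>"

text \<open>The choice cancels in \<open>normal_density\<close>, where it enters \<mu> and \<nu>
  with the same determinant.\<close>

definition tangent_basis :: "'n \<Rightarrow> nat \<Rightarrow> 'n tvec"
  where "tangent_basis q = (SOME w. (\<forall>i<N.m. w i \<in> N.T q) \<and> \<nu> q w \<noteq> 0)"

text \<open>The density \<open>\<mu> / \<nu>\<close> on the normal bundle.\<close>

definition normal_density :: "'n \<Rightarrow> (nat \<Rightarrow> 'm tvec set) \<Rightarrow> real"
  where "normal_density q c = \<mu> (\<iota> q) (\<lambda>i. if i < N.m then push (tangent_basis q i)
    else (SOME v. v \<in> M.T (\<iota> q) \<and> c (i - N.m) = lin_coset (TI q) v)) / \<nu> q (tangent_basis q)"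

lemma tangent_basis: "i < N.m \<Longrightarrow> tangent_basis q i \<in> N.T q" "\<nu> q (tangent_basis q) \<noteq> 0"
  using someI_ex[OF N.volume_nonzero[OF \<nu>, of q]] unfolding tangent_basis_def by auto

text \<open>In adapted coordinates the matrix is block triangular, since pushed vectors have no
  normal components. The tangential block cancels against \<nu>, and the chosen representatives of
  the classes enter through their normal coordinates only.\<close>

lemma normal_density_frame:
  assumes A: "adapted V y E W e" and q: "q \<in> W" and c: "\<And>k. k < codim \<Longrightarrow> c k \<in> nu q"
  shows "normal_density q c = ndet codim (\<lambda>k j. ncoord y q (c k) (N.m + j)) *
    (\<mu> (\<iota> q) (\<lambda>i. E i (\<iota> q)) / \<nu> q (\<lambda>i. e i q))"
proof -
  note ad = adaptedD[OF A]
  define b where "b = tangent_basis q"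
  define z where "z k = (SOME v. v \<in> M.T (\<iota> q) \<and> c k = lin_coset (TI q) v)" for k
  have z: "z k \<in> M.T (\<iota> q)" "c k = lin_coset (TI q) (z k)" if "k < codim" for k
  proof -
    have "\<exists>v. v \<in> M.T (\<iota> q) \<and> c k = lin_coset (TI q) v" using nuE[OF c[OF that]] by metis
    from someI_ex[OF this] show "z k \<in> M.T (\<iota> q)" "c k = lin_coset (TI q) (z k)" unfolding z_def by auto
  qed
  have b: "b i \<in> N.T q" if "i < N.m" for i using tangent_basis(1)[OF that] by (simp add: b_def)
  define v where "v i = (if i < N.m then push (b i) else z (i - N.m))" for i
  have v: "v i \<in> M.T (\<iota> q)" if "i < M.m" for i
    using that push_tangent[OF b] z(1) by (auto simp: v_def)
  have m: "M.m = N.m + codim" using ad(4) by simp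
  let ?x = "\<lambda>i r. y i (\<iota> r)"
  have "\<mu> (\<iota> q) v = ndet M.m (\<lambda>i j. v i (y j)) * \<mu> (\<iota> q) (\<lambda>i. E i (\<iota> q))"
    by (rule M.volume_expand[OF \<mu> ad(1) ad(3)[OF q] v])
  also have "ndet M.m (\<lambda>i j. v i (y j)) =
      ndet N.m (\<lambda>i j. v i (y j)) * ndet codim (\<lambda>i j. v (N.m + i) (y (N.m + j)))"
    by (subst m, rule ndet_block) (use adapted_normal[OF A q b] in \<open>auto simp: v_def\<close>)
  also have "ndet N.m (\<lambda>i j. v i (y j)) = ndet N.m (\<lambda>i j. b i (?x j))"
    by (rule ndet_cong) (use M.frameD(2)[OF ad(1)] ad(4) in \<open>auto simp: v_def push_apply\<close>)
  also have "ndet codim (\<lambda>i j. v (N.m + i) (y (N.m + j))) = ndet codim (\<lambda>k j. ncoord y q (c k) (N.m + j))"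
    by (rule ndet_cong) (use ncoord_coset[OF A q z(1)] z(2) in \<open>auto simp: v_def\<close>)
  finally have 1: "\<mu> (\<iota> q) v = ndet N.m (\<lambda>i j. b i (?x j)) * ndet codim (\<lambda>k j. ncoord y q (c k) (N.m + j)) *
      \<mu> (\<iota> q) (\<lambda>i. E i (\<iota> q))" .
  have 2: "\<nu> q b = ndet N.m (\<lambda>i j. b i (?x j)) * \<nu> q (\<lambda>i. e i q)"
    by (rule N.volume_expand[OF \<nu> ad(2) q b])
  have nz: "ndet N.m (\<lambda>i j. b i (?x j)) \<noteq> 0" using 2 tangent_basis(2)[of q] by (auto simp: b_def)
  have "normal_density q c = \<mu> (\<iota> q) v / \<nu> q b"
    unfolding normal_density_def v_def b_def z_def ..
  then show ?thesis unfolding 1 2 using nz by simp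
qed

text \<open>The integrand for the representative of the relative modular class without a hamiltonian
  term.\<close>

definition modular_rate :: "real \<Rightarrow> real"
  where "modular_rate t = a t (X\<mu> (\<iota> (\<gamma> t)) - push (X\<nu> (\<gamma> t)))"

lemma pairing_push_modular:
  assumes A: "adapted V y E W e" and t: "t \<in> {0..1}" and q: "\<gamma> t \<in> W"
  shows "a t (push (X\<nu> (\<gamma> t))) = (\<Sum>i<M.m. a t (E i (\<iota> (\<gamma> t))) * X\<nu> (\<gamma> t) (\<lambda>r. y i (\<iota> r)))"
proof -
  note ad = adaptedD[OF A]
  have "X\<nu> (\<gamma> t) \<in> N.T (\<gamma> t)" by (rule N.vf_tangent[OF N.vf_modular[OF \<nu>]])
  from M.covec_expand(1)[OF ad(1) ad(3)[OF q] path_cot[OF t] push_tangent[OF this]] show ?thesis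
    using M.frameD(2)[OF ad(1)] by (simp add: push_apply)
qed

text \<open>The terms with tangential \<open>j\<close> are the same in the two divergence formulas,
  because brackets of restrictions are restrictions of brackets and \<open>e j\<close> pushes to
  \<open>E j\<close>. The normal terms remain and form the trace.\<close>

lemma modular_rate_frame:
  assumes A: "adapted V y E W e" and t: "t \<in> {0..1}" and q: "\<gamma> t \<in> W"
    and w: "w \<in> N.T (\<gamma> t)" "sharp M \<pi> (\<iota> (\<gamma> t)) (a t) = push w"
  shows "modular_rate t = w (\<lambda>r. \<mu> (\<iota> r) (\<lambda>i. E i (\<iota> r))) / \<mu> (\<iota> (\<gamma> t)) (\<lambda>i. E i (\<iota> (\<gamma> t))) -
    w (\<lambda>r. \<nu> r (\<lambda>i. e i r)) / \<nu> (\<gamma> t) (\<lambda>i. e i (\<gamma> t)) +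
    (\<Sum>j\<in>normal_indices. transport_mat y E j j t)"
proof -
  note ad = adaptedD[OF A]
  note f = M.frameD[OF ad(1)]
  let ?q = "\<gamma> t"
  let ?p = "\<iota> ?q"
  let ?x = "\<lambda>i r. y i (\<iota> r)"
  define \<rho> where "\<rho> p = \<mu> p (\<lambda>i. E i p)" for p
  define \<sigma> where "\<sigma> r = \<nu> r (\<lambda>i. e i r)" for r
  define c where "c i = a t (E i ?p)" for i
  define P where "P i j = E j ?p (M.pb (y i) (y j))" for i j
  have \<rho>: "\<rho> \<in> M.C" unfolding \<rho>_def[abs_def] by (rule M.volume_frame(1)[OF \<mu> ad(1)])
  have \<sigma>: "\<sigma> \<in> N.C" unfolding \<sigma>_def[abs_def] by (rule N.volume_frame(1)[OF \<nu> ad(2)])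
  have xC: "?x i \<in> N.C" if "i < M.m" for i by (rule pullback_smooth[OF f(2)[OF that]])
  have X\<mu>: "X\<mu> ?p (y i) = M.ham (y i) ?p \<rho> / \<rho> ?p + (\<Sum>j<M.m. P i j)" if "i < M.m" for i
    using M.modular_frame[OF \<mu> ad(1) ad(3)[OF q] f(2)[OF that]] by (simp add: \<rho>_def[abs_def] P_def)
  have X\<nu>: "X\<nu> ?q (?x i) = N.ham (?x i) ?q \<sigma> / \<sigma> ?q + (\<Sum>j<N.m. P i j)" if i: "i < M.m" for i
  proof -
    have "e j ?q (N.pb (?x i) (?x j)) = P i j" if j: "j < N.m" for j
    proof -
      have jm: "j < M.m" using j ad(4) by simp
      have "N.pb (?x i) (?x j) = (\<lambda>r. M.pb (y i) (y j) (\<iota> r))"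
        using poisson_map[OF f(2)[OF i] f(2)[OF jm]] by auto
      then have "e j ?q (N.pb (?x i) (?x j)) = push (e j ?q) (M.pb (y i) (y j))"
        using push_apply[OF M.pb_smooth[OF f(2)[OF i] f(2)[OF jm]]] by simp
      then show ?thesis using adapted_push_frame[OF A q j] by (simp add: P_def)
    qed
    then show ?thesis
      using N.modular_frame[OF \<nu> ad(2) q xC[OF i]] by (simp add: \<sigma>_def[abs_def])
  qed
  have ham_t: "N.ham (?x i) ?q \<in> N.T ?q" if "i < M.m" for i by (rule N.vf_tangent[OF N.vf_ham[OF xC[OF that]]])
  have c_ham: "(\<Sum>i<M.m. c i * M.ham (y i) ?p g) = push w g" if "g \<in> M.C" for g
    using M.sharp_frame[OF ad(1) ad(3)[OF q] path_cot[OF t] that] w(2) that by (simp add: c_def M.ham_apply)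
  \<comment> \<open>\<open>\<sigma>\<close> is a function on \<open>N\<close> only, so the expansion
    of \<open>push w\<close> on functions of \<open>M\<close> does not reach it; injectivity of
    \<open>push\<close> moves the expansion to \<open>N\<close>.\<close>
  define h where "h = (\<Sum>i<M.m. c i *\<^sub>R N.ham (?x i) ?q)"
  have hT: "h \<in> N.T ?q" unfolding h_def by (intro N.tangent_lincomb N.tangent_scale ham_t) auto
  have "push h = push w"
  proof
    fix g
    show "push h g = push w g"
    proof (cases "g \<in> M.C")
      case True
      have "push h g = (\<Sum>i<M.m. c i * push (N.ham (?x i) ?q) g)"
        using True by (simp add: push_apply h_def tvec_sum_apply)
      also have "\<dots> = (\<Sum>i<M.m. c i * M.ham (y i) ?p g)" using push_ham[OF f(2)] by simp
      finally show ?thesis using c_ham[OF True] by simp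
    qed (simp add: pushforward_def)
  qed
  then have "h = w" by (rule push_inj[OF hT w(1)])
  moreover have "h \<sigma> = (\<Sum>i<M.m. c i * N.ham (?x i) ?q \<sigma>)" unfolding h_def by (rule tvec_sum_apply)
  ultimately have c_hamN: "(\<Sum>i<M.m. c i * N.ham (?x i) ?q \<sigma>) = w \<sigma>" by simp
  have X\<mu>T: "X\<mu> ?p \<in> M.T ?p" by (rule M.vf_tangent[OF M.vf_modular[OF \<mu>]])
  have X\<nu>T: "push (X\<nu> ?q) \<in> M.T ?p" by (rule push_tangent[OF N.vf_tangent[OF N.vf_modular[OF \<nu>]]])
  have "a t (X\<mu> ?p) = (\<Sum>i<M.m. c i * (M.ham (y i) ?p \<rho> / \<rho> ?p + (\<Sum>j<M.m. P i j)))"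
    using M.covec_expand(1)[OF ad(1) ad(3)[OF q] path_cot[OF t] X\<mu>T] X\<mu> by (simp add: c_def)
  also have "\<dots> = push w \<rho> / \<rho> ?p + (\<Sum>i<M.m. c i * (\<Sum>j<M.m. P i j))"
    by (simp add: distrib_left sum.distrib flip: c_ham[OF \<rho>] sum_divide_distrib)
  finally have 1: "a t (X\<mu> ?p) = \<dots>" .
  have "a t (push (X\<nu> ?q)) = (\<Sum>i<M.m. c i * (N.ham (?x i) ?q \<sigma> / \<sigma> ?q + (\<Sum>j<N.m. P i j)))"
    unfolding pairing_push_modular[OF A t q] using X\<nu> by (simp add: c_def)
  also have "\<dots> = w \<sigma> / \<sigma> ?q + (\<Sum>i<M.m. c i * (\<Sum>j<N.m. P i j))"
    by (simp add: distrib_left sum.distrib flip: c_hamN sum_divide_distrib)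
  finally have 2: "a t (push (X\<nu> ?q)) = \<dots>" .
  have 3: "(\<Sum>i<M.m. c i * (\<Sum>j<M.m. P i j)) = (\<Sum>i<M.m. c i * (\<Sum>j<N.m. P i j)) +
      (\<Sum>j\<in>normal_indices. transport_mat y E j j t)"
  proof -
    have "(\<Sum>i<M.m. c i * (\<Sum>j\<in>normal_indices. P i j)) = (\<Sum>j\<in>normal_indices. \<Sum>i<M.m. c i * P i j)"
      unfolding sum_distrib_left by (rule sum.swap)
    also have "\<dots> = (\<Sum>j\<in>normal_indices. transport_mat y E j j t)"
      by (simp add: transport_mat_def c_def P_def)
    finally show ?thesis by (simp add: frame_sum_split[OF A, of "P _"] distrib_left sum.distrib)
  qed
  have "modular_rate t = a t (X\<mu> ?p) - a t (push (X\<nu> ?q))"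
    unfolding modular_rate_def by (rule M.covec_diff[OF path_cot[OF t] X\<mu>T X\<nu>T])
  then show ?thesis
    unfolding 1 2 3 using push_apply[OF \<rho>, of w] by (simp add: \<rho>_def[abs_def] \<sigma>_def[abs_def])
qed

text \<open>\<open>X\<nu>\<close> is defined over \<open>N\<close> only, so the continuity built
  into cotangent paths does not apply to it directly. Near each time it is expanded in a frame of
  global fields on \<open>M\<close> whose coefficients are smooth functions on
  \<open>N\<close>.\<close>

lemma modular_rate_continuous: "continuous_on {0..1} modular_rate"
proof -
  have "continuous_on {0..1} (\<lambda>t. a t (push (X\<nu> (\<gamma> t))))"
    unfolding continuous_on_def
  proof
    fix t :: real assume t: "t \<in> {0..1}"
    obtain V y E W e where A: "\<gamma> t \<in> W" "adapted V y E W e"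
      by (rule adapted_exists) (rule that; assumption)
    note ad = adaptedD[OF A(2)]
    note f = M.frameD[OF ad(1)]
    let ?g = "\<lambda>\<tau>. \<Sum>i<M.m. a \<tau> (E i (\<iota> (\<gamma> \<tau>))) * X\<nu> (\<gamma> \<tau>) (\<lambda>r. y i (\<iota> r))"
    have "continuous_on {0..1} (\<lambda>\<tau>. X\<nu> (\<gamma> \<tau>) (\<lambda>r. y i (\<iota> r)))" if "i < M.m" for i
      by (rule path_smooth_continuous[OF N.vf_smooth[OF N.vf_modular[OF \<nu>] pullback_smooth[OF f(2)[OF that]]]])
    then have "continuous_on {0..1} ?g"
      by (intro continuous_on_sum continuous_on_mult path_pairing f(3)) auto
    then have "(?g \<longlongrightarrow> ?g t) (at t within {0..1})" using t by (simp add: continuous_on_def)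
    moreover have "\<forall>\<^sub>F \<tau> in at t within {0..1}. \<gamma> \<tau> \<in> W \<and> \<tau> \<in> {0..1}"
      using eventually_in_nbhd[OF _ _ t N.frameD(1)[OF ad(2)] A(1)] by (simp add: eventually_conj_iff eventually_at_filter)
    then have "\<forall>\<^sub>F \<tau> in at t within {0..1}. ?g \<tau> = a \<tau> (push (X\<nu> (\<gamma> \<tau>)))"
      by (rule eventually_mono) (simp add: pairing_push_modular[OF A(2)])
    ultimately show "((\<lambda>t. a t (push (X\<nu> (\<gamma> t)))) \<longlongrightarrow> a t (push (X\<nu> (\<gamma> t)))) (at t within {0..1})"
      unfolding pairing_push_modular[OF A(2) t A(1)] by (rule Lim_transform_eventually)
  qed
  moreover have "continuous_on {0..1} (\<lambda>t. a t (X\<mu> (\<iota> (\<gamma> t))))"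
    by (rule path_pairing[OF M.vf_modular[OF \<mu>]])
  ultimately have "continuous_on {0..1} (\<lambda>t. a t (X\<mu> (\<iota> (\<gamma> t))) - a t (push (X\<nu> (\<gamma> t))))"
    by (intro continuous_on_diff)
  moreover have "modular_rate t = a t (X\<mu> (\<iota> (\<gamma> t))) - a t (push (X\<nu> (\<gamma> t)))" if "t \<in> {0..1}" for t
    unfolding modular_rate_def
    by (rule M.covec_diff[OF path_cot[OF that] M.vf_tangent[OF M.vf_modular[OF \<mu>]]
        push_tangent[OF N.vf_tangent[OF N.vf_modular[OF \<nu>]]]])
  ultimately show ?thesis by (metis (no_types, lifting) continuous_on_eq)
qed

lemma normal_density_derivative:
  assumes s: "\<And>k. k < codim \<Longrightarrow> parallel_on 0 1 (s k)" and t: "t \<in> {0..1}"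
  shows "((\<lambda>\<tau>. normal_density (\<gamma> \<tau>) (\<lambda>k. s k \<tau>)) has_real_derivative
    modular_rate t * normal_density (\<gamma> t) (\<lambda>k. s k t)) (at t within {0..1})"
proof -
  obtain V y E W e where A: "\<gamma> t \<in> W" "adapted V y E W e"
    by (rule adapted_exists) (rule that; assumption)
  note ad = adaptedD[OF A(2)]
  let ?q = "\<gamma> t" and ?n = "N.m"
  obtain w where w: "w \<in> N.T ?q" "sharp M \<pi> (\<iota> ?q) (a t) = push w"
    "\<And>f. f \<in> N.C \<Longrightarrow> ((\<lambda>\<tau>. f (\<gamma> \<tau>)) has_real_derivative w f) (at t within {0..1})"
    by (rule path_velocity[OF t]) (rule that; assumption)
  define \<rho> where "\<rho> r = \<mu> (\<iota> r) (\<lambda>i. E i (\<iota> r))" for r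
  define \<sigma> where "\<sigma> r = \<nu> r (\<lambda>i. e i r)" for r
  have \<rho>: "\<rho> \<in> N.C" unfolding \<rho>_def[abs_def] by (rule pullback_smooth[OF M.volume_frame(1)[OF \<mu> ad(1)]])
  have \<sigma>: "\<sigma> \<in> N.C" unfolding \<sigma>_def[abs_def] by (rule N.volume_frame(1)[OF \<nu> ad(2)])
  have nz: "\<rho> ?q \<noteq> 0" "\<sigma> ?q \<noteq> 0"
    unfolding \<rho>_def \<sigma>_def using M.volume_frame(2)[OF \<mu> ad(1) ad(3)[OF A(1)]] N.volume_frame(2)[OF \<nu> ad(2) A(1)] by auto
  define S where "S \<tau> k j = ncoord y (\<gamma> \<tau>) (s k \<tau>) (?n + j)" for \<tau> k j
  \<comment> \<open>Transposed, because the parallel fields are the rows of \<open>S\<close>: their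
    equation reads \<open>S' = S B\<close>, the case of \<open>ndet_trace_right\<close>.\<close>
  define B where "B l j = transport_mat y E (?n + j) (?n + l) t" for l j
  have shift: "(\<Sum>k\<in>normal_indices. h k) = (\<Sum>l<codim. h (?n + l))" for h :: "nat \<Rightarrow> real"
    by (rule sum.reindex_bij_witness[of _ "\<lambda>l. ?n + l" "\<lambda>k. k - ?n"]) auto
  have S': "((\<lambda>\<tau>. S \<tau> k j) has_real_derivative (\<Sum>l<codim. S t k l * B l j)) (at t within {0..1})"
    if "k < codim" "j < codim" for k j
    using parallel_ode[OF _ _ s[OF that(1)] t A(2,1), of "?n + j"] that(2)
    by (simp add: S_def shift B_def mult.commute)
  have D: "((\<lambda>\<tau>. ndet codim (S \<tau>)) has_real_derivative (\<Sum>l<codim. B l l) * ndet codim (S t)) (at t within {0..1})"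
    using ndet_has_derivative[of codim S "\<lambda>k j. \<Sum>l<codim. S t k l * B l j" t "{0..1}"] S'
    by (simp add: ndet_trace_right)
  let ?F = "\<lambda>\<tau>. ndet codim (S \<tau>) * (\<rho> (\<gamma> \<tau>) / \<sigma> (\<gamma> \<tau>))"
  have rate: "modular_rate t = w \<rho> / \<rho> ?q - w \<sigma> / \<sigma> ?q + (\<Sum>l<codim. B l l)"
    using modular_rate_frame[OF A(2) t A(1) w(1,2)] by (simp add: shift B_def \<rho>_def[abs_def] \<sigma>_def[abs_def])
  have "(?F has_real_derivative (\<Sum>l<codim. B l l) * ndet codim (S t) * (\<rho> ?q / \<sigma> ?q) +
      (w \<rho> * \<sigma> ?q - \<rho> ?q * w \<sigma>) / (\<sigma> ?q * \<sigma> ?q) * ndet codim (S t)) (at t within {0..1})"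
    by (intro DERIV_mult D DERIV_divide w(3) \<rho> \<sigma> nz)
  also have "(\<Sum>l<codim. B l l) * ndet codim (S t) * (\<rho> ?q / \<sigma> ?q) +
      (w \<rho> * \<sigma> ?q - \<rho> ?q * w \<sigma>) / (\<sigma> ?q * \<sigma> ?q) * ndet codim (S t) = modular_rate t * ?F t"
    unfolding rate using nz by (simp add: field_simps)
  finally have FD: "(?F has_real_derivative modular_rate t * ?F t) (at t within {0..1})" .
  have eq: "?F \<tau> = normal_density (\<gamma> \<tau>) (\<lambda>k. s k \<tau>)" if "\<gamma> \<tau> \<in> W" "\<tau> \<in> {0..1}" for \<tau>
    using normal_density_frame[OF A(2) that(1), of "\<lambda>k. s k \<tau>"] s that(2)
    by (simp add: parallel_on_def S_def[abs_def] \<rho>_def \<sigma>_def)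
  have "\<forall>\<^sub>F \<tau> in at t within {0..1}. \<gamma> \<tau> \<in> W \<and> \<tau> \<in> {0..1}"
    using eventually_in_nbhd[OF _ _ t N.frameD(1)[OF ad(2)] A(1)] by (simp add: eventually_conj_iff eventually_at_filter)
  then have "\<forall>\<^sub>F \<tau> in at t within {0..1}. ?F \<tau> = normal_density (\<gamma> \<tau>) (\<lambda>k. s k \<tau>)"
    by (rule eventually_mono) (use eq in blast)
  from iffD1[OF has_field_derivative_cong_eventually[OF this eq[OF A(1) t]] FD] show ?thesis
    by (simp only: eq[OF A(1) t])
qed

text \<open>An integrating factor in place of a logarithm, so that the sign and possible zeros of
  the density need no discussion.\<close>

lemma normal_density_transport:
  assumes s: "\<And>k. k < codim \<Longrightarrow> parallel_on 0 1 (s k)"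
  shows "normal_density (\<gamma> 1) (\<lambda>k. s k 1) =
    exp (integral {0..1} modular_rate) * normal_density (\<gamma> 0) (\<lambda>k. s k 0)"
proof -
  let ?F = "\<lambda>t. normal_density (\<gamma> t) (\<lambda>k. s k t)" and ?I = "\<lambda>t. integral {0..t} modular_rate"
  have "((\<lambda>t. ?F t * exp (- ?I t)) has_real_derivative 0) (at t within {0..1})" if t: "t \<in> {0..1}" for t
  proof -
    have "(?I has_real_derivative modular_rate t) (at t within {0..1})"
      using integral_has_vector_derivative[OF modular_rate_continuous t]
      by (simp add: has_real_derivative_iff_has_vector_derivative)
    then have "((\<lambda>t. exp (- ?I t)) has_real_derivative exp (- ?I t) * - modular_rate t) (at t within {0..1})"
      by (auto intro!: derivative_eq_intros)
    from DERIV_mult[OF normal_density_derivative[OF s t] this] show ?thesis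
      by (simp add: algebra_simps)
  qed
  then obtain c where c: "\<And>t. t \<in> {0..1} \<Longrightarrow> ?F t * exp (- ?I t) = c"
    using has_field_derivative_zero_constant[of "{0..1::real}" "\<lambda>t. ?F t * exp (- ?I t)"] by auto
  have "?F 1 * exp (- ?I 1) = ?F 0 * exp (- ?I 0)" using c[of 0] c[of 1] by simp
  then show ?thesis by (simp add: exp_minus field_simps)
qed

text \<open>The hamiltonian term of a representative integrates to a difference of values of
  \<open>f\<close> at the end points, which is 0 on a loop; all representatives thus give one value,
  as the definite description demands.\<close>

lemma path_integral_class_eq:
  assumes loop: "\<gamma> 0 = \<gamma> 1"
  shows "path_integral_class \<gamma> a (relative_modular_class M \<pi> N \<pi>\<^sub>N \<iota> \<mu> \<nu>) = integral {0..1} modular_rate"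
proof -
  have int: "path_integral \<gamma> a (\<lambda>q. X\<mu> (\<iota> q) - push (X\<nu> q) + push (N.ham f q)) = integral {0..1} modular_rate"
    if f: "f \<in> N.C" for f
  proof -
    let ?h = "\<lambda>t. a t (push (N.ham f (\<gamma> t)))"
    have hT: "push (N.ham f q) \<in> M.T (\<iota> q)" for q
      by (rule push_tangent[OF N.vf_tangent[OF N.vf_ham[OF f]]])
    have "((\<lambda>t. - f (\<gamma> t)) has_real_derivative ?h t) (at t within {0..1})" if t: "t \<in> {0..1}" for t
    proof -
      obtain w where w: "w \<in> N.T (\<gamma> t)" "sharp M \<pi> (\<iota> (\<gamma> t)) (a t) = push w"
        "\<And>f. f \<in> N.C \<Longrightarrow> ((\<lambda>\<tau>. f (\<gamma> \<tau>)) has_real_derivative w f) (at t within {0..1})"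
        by (rule path_velocity[OF t]) (rule that; assumption)
      show ?thesis
        using DERIV_minus[OF w(3)[OF f]] covec_push_ham[OF path_cot[OF t] w(1,2) f] by simp
    qed
    then have "(?h has_integral (- f (\<gamma> 1) - - f (\<gamma> 0))) {0..1}"
      by (intro fundamental_theorem_of_calculus) (auto simp: has_real_derivative_iff_has_vector_derivative)
    then have h0: "(?h has_integral 0) {0..1}" using loop by simp
    have "(modular_rate has_integral integral {0..1} modular_rate) {0..1}"
      by (rule integrable_integral[OF integrable_continuous_real[OF modular_rate_continuous]])
    from has_integral_add[OF this h0]
    have i1: "((\<lambda>t. modular_rate t + ?h t) has_integral integral {0..1} modular_rate) {0..1}" by simp
    have i2: "a t (X\<mu> (\<iota> (\<gamma> t)) - push (X\<nu> (\<gamma> t)) + push (N.ham f (\<gamma> t))) = modular_rate t + ?h t"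
      if "t \<in> {0..1}" for t
      unfolding modular_rate_def
      by (rule M.covec_add[OF path_cot[OF that] M.tangent_sub[OF M.vf_tangent[OF M.vf_modular[OF \<mu>]]
          push_tangent[OF N.vf_tangent[OF N.vf_modular[OF \<nu>]]]] hT])
    have "((\<lambda>t. a t (X\<mu> (\<iota> (\<gamma> t)) - push (X\<nu> (\<gamma> t)) + push (N.ham f (\<gamma> t)))) has_integral
        integral {0..1} modular_rate) {0..1}"
      by (rule has_integral_eq[OF i2[symmetric] i1])
    then show ?thesis unfolding path_integral_def by (rule integral_unique)
  qed
  have all: "path_integral \<gamma> a X = integral {0..1} modular_rate"
    if "X \<in> relative_modular_class M \<pi> N \<pi>\<^sub>N \<iota> \<mu> \<nu>" for X
    using that int unfolding relative_modular_class_def by blast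
  have "\<exists>X. X \<in> relative_modular_class M \<pi> N \<pi>\<^sub>N \<iota> \<mu> \<nu>"
    using N.smooth_funs_const unfolding relative_modular_class_def by blast
  then show ?thesis
    unfolding path_integral_class_def using all by (intro the_equality) auto
qed

text \<open>
  Comparing traces of the two base changes shows that every basis of the normal space has
  \<open>codim\<close> elements.
\<close>

lemma quotient_basis_coords:
  assumes A: "adapted V y E W e" and q: "q \<in> W" and b: "quotient_basis (M.T (\<iota> q)) (TI q) r v"
  shows "r = codim" and "ndet codim (\<lambda>k j. v k (y (N.m + j))) \<noteq> 0"
proof -
  note ad = adaptedD[OF A]
  note f = M.frameD[OF ad(1)]
  let ?n = "N.m" and ?p = "\<iota> q"
  define P where "P k j = v k (y (?n + j))" for k j
  have vT: "v k \<in> M.T ?p" if "k < r" for k using b that by (simp add: quotient_basis_def)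
  have ET: "E j ?p \<in> M.T ?p" if "j < M.m" for j by (rule M.vf_tangent[OF f(3)[OF that]])
  have comb: "(\<Sum>k<r. c k *\<^sub>R v k) \<in> M.T ?p" for c
    by (intro M.tangent_lincomb M.tangent_scale vT) auto
  define R where "R j c \<longleftrightarrow> lin_coset (TI q) (E (?n + j) ?p) = lin_coset (TI q) (\<Sum>k<r. c k *\<^sub>R v k)"
    for j and c :: "nat \<Rightarrow> real"
  have "\<exists>c. R j c" if "j < codim" for j
    using b ET[of "?n + j"] that unfolding quotient_basis_def R_def by simp
  \<comment> \<open>Row \<open>j\<close> of \<open>Q\<close> expresses the \<open>j\<close>-th
    normal frame vector in the given basis modulo tangent vectors, while \<open>P\<close> holds the
    normal coordinates of that basis; taking normal coordinates gives
    \<open>Q P = 1\<close>.\<close>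
  then obtain Q where "\<And>j. j < codim \<Longrightarrow> R j (Q j)" by metis
  then have Q: "\<And>j. j < codim \<Longrightarrow> lin_coset (TI q) (E (?n + j) ?p) = lin_coset (TI q) (\<Sum>k<r. Q j k *\<^sub>R v k)"
    by (simp add: R_def)
  have QP: "(\<Sum>k<r. Q j k * P k i) = (if j = i then 1 else 0)" if ij: "i < codim" "j < codim" for i j
  proof -
    have "ncoord y q (lin_coset (TI q) (E (?n + j) ?p)) (?n + i) = E (?n + j) ?p (y (?n + i))"
      using ij by (intro ncoord_coset[OF A q ET]) auto
    moreover have "ncoord y q (lin_coset (TI q) (\<Sum>k<r. Q j k *\<^sub>R v k)) (?n + i) = (\<Sum>k<r. Q j k * P k i)"
      using ij ncoord_coset[OF A q comb, of "?n + i"] by (simp add: tvec_sum_apply P_def)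
    ultimately show ?thesis using Q[OF ij(2)] f(4)[OF ad(3)[OF q], of "?n + j" "?n + i"] ij by simp
  qed
  \<comment> \<open>The reverse product uses independence: row \<open>k\<close> of
    \<open>P Q - 1\<close> combines the basis to a vector without normal coordinates, hence to a
    tangent vector.\<close>
  have PQ: "(\<Sum>j<codim. P k j * Q j l) = (if k = l then 1 else 0)" if kl: "k < r" "l < r" for k l
  proof -
    define d where "d l = (\<Sum>j<codim. P k j * Q j l) - (if k = l then 1 else 0)" for l
    have "(\<Sum>l<r. d l * P l i) = 0" if i: "i < codim" for i
    proof -
      have "(\<Sum>l<r. d l * P l i) = (\<Sum>l<r. \<Sum>j<codim. P k j * Q j l * P l i) - (\<Sum>l<r. if k = l then P l i else 0)"
        unfolding sum_subtractf[symmetric]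
        by (intro sum.cong refl) (simp add: d_def left_diff_distrib sum_distrib_right)
      also have "(\<Sum>l<r. \<Sum>j<codim. P k j * Q j l * P l i) = (\<Sum>j<codim. P k j * (\<Sum>l<r. Q j l * P l i))"
        by (subst sum.swap) (simp add: sum_distrib_left mult.assoc)
      also have "\<dots> = (\<Sum>j<codim. if j = i then P k i else 0)"
        by (intro sum.cong refl) (auto simp: QP[OF i])
      finally show ?thesis using kl i by simp
    qed
    then have coords: "(\<Sum>l<r. d l *\<^sub>R v l) (y (?n + i)) = 0" if "i < codim" for i
      using that by (simp add: tvec_sum_apply P_def)
    have "(\<Sum>l<r. d l *\<^sub>R v l) (y j) = 0" if "?n \<le> j" "j < M.m" for j
      using coords[of "j - ?n"] that by simp
    then have "(\<Sum>l<r. d l *\<^sub>R v l) \<in> TI q" using tangent_image_iff[OF A q comb] by blast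
    then have "d l = 0" using b kl(2) unfolding quotient_basis_def by blast
    then show ?thesis by (simp add: d_def)
  qed
  have "real codim = (\<Sum>j<codim. \<Sum>k<r. Q j k * P k j)" by (simp add: QP)
  also have "\<dots> = (\<Sum>k<r. \<Sum>j<codim. P k j * Q j k)" by (subst sum.swap) (simp add: mult.commute)
  also have "\<dots> = real r" by (simp add: PQ)
  finally show r: "r = codim" by linarith
  have "ndet codim Q * ndet codim P = ndet codim (\<lambda>j i. if j = i then 1 else 0)"
    unfolding ndet_mult[symmetric] by (rule ndet_cong) (use QP r in auto)
  then have "ndet codim P \<noteq> 0" unfolding ndet_one by auto
  then show "ndet codim (\<lambda>k j. v k (y (N.m + j))) \<noteq> 0" by (simp add: P_def[abs_def])
qed

text \<open>Basis and size are arbitrary because \<open>quotient_det\<close> admits every choice. On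
  a loop the parallel frame ends in the normal space where it began, and there its density is the
  determinant of \<open>H\<close> times the initial one; comparison with
  \<open>normal_density_transport\<close> gives the value.\<close>

lemma holonomy_matrix_det:
  assumes loop: "\<gamma> 0 = \<gamma> 1" and b: "quotient_basis (M.T (\<iota> (\<gamma> 0))) (TI (\<gamma> 0)) r v"
    and H: "\<And>j. j < r \<Longrightarrow> linear_holonomy N M \<pi> \<iota> \<gamma> a (lin_coset (TI (\<gamma> 0)) (v j)) =
      lin_coset (TI (\<gamma> 0)) (\<Sum>i<r. H i j *\<^sub>R v i)"
  shows "ndet r H = exp (integral {0..1} modular_rate)"
proof -
  let ?q = "\<gamma> 0"
  obtain V y E W e where A: "?q \<in> W" "adapted V y E W e"
    by (rule adapted_exists) (rule that; assumption)
  note ad = adaptedD[OF A(2)]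
  have r: "r = codim" and nz: "ndet codim (\<lambda>k j. v k (y (N.m + j))) \<noteq> 0"
    using quotient_basis_coords[OF A(2,1) b] by auto
  have vT: "v k \<in> M.T (\<iota> ?q)" if "k < codim" for k using b that r by (simp add: quotient_basis_def)
  have "\<exists>s. parallel_on 0 1 s \<and> s 0 = lin_coset (TI ?q) (v k)" if k: "k < codim" for k
    by (rule parallel_exists[of "lin_coset (TI ?q) (v k)"]) (use vT[OF k] in \<open>auto simp: normal_space_def\<close>)
  then obtain s where s: "\<And>k. k < codim \<Longrightarrow> parallel_on 0 1 (s k)" "\<And>k. k < codim \<Longrightarrow> s k 0 = lin_coset (TI ?q) (v k)"
    by metis
  have s1: "s k 1 = lin_coset (TI ?q) (\<Sum>i<codim. H i k *\<^sub>R v i)" if "k < codim" for k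
    using linear_holonomy_eq[OF s(1)[OF that]] s(2)[OF that] H[of k] that r by simp
  have nu: "s k 0 \<in> nu ?q" "s k 1 \<in> nu ?q" if "k < codim" for k
  proof -
    have "s k 0 \<in> nu (\<gamma> 0)" "s k 1 \<in> nu (\<gamma> 1)" using s(1)[OF that] by (simp_all add: parallel_on_def)
    then show "s k 0 \<in> nu ?q" "s k 1 \<in> nu ?q" using loop by simp_all
  qed
  let ?g = "\<mu> (\<iota> ?q) (\<lambda>i. E i (\<iota> ?q)) / \<nu> ?q (\<lambda>i. e i ?q)"
  have g: "?g \<noteq> 0"
    using M.volume_frame(2)[OF \<mu> ad(1) ad(3)[OF A(1)]] N.volume_frame(2)[OF \<nu> ad(2) A(1)] by simp
  have "normal_density ?q (\<lambda>k. s k 0) = ndet codim (\<lambda>k j. v k (y (N.m + j))) * ?g"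
  proof -
    have "normal_density ?q (\<lambda>k. s k 0) = ndet codim (\<lambda>k j. ncoord y ?q (s k 0) (N.m + j)) * ?g"
      by (rule normal_density_frame[OF A(2,1) nu(1)])
    also have "ndet codim (\<lambda>k j. ncoord y ?q (s k 0) (N.m + j)) = ndet codim (\<lambda>k j. v k (y (N.m + j)))"
      by (rule ndet_cong) (use ncoord_coset[OF A(2,1) vT] s(2) in auto)
    finally show ?thesis .
  qed
  moreover have "normal_density ?q (\<lambda>k. s k 1) = ndet codim (\<lambda>k j. \<Sum>i<codim. H i k * v i (y (N.m + j))) * ?g"
  proof -
    have "(\<Sum>i<codim. H i k *\<^sub>R v i) \<in> M.T (\<iota> ?q)" for k
      by (intro M.tangent_lincomb M.tangent_scale vT) auto
    note comb = ncoord_coset[OF A(2,1) this]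
    have "normal_density ?q (\<lambda>k. s k 1) = ndet codim (\<lambda>k j. ncoord y ?q (s k 1) (N.m + j)) * ?g"
      by (rule normal_density_frame[OF A(2,1) nu(2)])
    also have "ndet codim (\<lambda>k j. ncoord y ?q (s k 1) (N.m + j)) =
        ndet codim (\<lambda>k j. \<Sum>i<codim. H i k * v i (y (N.m + j)))"
      by (rule ndet_cong) (simp add: s1 comb tvec_sum_apply)
    finally show ?thesis .
  qed
  moreover have "normal_density ?q (\<lambda>k. s k 1) = exp (integral {0..1} modular_rate) * normal_density ?q (\<lambda>k. s k 0)"
    using normal_density_transport[of s, OF s(1)] loop by simp
  moreover have "ndet codim (\<lambda>k j. \<Sum>i<codim. H i k * v i (y (N.m + j))) = ndet codim H * ndet codim (\<lambda>k j. v k (y (N.m + j)))"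
    using ndet_mult[of codim "\<lambda>k i. H i k" "\<lambda>i j. v i (y (N.m + j))"] ndet_transpose[of codim H] by (simp only:)
  ultimately show ?thesis using nz g r by simp
qed

text \<open>An adapted frame supplies one basis and matrix, hence a candidate for the definite
  description; \<open>holonomy_matrix_det\<close> gives every other candidate the same
  value.\<close>

lemma holonomy_det_eq:
  assumes loop: "\<gamma> 0 = \<gamma> 1"
  shows "holonomy_det N M \<pi> \<iota> \<gamma> a = exp (integral {0..1} modular_rate)"
proof -
  let ?q = "\<gamma> 0" and ?hol = "linear_holonomy N M \<pi> \<iota> \<gamma> a"
  obtain V y E W e where A: "?q \<in> W" "adapted V y E W e"
    by (rule adapted_exists) (rule that; assumption)
  note ad = adaptedD[OF A(2)]
  note f = M.frameD[OF ad(1)]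
  define v where "v k = E (N.m + k) (\<iota> ?q)" for k
  have vT: "v k \<in> M.T (\<iota> ?q)" if "k < codim" for k
    unfolding v_def by (rule M.vf_tangent[OF f(3)]) (use that in auto)
  have comb: "(\<Sum>k<codim. c k *\<^sub>R v k) \<in> M.T (\<iota> ?q)" for c
    by (intro M.tangent_lincomb M.tangent_scale vT) auto
  have vy: "(\<Sum>k<codim. c k *\<^sub>R v k) (y (N.m + j)) = c j" if "j < codim" for c j
  proof -
    have "(\<Sum>k<codim. c k *\<^sub>R v k) (y (N.m + j)) = (\<Sum>k<codim. if k = j then c j else 0)"
      unfolding tvec_sum_apply v_def
      using f(4)[OF ad(3)[OF A(1)]] that by (intro sum.cong refl) auto
    then show ?thesis using that by simp
  qed
  have idx: "(\<forall>j. N.m \<le> j \<and> j < M.m \<longrightarrow> R j) \<longleftrightarrow> (\<forall>j<codim. R (N.m + j))" for R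
  proof -
    have "R j" if "\<forall>j<codim. R (N.m + j)" "N.m \<le> j" "j < M.m" for j
      using that(1)[rule_format, of "j - N.m"] that(2,3) by simp
    then show ?thesis by auto
  qed
  have span: "lin_coset (TI ?q) u = lin_coset (TI ?q) (\<Sum>k<codim. u (y (N.m + k)) *\<^sub>R v k)" if u: "u \<in> M.T (\<iota> ?q)" for u
    unfolding lin_coset_eq_iff[OF TI_subspace] tangent_image_iff[OF A(2,1) M.tangent_sub[OF u comb]] idx
    using vy by simp
  have basis: "quotient_basis (M.T (\<iota> ?q)) (TI ?q) codim v"
    unfolding quotient_basis_def
  proof (intro conjI allI impI ballI)
    show "\<exists>c::nat \<Rightarrow> real. lin_coset (TI ?q) u = lin_coset (TI ?q) (\<Sum>k<codim. c k *\<^sub>R v k)" if "u \<in> M.T (\<iota> ?q)" for u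
      by (intro exI[of _ "\<lambda>k. u (y (N.m + k))"] span that)
    show "c j = 0" if "(\<Sum>k<codim. c k *\<^sub>R v k) \<in> TI ?q" "j < codim" for c j
      using that vy[OF that(2), of c] unfolding tangent_image_iff[OF A(2,1) comb] idx by simp
  qed (rule vT)
  have "\<exists>u. u \<in> M.T (\<iota> ?q) \<and> ?hol (lin_coset (TI ?q) (v k)) = lin_coset (TI ?q) u" if k: "k < codim" for k
  proof -
    have "lin_coset (TI ?q) (v k) \<in> nu ?q" using vT[OF k] by (auto simp: normal_space_def)
    then obtain s where s: "parallel_on 0 1 s" "s 0 = lin_coset (TI ?q) (v k)"
      by (rule parallel_exists) (rule that; assumption)
    have "s 1 \<in> nu ?q" using s(1) loop by (simp add: parallel_on_def)
    then show ?thesis using linear_holonomy_eq[OF s(1)] s(2) nuE by metis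
  qed
  then obtain u where u: "\<And>k. k < codim \<Longrightarrow> u k \<in> M.T (\<iota> ?q)"
    "\<And>k. k < codim \<Longrightarrow> ?hol (lin_coset (TI ?q) (v k)) = lin_coset (TI ?q) (u k)" by metis
  define H where "H i k = u k (y (N.m + i))" for i k
  have H: "?hol (lin_coset (TI ?q) (v k)) = lin_coset (TI ?q) (\<Sum>i<codim. H i k *\<^sub>R v i)" if "k < codim" for k
    using u(2)[OF that] span[OF u(1)[OF that]] by (simp add: H_def)
  show ?thesis
    unfolding holonomy_det_def quotient_det_def ndet_def[symmetric]
  proof (rule the_equality)
    show "\<exists>r e A. quotient_basis (M.T (\<iota> ?q)) (TI ?q) r e \<and>
        (\<forall>j<r. ?hol (lin_coset (TI ?q) (e j)) = lin_coset (TI ?q) (\<Sum>i<r. A i j *\<^sub>R e i)) \<and>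
        exp (integral {0..1} modular_rate) = ndet r A"
      using basis H holonomy_matrix_det[OF loop basis H] by (intro exI[of _ codim] exI[of _ v] exI[of _ H]) simp
  next
    fix d
    assume "\<exists>r e A. quotient_basis (M.T (\<iota> ?q)) (TI ?q) r e \<and>
        (\<forall>j<r. ?hol (lin_coset (TI ?q) (e j)) = lin_coset (TI ?q) (\<Sum>i<r. A i j *\<^sub>R e i)) \<and> d = ndet r A"
    then show "d = exp (integral {0..1} modular_rate)" using holonomy_matrix_det[OF loop] by blast
  qed
qed

end

theorem theorem0p1:
  fixes M :: "('m::{t2_space,second_countable_topology}) manifold"
    and N :: "('n::{t2_space,second_countable_topology}) manifold"
    and \<pi> :: "'m bivector" and \<pi>\<^sub>N :: "'n bivector"
    and \<iota> :: "'n \<Rightarrow> 'm"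
    and \<mu> :: "'m top_form" and \<nu> :: "'n top_form"
    and \<gamma> :: "real \<Rightarrow> 'n" and a :: "real \<Rightarrow> 'm covec"
  assumes "poisson_manifold M \<pi>"
    and "poisson_submanifold N \<pi>\<^sub>N M \<pi> \<iota>"
    and "volume_form M \<mu>" and "volume_form N \<nu>"
    and "cotangent_loop N M \<pi> \<iota> \<gamma> a"
  shows "holonomy_det N M \<pi> \<iota> \<gamma> a =
    exp (path_integral_class \<gamma> a (relative_modular_class M \<pi> N \<pi>\<^sub>N \<iota> \<mu> \<nu>))"
proof -
  have pm: "poisson_bracket N \<pi>\<^sub>N (\<lambda>r. f (\<iota> r)) (\<lambda>r. g (\<iota> r)) q = poisson_bracket M \<pi> f g (\<iota> q)"
    if "f \<in> smooth_funs M" "g \<in> smooth_funs M" for f g q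
    using assms(2) that unfolding poisson_submanifold_def o_def by metis
  interpret cotangent_curve_volume M \<pi> N \<pi>\<^sub>N \<iota> \<gamma> a \<mu> \<nu>
    by unfold_locales
      (use assms pm in \<open>auto simp: poisson_manifold_def poisson_submanifold_def cotangent_loop_def\<close>)
  have "\<gamma> 0 = \<gamma> 1" using assms(5) by (simp add: cotangent_loop_def)
  then show ?thesis by (simp add: holonomy_det_eq path_integral_class_eq)
qed

end
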